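(* Let $N\in\mathbb{N}$ and put $N_4:=\gcd(N,4)$. Let $\theta_N(\tau;\nu)$, $\nu\in\{0,1\}$, be the unary theta functions described in the context. (1) There exists a mock modular form $\widetilde{\theta}^+_{N}(\tau;1)$ of weight $\tfrac12$ for $\overline{\rho}_N$ with shadow $\tfrac{1}{\sqrt{N}}\theta_N(\tau;1)$ such that $24N_4\,\widetilde{\theta}^+_{N}(\tau;1)$ has integral Fourier coefficients. (2) There exists a mock modular form $\widetilde{\theta}^+_{N}(\tau;0)$ of weight $\tfrac32$ for $\overline{\rho}_N$ with shadow $\tfrac{\sqrt{N}}{2\pi}\theta_N(\tau;0)$ such that $144N_4\,\widetilde{\theta}^+_{N}(\tau;0)$ has integral Fourier coefficients.
   Context: Notation: $q=e^{2\pi i\tau}$, $\tau=u+iv\in\mathbb{H}$, $\mathbf{e}(x)=e^{2\pi i x}$. $\mathrm{Mp}_2(\mathbb{Z})$ is the metaplectic double cover of $\mathrm{SL}_2(\mathbb{Z})$, consisting of pairs $(A,\phi)$ with $A=\begin{pmatrix}a&b\\c&d\end{pmatrix}\in\mathrm{SL}_2(\mathbb{Z})$ and $\phi$ holomorphic on $\mathbb{H}$ with $\phi(\tau)^2=c\tau+d$; it is generated by $T=(\begin{pmatrix}1&1\\0&1\end{pmatrix},1)$ and $S=(\begin{pmatrix}0&-1\\1&0\end{pmatrix},\sqrt{\tau})$. For an even lattice $L$ with quadratic form $Q$, bilinear form $(x,y)=Q(x+y)-Q(x)-Q(y)$, signature $(b^+,b^-)$, dual $L'$ and $A_L=L'/L$,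 the Weil representation $\rho_L$ on $\mathbb{C}[A_L]=\bigoplus_{h\in A_L}\mathbb{C}\mathfrak{e}_h$ is given by $\rho_L(T)\mathfrak{e}_h=\mathbf{e}(Q(h))\mathfrak{e}_h$ and $\rho_L(S)\mathfrak{e}_h=\frac{\mathbf{e}((b^--b^+)/8)}{\sqrt{|A_L|}}\sum_{\mu\in A_L}\mathbf{e}(-(h,\mu))\mathfrak{e}_\mu$. For $N\in\mathbb{N}$ let $\mathbb{Z}[N]$ be the lattice $\mathbb{Z}$ with $Q(x)=Nx^2$; its discriminant group is identified with $\mathbb{Z}/2N\mathbb{Z}$ ($Q(h)=h^2/4N$ mod 1, $(h,\mu)=h\mu/2N$ mod 1), $\rho_N$ denotes its Weil representation and $\overline{\rho}_N$ the complex conjugate representation (= Weil representation of $\mathbb{Z}$ with $Q(x)=-Nx^2$). A smooth $f:\mathbb{H}\to\mathbb{C}[\mathbb{Z}/2N\mathbb{Z}]$ is modular of weight $k$ for a representation $\rho$ if $f(A\tau)=\phi(\tau)^{2k}\rho((A,\phi))f(\tau)$ for all $(A,\phi)\in\mathrm{Mp}_2(\mathbb{Z})$. A harmonic Maass form of weight $k$ for $\rho$ is such an $f$ annihilated by the weight $k$ hyperbolic Laplacian $\Delta_k=-v^2(\partial_u^2+\partial_v^2)+ikv(\partial_u+i\partial_v)$ and of at most linear exponential growth as $v\to\infty$; it decomposes uniquely as $f=f^++f^-$ where the holomorphic part $f^+$ has an expansion $\sum_h\sum_{m\gg-\infty}a(h,m)q^m\mathfrak{e}_h$ and $f^-$ is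 the non-holomorphic part. Let $\xi_k f:=2iv^k\overline{\partial f/\partial\overline{\tau}}$. A mock modular form of weight $k$ for $\rho$ with shadow $g$ is the holomorphic part $f^+$ of a harmonic Maass form $f$ of weight $k$ for $\rho$ with $\xi_k f=g$. "Integral Fourier coefficients" means all $a(h,m)\in\mathbb{Z}$. For $\nu\in\{0,1\}$, $\theta_N(\tau;\nu):=\sum_{h\bmod 2N}\sum_{n\in 2N\mathbb{Z}+h}n^\nu q^{n^2/4N}\mathfrak{e}_h$, a holomorphic modular form of weight $\nu+\frac12$ for $\rho_N$. *)

theory Defs
  imports
    "HOL-Complex_Analysis.Complex_Analysis"
    "HOL-Library.Landau_Symbols"
    "HOL-Number_Theory.Cong"
    "HOL-Algebra.Generated_Groups"
    "Jordan_Normal_Form.Determinant"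
begin

definition uhp :: "complex set" where
  "uhp = {\<tau>. Im \<tau> > 0}"

text \<open>The normalised exponential \<open>x \<mapsto> exp (2 \<pi> i x)\<close>; thus \<open>q\<^sup>m = ee (m * \<tau>)\<close>.\<close>

definition ee :: "complex \<Rightarrow> complex" where
  "ee z = exp (2 * of_real pi * \<i> * z)"


section \<open>The metaplectic group\<close>

definition mat2 :: "int \<Rightarrow> int \<Rightarrow> int \<Rightarrow> int \<Rightarrow> int mat" where
  "mat2 a b c d = mat_of_rows_list 2 [[a, b], [c, d]]"

definition mob :: "int mat \<Rightarrow> complex \<Rightarrow> complex" where
  "mob A = moebius (of_int (A $$ (0,0))) (of_int (A $$ (0,1)))
                   (of_int (A $$ (1,0))) (of_int (A $$ (1,1)))"

text \<open>The function \<open>\<phi>\<close> lives on the upper half plane; it is made \<^const>\<open>extensional\<close> so that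
  equality of pairs is equality of functions on the upper half plane.\<close>

definition Mp2 :: "(int mat \<times> (complex \<Rightarrow> complex)) monoid" where
  "Mp2 = \<lparr>carrier = {(A, \<phi>). A \<in> carrier_mat 2 2 \<and> Determinant.det A = 1 \<and>
              \<phi> \<in> extensional uhp \<and> \<phi> holomorphic_on uhp \<and>
              (\<forall>\<tau>\<in>uhp. (\<phi> \<tau>)\<^sup>2 = of_int (A $$ (1,0)) * \<tau> + of_int (A $$ (1,1)))},
          monoid.mult = (\<lambda>(A, \<phi>) (B, \<psi>). (A * B, \<lambda>\<tau>\<in>uhp. \<phi> (mob B \<tau>) * \<psi> \<tau>)),
          one = (1\<^sub>m 2, \<lambda>\<tau>\<in>uhp. 1)\<rparr>"

definition mpT :: "int mat \<times> (complex \<Rightarrow> complex)" where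
  "mpT = (mat2 1 1 0 1, \<lambda>\<tau>\<in>uhp. 1)"

definition mpS :: "int mat \<times> (complex \<Rightarrow> complex)" where
  "mpS = (mat2 0 (-1) 1 0, \<lambda>\<tau>\<in>uhp. csqrt \<tau>)"


section \<open>The Weil representation of the lattice \<open>\<int>\<close> with \<open>Q(x) = N x\<^sup>2\<close>\<close>

text \<open>The discriminant group \<open>\<int>/2N\<int>\<close> is represented by the residues \<open>0, \<dots>, 2N - 1\<close>, so that
  endomorphisms of its group ring are \<open>2N \<times> 2N\<close> matrices; column \<open>h\<close> is the image of the basis
  vector with index \<open>h\<close>. The signature is \<open>(1, 0)\<close>.\<close>

definition weil_T :: "nat \<Rightarrow> complex mat" where
  "weil_T N = Matrix.mat (2 * N) (2 * N)
     (\<lambda>(\<mu>, h). if \<mu> = h then ee (of_nat (h\<^sup>2) / of_nat (4 * N)) else 0)"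

definition weil_S :: "nat \<Rightarrow> complex mat" where
  "weil_S N = Matrix.mat (2 * N) (2 * N)
     (\<lambda>(\<mu>, h). ee (- 1 / 8) / of_real (sqrt (real (2 * N))) *
        ee (- (of_nat (h * \<mu>) / of_nat (2 * N))))"

definition GL :: "nat \<Rightarrow> complex mat monoid" where
  "GL n = units_of (ring_mat TYPE(complex) n ())"

text \<open>As \<open>S\<close> and \<open>T\<close> generate the metaplectic group, the graph of the Weil representation is the
  subgroup of \<open>Mp2 \<times> GL(2N)\<close> generated by the two pairs \<open>(T, \<rho>(T))\<close> and \<open>(S, \<rho>(S))\<close>.
  The graph is single-valued, so the choice below picks the unique value.\<close>

definition weil_graph :: "nat \<Rightarrow> ((int mat \<times> (complex \<Rightarrow> complex)) \<times> complex mat) set" where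
  "weil_graph N = generate (Mp2 \<times>\<times> GL (2 * N)) {(mpT, weil_T N), (mpS, weil_S N)}"

definition weil_rep :: "nat \<Rightarrow> int mat \<times> (complex \<Rightarrow> complex) \<Rightarrow> complex mat" where
  "weil_rep N g = (SOME M. (g, M) \<in> weil_graph N)"

definition conj_weil_rep :: "nat \<Rightarrow> int mat \<times> (complex \<Rightarrow> complex) \<Rightarrow> complex mat" where
  "conj_weil_rep N g = map_mat cnj (weil_rep N g)"


section \<open>Differential operators\<close>

definition d_u :: "(complex \<Rightarrow> complex) \<Rightarrow> complex \<Rightarrow> complex" where
  "d_u f \<tau> = frechet_derivative f (at \<tau>) 1"

definition d_v :: "(complex \<Rightarrow> complex) \<Rightarrow> complex \<Rightarrow> complex" where
  "d_v f \<tau> = frechet_derivative f (at \<tau>) \<i>"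

text \<open>Here \<^const>\<open>differentiable_on\<close> is real differentiability, so this is \<open>C\<^sup>n\<close> in the
  two real variables \<open>u, v\<close>.\<close>

primrec Cn_uhp :: "nat \<Rightarrow> (complex \<Rightarrow> complex) \<Rightarrow> bool" where
  "Cn_uhp 0 f \<longleftrightarrow> continuous_on uhp f"
| "Cn_uhp (Suc n) f \<longleftrightarrow> f differentiable_on uhp \<and> Cn_uhp n (d_u f) \<and> Cn_uhp n (d_v f)"

definition smooth_uhp :: "(complex \<Rightarrow> complex) \<Rightarrow> bool" where
  "smooth_uhp f \<longleftrightarrow> (\<forall>n. Cn_uhp n f)"

definition d_taubar :: "(complex \<Rightarrow> complex) \<Rightarrow> complex \<Rightarrow> complex" where
  "d_taubar f \<tau> = (d_u f \<tau> + \<i> * d_v f \<tau>) / 2"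

definition laplacian :: "real \<Rightarrow> (complex \<Rightarrow> complex) \<Rightarrow> complex \<Rightarrow> complex" where
  "laplacian k f \<tau> =
     - of_real ((Im \<tau>)\<^sup>2) * (d_u (d_u f) \<tau> + d_v (d_v f) \<tau>)
     + \<i> * of_real (k * Im \<tau>) * (d_u f \<tau> + \<i> * d_v f \<tau>)"

definition xi :: "real \<Rightarrow> (complex \<Rightarrow> complex) \<Rightarrow> complex \<Rightarrow> complex" where
  "xi k f \<tau> = 2 * \<i> * of_real (Im \<tau> powr k) * cnj (d_taubar f \<tau>)"


section \<open>Vector-valued harmonic Maass forms and mock modular forms\<close>

text \<open>A function with values in the group ring of \<open>\<int>/2N\<int>\<close> is given by its components
  \<open>f h\<close> with \<open>h < 2N\<close>; all other values of \<open>f\<close> are ignored. The weight \<open>k\<close> is a half-integer.\<close>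

definition modular ::
  "nat \<Rightarrow> real \<Rightarrow> (int mat \<times> (complex \<Rightarrow> complex) \<Rightarrow> complex mat) \<Rightarrow>
   (nat \<Rightarrow> complex \<Rightarrow> complex) \<Rightarrow> bool" where
  "modular N k \<rho> f \<longleftrightarrow>
     (\<forall>(A, \<phi>)\<in>carrier Mp2. \<forall>\<tau>\<in>uhp. \<forall>h<2*N.
        f h (mob A \<tau>) = \<phi> \<tau> powi \<lfloor>2 * k\<rfloor> * (\<Sum>\<mu><2*N. \<rho> (A, \<phi>) $$ (h, \<mu>) * f \<mu> \<tau>))"

definition linear_exp_growth :: "(complex \<Rightarrow> complex) \<Rightarrow> bool" where
  "linear_exp_growth f \<longleftrightarrow>
     (\<exists>C. (\<lambda>\<tau>. norm (f \<tau>)) \<in> O[filtercomap Im at_top](\<lambda>\<tau>. exp (C * Im \<tau>)))"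

definition harmonic_maass_form ::
  "nat \<Rightarrow> real \<Rightarrow> (int mat \<times> (complex \<Rightarrow> complex) \<Rightarrow> complex mat) \<Rightarrow>
   (nat \<Rightarrow> complex \<Rightarrow> complex) \<Rightarrow> bool" where
  "harmonic_maass_form N k \<rho> f \<longleftrightarrow>
     (\<forall>h<2*N. smooth_uhp (f h)) \<and>
     modular N k \<rho> f \<and>
     (\<forall>h<2*N. \<forall>\<tau>\<in>uhp. laplacian k (f h) \<tau> = 0) \<and>
     (\<forall>h<2*N. linear_exp_growth (f h))"

text \<open>Since \<open>T\<close> acts diagonally by \<open>4N\<close>-th roots of unity, all exponents are of the form
  \<open>m = n/4N\<close> with an integer \<open>n\<close>; the coefficient \<open>a(h, n/4N)\<close> is written \<open>a h n\<close>.\<close>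

definition q_expansion ::
  "nat \<Rightarrow> (nat \<Rightarrow> complex \<Rightarrow> complex) \<Rightarrow> (nat \<Rightarrow> int \<Rightarrow> complex) \<Rightarrow> bool" where
  "q_expansion N F a \<longleftrightarrow>
     (\<exists>n\<^sub>0. \<forall>h<2*N. \<forall>n<n\<^sub>0. a h n = 0) \<and>
     (\<forall>h<2*N. \<forall>\<tau>\<in>uhp.
        ((\<lambda>n. a h n * ee (of_int n / of_nat (4 * N) * \<tau>)) has_sum F h \<tau>) UNIV)"

text \<open>The upper incomplete Gamma function \<open>\<Gamma>(s, x)\<close> for real \<open>x \<noteq> 0\<close> and real \<open>s\<close> that is not a
  non-positive integer: the integral for \<open>x > 0\<close>, and for \<open>x < 0\<close> its continuation
  \<open>\<Gamma>(s, x) = \<Gamma>(s) - (\<Sum>j. (-1)\<^sup>j x\<^bsup>s+j\<^esup> / (j! (s+j)))\<close> with the principal branch.\<close>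

definition inc_Gamma :: "real \<Rightarrow> real \<Rightarrow> complex" where
  "inc_Gamma s x =
     (if x > 0 then of_real (integral {x..} (\<lambda>t. t powr (s - 1) * exp (- t)))
      else of_real (Gamma s) -
        (\<Sum>j. (-1) ^ j * (of_real x :: complex) powr (of_real s + of_nat j) /
              (fact j * (of_real s + of_nat j))))"

text \<open>The expansion of a non-holomorphic part: with \<open>m = n/4N\<close>, the terms are
  \<open>v\<^bsup>1-k\<^esup>\<close> for \<open>m = 0\<close> and \<open>\<Gamma>(1 - k, -4\<pi>mv) q\<^sup>m\<close> for \<open>m \<noteq> 0\<close>, with \<open>m\<close> bounded above.
  These are the solutions of the weight \<open>k\<close> Laplace equation with \<open>u\<close>-dependence
  \<open>exp (2 \<pi> i m u)\<close> complementary to \<open>q\<^sup>m\<close>.\<close>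

definition nonhol_term :: "nat \<Rightarrow> real \<Rightarrow> int \<Rightarrow> complex \<Rightarrow> complex" where
  "nonhol_term N k n \<tau> =
     (if n = 0 then of_real (Im \<tau> powr (1 - k))
      else inc_Gamma (1 - k) (- 4 * pi * (of_int n / of_nat (4 * N)) * Im \<tau>) *
           ee (of_int n / of_nat (4 * N) * \<tau>))"

definition nonhol_expansion ::
  "nat \<Rightarrow> real \<Rightarrow> (nat \<Rightarrow> complex \<Rightarrow> complex) \<Rightarrow> (nat \<Rightarrow> int \<Rightarrow> complex) \<Rightarrow> bool" where
  "nonhol_expansion N k F b \<longleftrightarrow>
     (\<exists>n\<^sub>0. \<forall>h<2*N. \<forall>n>n\<^sub>0. b h n = 0) \<and>
     (\<forall>h<2*N. \<forall>\<tau>\<in>uhp. ((\<lambda>n. b h n * nonhol_term N k n \<tau>) has_sum F h \<tau>) UNIV)"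

definition is_holomorphic_part ::
  "nat \<Rightarrow> real \<Rightarrow> (nat \<Rightarrow> complex \<Rightarrow> complex) \<Rightarrow> (nat \<Rightarrow> complex \<Rightarrow> complex) \<Rightarrow> bool" where
  "is_holomorphic_part N k f F \<longleftrightarrow>
     (\<exists>a. q_expansion N F a) \<and>
     (\<exists>b. nonhol_expansion N k (\<lambda>h \<tau>. f h \<tau> - F h \<tau>) b)"

definition mock_modular_form ::
  "nat \<Rightarrow> real \<Rightarrow> (int mat \<times> (complex \<Rightarrow> complex) \<Rightarrow> complex mat) \<Rightarrow>
   (nat \<Rightarrow> complex \<Rightarrow> complex) \<Rightarrow> (nat \<Rightarrow> complex \<Rightarrow> complex) \<Rightarrow> bool" where
  "mock_modular_form N k \<rho> g F \<longleftrightarrow>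
     (\<exists>f. harmonic_maass_form N k \<rho> f \<and> is_holomorphic_part N k f F \<and>
          (\<forall>h<2*N. \<forall>\<tau>\<in>uhp. xi k (f h) \<tau> = g h \<tau>))"

definition integral_coefficients :: "nat \<Rightarrow> (nat \<Rightarrow> complex \<Rightarrow> complex) \<Rightarrow> bool" where
  "integral_coefficients N F \<longleftrightarrow> (\<exists>a. q_expansion N F a \<and> (\<forall>h<2*N. \<forall>n. a h n \<in> \<int>))"


section \<open>Unary theta functions\<close>

definition unary_theta :: "nat \<Rightarrow> nat \<Rightarrow> nat \<Rightarrow> complex \<Rightarrow> complex" where
  "unary_theta N \<nu> h \<tau> =
     (\<Sum>\<^sub>\<infinity>n\<in>{n::int. [n = int h] (mod int (2 * N))}.
        of_int n ^ \<nu> * ee (of_int (n\<^sup>2) / of_nat (4 * N) * \<tau>))"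

end

theory Submission
  imports Defs "HOL-Probability.Probability" "HOL-Real_Asymp.Real_Asymp"
begin

text \<open>
  Both forms are theta coefficients of a meromorphic Jacobi form. Let \<open>K = \<theta>\<^sub>1 / \<eta>\<^sup>3\<close>, so that
  \<open>Q = K^2\<close> has weight \<open>-2\<close>, index 1 and a double zero at the lattice points, and let \<open>G\<close> be an elliptic
  function of weight \<open>2N + k\<close>, \<open>k \<in> {1, 2}\<close>, with a pole of that order at the lattice points only. Then \<open>Q\<^sup>N G\<close> has index \<open>N\<close>,
  weight \<open>k\<close> and a pole of order \<open>k\<close>; subtracting the multiple of the non-holomorphic Poincare series \<open>PP\<close>
  with the same pole leaves a function that is entire in \<open>z\<close> and transforms like a Jacobi form. Its theta
  coefficients are therefore modular for the conjugate Weil representation. The coefficients of \<open>PP\<close> are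
  Mordell integrals, which evaluate to the non-holomorphic Eichler integral of the unary theta function
  up to an explicit monomial in \<open>q\<close>. Those of \<open>Q\<^sup>N G\<close> are integral as soon as \<open>G\<close> has an integral expansion, and
  polynomials in \<open>12 \<wp>\<close>, \<open>\<wp>'\<close>, \<open>\<wp>''\<close> and \<open>K(3z) / K(z)\<^sup>9\<close> provide integral \<open>G\<close> with leading coefficient \<open>12\<close>
  (\<open>-24\<close> for odd weight); dividing by half of that leading coefficient normalises the shadow.
\<close>

text \<open>The difficulty is to keep the denominators bounded while the pole order 2N + k grows
  with N. The Fourier coefficients of \<open>Q\<close>^N G are integral, so the only denominator
  comes from normalising the leading coefficient c of G. Powers of 12 wp alone would make c grow
  exponentially. However wp'^2 has leading coefficient 4 in weight 6, and the third division
  polynomial, which is K(3z) / K(z)^9, has leading coefficient 3 in weight 8. Powers of 4 and of 3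
  are coprime, so Bezout combinations bring c back to 12 in every even weight. The same vector of
  functions is described twice. As theta coefficients of a Jacobi form it is visibly modular, but
  nothing is visible about its dependence on t, because the Poincare series is holomorphic in z
  only. As an explicit q-series plus a series of error functions it is visibly harmonic with the
  right shadow, but its modularity is hidden. \<open>mock_form_exists\<close> joins the two
  descriptions. For k = 2 matching the leading term leaves a possible simple pole, which parity
  excludes.\<close>

abbreviation tpi :: complex where "tpi \<equiv> 2 * of_real pi * \<i>"

section \<open>The normalised exponential and the upper half plane\<close>

lemma ee_add: "ee (x + y) = ee x * ee y"
  by (simp add: ee_def exp_add ring_distribs)

lemma ee_0 [simp]: "ee 0 = 1" by (simp add: ee_def)

lemma ee_minus: "ee (- x) = inverse (ee x)"
  by (simp add: ee_def exp_minus)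

lemma ee_diff: "ee (x - y) = ee x / ee y"
  by (simp add: ee_def exp_diff ring_distribs)

lemma ee_nonzero [simp]: "ee x \<noteq> 0" by (simp add: ee_def)

lemma ee_of_int [simp]: "ee (of_int n) = 1"
  unfolding ee_def using exp_integer_2pi[of "of_int n"] by (simp add: mult_ac)

lemma ee_of_nat [simp]: "ee (of_nat n) = 1"
  using ee_of_int[of "int n"] by simp

lemma ee_1 [simp]: "ee 1 = 1" using ee_of_nat[of 1] by simp

lemma ee_eq_1_iff: "ee z = 1 \<longleftrightarrow> z \<in> \<int>"
proof
  assume "ee z = 1"
  then obtain n :: int where "- (2 * pi * Im z) = 0" "2 * pi * Re z = of_int (2 * n) * pi"
    unfolding ee_def exp_eq_1 by auto
  hence "z = of_int n" by (auto simp: complex_eq_iff)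
  then show "z \<in> \<int>" by simp
qed (auto elim!: Ints_cases)

lemma ee_power: "ee z ^ n = ee (of_nat n * z)"
  by (simp add: ee_def exp_of_nat_mult [symmetric] mult_ac)

lemma norm_ee: "norm (ee z) = exp (- 2 * pi * Im z)"
  by (simp add: ee_def norm_exp_eq_Re)

lemma cnj_ee: "cnj (ee z) = ee (- cnj z)"
  by (simp add: ee_def exp_cnj)

lemma ee_has_field_derivative: "((\<lambda>z. ee (k * z)) has_field_derivative tpi * k * ee (k * z)) (at z within S)"
  unfolding ee_def by (auto intro!: derivative_eq_intros simp: mult_ac)

lemma uhp_nonzero: "t \<in> uhp \<Longrightarrow> t \<noteq> 0"
  by (auto simp: uhp_def)

lemma minus_inverse_in_uhp: "t \<in> uhp \<Longrightarrow> - 1 / t \<in> uhp"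
  by (auto simp: uhp_def Im_divide field_simps complex_eq_iff sum_power2_gt_zero_iff)

lemma open_uhp: "open uhp"
  unfolding uhp_def by (simp add: open_halfspace_Im_gt)

lemma convex_uhp: "convex uhp"
  unfolding uhp_def by (simp add: convex_halfspace_Im_gt)

section \<open>The metaplectic group\<close>

lemma mat2_index [simp]:
  "mat2 a b c d $$ (0, 0) = a" "mat2 a b c d $$ (0, Suc 0) = b"
  "mat2 a b c d $$ (Suc 0, 0) = c" "mat2 a b c d $$ (Suc 0, Suc 0) = d"
  by (auto simp: mat2_def mat_of_rows_list_def)

lemma mat2_dim [simp]: "dim_row (mat2 a b c d) = 2" "dim_col (mat2 a b c d) = 2"
  by (auto simp: mat2_def mat_of_rows_list_def)

lemma mat2_carrier [simp]: "mat2 a b c d \<in> carrier_mat 2 2"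
  by (auto simp: mat2_def mat_of_rows_list_def)

lemma eq_mat2:
  assumes "A \<in> carrier_mat 2 2"
  shows "A = mat2 (A $$ (0, 0)) (A $$ (0, Suc 0)) (A $$ (Suc 0, 0)) (A $$ (Suc 0, Suc 0))"
  using assms by (intro eq_matI) (auto simp: mat2_def mat_of_rows_list_def numeral_2_eq_2 less_Suc_eq)

lemma mat2_eq_iff: "mat2 a b c d = mat2 a' b' c' d' \<longleftrightarrow> a = a' \<and> b = b' \<and> c = c' \<and> d = d'"
  by (metis mat2_index)

lemma mat2_mult:
  "mat2 a b c d * mat2 a' b' c' d' = mat2 (a * a' + b * c') (a * b' + b * d') (c * a' + d * c') (c * b' + d * d')"
  by (intro eq_matI)
     (auto simp: less_Suc_eq mat2_def mat_of_rows_list_def scalar_prod_def numeral_2_eq_2)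

lemma one_mat2: "1\<^sub>m 2 = mat2 1 0 0 1"
  by (intro eq_matI) (auto simp: less_Suc_eq mat2_def mat_of_rows_list_def numeral_2_eq_2)

lemma det_mat2: "Determinant.det (mat2 a b c d) = a * d - b * c"
  using laplace_expansion_row[OF mat2_carrier, of 0 a b c d]
  by (simp add: cofactor_def numeral_2_eq_2 mat_delete_def det_single)

lemma mob_mat2: "mob (mat2 a b c d) t = (of_int a * t + of_int b) / (of_int c * t + of_int d)"
  by (simp add: mob_def moebius_def)

lemma mob_denom_nonzero:
  assumes "a * d - b * c = (1::int)" "t \<in> uhp"
  shows "of_int c * t + of_int d \<noteq> 0"
proof
  assume *: "of_int c * t + of_int d = 0"
  hence "Im (of_int c * t + of_int d) = 0" by simp
  hence "c = 0" using assms by (auto simp: uhp_def)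
  with * have "d = 0" by simp
  with \<open>c = 0\<close> assms show False by simp
qed

lemma Im_mob:
  assumes "a * d - b * c = (1::int)" "t \<in> uhp"
  shows "mob (mat2 a b c d) t \<in> uhp"
proof -
  define D where "D = of_int c * t + of_int d"
  have nz: "D \<noteq> 0" unfolding D_def using mob_denom_nonzero[OF assms] .
  have "Im ((of_int a * t + of_int b) / D) = Im ((of_int a * t + of_int b) * cnj D) / (norm D)^2"
    by (simp add: complex_div_cnj[of _ D])
  also have "Im ((of_int a * t + of_int b) * cnj D) = of_int (a * d - b * c) * Im t"
    by (simp add: D_def algebra_simps)
  also have "\<dots> = Im t" using assms by simp
  finally show ?thesis using assms nz by (simp add: mob_mat2 D_def uhp_def)
qed

lemma Mp2_carrier_iff:
  "(A, \<phi>) \<in> carrier Mp2 \<longleftrightarrow> (\<exists>a b c d. A = mat2 a b c d \<and> a * d - b * c = 1 \<and> \<phi> \<in> extensional uhp \<and>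
     \<phi> holomorphic_on uhp \<and> (\<forall>t\<in>uhp. (\<phi> t)^2 = of_int c * t + of_int d))" (is "?l \<longleftrightarrow> ?r")
proof
  assume ?l
  hence "A \<in> carrier_mat 2 2" by (auto simp: Mp2_def)
  from eq_mat2[OF this] obtain a b c d where A: "A = mat2 a b c d" by blast
  with \<open>?l\<close> show ?r by (auto simp: Mp2_def det_mat2)
next
  assume ?r
  thus ?l by (auto simp: Mp2_def det_mat2)
qed

lemma Mp2_mult: "(A, \<phi>) \<otimes>\<^bsub>Mp2\<^esub> (B, \<psi>) = (A * B, \<lambda>t\<in>uhp. \<phi> (mob B t) * \<psi> t)"
  by (simp add: Mp2_def)

lemma Mp2_one: "\<one>\<^bsub>Mp2\<^esub> = (mat2 1 0 0 1, \<lambda>t\<in>uhp. 1)"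
  by (simp add: Mp2_def one_mat2)

lemma mob_one: "mob (mat2 1 0 0 1) t = t"
  by (simp add: mob_mat2)

text \<open>The second equation is the cocycle rule for the denominators. It is what makes the
  product of two square roots in \<open>Mp2\<close> square to the denominator of the product
  matrix.\<close>

lemma mob_mult:
  assumes "a * d - b * c = (1::int)" "a' * d' - b' * c' = (1::int)" "t \<in> uhp"
  shows "mob (mat2 a b c d * mat2 a' b' c' d') t = mob (mat2 a b c d) (mob (mat2 a' b' c' d') t)"
    and "of_int (c * a' + d * c') * t + of_int (c * b' + d * d') =
      (of_int c * mob (mat2 a' b' c' d') t + of_int d) * (of_int c' * t + of_int d')"
proof -
  note nz = mob_denom_nonzero[OF assms(2,3)]
  show *: "of_int (c * a' + d * c') * t + of_int (c * b' + d * d') =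
      (of_int c * mob (mat2 a' b' c' d') t + of_int d) * (of_int c' * t + of_int d')"
    using nz by (simp add: mob_mat2 field_simps)
  have **: "of_int (a * a' + b * c') * t + of_int (a * b' + b * d') =
      (of_int a * mob (mat2 a' b' c' d') t + of_int b) * (of_int c' * t + of_int d')"
    using nz by (simp add: mob_mat2 field_simps)
  show "mob (mat2 a b c d * mat2 a' b' c' d') t = mob (mat2 a b c d) (mob (mat2 a' b' c' d') t)"
    unfolding mat2_mult by (subst (1 2) mob_mat2) (simp only: * **, use nz in simp)
qed

lemma mob_holomorphic:
  assumes "a * d - b * c = (1::int)"
  shows "mob (mat2 a b c d) holomorphic_on uhp"
proof -
  have "(\<lambda>t. (of_int a * t + of_int b) / (of_int c * t + of_int d)) holomorphic_on uhp"
    by (intro holomorphic_intros) (use mob_denom_nonzero[OF assms] in auto)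
  thus ?thesis by (simp add: mob_mat2[abs_def, symmetric])
qed

lemma group_Mp2: "group Mp2"
proof (rule groupI)
  fix x y assume "x \<in> carrier Mp2" "y \<in> carrier Mp2"
  moreover obtain A \<phi> B \<psi> where xy: "x = (A, \<phi>)" "y = (B, \<psi>)" by (cases x, cases y)
  ultimately obtain a b c d a' b' c' d' where 1:
    "A = mat2 a b c d" "a * d - b * c = 1" "\<phi> holomorphic_on uhp"
    "\<forall>t\<in>uhp. (\<phi> t)^2 = of_int c * t + of_int d"
    and 2: "B = mat2 a' b' c' d'" "a' * d' - b' * c' = 1" "\<psi> holomorphic_on uhp"
    "\<forall>t\<in>uhp. (\<psi> t)^2 = of_int c' * t + of_int d'" by (auto simp: Mp2_carrier_iff)
  have det: "(a * a' + b * c') * (c * b' + d * d') - (a * b' + b * d') * (c * a' + d * c') = 1"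
  proof -
    have "(a * a' + b * c') * (c * b' + d * d') - (a * b' + b * d') * (c * a' + d * c')
      = (a * d - b * c) * (a' * d' - b' * c')" by (simp add: algebra_simps)
    thus ?thesis using 1 2 by simp
  qed
  have "(\<phi> \<circ> mob B) holomorphic_on uhp" unfolding 2(1)
    by (rule holomorphic_on_compose_gen[OF mob_holomorphic[OF 2(2)] 1(3)]) (use Im_mob[OF 2(2)] in auto)
  hence "(\<lambda>t. \<phi> (mob B t) * \<psi> t) holomorphic_on uhp"
    using 2(3) by (intro holomorphic_on_mult) (auto simp: o_def)
  hence hol: "(\<lambda>t\<in>uhp. \<phi> (mob B t) * \<psi> t) holomorphic_on uhp"
    by (rule holomorphic_transform) auto
  have "((\<lambda>t\<in>uhp. \<phi> (mob B t) * \<psi> t) t)^2 = of_int (c * a' + d * c') * t + of_int (c * b' + d * d')"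
    if "t \<in> uhp" for t
    using that 1(4) 2(4) Im_mob[OF 2(2) that] mob_mult(2)[OF 1(2) 2(2) that]
    by (simp add: power_mult_distrib 2(1))
  then show "x \<otimes>\<^bsub>Mp2\<^esub> y \<in> carrier Mp2"
    unfolding xy Mp2_mult Mp2_carrier_iff using det hol
    by (intro exI[of _ "a * a' + b * c'"] exI[of _ "a * b' + b * d'"] exI[of _ "c * a' + d * c'"]
        exI[of _ "c * b' + d * d'"]) (auto simp: 1(1) 2(1) mat2_mult)
next
  show "\<one>\<^bsub>Mp2\<^esub> \<in> carrier Mp2"
    unfolding Mp2_one Mp2_carrier_iff
    by (intro exI[of _ 1] exI[of _ 0]) (auto intro: holomorphic_transform[of "\<lambda>_. 1"])
next
  fix x y z assume "x \<in> carrier Mp2" "y \<in> carrier Mp2" "z \<in> carrier Mp2"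
  moreover obtain A \<phi> B \<psi> C \<eta> where xyz: "x = (A, \<phi>)" "y = (B, \<psi>)" "z = (C, \<eta>)"
    by (cases x, cases y, cases z)
  ultimately have car: "(A, \<phi>) \<in> carrier Mp2" "(B, \<psi>) \<in> carrier Mp2" "(C, \<eta>) \<in> carrier Mp2" by auto
  from car(1,2) have AB: "A \<in> carrier_mat 2 2" "B \<in> carrier_mat 2 2" "C \<in> carrier_mat 2 2"
    using car(3) by (auto simp: Mp2_def)
  from car(2,3) obtain a b c d a' b' c' d' where 1: "B = mat2 a b c d" "a * d - b * c = 1"
    and 2: "C = mat2 a' b' c' d'" "a' * d' - b' * c' = 1"
    by (auto simp: Mp2_carrier_iff)
  show "x \<otimes>\<^bsub>Mp2\<^esub> y \<otimes>\<^bsub>Mp2\<^esub> z = x \<otimes>\<^bsub>Mp2\<^esub> (y \<otimes>\<^bsub>Mp2\<^esub> z)"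
    unfolding xyz Mp2_mult
  proof (intro prod.inject[THEN iffD2] conjI)
    show "A * B * C = A * (B * C)" using AB by (simp add: assoc_mult_mat[of _ 2 2 _ 2 _ 2])
    show "(\<lambda>t\<in>uhp. (\<lambda>t\<in>uhp. \<phi> (mob B t) * \<psi> t) (mob C t) * \<eta> t) =
          (\<lambda>t\<in>uhp. \<phi> (mob (B * C) t) * (\<lambda>t\<in>uhp. \<psi> (mob C t) * \<eta> t) t)"
      using Im_mob[OF 2(2)] mob_mult(1)[OF 1(2) 2(2)] by (auto simp: fun_eq_iff restrict_def 1(1) 2(1))
  qed
next
  fix x assume "x \<in> carrier Mp2"
  moreover obtain A \<phi> where x: "x = (A, \<phi>)" by (cases x)
  ultimately have car: "(A, \<phi>) \<in> carrier Mp2" by simp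
  then obtain a b c d where 1:
    "A = mat2 a b c d" "a * d - b * c = 1" "\<phi> holomorphic_on uhp" "\<phi> \<in> extensional uhp"
    "\<forall>t\<in>uhp. (\<phi> t)^2 = of_int c * t + of_int d" by (auto simp: Mp2_carrier_iff)
  from 1(4) show "\<one>\<^bsub>Mp2\<^esub> \<otimes>\<^bsub>Mp2\<^esub> x = x"
    by (auto simp: x Mp2_one Mp2_mult 1(1) mat2_mult mob_one Im_mob[OF 1(2)]
             intro!: ext simp: restrict_def extensional_def)
  let ?B = "mat2 d (-b) (-c) a"
  have detB: "d * a - (-b) * (-c) = 1" using 1(2) by (simp add: mult_ac)
  \<comment> \<open>The product formula forces the second component of the inverse to be 1 / phi,
    evaluated at the point moved by the inverse matrix.\<close>
  define \<psi> where "\<psi> = (\<lambda>t\<in>uhp. inverse (\<phi> (mob ?B t)))"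
  have nz: "\<phi> t \<noteq> 0" if "t \<in> uhp" for t
    using mob_denom_nonzero[OF 1(2) that] 1(5) that by force
  have inv1: "mob ?B (mob A t) = t" "mob A (mob ?B t) = t" if "t \<in> uhp" for t
    using mob_mult(1)[OF detB 1(2) that] mob_mult(1)[OF 1(2) detB that] 1(2)
    by (auto simp: 1(1) mat2_mult algebra_simps mob_one)
  have "(\<phi> \<circ> mob ?B) holomorphic_on uhp"
    by (rule holomorphic_on_compose_gen[OF mob_holomorphic[OF detB] 1(3)]) (use Im_mob[OF detB] in auto)
  hence "(\<lambda>t. inverse (\<phi> (mob ?B t))) holomorphic_on uhp"
    using nz Im_mob[OF detB] by (intro holomorphic_on_inverse) (auto simp: o_def)
  hence hol: "\<psi> holomorphic_on uhp" unfolding \<psi>_def by (rule holomorphic_transform) auto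
  have sq: "(\<psi> t)^2 = of_int (- c) * t + of_int a" if "t \<in> uhp" for t
  proof -
    have m: "mob ?B t \<in> uhp" by (rule Im_mob[OF detB that])
    have "(of_int c * mob ?B t + of_int d) * (of_int (-c) * t + of_int a) = 1"
      using mob_mult(2)[OF 1(2) detB that] 1(2) by (simp add: algebra_simps)
    hence "(\<phi> (mob ?B t))^2 * (of_int (-c) * t + of_int a) = 1" using 1(5) m by auto
    thus ?thesis using that nz[OF m] by (simp add: \<psi>_def field_simps)
  qed
  have "(?B, \<psi>) \<in> carrier Mp2" unfolding Mp2_carrier_iff
    using detB hol sq by (intro exI[of _ d] exI[of _ "-b"] exI[of _ "-c"] exI[of _ a]) (auto simp: \<psi>_def)
  moreover have "(?B, \<psi>) \<otimes>\<^bsub>Mp2\<^esub> x = \<one>\<^bsub>Mp2\<^esub>"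
    unfolding x Mp2_mult Mp2_one using inv1 nz Im_mob[OF 1(2)] 1(2)
    by (auto simp: mat2_mult 1(1) mat2_eq_iff restrict_def \<psi>_def algebra_simps intro!: ext)
  ultimately show "\<exists>y\<in>carrier Mp2. y \<otimes>\<^bsub>Mp2\<^esub> x = \<one>\<^bsub>Mp2\<^esub>" by blast
qed

section \<open>General linear groups and the two generating Weil matrices\<close>

lemma monoid_ring_mat: "Group.monoid (ring_mat TYPE(complex) n ())"
  by (rule ring.is_monoid[OF ring_mat])

lemma group_GL: "group (GL n)"
  unfolding GL_def by (rule monoid.units_group[OF monoid_ring_mat])

lemma GL_mult [simp]: "A \<otimes>\<^bsub>GL n\<^esub> B = A * B"
  by (simp add: GL_def units_of_def ring_mat_def)

lemma GL_one [simp]: "\<one>\<^bsub>GL n\<^esub> = 1\<^sub>m n"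
  by (simp add: GL_def units_of_def ring_mat_def)

lemma GL_carrierD: "A \<in> carrier (GL n) \<Longrightarrow> A \<in> carrier_mat n n"
  by (auto simp: GL_def units_of_def ring_mat_def Units_def)

lemma GL_carrierI:
  "A \<in> carrier_mat n n \<Longrightarrow> B \<in> carrier_mat n n \<Longrightarrow> A * B = 1\<^sub>m n \<Longrightarrow> B * A = 1\<^sub>m n \<Longrightarrow> A \<in> carrier (GL n)"
  by (auto simp: GL_def units_of_def ring_mat_def Units_def)

lemma sum_roots_of_unity:
  assumes "n > 0" "i < n" "j < n"
  shows "(\<Sum>k<n. ee ((of_nat i - of_nat j) * of_nat k / of_nat n)) = (if i = j then of_nat n else 0)"
proof (cases "i = j")
  case False
  define x where "x = ee ((of_nat i - of_nat j) / of_nat n)"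
  have xp: "ee ((of_nat i - of_nat j) * of_nat k / of_nat n) = x ^ k" for k
    by (simp add: x_def ee_power mult_ac)
  have "x \<noteq> 1"
  proof
    assume "x = 1"
    then obtain m :: int where "(of_nat i - of_nat j) / of_nat n = (of_int m :: complex)"
      unfolding x_def ee_eq_1_iff by (auto elim: Ints_cases)
    hence "(of_nat i - of_nat j :: complex) = of_int m * of_nat n" using assms by (simp add: field_simps)
    hence "(of_int (int i - int j) :: complex) = of_int (m * int n)" by simp
    hence *: "int i - int j = m * int n" by (simp only: of_int_eq_iff)
    with False have "m \<noteq> 0" by auto
    hence "\<bar>m * int n\<bar> \<ge> int n" using assms by (simp add: abs_mult mult_le_cancel_right1)
    with * assms show False by linarith
  qed
  moreover have "x ^ n = 1"
    unfolding xp[symmetric] using assms ee_of_int[of "int i - int j"] by simp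
  ultimately show ?thesis using False by (simp only: xp) (simp add: geometric_sum)
qed auto

lemma weil_T_GL: assumes "N > 0" shows "weil_T N \<in> carrier (GL (2 * N))"
proof -
  define B where "B = Matrix.mat (2 * N) (2 * N)
     (\<lambda>(\<mu>, h). if \<mu> = h then ee (- (of_nat (h^2) / of_nat (4 * N))) else 0)"
  have "(\<Sum>i = 0..<2 * N. (if k = i then ee (of_nat (i^2) / of_nat (4 * N)) else 0) * (if i = j then ee (- (of_nat (j^2) / of_nat (4 * N))) else 0))
    = (if k = j then 1 else 0)" if "k < 2 * N" "j < 2 * N" for j k
    using that by (subst sum.remove[of _ k]) (auto simp: ee_minus)
  moreover have "(\<Sum>i = 0..<2 * N. (if k = i then ee (- (of_nat (i^2) / of_nat (4 * N))) else 0) * (if i = j then ee (of_nat (j^2) / of_nat (4 * N)) else 0))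
    = (if k = j then 1 else 0)" if "k < 2 * N" "j < 2 * N" for j k
    using that by (subst sum.remove[of _ k]) (auto simp: ee_minus)
  ultimately show ?thesis
    by (intro GL_carrierI[of _ _ B]; (intro eq_matI)?) (auto simp: weil_T_def B_def scalar_prod_def)
qed

text \<open>The matrix is symmetric and unitary, so its inverse is the complex conjugate; both
  products reduce to orthogonality of the characters of Z/2N.\<close>

lemma weil_S_GL: assumes "N > 0" shows "weil_S N \<in> carrier (GL (2 * N))"
proof -
  define r where "r = complex_of_real (sqrt (real (2 * N)))"
  have r: "r \<noteq> 0" "r * r = of_nat (2 * N)"
    using assms unfolding r_def by (simp_all flip: of_real_mult del: of_nat_mult)
  define B where "B = Matrix.mat (2 * N) (2 * N)
     (\<lambda>(\<mu>, h). ee (1 / 8) / r * ee (of_nat (h * \<mu>) / of_nat (2 * N)))"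
  have sum1: "(\<Sum>i = 0..<2 * N. ee (- 1 / 8) / r * ee (- (of_nat (i * k) / of_nat (2 * N))) *
         (ee (1 / 8) / r * ee (of_nat (j * i) / of_nat (2 * N)))) = (if k = j then 1 else 0)" (is "?l = _")
    if "k < 2 * N" "j < 2 * N" for j k
  proof -
    have "?l = (\<Sum>i = 0..<2 * N. ee ((of_nat j - of_nat k) * of_nat i / of_nat (2 * N)) / of_nat (2 * N))"
    proof (intro sum.cong refl, goal_cases)
      case (1 i)
      have "ee (- 1 / 8) * ee (1 / 8) = 1" by (simp flip: ee_add)
      moreover have "ee (- (of_nat (i * k) / of_nat (2 * N))) * ee (of_nat (j * i) / of_nat (2 * N))
        = ee ((of_nat j - of_nat k) * of_nat i / of_nat (2 * N))"
        by (simp flip: ee_add add: right_diff_distrib diff_divide_distrib mult_ac)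
      moreover have "ee (- 1 / 8) / r * ee (- (of_nat (i * k) / of_nat (2 * N))) *
         (ee (1 / 8) / r * ee (of_nat (j * i) / of_nat (2 * N))) =
         (ee (- 1 / 8) * ee (1 / 8)) * (ee (- (of_nat (i * k) / of_nat (2 * N))) * ee (of_nat (j * i) / of_nat (2 * N))) / (r * r)"
        by simp
      ultimately show ?case unfolding r(2) by simp
    qed
    also have "\<dots> = (if k = j then 1 else 0)"
      unfolding sum_divide_distrib[symmetric] atLeast0LessThan
      by (subst sum_roots_of_unity) (use that assms in auto)
    finally show ?thesis .
  qed
  have 2: "(\<Sum>i = 0..<2 * N. ee (1 / 8) / r * ee (of_nat (i * k) / of_nat (2 * N)) *
         (ee (- 1 / 8) / r * ee (- (of_nat (j * i) / of_nat (2 * N))))) = (if k = j then 1 else 0)" (is "?l = _")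
    if "k < 2 * N" "j < 2 * N" for j k
  proof -
    have "?l = (\<Sum>i = 0..<2 * N. ee (- 1 / 8) / r * ee (- (of_nat (i * j) / of_nat (2 * N))) *
         (ee (1 / 8) / r * ee (of_nat (k * i) / of_nat (2 * N))))"
      by (intro sum.cong refl) (simp only: mult_ac)
    thus ?thesis using sum1[OF that(2,1)] by (simp only: eq_commute[of j k])
  qed
  show ?thesis
  proof (rule GL_carrierI[of _ _ B])
    show "weil_S N * B = 1\<^sub>m (2 * N)"
    proof (rule eq_matI, goal_cases)
      case (1 k j)
      hence kj: "k < 2 * N" "j < 2 * N" by auto
      have "(weil_S N * B) $$ (k, j) = (\<Sum>i = 0..<2 * N. ee (- 1 / 8) / r * ee (- (of_nat (i * k) / of_nat (2 * N))) *
         (ee (1 / 8) / r * ee (of_nat (j * i) / of_nat (2 * N))))"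
        using kj by (simp add: weil_S_def B_def scalar_prod_def r_def)
      thus ?case using kj sum1 by simp
    qed (auto simp: weil_S_def B_def)
    show "B * weil_S N = 1\<^sub>m (2 * N)"
    proof (rule eq_matI, goal_cases)
      case (1 k j)
      hence kj: "k < 2 * N" "j < 2 * N" by auto
      have "(B * weil_S N) $$ (k, j) = (\<Sum>i = 0..<2 * N. ee (1 / 8) / r * ee (of_nat (i * k) / of_nat (2 * N)) *
         (ee (- 1 / 8) / r * ee (- (of_nat (j * i) / of_nat (2 * N)))))"
        using kj by (simp add: weil_S_def B_def scalar_prod_def r_def)
      thus ?case using kj 2 by simp
    qed (auto simp: weil_S_def B_def)
  qed (auto simp: weil_S_def B_def)
qed

section \<open>Generation of the metaplectic group by S and T\<close>

lemma mpT_carrier: "mpT \<in> carrier Mp2"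
  unfolding mpT_def Mp2_carrier_iff
  by (intro exI[of _ 1] exI[of _ 0] exI[of _ "0::int"] exI) (auto intro: holomorphic_transform[of "\<lambda>_. 1"])

lemma mpS_carrier: "mpS \<in> carrier Mp2"
proof -
  have "csqrt holomorphic_on uhp"
    by (rule holomorphic_on_subset[OF holomorphic_on_csqrt]) (auto simp: uhp_def complex_nonpos_Reals_iff)
  hence "(\<lambda>t\<in>uhp. csqrt t) holomorphic_on uhp" by (rule holomorphic_transform) auto
  thus ?thesis unfolding mpS_def Mp2_carrier_iff
    by (intro exI[of _ 0] exI[of _ "-1"] exI[of _ 1] exI) auto
qed

text \<open>Two square roots of the same zero-free function have a continuous quotient with values
  in {1, -1}, which is constant on the connected half plane.\<close>

lemma Mp2_eq_up_to_sign:
  assumes "(A, \<phi>) \<in> carrier Mp2" "(A, \<psi>) \<in> carrier Mp2"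
  shows "\<psi> = \<phi> \<or> \<psi> = (\<lambda>t\<in>uhp. - \<phi> t)"
proof -
  obtain a b c d where 1:
    "A = mat2 a b c d" "a * d - b * c = 1" "\<phi> holomorphic_on uhp" "\<phi> \<in> extensional uhp"
    "\<forall>t\<in>uhp. (\<phi> t)^2 = of_int c * t + of_int d" using assms by (auto simp: Mp2_carrier_iff)
  have 2: "\<psi> holomorphic_on uhp" "\<psi> \<in> extensional uhp" "\<forall>t\<in>uhp. (\<psi> t)^2 = of_int c * t + of_int d"
    using assms(2) by (auto simp: Mp2_carrier_iff 1(1) mat2_eq_iff)
  have nz: "\<phi> t \<noteq> 0" if "t \<in> uhp" for t
    using mob_denom_nonzero[OF 1(2) that] 1(5) that by force
  have pm: "\<psi> t / \<phi> t \<in> {1, -1}" if "t \<in> uhp" for t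
  proof -
    have "(\<psi> t)^2 = (\<phi> t)^2" using that 1(5) 2(3) by simp
    hence "(\<psi> t / \<phi> t)^2 = 1" using nz[OF that] by (simp add: power_divide)
    thus ?thesis by (simp add: power2_eq_1_iff)
  qed
  have "continuous_on uhp (\<lambda>t. \<psi> t / \<phi> t)"
    using nz 1 2 by (intro holomorphic_on_imp_continuous_on holomorphic_on_divide) auto
  moreover have "finite ((\<lambda>t. \<psi> t / \<phi> t) ` uhp)"
    by (rule finite_subset[of _ "{1,-1}"]) (use pm in blast, simp)
  ultimately have "(\<lambda>t. \<psi> t / \<phi> t) constant_on uhp"
    by (intro continuous_finite_range_constant convex_connected convex_uhp)
  then obtain k where k: "\<And>t. t \<in> uhp \<Longrightarrow> \<psi> t / \<phi> t = k" by (auto simp: constant_on_def)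
  have "\<i> \<in> uhp" by (simp add: uhp_def)
  with k pm have "k = 1 \<or> k = -1" by blast
  moreover have "\<psi> t = k * \<phi> t" if "t \<in> uhp" for t using k[OF that] nz[OF that] by (simp add: field_simps)
  ultimately have "(\<forall>t\<in>uhp. \<psi> t = \<phi> t) \<or> (\<forall>t\<in>uhp. \<psi> t = - \<phi> t)" by auto
  thus ?thesis
  proof
    assume "\<forall>t\<in>uhp. \<psi> t = \<phi> t"
    thus ?thesis using 1(4) 2(2) by (auto intro: extensionalityI)
  next
    assume "\<forall>t\<in>uhp. \<psi> t = - \<phi> t"
    hence "\<psi> = (\<lambda>t\<in>uhp. - \<phi> t)" by (intro extensionalityI[OF 2(2) restrict_extensional]) auto
    thus ?thesis ..
  qed
qed

text \<open>The matrix components are handled by the Euclidean algorithm on the first column. That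
  fixes the second component up to sign, and S^4 supplies the missing sign.\<close>

lemma Mp2_generated:
  assumes g: "g \<in> carrier Mp2"
    and S: "mpS \<in> H" and T: "mpT \<in> H"
    and mult: "\<And>x y. x \<in> H \<Longrightarrow> y \<in> H \<Longrightarrow> x \<otimes>\<^bsub>Mp2\<^esub> y \<in> H"
    and inv: "\<And>x. x \<in> H \<Longrightarrow> inv\<^bsub>Mp2\<^esub> x \<in> H"
    and sub: "H \<subseteq> carrier Mp2"
  shows "g \<in> H"
proof -
  interpret group Mp2 by (rule group_Mp2)
  define HA where "HA = fst ` H"
  have HA_mult: "A * B \<in> HA" if "A \<in> HA" "B \<in> HA" for A B
  proof -
    from that obtain \<phi> \<psi> where "(A, \<phi>) \<in> H" "(B, \<psi>) \<in> H" by (auto simp: HA_def)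
    from mult[OF this] show ?thesis by (auto simp: HA_def Mp2_mult image_iff intro: bexI[rotated])
  qed
  have HA_S: "mat2 0 (-1) 1 0 \<in> HA" using S by (force simp: HA_def mpS_def image_iff)
  have HA_T: "mat2 1 1 0 1 \<in> HA" using T by (force simp: HA_def mpT_def image_iff)
  have HA_SS: "mat2 (-1) 0 0 (-1) \<in> HA" using HA_mult[OF HA_S HA_S] by (simp add: mat2_mult)
  have HA_S': "mat2 0 1 (-1) 0 \<in> HA" using HA_mult[OF HA_SS HA_S] by (simp add: mat2_mult)
  \<comment> \<open>The relation (ST)^3 = -1 in SL2 expresses the inverse of T as the word S T S T
    S' with S' = -S.\<close>
  have HA_T': "mat2 1 (-1) 0 1 \<in> HA"
    using HA_mult[OF HA_mult[OF HA_mult[OF HA_mult[OF HA_S HA_T] HA_S] HA_T] HA_S'] 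
    using HA_mult[OF HA_mult[OF HA_mult[OF HA_mult[OF HA_S HA_T] HA_S] HA_T] HA_S]
    by (simp add: mat2_mult)
  have HA_Tn: "mat2 1 n 0 1 \<in> HA" for n
  proof (induction n rule: int_induct[of _ 1])
    case (step1 i) from HA_mult[OF step1(2) HA_T] show ?case by (simp add: mat2_mult add_ac)
  next
    case (step2 i) from HA_mult[OF step2(2) HA_T'] show ?case by (simp add: mat2_mult add_ac)
  qed (rule HA_T)
  have HA_all: "mat2 a b c d \<in> HA" if "a * d - b * c = 1" for a b c d
    using that
  proof (induction "nat \<bar>c\<bar>" arbitrary: a b c d rule: less_induct)
    case less
    show ?case
    proof (cases "c = 0")
      case True
      with less.prems have "a * d = 1" by simp
      hence "(a = 1 \<and> d = 1) \<or> (a = -1 \<and> d = -1)" by (simp add: zmult_eq_1_iff)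
      with HA_Tn[of b] HA_mult[OF HA_SS HA_Tn[of "-b"]] True show ?thesis by (auto simp: mat2_mult)
    next
      case False
      \<comment> \<open>One Euclidean step: T^(-n) replaces a by a mod c, and S then moves this
        smaller entry to the lower left corner.\<close>
      define n where "n = a div c"
      define a' b' where "a' = a - n * c" and "b' = b - n * d"
      have "a' = a mod c" by (simp add: a'_def n_def minus_div_mult_eq_mod)
      hence "\<bar>a'\<bar> < \<bar>c\<bar>" using False by (simp add: abs_mod_less)
      moreover have "(- c) * b' - (- d) * a' = 1"
        using less.prems by (simp add: a'_def b'_def algebra_simps)
      ultimately have "mat2 (-c) (-d) a' b' \<in> HA" by (intro less.hyps) auto
      from HA_mult[OF HA_Tn[of n] HA_mult[OF HA_S' this]] show ?thesis
        by (simp add: mat2_mult a'_def b'_def algebra_simps)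
    qed
  qed
  \<comment> \<open>This is the second component of S^2. Only its square -1 matters, not which
    square root of -1 the branches of \<open>csqrt\<close> produce: it makes S^4 equal to the
    identity matrix with second component -1.\<close>
  define \<psi> where "\<psi> = (\<lambda>t. csqrt (- 1 / t) * csqrt t)"
  have \<psi>2: "\<psi> t * \<psi> t = -1" if "t \<in> uhp" for t
  proof -
    have "\<psi> t * \<psi> t = (csqrt (- 1 / t))^2 * (csqrt t)^2" by (simp add: \<psi>_def power2_eq_square mult_ac)
    thus ?thesis using uhp_nonzero[OF that] by simp
  qed
  have SS: "mpS \<otimes>\<^bsub>Mp2\<^esub> mpS = (mat2 (-1) 0 0 (-1), \<lambda>t\<in>uhp. \<psi> t)"
    using minus_inverse_in_uhp
    by (auto simp: mpS_def Mp2_mult mat2_mult \<psi>_def restrict_def mob_mat2 intro!: ext)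
  have "(mat2 1 0 0 1, \<lambda>t\<in>uhp. -1) = (mpS \<otimes>\<^bsub>Mp2\<^esub> mpS) \<otimes>\<^bsub>Mp2\<^esub> (mpS \<otimes>\<^bsub>Mp2\<^esub> mpS)"
    using \<psi>2 unfolding SS Mp2_mult by (auto simp: mat2_mult restrict_def mob_mat2 intro!: ext)
  hence neg: "(mat2 1 0 0 1, \<lambda>t\<in>uhp. -1) \<in> H" using mult S by metis
  obtain A \<phi> where gA: "g = (A, \<phi>)" by (cases g)
  with g obtain a b c d where A: "A = mat2 a b c d" "a * d - b * c = 1" by (auto simp: Mp2_carrier_iff)
  from HA_all[OF A(2)] obtain \<phi>' where \<phi>': "(A, \<phi>') \<in> H" by (auto simp: HA_def A(1))
  have "(mat2 1 0 0 1, \<lambda>t\<in>uhp. -1) \<otimes>\<^bsub>Mp2\<^esub> (A, \<phi>') = (A, \<lambda>t\<in>uhp. - \<phi>' t)"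
    using Im_mob[OF A(2)] by (auto simp: Mp2_mult A(1) mat2_mult restrict_def intro!: ext)
  hence "(A, \<lambda>t\<in>uhp. - \<phi>' t) \<in> H" using mult[OF neg \<phi>'] by simp
  with Mp2_eq_up_to_sign[of A \<phi>' \<phi>] \<phi>' sub g show ?thesis unfolding gA by auto
qed

text \<open>The transformation law is treated as a relation \<open>R\<close> between a group element
  and a matrix and proved for every pair of the graph by induction over \<open>generate\<close>. It
  then holds for whichever matrix \<open>weil_rep\<close> chooses, and \<open>Mp2_generated\<close>
  shows that there is one to choose.\<close>

lemma modularI:
  fixes f :: "nat \<Rightarrow> complex \<Rightarrow> complex"
  assumes N: "N > 0"
    and fT: "\<And>t h. t \<in> uhp \<Longrightarrow> h < 2 * N \<Longrightarrow> f h (t + 1) = ee (- (of_nat (h^2) / of_nat (4 * N))) * f h t"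
    and fS: "\<And>t h. t \<in> uhp \<Longrightarrow> h < 2 * N \<Longrightarrow> f h (- 1 / t) = csqrt t powi \<lfloor>2 * k\<rfloor> *
        (\<Sum>\<mu><2*N. ee (1 / 8) / of_real (sqrt (real (2 * N))) * ee (of_nat (h * \<mu>) / of_nat (2 * N)) * f \<mu> t)"
  shows "modular N k (conj_weil_rep N) f"
proof -
  let ?G = "Mp2 \<times>\<times> GL (2 * N)"
  define R where "R = (\<lambda>(A, \<phi>) M. \<forall>t\<in>uhp. \<forall>h<2*N.
        f h (mob A t) = \<phi> t powi \<lfloor>2 * k\<rfloor> * (\<Sum>\<mu><2*N. cnj (M $$ (h, \<mu>)) * f \<mu> t))"
  interpret M: group Mp2 by (rule group_Mp2)
  interpret L: group "GL (2 * N)" by (rule group_GL)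
  interpret G: group ?G by (intro DirProd_group group_Mp2 group_GL)
  have gens: "{(mpT, weil_T N), (mpS, weil_S N)} \<subseteq> carrier ?G"
    using mpT_carrier mpS_carrier weil_T_GL[OF N] weil_S_GL[OF N] by auto
  have car: "x \<in> carrier ?G" if "x \<in> weil_graph N" for x
    using that G.generate_in_carrier[OF gens] unfolding weil_graph_def by blast
  have R_T: "R mpT (weil_T N)"
    unfolding R_def mpT_def
  proof (clarify, goal_cases)
    case (1 t h)
    have "(\<Sum>\<mu><2*N. cnj (weil_T N $$ (h, \<mu>)) * f \<mu> t) = cnj (weil_T N $$ (h, h)) * f h t"
      using 1 by (subst sum.remove[of _ h]) (auto simp: weil_T_def intro!: sum.neutral)
    also have "cnj (weil_T N $$ (h, h)) = ee (- (of_nat (h^2) / of_nat (4 * N)))"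
      using 1 by (simp add: weil_T_def cnj_ee)
    finally show ?case using fT[OF 1] 1 by (simp add: mob_mat2)
  qed
  have R_S: "R mpS (weil_S N)"
    unfolding R_def mpS_def
  proof (clarify, goal_cases)
    case (1 t h)
    have "(\<Sum>\<mu><2*N. cnj (weil_S N $$ (h, \<mu>)) * f \<mu> t) = (\<Sum>\<mu><2*N. ee (1 / 8) / of_real (sqrt (real (2 * N))) * ee (of_nat (h * \<mu>) / of_nat (2 * N)) * f \<mu> t)"
      using 1 by (intro sum.cong refl) (simp add: weil_S_def cnj_ee mult_ac)
    then show ?case using fS[OF 1] 1 by (simp add: mob_mat2)
  qed
  have R_inv: "R (inv\<^bsub>Mp2\<^esub> g) (inv\<^bsub>GL (2 * N)\<^esub> M)"
    if gM: "g \<in> carrier Mp2" "M \<in> carrier (GL (2 * N))" and R: "R g M" for g M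
  proof -
    obtain A \<phi> A' \<phi>' where g: "g = (A, \<phi>)" "inv\<^bsub>Mp2\<^esub> g = (A', \<phi>')" by (cases g, cases "inv\<^bsub>Mp2\<^esub> g")
    define M' where "M' = inv\<^bsub>GL (2 * N)\<^esub> M"
    have c': "(A', \<phi>') \<in> carrier Mp2" "(A, \<phi>) \<in> carrier Mp2" using M.inv_closed[OF gM(1)] gM(1) g by auto
    obtain a b c d where A: "A = mat2 a b c d" "a * d - b * c = 1" using c' by (auto simp: Mp2_carrier_iff)
    obtain a' b' c'' d' where A': "A' = mat2 a' b' c'' d'" "a' * d' - b' * c'' = 1" using c' by (auto simp: Mp2_carrier_iff)
    have "(A, \<phi>) \<otimes>\<^bsub>Mp2\<^esub> (A', \<phi>') = \<one>\<^bsub>Mp2\<^esub>" using M.r_inv[OF gM(1)] g by simp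
    hence AA: "A * A' = mat2 1 0 0 1" and \<phi>\<phi>: "(\<lambda>t\<in>uhp. \<phi> (mob A' t) * \<phi>' t) = (\<lambda>t\<in>uhp. 1)"
      by (auto simp: Mp2_mult Mp2_one)
    have M'c: "M' \<in> carrier_mat (2 * N) (2 * N)" and Mc: "M \<in> carrier_mat (2 * N) (2 * N)"
      using GL_carrierD[OF L.inv_closed[OF gM(2)]] GL_carrierD[OF gM(2)] by (auto simp: M'_def)
    have MM: "M' * M = 1\<^sub>m (2 * N)" using L.l_inv[OF gM(2)] by (simp add: M'_def)
    have MMij: "(\<Sum>h<2*N. M' $$ (j, h) * M $$ (h, \<mu>)) = (if j = \<mu> then 1 else 0)" if "j < 2 * N" "\<mu> < 2 * N" for j \<mu>
    proof -
      have "(M' * M) $$ (j, \<mu>) = (\<Sum>h<2*N. M' $$ (j, h) * M $$ (h, \<mu>))"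
        using that M'c Mc by (simp add: scalar_prod_def atLeast0LessThan)
      thus ?thesis using that by (simp add: MM)
    qed
    have "f j (mob A' t) = \<phi>' t powi \<lfloor>2 * k\<rfloor> * (\<Sum>\<mu><2*N. cnj (M' $$ (j, \<mu>)) * f \<mu> t)"
      if t: "t \<in> uhp" and j: "j < 2 * N" for t j
    proof -
      \<comment> \<open>Apply the known law at the preimage of t and solve the resulting linear
        system with the inverse matrix.\<close>
      define \<sigma> where "\<sigma> = mob A' t"
      have \<sigma>: "\<sigma> \<in> uhp" unfolding \<sigma>_def A'(1) by (rule Im_mob[OF A'(2) t])
      have A\<sigma>: "mob A \<sigma> = t" using mob_mult(1)[OF A(2) A'(2) t] AA by (simp add: \<sigma>_def A A' mob_one)
      have p: "\<phi> \<sigma> * \<phi>' t = 1" using fun_cong[OF \<phi>\<phi>, of t] t by (simp add: \<sigma>_def)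
      have ft: "f h t = \<phi> \<sigma> powi \<lfloor>2 * k\<rfloor> * (\<Sum>\<mu><2*N. cnj (M $$ (h, \<mu>)) * f \<mu> \<sigma>)" if "h < 2 * N" for h
        using R \<sigma> that A\<sigma> unfolding g R_def by force
      have "(\<Sum>h<2*N. cnj (M' $$ (j, h)) * f h t)
          = \<phi> \<sigma> powi \<lfloor>2 * k\<rfloor> * (\<Sum>h<2*N. \<Sum>\<mu><2*N. cnj (M' $$ (j, h)) * cnj (M $$ (h, \<mu>)) * f \<mu> \<sigma>)"
        by (simp add: ft sum_distrib_left mult_ac)
      also have "(\<Sum>h<2*N. \<Sum>\<mu><2*N. cnj (M' $$ (j, h)) * cnj (M $$ (h, \<mu>)) * f \<mu> \<sigma>)
          = (\<Sum>\<mu><2*N. cnj (\<Sum>h<2*N. M' $$ (j, h) * M $$ (h, \<mu>)) * f \<mu> \<sigma>)"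
        by (subst sum.swap) (simp add: sum_distrib_right)
      also have "\<dots> = (\<Sum>\<mu><2*N. (if j = \<mu> then f \<mu> \<sigma> else 0))"
        using j by (intro sum.cong refl) (simp add: MMij)
      also have "\<dots> = f j \<sigma>" using j by simp
      finally have eq: "(\<Sum>h<2*N. cnj (M' $$ (j, h)) * f h t) = \<phi> \<sigma> powi \<lfloor>2 * k\<rfloor> * f j \<sigma>" .
      have "\<phi>' t powi \<lfloor>2 * k\<rfloor> * \<phi> \<sigma> powi \<lfloor>2 * k\<rfloor> = 1"
        using p by (simp add: power_int_mult_distrib[symmetric] mult_ac)
      thus ?thesis unfolding eq \<sigma>_def[symmetric] by (simp add: mult.assoc[symmetric])
    qed
    thus ?thesis unfolding g(2) M'_def[symmetric] by (auto simp: R_def)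
  qed
  have R_mult: "R (g \<otimes>\<^bsub>Mp2\<^esub> g') (M * M')"
    if gM: "g \<in> carrier Mp2" "M \<in> carrier (GL (2 * N))" "g' \<in> carrier Mp2" "M' \<in> carrier (GL (2 * N))"
      and R: "R g M" "R g' M'" for g M g' M'
  proof -
    obtain A \<phi> A' \<phi>' where g: "g = (A, \<phi>)" "g' = (A', \<phi>')" by (cases g, cases g')
    obtain a b c d where A: "A = mat2 a b c d" "a * d - b * c = 1" using gM g by (auto simp: Mp2_carrier_iff)
    obtain a' b' c'' d' where A': "A' = mat2 a' b' c'' d'" "a' * d' - b' * c'' = 1" using gM g by (auto simp: Mp2_carrier_iff)
    have Mc: "M' \<in> carrier_mat (2 * N) (2 * N)" "M \<in> carrier_mat (2 * N) (2 * N)" using GL_carrierD gM by auto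
    have "f h (mob (A * A') t) = (\<phi> (mob A' t) * \<phi>' t) powi \<lfloor>2 * k\<rfloor> * (\<Sum>\<mu><2*N. cnj ((M * M') $$ (h, \<mu>)) * f \<mu> t)"
      if t: "t \<in> uhp" and h: "h < 2 * N" for t h
    proof -
      have \<sigma>: "mob A' t \<in> uhp" unfolding A'(1) by (rule Im_mob[OF A'(2) t])
      have "f h (mob (A * A') t) = f h (mob A (mob A' t))"
        using mob_mult(1)[OF A(2) A'(2) t] by (simp add: A A')
      also have "\<dots> = \<phi> (mob A' t) powi \<lfloor>2 * k\<rfloor> * (\<Sum>\<mu><2*N. cnj (M $$ (h, \<mu>)) * f \<mu> (mob A' t))"
        using R(1) \<sigma> h unfolding g R_def by auto
      also have "(\<Sum>\<mu><2*N. cnj (M $$ (h, \<mu>)) * f \<mu> (mob A' t)) =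
          (\<Sum>\<mu><2*N. cnj (M $$ (h, \<mu>)) * (\<phi>' t powi \<lfloor>2 * k\<rfloor> * (\<Sum>\<nu><2*N. cnj (M' $$ (\<mu>, \<nu>)) * f \<nu> t)))"
        using R(2) t unfolding g R_def by (intro sum.cong refl) auto
      also have "\<dots> = \<phi>' t powi \<lfloor>2 * k\<rfloor> * (\<Sum>\<mu><2*N. \<Sum>\<nu><2*N. cnj (M $$ (h, \<mu>)) * cnj (M' $$ (\<mu>, \<nu>)) * f \<nu> t)"
        by (simp add: sum_distrib_left mult_ac)
      also have "(\<Sum>\<mu><2*N. \<Sum>\<nu><2*N. cnj (M $$ (h, \<mu>)) * cnj (M' $$ (\<mu>, \<nu>)) * f \<nu> t)
         = (\<Sum>\<nu><2*N. cnj (\<Sum>\<mu><2*N. M $$ (h, \<mu>) * M' $$ (\<mu>, \<nu>)) * f \<nu> t)"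
        by (subst sum.swap) (simp add: sum_distrib_right)
      also have "\<dots> = (\<Sum>\<mu><2*N. cnj ((M * M') $$ (h, \<mu>)) * f \<mu> t)"
        using h Mc by (intro sum.cong refl) (simp add: scalar_prod_def atLeast0LessThan)
      finally show ?thesis by (simp add: power_int_mult_distrib mult_ac)
    qed
    thus ?thesis unfolding g Mp2_mult by (simp add: R_def)
  qed
  have R_graph: "R (fst x) (snd x)" if "x \<in> weil_graph N" for x
    using that unfolding weil_graph_def
  proof (induction rule: generate.induct)
    case one
    have "R (mat2 1 0 0 1, \<lambda>t\<in>uhp. 1) (1\<^sub>m (2 * N))"
      unfolding R_def
    proof (clarify, goal_cases)
      case (1 t h)
      have "(\<Sum>\<mu><2*N. cnj (1\<^sub>m (2 * N) $$ (h, \<mu>)) * f \<mu> t) = (\<Sum>\<mu><2*N. if \<mu> = h then f \<mu> t else 0)"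
        using 1 by (intro sum.cong) auto
      thus ?case using 1 by (simp add: mob_one)
    qed
    thus ?case by (simp add: Mp2_one)
  next
    case (incl h) thus ?case using R_T R_S by auto
  next
    case (inv h)
    hence "h \<in> carrier ?G" "R (fst h) (snd h)" using gens R_T R_S by auto
    thus ?case using R_inv[of "fst h" "snd h"] inv_DirProd[OF group_Mp2 group_GL, of "fst h" "snd h" "2 * N"] by auto
  next
    case (eng h1 h2)
    hence "h1 \<in> carrier ?G" "h2 \<in> carrier ?G" using car unfolding weil_graph_def by auto
    thus ?case using R_mult[OF _ _ _ _ eng.IH] by (auto simp: mult_DirProd')
  qed
  have ex: "\<exists>M. (g, M) \<in> weil_graph N" if "g \<in> carrier Mp2" for g
  proof -
    have sg: "subgroup (weil_graph N) ?G" unfolding weil_graph_def by (rule G.generate_is_subgroup[OF gens])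
    have "g \<in> {g \<in> carrier Mp2. \<exists>M. (g, M) \<in> weil_graph N}"
    proof (rule Mp2_generated[OF that])
      show "mpS \<in> {g \<in> carrier Mp2. \<exists>M. (g, M) \<in> weil_graph N}" "mpT \<in> {g \<in> carrier Mp2. \<exists>M. (g, M) \<in> weil_graph N}"
        using mpS_carrier mpT_carrier unfolding weil_graph_def by (auto intro: generate.incl)
    next
      fix x y assume "x \<in> {g \<in> carrier Mp2. \<exists>M. (g, M) \<in> weil_graph N}" "y \<in> {g \<in> carrier Mp2. \<exists>M. (g, M) \<in> weil_graph N}"
      then obtain M M' where "(x, M) \<in> weil_graph N" "(y, M') \<in> weil_graph N" and xy: "x \<in> carrier Mp2" "y \<in> carrier Mp2" by auto
      from subgroup.m_closed[OF sg this(1,2)] xy show "x \<otimes>\<^bsub>Mp2\<^esub> y \<in> {g \<in> carrier Mp2. \<exists>M. (g, M) \<in> weil_graph N}"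
        by auto
    next
      fix x assume "x \<in> {g \<in> carrier Mp2. \<exists>M. (g, M) \<in> weil_graph N}"
      then obtain M where x: "(x, M) \<in> weil_graph N" "x \<in> carrier Mp2" by auto
      with car[OF x(1)] subgroup.m_inv_closed[OF sg x(1)] show "inv\<^bsub>Mp2\<^esub> x \<in> {g \<in> carrier Mp2. \<exists>M. (g, M) \<in> weil_graph N}"
        using inv_DirProd[OF group_Mp2 group_GL, of x M "2 * N"] by auto
    qed auto
    thus ?thesis by simp
  qed
  show ?thesis
    unfolding modular_def
  proof (clarify, goal_cases)
    case (1 A \<phi> t h)
    define M where "M = weil_rep N (A, \<phi>)"
    have "((A, \<phi>), M) \<in> weil_graph N" unfolding M_def weil_rep_def using someI_ex[OF ex[OF 1(1)]] .
    from R_graph[OF this] car[OF this] have R: "R (A, \<phi>) M" and Mc: "M \<in> carrier_mat (2 * N) (2 * N)"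
      by (auto dest: GL_carrierD)
    have "f h (mob A t) = \<phi> t powi \<lfloor>2 * k\<rfloor> * (\<Sum>\<mu><2*N. cnj (M $$ (h, \<mu>)) * f \<mu> t)"
      using R 1 unfolding R_def by auto
    also have "(\<Sum>\<mu><2*N. cnj (M $$ (h, \<mu>)) * f \<mu> t) = (\<Sum>\<mu><2*N. conj_weil_rep N (A, \<phi>) $$ (h, \<mu>) * f \<mu> t)"
      using Mc 1 by (intro sum.cong refl) (simp add: conj_weil_rep_def M_def)
    finally show ?case .
  qed
qed

section \<open>The complementary error function\<close>

text \<open>This is the complementary error function erfc, with a lower limit of either
  sign.\<close>

definition er :: "real \<Rightarrow> real" where
  "er x = 2 / sqrt pi * (LINT t|lborel. indicator {x..} t *\<^sub>R exp (- t\<^sup>2))"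

lemma integrable_gauss: "integrable lborel (\<lambda>t::real. exp (- t\<^sup>2))"
  using has_bochner_integral_even_function[OF gaussian_moment_0]
  by (auto simp: has_bochner_integral_iff)

lemma integral_gauss: "(LINT t|lborel. exp (- (t::real)\<^sup>2)) = sqrt pi"
  using has_bochner_integral_even_function[OF gaussian_moment_0]
  by (auto simp: has_bochner_integral_iff)

lemma integrable_gauss_indicator: "A \<in> sets borel \<Longrightarrow> integrable lborel (\<lambda>t::real. indicator A t *\<^sub>R exp (- t\<^sup>2))"
  using integrable_mult_indicator[OF _ integrable_gauss, of A] by simp

lemma er_0: "er 0 = 1"
  using gaussian_moment_0 by (simp add: er_def has_bochner_integral_iff)

lemma er_shift: "er x = 2 / sqrt pi * (LINT s|lborel. indicator {0..} s *\<^sub>R exp (- (x + s)\<^sup>2))"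
  unfolding er_def by (subst lborel_integral_real_affine[where c=1 and t=x])
    (auto intro!: Bochner_Integration.integral_cong split: split_indicator)

lemma er_nonneg: "er x \<ge> 0"
  unfolding er_def by (intro mult_nonneg_nonneg Bochner_Integration.integral_nonneg) auto

text \<open>For nonnegative x and s one has (x + s)^2 >= x^2 + s^2, so the shifted integral is at
  most exp (- x^2) times half of the Gaussian integral. This decay carries the convergence of all
  series of error functions below.\<close>

lemma er_le: assumes "x \<ge> 0" shows "er x \<le> exp (- x\<^sup>2)"
proof -
  have "(LINT s|lborel. indicator {0..} s *\<^sub>R exp (- (x + s)\<^sup>2)) \<le>
        (LINT s|lborel. exp (- x\<^sup>2) * (indicator {0..} s *\<^sub>R exp (- s\<^sup>2)))"
  proof (rule integral_mono)
    show "integrable lborel (\<lambda>s. exp (- x\<^sup>2) * (indicator {0..} s *\<^sub>R exp (- s\<^sup>2)))"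
      by (intro integrable_mult_right integrable_gauss_indicator) auto
    have "integrable lborel (\<lambda>s. indicator {x..} (x + 1 * s) *\<^sub>R exp (- (x + 1 * s)\<^sup>2))"
      using lborel_integrable_real_affine[OF integrable_gauss_indicator[of "{x..}"], of 1 x] by simp
    thus "integrable lborel (\<lambda>s. indicator {0..} s *\<^sub>R exp (- (x + s)\<^sup>2))"
      by (rule Bochner_Integration.integrable_cong[THEN iffD1, rotated 2]) (auto split: split_indicator)
  next
    fix s :: real
    have "- (x + s)\<^sup>2 \<le> - x\<^sup>2 + - s\<^sup>2" if "s \<ge> 0" using that assms by (simp add: power2_eq_square algebra_simps)
    hence "exp (- (x + s)\<^sup>2) \<le> exp (- x\<^sup>2) * exp (- s\<^sup>2)" if "s \<ge> 0"
      using that unfolding exp_add[symmetric] by simp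
    thus "indicator {0..} s *\<^sub>R exp (- (x + s)\<^sup>2) \<le> exp (- x\<^sup>2) * (indicator {0..} s *\<^sub>R exp (- s\<^sup>2))"
      by (auto split: split_indicator)
  qed
  also have "\<dots> = exp (- x\<^sup>2) * (sqrt pi / 2)"
    using gaussian_moment_0 by (simp add: has_bochner_integral_iff)
  finally show ?thesis unfolding er_shift by (simp add: field_simps)
qed

lemma er_minus: "er (- x) = 2 - er x"
proof -
  have "(LINT t|lborel. indicator {-x..} t *\<^sub>R exp (- t\<^sup>2)) = (LINT t|lborel. indicator {..x} t *\<^sub>R exp (- (t::real)\<^sup>2))"
    by (subst lborel_integral_real_affine[where c="-1" and t=0])
      (auto intro!: Bochner_Integration.integral_cong split: split_indicator)
  also have "\<dots> = (LINT t|lborel. indicator {..<x} t *\<^sub>R exp (- (t::real)\<^sup>2))"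
  proof (rule integral_cong_AE)
    show "AE t in lborel. indicator {..x} t *\<^sub>R exp (- t\<^sup>2) = indicator {..<x} t *\<^sub>R exp (- t\<^sup>2)"
      using AE_lborel_singleton[of x] by eventually_elim (auto split: split_indicator)
  qed auto
  also have "\<dots> + (LINT t|lborel. indicator {x..} t *\<^sub>R exp (- (t::real)\<^sup>2)) =
     (LINT t|lborel. indicator {..<x} t *\<^sub>R exp (- t\<^sup>2) + indicator {x..} t *\<^sub>R exp (- (t::real)\<^sup>2))"
    by (rule Bochner_Integration.integral_add[symmetric]) (simp_all only: integrable_gauss_indicator borel_singleton atLeast_borel lessThan_borel atLeastLessThan_borel)
  also have "\<dots> = sqrt pi"
    unfolding integral_gauss[symmetric]
    by (intro Bochner_Integration.integral_cong refl) (auto split: split_indicator)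
  finally show ?thesis unfolding er_def by (simp add: field_simps)
qed

lemma DERIV_er: "(er has_real_derivative - (2 / sqrt pi * exp (- x\<^sup>2))) (at x)"
proof -
  \<comment> \<open>Near x the improper integral is a constant minus an integral over a compact
    interval, to which the fundamental theorem of calculus applies.\<close>
  have eq: "er y = er (x - 1) - 2 / sqrt pi * integral {x - 1..y} (\<lambda>t. exp (- t\<^sup>2))" if "y \<ge> x - 1" for y
  proof -
    have "(LINT t|lborel. indicator {x - 1..} t *\<^sub>R exp (- t\<^sup>2)) =
      (LINT t|lborel. indicator {x - 1..<y} t *\<^sub>R exp (- t\<^sup>2) + indicator {y..} t *\<^sub>R exp (- (t::real)\<^sup>2))"
      using that by (intro Bochner_Integration.integral_cong refl) (auto split: split_indicator)
    also have "\<dots> = (LINT t|lborel. indicator {x - 1..<y} t *\<^sub>R exp (- t\<^sup>2)) + (LINT t|lborel. indicator {y..} t *\<^sub>R exp (- (t::real)\<^sup>2))"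
      by (rule Bochner_Integration.integral_add) (simp_all only: integrable_gauss_indicator borel_singleton atLeast_borel lessThan_borel atLeastLessThan_borel)
    also have "(LINT t|lborel. indicator {x - 1..<y} t *\<^sub>R exp (- t\<^sup>2)) = (LINT t|lborel. indicator {x - 1..y} t *\<^sub>R exp (- (t::real)\<^sup>2))"
    proof (rule integral_cong_AE)
      show "AE t in lborel. indicator {x - 1..<y} t *\<^sub>R exp (- t\<^sup>2) = indicator {x - 1..y} t *\<^sub>R exp (- t\<^sup>2)"
        using AE_lborel_singleton[of y] by eventually_elim (auto split: split_indicator)
    qed auto
    also have "\<dots> = integral {x - 1..y} (\<lambda>t. exp (- t\<^sup>2))"
      using set_borel_integral_eq_integral(2)[of "{x - 1..y}" "\<lambda>t. exp (- t\<^sup>2)"] integrable_gauss_indicator[of "{x - 1..y}"]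
      by (simp add: set_lebesgue_integral_def set_integrable_def)
    finally show ?thesis unfolding er_def by (simp add: field_simps)
  qed
  have "((\<lambda>y. integral {x - 1..y} (\<lambda>t. exp (- t\<^sup>2))) has_real_derivative exp (- x\<^sup>2)) (at x within {x - 1..x + 1})"
    by (rule integral_has_real_derivative) (auto intro!: continuous_intros)
  hence "((\<lambda>y. er (x - 1) - 2 / sqrt pi * integral {x - 1..y} (\<lambda>t. exp (- t\<^sup>2))) has_real_derivative - (2 / sqrt pi * exp (- x\<^sup>2))) (at x within {x - 1..x + 1})"
    by (rule DERIV_cmult[THEN DERIV_diff[OF DERIV_const], THEN DERIV_cong]) simp
  hence "(er has_real_derivative - (2 / sqrt pi * exp (- x\<^sup>2))) (at x within {x - 1..x + 1})"
    by (rule has_field_derivative_transform_within[of _ _ _ _ 1]) (simp_all only: eq[symmetric] atLeastAtMost_iff zero_less_one, auto)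
  thus ?thesis by (simp add: at_within_Icc_at)
qed

lemma DERIV_er_chain [derivative_intros]:
  "(f has_real_derivative f') (at x within S) \<Longrightarrow>
   ((\<lambda>x. er (f x)) has_real_derivative - (2 / sqrt pi * exp (- (f x)\<^sup>2)) * f') (at x within S)"
  by (rule DERIV_chain2[OF DERIV_er])

lemma er_tendsto_0: "(er \<longlongrightarrow> 0) at_top"
proof (rule tendsto_sandwich[where f="\<lambda>_. 0"])
  show "eventually (\<lambda>x. er x \<le> exp (- x\<^sup>2)) at_top"
    using eventually_ge_at_top[of 0] by eventually_elim (rule er_le)
  show "((\<lambda>x::real. exp (- x\<^sup>2)) \<longlongrightarrow> 0) at_top" by real_asymp
qed (auto simp: er_nonneg)

text \<open>\<open>inc_Gamma\<close> uses the gauge integral over a half line; the value is imported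
  from the nonnegative Lebesgue integral, where monotone convergence gives the improper fundamental
  theorem.\<close>

lemma has_integral_atLeast_FTC:
  fixes f :: "real \<Rightarrow> real"
  assumes f[measurable]: "f \<in> borel_measurable borel"
    and D: "\<And>x. a \<le> x \<Longrightarrow> DERIV F x :> f x"
    and nonneg: "\<And>x. a \<le> x \<Longrightarrow> 0 \<le> f x"
    and lim: "(F \<longlongrightarrow> T) at_top"
  shows "(f has_integral (T - F a)) {a..}"
proof -
  have "F a \<le> T"
  proof (rule tendsto_lowerbound[OF lim])
    show "eventually (\<lambda>x. F a \<le> F x) at_top"
      using eventually_ge_at_top[of a]
      by eventually_elim (rule DERIV_nonneg_imp_nondecreasing, use D nonneg in auto)
  qed auto
  have "(\<integral>\<^sup>+x. ennreal (f x * indicator {a..} x) \<partial>lborel) = (\<integral>\<^sup>+x. ennreal (f x) * indicator {a..} x \<partial>lborel)"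
    by (intro nn_integral_cong) (auto split: split_indicator)
  also have "\<dots> = T - F a" by (rule nn_integral_FTC_atLeast[OF f D nonneg lim])
  finally have "((\<lambda>x. f x * indicator {a..} x) has_integral (T - F a)) UNIV"
    using nonneg \<open>F a \<le> T\<close> by (intro nn_integral_has_integral) (auto split: split_indicator)
  hence "((\<lambda>x. if x \<in> {a..} then f x else 0) has_integral (T - F a)) UNIV"
    by (rule has_integral_eq[rotated]) (auto split: split_indicator)
  thus ?thesis by (simp only: has_integral_restrict_UNIV)
qed

lemma inc_Gamma_half:
  assumes "x > 0" shows "inc_Gamma (1/2) x = of_real (sqrt pi * er (sqrt x))"
proof -
  have "((\<lambda>t. t powr (1/2 - 1) * exp (- t)) has_integral (0 - (- sqrt pi * er (sqrt x)))) {x..}"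
  proof (rule has_integral_atLeast_FTC)
    fix t :: real assume "x \<le> t"
    hence t: "t > 0" using assms by simp
    show "((\<lambda>t. - sqrt pi * er (sqrt t)) has_real_derivative t powr (1 / 2 - 1) * exp (- t)) (at t)"
      using t by (auto intro!: derivative_eq_intros simp: powr_minus powr_half_sqrt field_simps)
  next
    have "((\<lambda>t. - sqrt pi * er (sqrt t)) \<longlongrightarrow> - sqrt pi * 0) at_top"
      by (intro tendsto_intros filterlim_compose[OF er_tendsto_0] sqrt_at_top)
    thus "((\<lambda>t. - sqrt pi * er (sqrt t)) \<longlongrightarrow> 0) at_top" by simp
  qed auto
  thus ?thesis using assms by (simp add: inc_Gamma_def integral_unique)
qed

lemma inc_Gamma_minus_half:
  assumes "x > 0" shows "inc_Gamma (-1/2) x = of_real (2 / sqrt x * exp (- x) - 2 * sqrt pi * er (sqrt x))"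
proof -
  have "((\<lambda>t. t powr (-1/2 - 1) * exp (- t)) has_integral (0 - (2 * sqrt pi * er (sqrt x) - 2 / sqrt x * exp (- x)))) {x..}"
  proof (rule has_integral_atLeast_FTC)
    fix t :: real assume "x \<le> t"
    hence t: "t > 0" using assms by simp
    have p: "t powr (-1/2 - 1) = 1 / (t * sqrt t)"
      using t powr_mult_base[of t "1/2"] by (simp add: powr_minus_divide powr_half_sqrt)
    show "((\<lambda>t. 2 * sqrt pi * er (sqrt t) - 2 / sqrt t * exp (- t)) has_real_derivative t powr (-1 / 2 - 1) * exp (- t)) (at t)"
      unfolding p using t
      by (auto intro!: derivative_eq_intros simp: field_simps)
  next
    have "((\<lambda>t. 2 * sqrt pi * er (sqrt t)) \<longlongrightarrow> 2 * sqrt pi * 0) at_top"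
      by (intro tendsto_intros filterlim_compose[OF er_tendsto_0] sqrt_at_top)
    moreover have "((\<lambda>t::real. 2 / sqrt t * exp (- t)) \<longlongrightarrow> 0) at_top" by real_asymp
    ultimately show "((\<lambda>t. 2 * sqrt pi * er (sqrt t) - 2 / sqrt t * exp (- t)) \<longlongrightarrow> 0) at_top"
      using tendsto_diff by fastforce
  qed auto
  thus ?thesis using assms by (simp add: inc_Gamma_def integral_unique)
qed

section \<open>Partial derivatives\<close>

text \<open>Real differentiability is recorded together with both partial derivatives, because
  \<open>d_u\<close> and \<open>d_v\<close> have no meaning where the function is not
  differentiable.\<close>

definition has_duv :: "(complex \<Rightarrow> complex) \<Rightarrow> complex \<Rightarrow> complex \<Rightarrow> complex \<Rightarrow> bool" where
  "has_duv f fu fv t \<longleftrightarrow> (f has_derivative (\<lambda>x. of_real (Re x) * fu + of_real (Im x) * fv)) (at t)"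

lemma has_duv_d_u: "has_duv f fu fv t \<Longrightarrow> d_u f t = fu"
  unfolding has_duv_def d_u_def by (drule frechet_derivative_at[symmetric]) simp

lemma has_duv_d_v: "has_duv f fu fv t \<Longrightarrow> d_v f t = fv"
  unfolding has_duv_def d_v_def by (drule frechet_derivative_at[symmetric]) simp

lemma has_duv_eq: "has_duv f a b t \<Longrightarrow> f = g \<Longrightarrow> a = a' \<Longrightarrow> b = b' \<Longrightarrow> has_duv g a' b' t"
  by simp

lemma has_duv_add: "has_duv f fu fv t \<Longrightarrow> has_duv g gu gv t \<Longrightarrow> has_duv (\<lambda>x. f x + g x) (fu + gu) (fv + gv) t"
  unfolding has_duv_def by (drule (1) has_derivative_add) (simp add: algebra_simps)

lemma has_duv_mult: "has_duv f fu fv t \<Longrightarrow> has_duv g gu gv t \<Longrightarrow>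
    has_duv (\<lambda>x. f x * g x) (fu * g t + f t * gu) (fv * g t + f t * gv) t"
  unfolding has_duv_def by (drule (1) has_derivative_mult) (simp add: algebra_simps)

lemma has_duv_const: "has_duv (\<lambda>x. c) 0 0 t"
  unfolding has_duv_def by simp

lemma has_duv_cmult: "has_duv f fu fv t \<Longrightarrow> has_duv (\<lambda>x. c * f x) (c * fu) (c * fv) t"
  using has_duv_mult[OF has_duv_const, of f fu fv t c] by simp

lemma has_duv_hol: "(f has_field_derivative d) (at t) \<Longrightarrow> has_duv f d (\<i> * d) t"
proof -
  have "(\<lambda>x. complex_of_real (Re x) * d + complex_of_real (Im x) * (\<i> * d)) = (*) d"
  proof
    fix x show "complex_of_real (Re x) * d + complex_of_real (Im x) * (\<i> * d) = d * x"
      by (subst (3) complex_eq[of x]) (simp add: algebra_simps)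
  qed
  thus "(f has_field_derivative d) (at t) \<Longrightarrow> ?thesis"
    unfolding has_duv_def has_field_derivative_def by simp
qed

lemma has_duv_antihol: "(f has_field_derivative d) (at t) \<Longrightarrow> has_duv (\<lambda>x. cnj (f x)) (cnj d) (- \<i> * cnj d) t"
proof -
  assume "(f has_field_derivative d) (at t)"
  hence "has_duv f d (\<i> * d) t" by (rule has_duv_hol)
  hence "((\<lambda>x. cnj (f x)) has_derivative (\<lambda>x. cnj (complex_of_real (Re x) * d + complex_of_real (Im x) * (\<i> * d)))) (at t)"
    unfolding has_duv_def by (rule has_derivative_cnj)
  thus ?thesis unfolding has_duv_def by simp
qed

lemma has_duv_Im: assumes "(g has_real_derivative d) (at (Im t))"
  shows "has_duv (\<lambda>x. of_real (g (Im x))) 0 (of_real d) t"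
proof -
  have "(g has_derivative (\<lambda>x. x * d)) (at (Im t))"
    using assms by (simp add: has_field_derivative_def mult_commute_abs)
  from has_derivative_compose[OF bounded_linear.has_derivative[OF bounded_linear_Im has_derivative_ident] this]
  have "((\<lambda>x. g (Im x)) has_derivative (\<lambda>x. Im x * d)) (at t)" by simp
  from has_derivative_of_real[OF this] show ?thesis unfolding has_duv_def by simp
qed

lemma has_duv_transform:
  assumes "has_duv f fu fv t" "t \<in> uhp" "\<And>x. x \<in> uhp \<Longrightarrow> f x = g x"
  shows "has_duv g fu fv t"
  using assms open_uhp unfolding has_duv_def by (auto intro: has_derivative_transform_within_open)

text \<open>Derivatives at points of the open half plane only see nearby values. This permits
  rewriting powers of v by formulas that agree for v > 0 only.\<close>

lemma Cn_uhp_cong: "(\<And>x. x \<in> uhp \<Longrightarrow> f x = g x) \<Longrightarrow> Cn_uhp n f \<Longrightarrow> Cn_uhp n g"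
proof (induction n arbitrary: f g)
  case 0 thus ?case using continuous_on_cong[of uhp uhp f g] by auto
next
  case (Suc n)
  have f: "f differentiable_on uhp" "Cn_uhp n (d_u f)" "Cn_uhp n (d_v f)" using Suc.prems by auto
  have D: "(f has_derivative f') (at t) \<longleftrightarrow> (g has_derivative f') (at t)" if "t \<in> uhp" for t f'
    using has_derivative_transform_within_open[OF _ open_uhp that, of f f' UNIV g]
      has_derivative_transform_within_open[OF _ open_uhp that, of g f' UNIV f] Suc.prems(1) by auto
  have "d_u f t = d_u g t" "d_v f t = d_v g t" if "t \<in> uhp" for t
    using D[OF that] by (auto simp: d_u_def d_v_def frechet_derivative_def)
  hence "Cn_uhp n (d_u g)" "Cn_uhp n (d_v g)"
    using Suc.IH[of "d_u f" "d_u g"] Suc.IH[of "d_v f" "d_v g"] f by blast+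
  moreover have "g differentiable_on uhp"
    unfolding differentiable_on_def differentiable_def
  proof
    fix t assume t: "t \<in> uhp"
    with f(1) obtain f' where "(f has_derivative f') (at t within uhp)"
      unfolding differentiable_on_def differentiable_def by blast
    hence "(g has_derivative f') (at t)" using D[OF t] at_within_open[OF t open_uhp] by simp
    thus "\<exists>D. (g has_derivative D) (at t within uhp)" using has_derivative_at_withinI by blast
  qed
  ultimately show ?case by simp
qed

text \<open>A class of functions that is closed under both partial derivatives consists of smooth
  functions, by induction on the order.\<close>

lemma smooth_uhpI:
  assumes "\<And>f. f \<in> X \<Longrightarrow> \<exists>fu\<in>X. \<exists>fv\<in>X. \<forall>t\<in>uhp. has_duv f (fu t) (fv t) t" "f \<in> X"
  shows "smooth_uhp f"
proof -
  have diff: "f differentiable_on uhp" if "f \<in> X" for f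
    using assms(1)[OF that] unfolding differentiable_on_def differentiable_def has_duv_def
    by (meson has_derivative_at_withinI)
  have "Cn_uhp n f" if "f \<in> X" for n f
    using that
  proof (induction n arbitrary: f)
    case 0 thus ?case using diff differentiable_imp_continuous_on by auto
  next
    case (Suc n)
    then obtain fu fv where fuv: "fu \<in> X" "fv \<in> X" "\<And>t. t \<in> uhp \<Longrightarrow> has_duv f (fu t) (fv t) t"
      using assms(1)[OF Suc.prems] by blast
    have "Cn_uhp n (d_u f)" by (rule Cn_uhp_cong[OF _ Suc.IH[OF fuv(1)]]) (use has_duv_d_u[OF fuv(3)] in simp)
    moreover have "Cn_uhp n (d_v f)" by (rule Cn_uhp_cong[OF _ Suc.IH[OF fuv(2)]]) (use has_duv_d_v[OF fuv(3)] in simp)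
    ultimately show ?case using diff[OF Suc.prems] by simp
  qed
  thus ?thesis using assms(2) by (simp add: smooth_uhp_def)
qed

text \<open>The majorants are uniform only on half planes Im t > v0, since the series degenerate at
  the real line; differentiability is local, so v0 = Im t / 2 suffices at t.\<close>

lemma has_duv_series:
  fixes f fu fv :: "nat \<Rightarrow> complex \<Rightarrow> complex"
  assumes d: "\<And>n t. t \<in> uhp \<Longrightarrow> has_duv (f n) (fu n t) (fv n t) t"
    and b: "\<And>v0. v0 > 0 \<Longrightarrow> \<exists>M. summable M \<and> (\<forall>n t. Im t > v0 \<longrightarrow>
       norm (f n t) \<le> M n \<and> norm (fu n t) \<le> M n \<and> norm (fv n t) \<le> M n)"
    and t: "t \<in> uhp"
  shows "has_duv (\<lambda>t. \<Sum>n. f n t) (\<Sum>n. fu n t) (\<Sum>n. fv n t) t"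
proof -
  define v0 where "v0 = Im t / 2"
  have v0: "v0 > 0" "v0 < Im t" using t by (auto simp: v0_def uhp_def)
  define S where "S = {z. Im z > v0}"
  have S: "convex S" "open S" "t \<in> S" "S \<subseteq> uhp"
    using v0 by (auto simp: S_def convex_halfspace_Im_gt open_halfspace_Im_gt uhp_def)
  from b[OF v0(1)] obtain M where M: "summable M"
    "\<And>n t. t \<in> S \<Longrightarrow> norm (f n t) \<le> M n" "\<And>n t. t \<in> S \<Longrightarrow> norm (fu n t) \<le> M n"
    "\<And>n t. t \<in> S \<Longrightarrow> norm (fv n t) \<le> M n" by (auto simp: S_def)
  have ulim: "uniform_limit S (\<lambda>n x. \<Sum>i<n. fu i x) (\<lambda>x. \<Sum>i. fu i x) sequentially"
    "uniform_limit S (\<lambda>n x. \<Sum>i<n. fv i x) (\<lambda>x. \<Sum>i. fv i x) sequentially"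
    by (rule Weierstrass_m_test[OF _ M(1)], use M in blast)+
  have "\<exists>g. \<forall>x\<in>S. (\<lambda>n. f n x) sums g x \<and>
     (g has_derivative (\<lambda>h. of_real (Re h) * (\<Sum>n. fu n x) + of_real (Im h) * (\<Sum>n. fv n x))) (at x within S)"
  proof (rule has_derivative_series[OF S(1)])
    show "((f n) has_derivative (\<lambda>h. of_real (Re h) * fu n x + of_real (Im h) * fv n x)) (at x within S)"
      if "x \<in> S" for n x
      using d[of x n] that S(4) by (auto simp: has_duv_def intro: has_derivative_at_withinI)
    show "(\<lambda>n. f n t) sums (\<Sum>n. f n t)"
      by (rule summable_sums, rule summable_comparison_test[OF _ M(1)]) (use M(2) S(3) in auto)
    show "t \<in> S" by fact
    fix e :: real assume e: "e > 0"
    have "\<forall>\<^sub>F n in sequentially. (\<forall>x\<in>S. norm ((\<Sum>i<n. fu i x) - (\<Sum>i. fu i x)) < e / 2)"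
      "\<forall>\<^sub>F n in sequentially. (\<forall>x\<in>S. norm ((\<Sum>i<n. fv i x) - (\<Sum>i. fv i x)) < e / 2)"
      using ulim[unfolded uniform_limit_iff dist_norm, rule_format, of "e / 2"] e by simp_all
    thus "\<forall>\<^sub>F n in sequentially. \<forall>x\<in>S. \<forall>h. norm ((\<Sum>i<n. of_real (Re h) * fu i x + of_real (Im h) * fv i x) -
        (of_real (Re h) * (\<Sum>n. fu n x) + of_real (Im h) * (\<Sum>n. fv n x))) \<le> e * norm h"
    proof eventually_elim
      case (elim n)
      show ?case
      proof (intro ballI allI)
        fix x h assume "x \<in> S"
        have "(\<Sum>i<n. of_real (Re h) * fu i x + of_real (Im h) * fv i x) -
            (of_real (Re h) * (\<Sum>n. fu n x) + of_real (Im h) * (\<Sum>n. fv n x)) =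
           of_real (Re h) * ((\<Sum>i<n. fu i x) - (\<Sum>i. fu i x)) + of_real (Im h) * ((\<Sum>i<n. fv i x) - (\<Sum>i. fv i x))"
          by (simp add: sum.distrib sum_distrib_left[symmetric] algebra_simps)
        also have "norm \<dots> \<le> \<bar>Re h\<bar> * norm ((\<Sum>i<n. fu i x) - (\<Sum>i. fu i x)) + \<bar>Im h\<bar> * norm ((\<Sum>i<n. fv i x) - (\<Sum>i. fv i x))"
          by (rule order_trans[OF norm_triangle_ineq]) (simp add: norm_mult)
        also have "\<dots> \<le> norm h * (e / 2) + norm h * (e / 2)"
          using elim \<open>x \<in> S\<close> abs_Re_le_cmod abs_Im_le_cmod by (intro add_mono mult_mono) (auto intro: less_imp_le)
        finally show "norm ((\<Sum>i<n. of_real (Re h) * fu i x + of_real (Im h) * fv i x) -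
        (of_real (Re h) * (\<Sum>n. fu n x) + of_real (Im h) * (\<Sum>n. fv n x))) \<le> e * norm h" by simp
      qed
    qed
  qed
  then obtain g where g: "\<And>x. x \<in> S \<Longrightarrow> (\<lambda>n. f n x) sums g x"
     "(g has_derivative (\<lambda>h. of_real (Re h) * (\<Sum>n. fu n t) + of_real (Im h) * (\<Sum>n. fv n t))) (at t within S)"
    using S(3) by blast
  have "(g has_derivative (\<lambda>h. of_real (Re h) * (\<Sum>n. fu n t) + of_real (Im h) * (\<Sum>n. fv n t))) (at t)"
    using g(2) unfolding at_within_open[OF S(3,2)] .
  moreover have "g x = (\<Sum>n. f n x)" if "x \<in> S" for x using g(1)[OF that] by (simp add: sums_iff)
  ultimately show ?thesis unfolding has_duv_def
    using S(2,3) by (auto intro: has_derivative_transform_within_open)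
qed

section \<open>The non-holomorphic series\<close>

text \<open>For p = 0 and p = 1 these are the error function parts of the non-holomorphic Eichler
  integrals of unary theta functions. The power p is kept as a parameter because each derivative in
  t raises it. \<open>Tser\<close> is the complex conjugate of the matching theta series.\<close>

definition Eser :: "nat \<Rightarrow> (nat \<Rightarrow> real) \<Rightarrow> nat \<Rightarrow> complex \<Rightarrow> complex" where
  "Eser N c p t = (\<Sum>n. of_real (c n * real n ^ p * er (real n * sqrt (pi * Im t / real N))) *
      ee (- (of_nat (n^2) / of_nat (4 * N)) * t))"

definition Tser :: "nat \<Rightarrow> (nat \<Rightarrow> real) \<Rightarrow> nat \<Rightarrow> complex \<Rightarrow> complex" where
  "Tser N c p t = (\<Sum>n. of_real (c n * real n ^ p) * cnj (ee (of_nat (n^2) / of_nat (4 * N) * t)))"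

lemma summable_power_exp:
  assumes "a > 0" shows "summable (\<lambda>n. real n ^ p * exp (- a * real n))"
proof (rule summable_comparison_test_bigo)
  show "summable (\<lambda>n. norm (1 / real n ^ 2))" using inverse_power_summable[of 2] by (simp add: field_simps)
  show "(\<lambda>n. real n ^ p * exp (- a * real n)) \<in> O(\<lambda>n. 1 / real n ^ 2)"
    using assms by real_asymp
qed

lemma DERIV_er_sqrt:
  assumes "v > 0" "N > 0"
  shows "((\<lambda>v. er (x * sqrt (pi * v / real N))) has_real_derivative
     - (x * exp (- (pi * x^2 * v / real N)) / sqrt (real N * v))) (at v)"
proof -
  have pos: "pi * v / real N > 0" using assms by simp
  have sq: "sqrt (pi * v / real N) = sqrt pi * sqrt v / sqrt (real N)" by (simp add: real_sqrt_mult real_sqrt_divide)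
  have e: "(x * sqrt (pi * v / real N))^2 = pi * x^2 * v / real N" using pos assms by (simp add: power_mult_distrib mult_ac)
  have "((\<lambda>v. er (x * sqrt (pi * v / real N))) has_real_derivative
     - (2 / sqrt pi * exp (- (x * sqrt (pi * v / real N))\<^sup>2)) * (x * (pi / real N * (inverse (sqrt (pi * v / real N)) / 2)))) (at v)"
    using pos by (auto intro!: derivative_eq_intros simp: mult_ac)
  also have "- (2 / sqrt pi * exp (- (x * sqrt (pi * v / real N))\<^sup>2)) * (x * (pi / real N * (inverse (sqrt (pi * v / real N)) / 2)))
     = - (x * exp (- (pi * x^2 * v / real N)) / sqrt (real N * v)) * ((pi / (sqrt pi * sqrt pi)) * (sqrt (real N) * sqrt (real N) / real N))"
    unfolding e sq using assms by (simp add: real_sqrt_mult field_simps)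
  also have "(pi / (sqrt pi * sqrt pi)) * (sqrt (real N) * sqrt (real N) / real N) = 1" using assms by simp
  finally show ?thesis by simp
qed

text \<open>The Gaussian that appears when \<open>er\<close> is differentiated turns q^(-n^2/4N)
  into the conjugate of q^(n^2/4N). Hence the antiholomorphic derivative of \<open>Eser\<close> is a
  conjugate theta series times a power of v.\<close>

lemma exp_ee_cnj:
  assumes "N > 0"
  shows "of_real (exp (- (pi * (real n)^2 * Im t / real N))) * ee (- (of_nat (n^2) / of_nat (4 * N)) * t) =
    cnj (ee (of_nat (n^2) / of_nat (4 * N) * t))"
proof -
  have "of_real (- (pi * (real n)^2 * Im t / real N)) + tpi * (- (of_nat (n^2) / of_nat (4 * N)) * t)
     = cnj (tpi * (of_nat (n^2) / of_nat (4 * N) * t))"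
    using assms by (auto simp: complex_eq_iff field_simps)
  hence "exp (of_real (- (pi * (real n)^2 * Im t / real N)) + tpi * (- (of_nat (n^2) / of_nat (4 * N)) * t))
     = cnj (exp (tpi * (of_nat (n^2) / of_nat (4 * N) * t)))" by (simp only: exp_cnj)
  thus ?thesis unfolding ee_def exp_add exp_of_real .
qed

context
  fixes N :: nat and c :: "nat \<Rightarrow> real" and B :: real
  assumes N: "N > 0" and cB: "\<And>n. \<bar>c n\<bar> \<le> B"
begin

lemma exp_square_le:
  assumes "v > v0" "v0 > 0"
  shows "exp (- (pi / (2 * real N) * v * (real n)^2)) \<le> exp (- (pi / (2 * real N) * v0) * real n)"
proof -
  have "real n \<le> (real n)^2" by (simp add: power2_eq_square) (metis le_square of_nat_le_iff of_nat_mult)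
  hence "v0 * real n \<le> v * (real n)^2" using assms by (intro mult_mono) auto
  hence "pi / (2 * real N) * (v0 * real n) \<le> pi / (2 * real N) * (v * (real n)^2)" by (intro mult_left_mono) auto
  thus ?thesis by (simp add: mult.assoc)
qed

lemma Bnn: "B \<ge> 0" using cB[of 0] by linarith

text \<open>The power q^(-n^2/4N) grows like exp (pi n^2 v / 2N), but \<open>er\<close> decays like
  exp (- pi n^2 v / N); half of the Gaussian survives, and it is weakened to an exponential in n by
  n <= n^2.\<close>

lemma norm_Eterm:
  assumes "Im t > v0" "v0 > 0"
  shows "norm (of_real (c n * real n ^ p * er (real n * sqrt (pi * Im t / real N))) *
      ee (- (of_nat (n^2) / of_nat (4 * N)) * t)) \<le> B * (real n ^ p * exp (- (pi / (2 * real N) * v0) * real n))"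
proof -
  define e where "e = er (real n * sqrt (pi * Im t / real N))"
  have e: "\<bar>e\<bar> \<le> exp (- (pi / real N * Im t * (real n)^2))"
    using er_le[of "real n * sqrt (pi * Im t / real N)"] er_nonneg[of "real n * sqrt (pi * Im t / real N)"] assms
    by (simp add: e_def power_mult_distrib mult_ac)
  have "norm (of_real (c n * real n ^ p * e) * ee (- (of_nat (n^2) / of_nat (4 * N)) * t)) =
     \<bar>c n\<bar> * real n ^ p * (\<bar>e\<bar> * exp (pi / (2 * real N) * Im t * (real n)^2))"
    using N by (simp add: norm_mult norm_power norm_ee abs_mult field_simps)
  also have "\<dots> \<le> \<bar>c n\<bar> * real n ^ p * (exp (- (pi / real N * Im t * (real n)^2)) * exp (pi / (2 * real N) * Im t * (real n)^2))"
    using e by (intro mult_left_mono mult_right_mono) auto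
  also have "exp (- (pi / real N * Im t * (real n)^2)) * exp (pi / (2 * real N) * Im t * (real n)^2) = exp (- (pi / (2 * real N) * Im t * (real n)^2))"
    using N unfolding exp_add[symmetric] by (simp add: field_simps)
  also have "\<bar>c n\<bar> * real n ^ p * exp (- (pi / (2 * real N) * Im t * (real n)^2)) \<le> B * real n ^ p * exp (- (pi / (2 * real N) * v0) * real n)"
    using cB[of n] Bnn exp_square_le[OF assms, of n] by (intro mult_mono) auto
  finally show ?thesis by (simp add: e_def mult.assoc)
qed

lemma norm_Tterm:
  assumes "Im t > v0" "v0 > 0"
  shows "norm (of_real (c n * real n ^ p) * cnj (ee (of_nat (n^2) / of_nat (4 * N) * t)))
     \<le> B * (real n ^ p * exp (- (pi / (2 * real N) * v0) * real n))"
proof -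
  have "norm (of_real (c n * real n ^ p) * cnj (ee (of_nat (n^2) / of_nat (4 * N) * t))) =
     \<bar>c n\<bar> * real n ^ p * exp (- (pi / (2 * real N) * Im t * (real n)^2))"
    using N by (simp add: norm_mult norm_power norm_ee abs_mult field_simps)
  also have "\<dots> \<le> B * real n ^ p * exp (- (pi / (2 * real N) * v0) * real n)"
    using cB[of n] Bnn exp_square_le[OF assms, of n] by (intro mult_mono) auto
  finally show ?thesis by (simp add: mult.assoc)
qed

lemma summable_majorant: "v0 > 0 \<Longrightarrow> summable (\<lambda>n. K * (real n ^ p * exp (- (pi / (2 * real N) * v0) * real n)))"
  using N by (intro summable_mult summable_power_exp) auto

lemma summable_Eterm:
  assumes "t \<in> uhp"
  shows "summable (\<lambda>n. norm (of_real (c n * real n ^ p * er (real n * sqrt (pi * Im t / real N))) * ee (- (of_nat (n^2) / of_nat (4 * N)) * t)))"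
  by (rule summable_comparison_test[OF _ summable_majorant[of "Im t / 2" B p]])
     (use norm_Eterm[of "Im t / 2" t _ p] assms in \<open>auto simp: uhp_def\<close>)

lemma summable_Tterm:
  assumes "t \<in> uhp"
  shows "summable (\<lambda>n. norm (of_real (c n * real n ^ p) * cnj (ee (of_nat (n^2) / of_nat (4 * N) * t))))"
  by (rule summable_comparison_test[OF _ summable_majorant[of "Im t / 2" B p]])
     (use norm_Tterm[of "Im t / 2" t _ p] assms in \<open>auto simp: uhp_def\<close>)

lemma Eser_bounded: "\<exists>C. \<forall>t. Im t > 1 \<longrightarrow> norm (Eser N c p t) \<le> C"
proof (intro exI allI impI)
  fix t :: complex assume "Im t > 1"
  show "norm (Eser N c p t) \<le> (\<Sum>n. B * (real n ^ p * exp (- (pi / (2 * real N) * 1) * real n)))"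
    unfolding Eser_def using \<open>Im t > 1\<close>
    by (intro norm_suminf_le[OF norm_Eterm[of 1] summable_majorant[of 1]]) auto
qed

lemma Tser_bounded: "\<exists>C. \<forall>t. Im t > 1 \<longrightarrow> norm (Tser N c p t) \<le> C"
proof (intro exI allI impI)
  fix t :: complex assume "Im t > 1"
  show "norm (Tser N c p t) \<le> (\<Sum>n. B * (real n ^ p * exp (- (pi / (2 * real N) * 1) * real n)))"
    unfolding Tser_def using \<open>Im t > 1\<close>
    by (intro norm_suminf_le[OF norm_Tterm[of 1] summable_majorant[of 1]]) auto
qed

abbreviation half_pi_N :: complex where "half_pi_N \<equiv> of_real (pi / (2 * real N))"

lemma Tser_duv:
  assumes t: "t \<in> uhp"
  shows "has_duv (Tser N c p) (- \<i> * half_pi_N * Tser N c (p + 2) t) (- half_pi_N * Tser N c (p + 2) t) t"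
proof -
  let ?s = "\<lambda>p n t. of_real (c n * real n ^ p) * cnj (ee (of_nat (n^2) / of_nat (4 * N) * t))"
  have "has_duv (\<lambda>t. \<Sum>n. ?s p n t) (\<Sum>n. - \<i> * half_pi_N * ?s (p + 2) n t) (\<Sum>n. - half_pi_N * ?s (p + 2) n t) t"
  proof (rule has_duv_series[OF _ _ t])
    fix n \<sigma> assume "\<sigma> \<in> uhp"
    have d: "((\<lambda>t. ee (of_nat (n^2) / of_nat (4 * N) * t)) has_field_derivative
       tpi * (of_nat (n^2) / of_nat (4 * N)) * ee (of_nat (n^2) / of_nat (4 * N) * \<sigma>)) (at \<sigma>)"
      by (rule ee_has_field_derivative)
    show "has_duv (?s p n) (- \<i> * half_pi_N * ?s (p + 2) n \<sigma>) (- half_pi_N * ?s (p + 2) n \<sigma>) \<sigma>"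
      using has_duv_cmult[OF has_duv_antihol[OF d], of "of_real (c n * real n ^ p)"] N
      by (simp add: power_add power2_eq_square field_simps)
  next
    fix v0 :: real assume v0: "v0 > 0"
    define M where "M = (\<lambda>n. B * (real n ^ p * exp (- (pi / (2 * real N) * v0) * real n))
       + cmod half_pi_N * (B * (real n ^ (p + 2) * exp (- (pi / (2 * real N) * v0) * real n))))"
    have nn: "B * (real n ^ q * exp (- (pi / (2 * real N) * v0) * real n)) \<ge> 0" for n q using Bnn by simp
    have "norm (?s p n \<sigma>) \<le> M n \<and> norm (- \<i> * half_pi_N * ?s (p + 2) n \<sigma>) \<le> M n \<and> norm (- half_pi_N * ?s (p + 2) n \<sigma>) \<le> M n"
      if "Im \<sigma> > v0" for n \<sigma>
    proof -
      have 1: "norm (?s p n \<sigma>) \<le> B * (real n ^ p * exp (- (pi / (2 * real N) * v0) * real n))"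
        by (rule norm_Tterm[OF that v0])
      have 2: "norm half_pi_N * norm (?s (p + 2) n \<sigma>) \<le> norm half_pi_N * (B * (real n ^ (p + 2) * exp (- (pi / (2 * real N) * v0) * real n)))"
        by (rule mult_left_mono[OF norm_Tterm[OF that v0]]) simp
      have 3: "norm (- \<i> * half_pi_N * ?s (p + 2) n \<sigma>) = norm half_pi_N * norm (?s (p + 2) n \<sigma>)"
        "norm (- half_pi_N * ?s (p + 2) n \<sigma>) = norm half_pi_N * norm (?s (p + 2) n \<sigma>)" by (simp_all only: norm_mult norm_minus_cancel norm_ii mult_1)
      have 4: "norm half_pi_N * (B * (real n ^ (p + 2) * exp (- (pi / (2 * real N) * v0) * real n))) \<ge> 0"
        by (intro mult_nonneg_nonneg nn) auto
      show ?thesis unfolding 3 M_def using 1 2 4 nn[of n p] by linarith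
    qed
    moreover have "summable M" unfolding M_def by (intro summable_add summable_mult[of _ "cmod half_pi_N"] summable_majorant v0)
    ultimately show "\<exists>M. summable M \<and> (\<forall>n t. v0 < Im t \<longrightarrow> norm (?s p n t) \<le> M n \<and>
         norm (- \<i> * half_pi_N * ?s (p + 2) n t) \<le> M n \<and> norm (- half_pi_N * ?s (p + 2) n t) \<le> M n)" by blast
  qed
  also have "(\<lambda>t. \<Sum>n. ?s p n t) = Tser N c p" by (simp add: Tser_def fun_eq_iff)
  also have "(\<Sum>n. - \<i> * half_pi_N * ?s (p + 2) n t) = - \<i> * half_pi_N * Tser N c (p + 2) t"
    unfolding Tser_def by (rule suminf_mult[OF summable_norm_cancel[OF summable_Tterm[OF t]]])
  also have "(\<Sum>n. - half_pi_N * ?s (p + 2) n t) = - half_pi_N * Tser N c (p + 2) t"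
    unfolding Tser_def by (rule suminf_mult[OF summable_norm_cancel[OF summable_Tterm[OF t]]])
  finally show ?thesis .
qed

abbreviation inv_sqrt_Nv :: "complex \<Rightarrow> complex" where "inv_sqrt_Nv t \<equiv> of_real (1 / sqrt (real N * Im t))"

text \<open>The q-power is holomorphic and contributes n^2 to both partials; \<open>er\<close>
  depends on v only and contributes the conjugate theta term to the v-derivative.\<close>

lemma Eser_duv:
  assumes t: "t \<in> uhp"
  shows "has_duv (Eser N c p) (- \<i> * half_pi_N * Eser N c (p + 2) t) (half_pi_N * Eser N c (p + 2) t - inv_sqrt_Nv t * Tser N c (p + 1) t) t"
proof -
  let ?e = "\<lambda>p n t. of_real (c n * real n ^ p * er (real n * sqrt (pi * Im t / real N))) * ee (- (of_nat (n^2) / of_nat (4 * N)) * t)"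
  let ?s = "\<lambda>p n t. of_real (c n * real n ^ p) * cnj (ee (of_nat (n^2) / of_nat (4 * N) * t))"
  have "has_duv (\<lambda>t. \<Sum>n. ?e p n t) (\<Sum>n. - \<i> * half_pi_N * ?e (p + 2) n t) (\<Sum>n. half_pi_N * ?e (p + 2) n t - inv_sqrt_Nv t * ?s (p + 1) n t) t"
  proof (rule has_duv_series[OF _ _ t])
    fix n \<sigma> assume \<sigma>: "\<sigma> \<in> uhp"
    hence v: "Im \<sigma> > 0" by (simp add: uhp_def)
    let ?k = "- (of_nat (n^2) / of_nat (4 * N)) :: complex"
    define E where "E = ee (?k * \<sigma>)"
    define R where "R = er (real n * sqrt (pi * Im \<sigma> / real N))"
    define X where "X = exp (- (pi * (real n)^2 * Im \<sigma> / real N))"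
    have XE: "cnj (ee (of_nat (n^2) / of_nat (4 * N) * \<sigma>)) = of_real X * E"
      unfolding X_def E_def by (rule exp_ee_cnj[OF N, symmetric])
    have d: "((\<lambda>t. ee (?k * t)) has_field_derivative tpi * ?k * E) (at \<sigma>)"
      unfolding E_def by (rule ee_has_field_derivative)
    note D = has_duv_cmult[OF has_duv_mult[OF has_duv_Im[OF DERIV_er_sqrt[OF v N]] has_duv_hol[OF d]], of "of_real (c n * real n ^ p)" "real n"]
    have "has_duv (?e p n) (- \<i> * half_pi_N * (of_real (c n * real n ^ (p + 2) * R) * E)) (half_pi_N * (of_real (c n * real n ^ (p + 2) * R) * E)
        - inv_sqrt_Nv \<sigma> * (of_real (c n * real n ^ (p + 1)) * (of_real X * E))) \<sigma>"
    proof (rule has_duv_eq[OF D])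
      show "of_real (c n * real n ^ p) * (0 * ee (?k * \<sigma>) + of_real (er (real n * sqrt (pi * Im \<sigma> / real N))) * (tpi * ?k * E))
        = - \<i> * half_pi_N * (of_real (c n * real n ^ (p + 2) * R) * E)"
        unfolding R_def using N by (simp add: power_add power2_eq_square)
      show "of_real (c n * real n ^ p) * (of_real (- (real n * exp (- (pi * (real n)^2 * Im \<sigma> / real N)) / sqrt (real N * Im \<sigma>))) * ee (?k * \<sigma>) +
          of_real (er (real n * sqrt (pi * Im \<sigma> / real N))) * (\<i> * (tpi * ?k * E)))
        = half_pi_N * (of_real (c n * real n ^ (p + 2) * R) * E) - inv_sqrt_Nv \<sigma> * (of_real (c n * real n ^ (p + 1)) * (of_real X * E))"
        unfolding R_def[symmetric] X_def[symmetric] E_def[symmetric] using N by (simp add: power_add power2_eq_square algebra_simps)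
    qed (simp add: fun_eq_iff)
    thus "has_duv (?e p n) (- \<i> * half_pi_N * ?e (p + 2) n \<sigma>) (half_pi_N * ?e (p + 2) n \<sigma> - inv_sqrt_Nv \<sigma> * ?s (p + 1) n \<sigma>) \<sigma>"
      unfolding XE by (simp only: E_def R_def)
  next
    fix v0 :: real assume v0: "v0 > 0"
    define m where "m = (\<lambda>q n. B * (real n ^ q * exp (- (pi / (2 * real N) * v0) * real n)))"
    define W where "W = 1 / sqrt (real N * v0)"
    define M where "M = (\<lambda>n. m p n + cmod half_pi_N * m (p + 2) n + W * m (p + 1) n)"
    have nn: "m q n \<ge> 0" for n q unfolding m_def using Bnn by simp
    have W: "W \<ge> 0" unfolding W_def using v0 by simp
    have "norm (?e p n \<sigma>) \<le> M n \<and> norm (- \<i> * half_pi_N * ?e (p + 2) n \<sigma>) \<le> M n \<and> norm (half_pi_N * ?e (p + 2) n \<sigma> - inv_sqrt_Nv \<sigma> * ?s (p + 1) n \<sigma>) \<le> M n"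
      if "Im \<sigma> > v0" for n \<sigma>
    proof -
      have 1: "norm (?e p n \<sigma>) \<le> m p n" unfolding m_def by (rule norm_Eterm[OF that v0])
      have 2: "norm half_pi_N * norm (?e (p + 2) n \<sigma>) \<le> norm half_pi_N * m (p + 2) n"
        unfolding m_def by (rule mult_left_mono[OF norm_Eterm[OF that v0]]) simp
      have "sqrt (real N * v0) \<le> sqrt (real N * Im \<sigma>)" using that v0 by (simp add: mult_left_mono)
      hence w: "norm (inv_sqrt_Nv \<sigma>) \<le> W" unfolding W_def norm_of_real using v0 N that by (simp add: frac_le)
      have 3: "norm (inv_sqrt_Nv \<sigma>) * norm (?s (p + 1) n \<sigma>) \<le> W * m (p + 1) n"
        unfolding m_def by (rule mult_mono[OF w norm_Tterm[OF that v0] W]) simp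
      have 4: "norm (- \<i> * half_pi_N * ?e (p + 2) n \<sigma>) = norm half_pi_N * norm (?e (p + 2) n \<sigma>)" by (simp only: norm_mult norm_minus_cancel norm_ii mult_1)
      have 5: "norm (half_pi_N * ?e (p + 2) n \<sigma> - inv_sqrt_Nv \<sigma> * ?s (p + 1) n \<sigma>) \<le> norm half_pi_N * norm (?e (p + 2) n \<sigma>) + norm (inv_sqrt_Nv \<sigma>) * norm (?s (p + 1) n \<sigma>)"
        by (rule order_trans[OF norm_triangle_ineq4]) (simp only: norm_mult order_refl)
      have 6: "norm half_pi_N * m (p + 2) n \<ge> 0" "W * m (p + 1) n \<ge> 0" using nn W by (simp_all only: mult_nonneg_nonneg norm_ge_zero)
      show ?thesis unfolding M_def 4 using 1 2 3 5 6 nn[of p n] by linarith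
    qed
    moreover have "summable M" unfolding M_def m_def
      by (intro summable_add summable_mult[of _ "cmod half_pi_N"] summable_mult[of _ W] summable_majorant v0)
    ultimately show "\<exists>M. summable M \<and> (\<forall>n t. v0 < Im t \<longrightarrow> norm (?e p n t) \<le> M n \<and>
         norm (- \<i> * half_pi_N * ?e (p + 2) n t) \<le> M n \<and> norm (half_pi_N * ?e (p + 2) n t - inv_sqrt_Nv t * ?s (p + 1) n t) \<le> M n)" by blast
  qed
  also have "(\<lambda>t. \<Sum>n. ?e p n t) = Eser N c p" by (simp add: Eser_def fun_eq_iff)
  also have "(\<Sum>n. - \<i> * half_pi_N * ?e (p + 2) n t) = - \<i> * half_pi_N * Eser N c (p + 2) t"
    unfolding Eser_def by (rule suminf_mult[OF summable_norm_cancel[OF summable_Eterm[OF t]]])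
  also have "(\<Sum>n. half_pi_N * ?e (p + 2) n t - inv_sqrt_Nv t * ?s (p + 1) n t) = (\<Sum>n. half_pi_N * ?e (p + 2) n t) - (\<Sum>n. inv_sqrt_Nv t * ?s (p + 1) n t)"
    by (rule suminf_diff[symmetric]; rule summable_mult; rule summable_norm_cancel; (rule summable_Eterm[OF t] summable_Tterm[OF t]))
  also have "(\<Sum>n. half_pi_N * ?e (p + 2) n t) = half_pi_N * Eser N c (p + 2) t"
    unfolding Eser_def by (rule suminf_mult[OF summable_norm_cancel[OF summable_Eterm[OF t]]])
  also have "(\<Sum>n. inv_sqrt_Nv t * ?s (p + 1) n t) = inv_sqrt_Nv t * Tser N c (p + 1) t"
    unfolding Tser_def by (rule suminf_mult[OF summable_norm_cancel[OF summable_Tterm[OF t]]])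
  finally show ?thesis .
qed

text \<open>Differentiating \<open>Eser\<close> yields only \<open>Eser\<close>, \<open>Tser\<close>
  and powers of v, so this class is closed under both partials and can be fed to
  \<open>smooth_uhpI\<close>.\<close>

inductive_set SM :: "(complex \<Rightarrow> complex) set" where
  hol: "f holomorphic_on uhp \<Longrightarrow> f \<in> SM"
| E: "Eser N c p \<in> SM"
| T: "Tser N c p \<in> SM"
| pow: "(\<lambda>t. of_real (Im t powr s)) \<in> SM"
| add: "f \<in> SM \<Longrightarrow> g \<in> SM \<Longrightarrow> (\<lambda>t. f t + g t) \<in> SM"
| mult: "f \<in> SM \<Longrightarrow> g \<in> SM \<Longrightarrow> (\<lambda>t. f t * g t) \<in> SM"

lemma SM_const: "(\<lambda>_. k) \<in> SM" by (rule SM.hol) simp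

lemma SM_smooth:
  assumes "f \<in> SM" shows "smooth_uhp f"
proof (rule smooth_uhpI[OF _ assms])
  fix f assume "f \<in> SM"
  thus "\<exists>fu\<in>SM. \<exists>fv\<in>SM. \<forall>t\<in>uhp. has_duv f (fu t) (fv t) t"
  proof induction
    case (hol f)
    have "deriv f holomorphic_on uhp" by (rule holomorphic_deriv[OF hol open_uhp])
    hence "deriv f \<in> SM" "(\<lambda>t. \<i> * deriv f t) \<in> SM" by (auto intro!: SM.hol holomorphic_intros)
    moreover have "\<forall>t\<in>uhp. has_duv f (deriv f t) (\<i> * deriv f t) t"
      using has_duv_hol holomorphic_derivI[OF hol open_uhp] by blast
    ultimately show ?case by (intro bexI[of _ "deriv f"] bexI[of _ "\<lambda>t. \<i> * deriv f t"]) auto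
  next
    case (E p)
    have w: "inv_sqrt_Nv t = of_real (1 / sqrt (real N)) * of_real (Im t powr (-1/2))" if "t \<in> uhp" for t
      using that by (simp add: uhp_def real_sqrt_mult powr_minus powr_half_sqrt field_simps)
    have "(\<lambda>t. - \<i> * half_pi_N * Eser N c (p + 2) t) \<in> SM" by (intro SM.mult SM.E SM_const)
    moreover have "(\<lambda>t. half_pi_N * Eser N c (p + 2) t + (- 1) * (of_real (1 / sqrt (real N)) * of_real (Im t powr (-1/2))) * Tser N c (p + 1) t) \<in> SM"
      by (intro SM.add SM.mult SM.E SM_const SM.T SM.pow)
    moreover have "\<forall>t\<in>uhp. has_duv (Eser N c p) (- \<i> * half_pi_N * Eser N c (p + 2) t)
       (half_pi_N * Eser N c (p + 2) t + (- 1) * (of_real (1 / sqrt (real N)) * of_real (Im t powr (-1/2))) * Tser N c (p + 1) t) t"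
    proof
      fix t assume t: "t \<in> uhp"
      show "has_duv (Eser N c p) (- \<i> * half_pi_N * Eser N c (p + 2) t)
       (half_pi_N * Eser N c (p + 2) t + (- 1) * (of_real (1 / sqrt (real N)) * of_real (Im t powr (-1/2))) * Tser N c (p + 1) t) t"
        using Eser_duv[OF t, of p] unfolding w[OF t] by (simp only: diff_conv_add_uminus mult_minus_left mult_1)
    qed
    ultimately show ?case by (intro bexI[of _ "\<lambda>t. - \<i> * half_pi_N * Eser N c (p + 2) t"]
      bexI[of _ "\<lambda>t. half_pi_N * Eser N c (p + 2) t + (- 1) * (of_real (1 / sqrt (real N)) * of_real (Im t powr (-1/2))) * Tser N c (p + 1) t"])
  next
    case (T p)
    have "(\<lambda>t. - \<i> * half_pi_N * Tser N c (p + 2) t) \<in> SM" "(\<lambda>t. - half_pi_N * Tser N c (p + 2) t) \<in> SM"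
      by (intro SM.mult SM.T SM_const)+
    thus ?case using Tser_duv by (intro bexI[of _ "\<lambda>t. - \<i> * half_pi_N * Tser N c (p + 2) t"] bexI[of _ "\<lambda>t. - half_pi_N * Tser N c (p + 2) t"] ballI)
  next
    case (pow s)
    have "has_duv (\<lambda>t. of_real (Im t powr s)) 0 (of_real s * of_real (Im t powr (s - 1))) t" if "t \<in> uhp" for t
    proof -
      have "((\<lambda>v. v powr s) has_real_derivative s * Im t powr (s - 1)) (at (Im t))"
        using that by (intro has_real_derivative_powr) (auto simp: uhp_def)
      from has_duv_Im[OF this] show ?thesis by simp
    qed
    moreover have "(\<lambda>t. of_real s * of_real (Im t powr (s - 1))) \<in> SM" by (intro SM.mult SM_const SM.pow)
    ultimately show ?case using SM_const[of 0] by (intro bexI[of _ "\<lambda>_. 0"] bexI[of _ "\<lambda>t. of_real s * of_real (Im t powr (s - 1))"]) auto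
  next
    case (add f g)
    then obtain fu fv gu gv where "fu \<in> SM" "fv \<in> SM" "gu \<in> SM" "gv \<in> SM"
      "\<forall>t\<in>uhp. has_duv f (fu t) (fv t) t" "\<forall>t\<in>uhp. has_duv g (gu t) (gv t) t" by blast
    thus ?case by (intro bexI[of _ "\<lambda>t. fu t + gu t"] bexI[of _ "\<lambda>t. fv t + gv t"] ballI has_duv_add SM.add) auto
  next
    case (mult f g)
    then obtain fu fv gu gv where "fu \<in> SM" "fv \<in> SM" "gu \<in> SM" "gv \<in> SM"
      "\<forall>t\<in>uhp. has_duv f (fu t) (fv t) t" "\<forall>t\<in>uhp. has_duv g (gu t) (gv t) t" by blast
    thus ?case using mult.hyps
      by (intro bexI[of _ "\<lambda>t. fu t * g t + f t * gu t"] bexI[of _ "\<lambda>t. fv t * g t + f t * gv t"] ballI has_duv_mult SM.add SM.mult) auto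
  qed
qed

end

text \<open>\<open>P\<close> measures the failure of the Cauchy-Riemann equation f_v = i f_u.
  Writing the v-derivative this way makes the second derivatives of the holomorphic part cancel, and
  both the Laplacian and \<open>xi\<close> depend on \<open>P\<close> alone up to the mixed terms of
  \<open>fu\<close>.\<close>

lemma laplacian_dbar:
  assumes f: "\<forall>t\<in>uhp. has_duv f (fu t) (\<i> * fu t + P t) t" and t: "t \<in> uhp"
    and fu: "has_duv fu a b t" and P: "has_duv P c d t"
  shows "d_u (d_u f) t + d_v (d_v f) t = a + \<i> * b + d" "d_u f t + \<i> * d_v f t = \<i> * P t"
proof -
  note d = has_duv_d_u[OF bspec[OF f]] has_duv_d_v[OF bspec[OF f]]
  have "has_duv (d_u f) a b t" by (rule has_duv_transform[OF fu t]) (simp add: d)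
  moreover have "has_duv (d_v f) (\<i> * a + c) (\<i> * b + d) t"
    by (rule has_duv_transform[OF has_duv_add[OF has_duv_cmult[OF fu] P] t]) (simp add: d)
  ultimately show "d_u (d_u f) t + d_v (d_v f) t = a + \<i> * b + d" using has_duv_d_u has_duv_d_v by fastforce
  show "d_u f t + \<i> * d_v f t = \<i> * P t" using d[OF t] by (simp add: algebra_simps)
qed

lemma has_duv_w:
  assumes "t \<in> uhp" "N > 0"
  shows "has_duv (\<lambda>t. of_real (1 / sqrt (real N * Im t))) 0 (of_real (- 1 / (2 * Im t * sqrt (real N * Im t)))) t"
proof (rule has_duv_Im)
  have v: "Im t > 0" using assms by (simp add: uhp_def)
  define s where "s = sqrt (real N * Im t)"
  have s: "s > 0" "s * s = real N * Im t" using v assms by (auto simp: s_def)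
  have "((\<lambda>v. 1 / sqrt (real N * v)) has_real_derivative - (real N * (inverse s / 2)) / (s * s)) (at (Im t))"
    unfolding s_def using v assms by (auto intro!: derivative_eq_intros simp: mult_less_0_iff)
  also have "- (real N * (inverse s / 2)) / (s * s) = - 1 / (2 * Im t * sqrt (real N * Im t))"
    unfolding s(2) s_def[symmetric] using s(1) v assms by (simp add: field_simps)
  finally show "((\<lambda>v. 1 / sqrt (real N * v)) has_real_derivative - 1 / (2 * Im t * sqrt (real N * Im t))) (at (Im t))" .
qed

context
  fixes N :: nat and c :: "nat \<Rightarrow> real" and B :: real and h :: "complex \<Rightarrow> complex"
  assumes N: "N > 0" and cB: "\<And>n. \<bar>c n\<bar> \<le> B" and h: "h holomorphic_on uhp"
begin

lemma has_duv_deriv: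
  assumes "t \<in> uhp"
  shows "has_duv h (deriv h t) (\<i> * deriv h t) t" "has_duv (deriv h) (deriv (deriv h) t) (\<i> * deriv (deriv h) t) t"
  by (intro has_duv_hol holomorphic_derivI[OF _ open_uhp assms] holomorphic_deriv h open_uhp)+

text \<open>The antiholomorphic derivative is (N v)^(-1/2) times an antiholomorphic series. The
  factor v^(1/2) in \<open>xi\<close> cancels this power of v, and the same cancellation makes the
  Laplacian vanish.\<close>

lemma maass_half:
  defines "f \<equiv> \<lambda>t. h t + Eser N c 0 t"
  shows "smooth_uhp f"
    and "t \<in> uhp \<Longrightarrow> laplacian (1/2) f t = 0"
    and "t \<in> uhp \<Longrightarrow> xi (1/2) f t = - of_real (1 / sqrt (real N)) * cnj (Tser N c 1 t)"
proof -
  have "h \<in> SM N c" "Eser N c 0 \<in> SM N c" by (auto intro: SM.intros[OF N cB] h)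
  hence "(\<lambda>t. h t + Eser N c 0 t) \<in> SM N c" by (rule SM.add[OF N cB])
  thus "smooth_uhp f" unfolding f_def by (rule SM_smooth[OF N cB])
  let ?b = "complex_of_real (pi / (2 * real N))"
  let ?w = "\<lambda>t. complex_of_real (1 / sqrt (real N * Im t))"
  let ?E = "Eser N c" and ?T = "Tser N c"
  note ED = Eser_duv[OF N cB] and TD = Tser_duv[OF N cB]
  define fu where "fu = (\<lambda>t. deriv h t + - \<i> * ?b * ?E 2 t)"
  define P where "P = (\<lambda>t. (- 1) * (?w t * ?T 1 t))"
  have f1: "\<forall>t\<in>uhp. has_duv f (fu t) (\<i> * fu t + P t) t"
    unfolding f_def by (intro ballI, rule has_duv_eq[OF has_duv_add[OF has_duv_deriv(1) ED] refl])
      (simp_all add: fu_def P_def algebra_simps numeral_2_eq_2)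
  assume t: "t \<in> uhp"
  let ?w' = "of_real (- 1 / (2 * Im t * sqrt (real N * Im t)))"
  have fuu: "has_duv fu (deriv (deriv h) t + (- \<i> * ?b * (- \<i> * ?b * ?E (2 + 2) t)))
     (\<i> * deriv (deriv h) t + (- \<i> * ?b * (?b * ?E (2 + 2) t - ?w t * ?T (2 + 1) t))) t"
    unfolding fu_def by (rule has_duv_add[OF has_duv_deriv(2)[OF t] has_duv_cmult[OF ED[OF t]]])
  have Pv: "has_duv P (- 1 * (0 * ?T 1 t + ?w t * (- \<i> * ?b * ?T (1 + 2) t))) (- 1 * (?w' * ?T 1 t + ?w t * (- ?b * ?T (1 + 2) t))) t"
    unfolding P_def by (rule has_duv_cmult[OF has_duv_mult[OF has_duv_w[OF t N] TD[OF t]]])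
  have lap: "d_u (d_u f) t + d_v (d_v f) t = - ?w' * ?T 1 t"
    unfolding laplacian_dbar(1)[of f fu P, OF f1 t fuu Pv] by (simp add: algebra_simps numeral_3_eq_3)
  have D: "d_u f t + \<i> * d_v f t = - \<i> * ?w t * ?T 1 t"
    unfolding laplacian_dbar(2)[of f fu P, OF f1 t fuu Pv] by (simp add: P_def)
  have v: "Im t > 0" using t by (simp add: uhp_def)
  have r: "(Im t)^2 * (- 1 / (2 * Im t * sqrt (real N * Im t))) = - (1 / 2 * Im t) * (1 / sqrt (real N * Im t))"
    using v by (simp add: power2_eq_square)
  have "laplacian (1/2) f t = of_real ((Im t)^2 * (- 1 / (2 * Im t * sqrt (real N * Im t)))) * ?T 1 t + of_real (1 / 2 * Im t * (1 / sqrt (real N * Im t))) * ?T 1 t"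
    unfolding laplacian_def lap D by (simp add: mult_ac)
  also have "\<dots> = 0" unfolding r by simp
  finally show "laplacian (1/2) f t = 0" .
  have "xi (1/2) f t = - of_real (sqrt (Im t) * (1 / sqrt (real N * Im t))) * cnj (?T 1 t)"
    unfolding xi_def d_taubar_def D using v by (simp add: powr_half_sqrt mult_ac)
  also have "sqrt (Im t) * (1 / sqrt (real N * Im t)) = 1 / sqrt (real N)"
    using v N by (simp add: real_sqrt_mult)
  finally show "xi (1/2) f t = - of_real (1 / sqrt (real N)) * cnj (?T 1 t)" .
qed

text \<open>In weight 3/2 the error functions alone have an antiholomorphic derivative with the
  wrong power of v. The added conjugate theta term repairs this, leaving only the derivative of (N
  v)^(-1/2) times \<open>Tser\<close>.\<close>

lemma maass_three_half:
  defines "f \<equiv> \<lambda>t. h t + (Eser N c 1 t + of_real (- (real N / pi)) * (of_real (1 / sqrt (real N * Im t)) * Tser N c 0 t))"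
  shows "smooth_uhp f"
    and "t \<in> uhp \<Longrightarrow> laplacian (3/2) f t = 0"
    and "t \<in> uhp \<Longrightarrow> xi (3/2) f t = of_real (sqrt (real N) / (2 * pi)) * cnj (Tser N c 0 t)"
proof -
  let ?b = "complex_of_real (pi / (2 * real N))"
  let ?w = "\<lambda>t. complex_of_real (1 / sqrt (real N * Im t))"
  let ?K = "complex_of_real (- (real N / pi))"
  let ?E = "Eser N c" and ?T = "Tser N c"
  have "(\<lambda>t. h t + (?E 1 t + ?K * (of_real (1 / sqrt (real N)) * of_real (Im t powr (-1/2)) * ?T 0 t))) \<in> SM N c"
    by (intro SM.intros(5,6)[OF N cB] SM.intros(2,3,4)[OF N cB] SM.hol[OF N cB h] SM_const[OF N cB])
  from SM_smooth[OF N cB this] have sm: "smooth_uhp (\<lambda>t. h t + (?E 1 t + ?K * (of_real (1 / sqrt (real N)) * of_real (Im t powr (-1/2)) * ?T 0 t)))" .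
  moreover have w_eq: "of_real (1 / sqrt (real N)) * of_real (Im t powr (-1/2)) = ?w t" if "t \<in> uhp" for t
    using that by (simp add: uhp_def real_sqrt_mult powr_minus powr_half_sqrt field_simps)
  ultimately have "Cn_uhp n f" for n
  proof -
    have "Cn_uhp n (\<lambda>t. h t + (?E 1 t + ?K * (of_real (1 / sqrt (real N)) * of_real (Im t powr (-1/2)) * ?T 0 t)))"
      using sm by (simp only: smooth_uhp_def)
    thus ?thesis by (rule Cn_uhp_cong[rotated]) (simp only: f_def w_eq)
  qed
  thus "smooth_uhp f" by (simp add: smooth_uhp_def)
  note ED = Eser_duv[OF N cB] and TD = Tser_duv[OF N cB]
  let ?w1 = "\<lambda>t. complex_of_real (- 1 / (2 * Im t * sqrt (real N * Im t)))"
  let ?w2 = "\<lambda>t. complex_of_real (3 / (4 * (Im t)^2 * sqrt (real N * Im t)))"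
  have w1: "has_duv ?w1 0 (?w2 t) t" if t: "t \<in> uhp" for t
  proof (rule has_duv_Im)
    define s where "s = sqrt (real N * Im t)"
    have v: "Im t > 0" using t by (simp add: uhp_def)
    have s: "s > 0" "s * s = real N * Im t" using v N by (auto simp: s_def)
    have "((\<lambda>v. - 1 / (2 * v * sqrt (real N * v))) has_real_derivative
       (2 * s + 2 * Im t * (real N * (inverse s / 2))) / ((2 * Im t * s) * (2 * Im t * s))) (at (Im t))"
      unfolding s_def using v N by (auto intro!: derivative_eq_intros simp: mult_ac mult_less_0_iff) (simp add: minus_divide_left add.commute)
    also have "2 * s + 2 * Im t * (real N * (inverse s / 2)) = 3 * s"
      using s by (simp add: field_simps)
    also have "3 * s / ((2 * Im t * s) * (2 * Im t * s)) = 3 / (4 * (Im t)^2 * s)"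
      using s v by (simp add: field_simps power2_eq_square)
    finally show "((\<lambda>v. - 1 / (2 * v * sqrt (real N * v))) has_real_derivative 3 / (4 * (Im t)^2 * sqrt (real N * Im t))) (at (Im t))"
      unfolding s_def .
  qed
  \<comment> \<open>This is the choice of constant: it gives 1 + 2 K b = 0, so the
    \<open>T 2\<close> terms drop out of the antiholomorphic derivative.\<close>
  have Kb: "?K * ?b = - 1 / 2" using N by (simp add: field_simps)
  define fu where "fu = (\<lambda>t. deriv h t + (- \<i> * ?b * ?E 3 t + - \<i> * (- 1 / 2) * (?w t * ?T 2 t)))"
  define P where "P = (\<lambda>t. ?K * (?w1 t * ?T 0 t))"
  have i: "(1::nat) + 2 = 3" "(1::nat) + 1 = 2" "(0::nat) + 2 = 2" "(3::nat) + 1 = 2 + 2" by simp_all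
  have f1: "\<forall>t\<in>uhp. has_duv f (fu t) (\<i> * fu t + P t) t"
  proof
    fix t assume that: "t \<in> uhp"
    note * = has_duv_add[OF has_duv_deriv(1)[OF that] has_duv_add[OF ED[OF that] has_duv_cmult[OF has_duv_mult[OF has_duv_w[OF that N] TD[OF that]], of ?K]]]
    have 1: "K * (0 * x + w * (- \<i> * b * y)) = - \<i> * (K * b) * (w * y)" for K b w x y :: complex by simp
    have 2: "\<i> * D + (b * E - w * y + K * (u + w * (- b * y))) = \<i> * (D + (- \<i> * b * E + - \<i> * (K * b) * (w * y))) + K * u - (1 + 2 * (K * b)) * (w * y)"
      for K b w y D E u :: complex by (simp add: algebra_simps)
    show "has_duv f (fu t) (\<i> * fu t + P t) t" unfolding f_def
      by (rule has_duv_eq[OF * refl]) (simp_all only: i 1 2 fu_def P_def Kb, simp_all)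
  qed
  assume t: "t \<in> uhp"
  have fuu: "has_duv fu (deriv (deriv h) t + (- \<i> * ?b * (- \<i> * ?b * ?E (3 + 2) t) + - \<i> * (- 1 / 2) * (0 * ?T 2 t + ?w t * (- \<i> * ?b * ?T (2 + 2) t))))
     (\<i> * deriv (deriv h) t + (- \<i> * ?b * (?b * ?E (3 + 2) t - ?w t * ?T (3 + 1) t) + - \<i> * (- 1 / 2) * (?w1 t * ?T 2 t + ?w t * (- ?b * ?T (2 + 2) t)))) t"
    unfolding fu_def by (rule has_duv_add[OF has_duv_deriv(2)[OF t]
       has_duv_add[OF has_duv_cmult[OF ED[OF t]] has_duv_cmult[OF has_duv_mult[OF has_duv_w[OF t N] TD[OF t]]]]])
  have Pv: "has_duv P (?K * (0 * ?T 0 t + ?w1 t * (- \<i> * ?b * ?T (0 + 2) t))) (?K * (?w2 t * ?T 0 t + ?w1 t * (- ?b * ?T (0 + 2) t))) t"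
    unfolding P_def by (rule has_duv_cmult[OF has_duv_mult[OF w1[OF t] TD[OF t]]])
  have lap: "d_u (d_u f) t + d_v (d_v f) t = ?K * ?w2 t * ?T 0 t"
  proof -
    have x: "K * (u * r + s * (- b * x)) = K * u * r - (K * b) * (s * x)" for K u r s b x :: complex by (simp add: algebra_simps)
    show ?thesis unfolding laplacian_dbar(1)[of f fu P, OF f1 t fuu Pv] i x Kb by (simp add: algebra_simps)
  qed
  have D: "d_u f t + \<i> * d_v f t = \<i> * ?K * ?w1 t * ?T 0 t"
    unfolding laplacian_dbar(2)[of f fu P, OF f1 t fuu Pv] by (simp add: P_def)
  have v: "Im t > 0" using t by (simp add: uhp_def)
  have "laplacian (3/2) f t = - of_real ((Im t)^2 * (3 / (4 * (Im t)^2 * sqrt (real N * Im t))) + 3 / 2 * Im t * (- 1 / (2 * Im t * sqrt (real N * Im t)))) * (?K * ?T 0 t)"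
    unfolding laplacian_def lap D by (simp add: algebra_simps)
  also have "(Im t)^2 * (3 / (4 * (Im t)^2 * sqrt (real N * Im t))) + 3 / 2 * Im t * (- 1 / (2 * Im t * sqrt (real N * Im t))) = 0"
    using v N by (simp add: field_simps)
  finally show "laplacian (3/2) f t = 0" by simp
  have "xi (3/2) f t = of_real (Im t powr (3/2) * (real N / pi) * (1 / (2 * Im t * sqrt (real N * Im t)))) * cnj (?T 0 t)"
    unfolding xi_def d_taubar_def D by (simp add: mult_ac)
  also have "Im t powr (3/2) * (real N / pi) * (1 / (2 * Im t * sqrt (real N * Im t))) = sqrt (real N) / (2 * pi)"
  proof -
    have p: "Im t powr (3/2) = Im t * sqrt (Im t)" using powr_mult_base[of "Im t" "1/2"] v by (simp add: powr_half_sqrt)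
    have "real N = sqrt (real N) * sqrt (real N)" by simp
    thus ?thesis unfolding p using v N by (simp add: real_sqrt_mult field_simps)
  qed
  finally show "xi (3/2) f t = of_real (sqrt (real N) / (2 * pi)) * cnj (?T 0 t)" .
qed

end

lemma nonhol_term_half:
  assumes "N > 0" "n > 0" "t \<in> uhp"
  shows "nonhol_term N (1/2) (- (int n)\<^sup>2) t =
    of_real (sqrt pi * er (real n * sqrt (pi * Im t / real N))) * ee (- (of_nat (n^2) / of_nat (4 * N)) * t)"
proof -
  define x where "x = pi * (real n)^2 * Im t / real N"
  have x: "x > 0" using assms by (simp add: x_def uhp_def)
  have sx: "sqrt x = real n * sqrt (pi * Im t / real N)"
    by (simp add: x_def real_sqrt_mult real_sqrt_divide)
  have "- 4 * pi * (of_int (- (int n)\<^sup>2) / of_nat (4 * N)) * Im t = x" using assms by (simp add: x_def)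
  thus ?thesis using assms inc_Gamma_half[OF x] by (simp add: nonhol_term_def sx)
qed

text \<open>The incomplete Gamma function at -1/2 consists of an error function and an exponential,
  so the two summands of the weight 3/2 form are one multiple of a single non-holomorphic
  term.\<close>

lemma nonhol_term_three_half:
  assumes "N > 0" "n > 0" "t \<in> uhp"
  shows "of_real (- (real n / (2 * sqrt pi))) * nonhol_term N (3/2) (- (int n)\<^sup>2) t =
    of_real (real n * er (real n * sqrt (pi * Im t / real N))) * ee (- (of_nat (n^2) / of_nat (4 * N)) * t)
     + of_real (- (real N / pi)) * (of_real (1 / sqrt (real N * Im t)) * cnj (ee (of_nat (n^2) / of_nat (4 * N) * t)))"
proof -
  define x where "x = pi * (real n)^2 * Im t / real N"
  have v: "Im t > 0" using assms by (simp add: uhp_def)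
  have x: "x > 0" using assms by (simp add: x_def uhp_def)
  have sx: "sqrt x = real n * sqrt (pi * Im t / real N)"
    by (simp add: x_def real_sqrt_mult real_sqrt_divide)
  define R where "R = er (real n * sqrt (pi * Im t / real N))"
  define E where "E = ee (- (of_nat (n^2) / of_nat (4 * N)) * t)"
  have c: "cnj (ee (of_nat (n^2) / of_nat (4 * N) * t)) = of_real (exp (- x)) * E"
    unfolding E_def x_def by (rule exp_ee_cnj[OF assms(1), symmetric])
  have "- 4 * pi * (of_int (- (int n)\<^sup>2) / of_nat (4 * N)) * Im t = x" using assms by (simp add: x_def)
  hence "nonhol_term N (3/2) (- (int n)\<^sup>2) t = of_real (2 / sqrt x * exp (- x) - 2 * sqrt pi * er (sqrt x)) * E"
    using assms inc_Gamma_minus_half[OF x] by (simp add: nonhol_term_def E_def)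
  moreover have "- (real n / (2 * sqrt pi)) * (2 / sqrt x * exp (- x) - 2 * sqrt pi * er (sqrt x)) = real n * R + (- (real N / pi)) * (1 / sqrt (real N * Im t)) * exp (- x)"
  proof -
    have 1: "real n / (sqrt pi * sqrt x) = real N / pi * (1 / sqrt (real N * Im t))"
    proof -
      have "real n / (sqrt pi * sqrt x) = sqrt (real N) / (sqrt pi * sqrt pi * sqrt (Im t))"
        unfolding sx using assms(2) by (simp add: real_sqrt_mult real_sqrt_divide)
      also have "\<dots> = (sqrt (real N) * sqrt (real N)) / (pi * (sqrt (real N) * sqrt (Im t)))"
        using assms(1) by (simp del: real_sqrt_mult_self add: field_simps) simp
      also have "\<dots> = real N / pi * (1 / sqrt (real N * Im t))" by (simp add: real_sqrt_mult)
      finally show ?thesis .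
    qed
    have R: "er (sqrt x) = R" unfolding R_def sx ..
    have "- (real n / (2 * sqrt pi)) * (2 / sqrt x * exp (- x) - 2 * sqrt pi * R) =
       real n * R - real n / (sqrt pi * sqrt x) * exp (- x)"
      using x by (simp add: field_simps)
    thus ?thesis unfolding 1 R by simp
  qed
  ultimately show ?thesis unfolding c R_def[symmetric] E_def[symmetric]
    by (simp only: mult.assoc[symmetric] of_real_mult[symmetric] of_real_add[symmetric] distrib_right[symmetric])
qed

section \<open>Term by term differentiation and multiplication of unordered sums\<close>

lemma infsum_has_field_derivative:
  fixes f :: "'i \<Rightarrow> complex \<Rightarrow> complex"
  assumes r: "r > 0" and hol: "\<And>i w. i \<in> I \<Longrightarrow> w \<in> cball z r \<Longrightarrow> (f i has_field_derivative f' i w) (at w)"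
    and M: "M summable_on I" "\<And>i w. i \<in> I \<Longrightarrow> w \<in> cball z r \<Longrightarrow> norm (f i w) \<le> M i"
  obtains g' where "((\<lambda>z. \<Sum>\<^sub>\<infinity>i\<in>I. f i z) has_field_derivative g') (at z)" "((\<lambda>i. f' i z) has_sum g') I"
proof -
  have ul: "uniform_limit (cball z r) (\<lambda>X w. \<Sum>i\<in>X. f i w) (\<lambda>w. \<Sum>\<^sub>\<infinity>i\<in>I. f i w) (finite_subsets_at_top I)"
    by (rule Weierstrass_m_test_general[OF M(2,1)])
  obtain g' where g': "\<And>w. w \<in> ball z r \<Longrightarrow> ((\<lambda>w. \<Sum>\<^sub>\<infinity>i\<in>I. f i w) has_field_derivative (g' w)) (at w) \<and>
      ((\<lambda>X. \<Sum>i\<in>X. f' i w) \<longlongrightarrow> g' w) (finite_subsets_at_top I)"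
  proof (rule has_complex_derivative_uniform_limit[where f="\<lambda>X w. \<Sum>i\<in>X. f i w" and f'="\<lambda>X w. \<Sum>i\<in>X. f' i w" and F="finite_subsets_at_top I", OF _ ul _ r])
    have "\<forall>\<^sub>F X in finite_subsets_at_top I. finite X \<and> X \<subseteq> I" by (rule eventually_finite_subsets_at_top_weakI) auto
    thus "\<forall>\<^sub>F X in finite_subsets_at_top I. continuous_on (cball z r) (\<lambda>w. \<Sum>i\<in>X. f i w) \<and>
       (\<forall>w\<in>ball z r. ((\<lambda>w. \<Sum>i\<in>X. f i w) has_field_derivative (\<Sum>i\<in>X. f' i w)) (at w))"
    proof eventually_elim
      case (elim X)
      have "((\<lambda>w. \<Sum>i\<in>X. f i w) has_field_derivative (\<Sum>i\<in>X. f' i w)) (at w)" if "w \<in> cball z r" for w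
        by (rule DERIV_sum) (use elim that hol in auto)
      thus ?case by (auto intro!: continuous_at_imp_continuous_on DERIV_isCont)
    qed
  qed auto
  show ?thesis using g'[of z] r by (intro that[of "g' z"]) (auto simp: has_sum_def)
qed

lemma infsum_holomorphic:
  fixes f :: "'i \<Rightarrow> complex \<Rightarrow> complex"
  assumes S: "open S" and hol: "\<And>i. i \<in> I \<Longrightarrow> f i holomorphic_on S"
    and M: "\<And>z. z \<in> S \<Longrightarrow> \<exists>r>0. \<exists>M. cball z r \<subseteq> S \<and> M summable_on I \<and> (\<forall>i\<in>I. \<forall>w\<in>cball z r. norm (f i w) \<le> M i)"
  shows "(\<lambda>z. \<Sum>\<^sub>\<infinity>i\<in>I. f i z) holomorphic_on S"
  unfolding holomorphic_on_open[OF S]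
proof
  fix z assume "z \<in> S"
  from M[OF this] obtain r M where r: "r > 0" "cball z r \<subseteq> S" "M summable_on I" "\<forall>i\<in>I. \<forall>w\<in>cball z r. norm (f i w) \<le> M i" by blast
  show "\<exists>f'. ((\<lambda>z. \<Sum>\<^sub>\<infinity>i\<in>I. f i z) has_field_derivative f') (at z)"
    by (rule infsum_has_field_derivative[of r I z f "\<lambda>i. deriv (f i)" M])
       (use r holomorphic_derivI[OF hol S] in blast)+
qed

lemma has_sum_times:
  fixes f :: "'a \<Rightarrow> complex" and g :: "'b \<Rightarrow> complex"
  assumes "(f has_sum a) A" "(g has_sum b) B"
  shows "((\<lambda>(x, y). f x * g y) has_sum (a * b)) (A \<times> B)"
proof (rule has_sum_SigmaI)
  show "((\<lambda>y. case (x, y) of (x, y) \<Rightarrow> f x * g y) has_sum f x * b) B" if "x \<in> A" for x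
    using has_sum_cmult_right[OF assms(2)] by simp
  show "((\<lambda>x. f x * b) has_sum a * b) A" by (rule has_sum_cmult_left[OF assms(1)])
  have "(\<lambda>x. norm (f x)) summable_on A" "(\<lambda>x. norm (g x)) summable_on B"
    using assms has_sum_imp_summable summable_on_iff_abs_summable_on_complex by blast+
  hence "(\<lambda>p. norm (case p of (x, y) \<Rightarrow> f x * g y)) summable_on (A \<times> B)"
    unfolding Infinite_Sum.abs_summable_on_Sigma_iff
    by (auto simp: norm_mult infsum_cmult_right' abs_mult infsum_nonneg intro!: summable_on_cmult_right summable_on_cmult_left)
  thus "(\<lambda>(x, y). f x * g y) summable_on (A \<times> B)" by (simp add: summable_on_iff_abs_summable_on_complex)
qed

lemma has_sum_diff:
  fixes f g :: "'a \<Rightarrow> complex"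
  assumes "(f has_sum a) A" "(g has_sum b) A"
  shows "((\<lambda>x. f x - g x) has_sum (a - b)) A"
  using has_sum_add[OF assms(1) has_sum_uminusI[OF assms(2)]] by simp

section \<open>Integral expansions\<close>

text \<open>A power series in ee z and ee (t - z). Both have norm below 1 exactly in the strip 0 <
  Im z < Im t, and q is their product, so nonnegative exponents suffice for functions with poles at
  the lattice points.\<close>

definition has_intexp :: "(nat \<times> nat \<Rightarrow> int) \<Rightarrow> (complex \<Rightarrow> complex \<Rightarrow> complex) \<Rightarrow> bool" where
  "has_intexp a G \<longleftrightarrow> (\<forall>t z. 0 < Im z \<longrightarrow> Im z < Im t \<longrightarrow>
     ((\<lambda>p. of_int (a p) * (ee z ^ fst p * ee (t - z) ^ snd p)) has_sum G t z) UNIV)"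

definition intexp :: "(complex \<Rightarrow> complex \<Rightarrow> complex) \<Rightarrow> bool" where
  "intexp G \<longleftrightarrow> (\<exists>a. has_intexp a G)"

text \<open>A sum over an arbitrary index set is regrouped by exponents. Finite fibres keep the
  collected coefficients integral.\<close>

lemma intexpI:
  fixes c :: "'x \<Rightarrow> int" and e :: "'x \<Rightarrow> nat \<times> nat"
  assumes fin: "\<And>p. finite {x \<in> X. e x = p}"
    and sum: "\<And>t z. 0 < Im z \<Longrightarrow> Im z < Im t \<Longrightarrow>
       ((\<lambda>x. of_int (c x) * (ee z ^ fst (e x) * ee (t - z) ^ snd (e x))) has_sum G t z) X"
  shows "intexp G"
  unfolding intexp_def
proof (intro exI[of _ "\<lambda>p. \<Sum>x\<in>{x \<in> X. e x = p}. c x"], unfold has_intexp_def, intro allI impI)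
  fix t z :: complex assume "0 < Im z" "Im z < Im t"
  note * = sum[OF this]
  have bij: "bij_betw (\<lambda>x. (e x, x)) X (Sigma UNIV (\<lambda>p. {x \<in> X. e x = p}))"
    by (rule bij_betwI') auto
  have "((\<lambda>px. of_int (c (snd px)) * (ee z ^ fst (fst px) * ee (t - z) ^ snd (fst px))) has_sum G t z) (Sigma UNIV (\<lambda>p. {x \<in> X. e x = p}))"
    using * by (subst has_sum_reindex_bij_betw[OF bij, symmetric]) simp
  thus "((\<lambda>p. of_int (\<Sum>x\<in>{x \<in> X. e x = p}. c x) * (ee z ^ fst p * ee (t - z) ^ snd p)) has_sum G t z) UNIV"
  proof (rule has_sum_SigmaD)
    fix p :: "nat \<times> nat"
    show "((\<lambda>y. of_int (c (snd (p, y))) * (ee z ^ fst (fst (p, y)) * ee (t - z) ^ snd (fst (p, y)))) has_sum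
          of_int (\<Sum>x\<in>{x \<in> X. e x = p}. c x) * (ee z ^ fst p * ee (t - z) ^ snd p)) {x \<in> X. e x = p}"
      by (rule has_sum_finiteI[OF fin]) (simp add: sum_distrib_right)
  qed
qed

lemma intexp_cong: "intexp G \<Longrightarrow> (\<And>t z. 0 < Im z \<Longrightarrow> Im z < Im t \<Longrightarrow> G t z = H t z) \<Longrightarrow> intexp H"
  unfolding intexp_def has_intexp_def by auto

lemma intexp_add: "intexp G \<Longrightarrow> intexp H \<Longrightarrow> intexp (\<lambda>t z. G t z + H t z)"
proof -
  assume "intexp G" "intexp H"
  then obtain a b where "has_intexp a G" "has_intexp b H" by (auto simp: intexp_def)
  hence "has_intexp (\<lambda>p. a p + b p) (\<lambda>t z. G t z + H t z)"
    unfolding has_intexp_def by (auto simp: distrib_right intro: has_sum_add)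
  thus ?thesis by (auto simp: intexp_def)
qed

lemma intexp_const: "intexp (\<lambda>t z. of_int k)"
  by (rule intexpI[of "{()}" "\<lambda>_. (0,0)" "\<lambda>_. k"]) (auto intro!: has_sum_finiteI)

lemma intexp_mult: "intexp G \<Longrightarrow> intexp H \<Longrightarrow> intexp (\<lambda>t z. G t z * H t z)"
proof -
  assume "intexp G" "intexp H"
  then obtain a b where ab: "has_intexp a G" "has_intexp b H" by (auto simp: intexp_def)
  show ?thesis
  proof (rule intexpI[of "UNIV \<times> UNIV" "\<lambda>(p, p'). (fst p + fst p', snd p + snd p')" "\<lambda>(p, p'). a p * b p'"])
    fix p :: "nat \<times> nat"
    have "{x \<in> UNIV \<times> UNIV. (case x of (p, p') \<Rightarrow> (fst p + fst p', snd p + snd p')) = p}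
       \<subseteq> ({..fst p} \<times> {..snd p}) \<times> ({..fst p} \<times> {..snd p})" by auto
    thus "finite {x \<in> UNIV \<times> UNIV. (case x of (p, p') \<Rightarrow> (fst p + fst p', snd p + snd p')) = p}"
      by (rule finite_subset) auto
  next
    fix t z :: complex assume "0 < Im z" "Im z < Im t"
    hence "((\<lambda>p. of_int (a p) * (ee z ^ fst p * ee (t - z) ^ snd p)) has_sum G t z) UNIV"
      "((\<lambda>p. of_int (b p) * (ee z ^ fst p * ee (t - z) ^ snd p)) has_sum H t z) UNIV" using ab by (auto simp: has_intexp_def)
    from has_sum_times[OF this]
    show "((\<lambda>x. of_int (case x of (p, p') \<Rightarrow> a p * b p') *
       (ee z ^ fst (case x of (p, p') \<Rightarrow> (fst p + fst p', snd p + snd p')) *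
        ee (t - z) ^ snd (case x of (p, p') \<Rightarrow> (fst p + fst p', snd p + snd p')))) has_sum G t z * H t z) (UNIV \<times> UNIV)"
      by (simp add: case_prod_unfold power_add mult_ac)
  qed
qed

lemma intexp_cmult: "intexp G \<Longrightarrow> intexp (\<lambda>t z. of_int k * G t z)"
  by (rule intexp_mult[OF intexp_const])

lemma intexp_diff: "intexp G \<Longrightarrow> intexp H \<Longrightarrow> intexp (\<lambda>t z. G t z - H t z)"
  using intexp_add[of G "\<lambda>t z. of_int (-1) * H t z"] intexp_cmult[of H "-1"] by simp

lemma intexp_power: "intexp G \<Longrightarrow> intexp (\<lambda>t z. G t z ^ n)"
proof (induction n)
  case 0 thus ?case using intexp_const[of 1] by simp
next
  case (Suc n) thus ?case using intexp_mult[of G "\<lambda>t z. G t z ^ n"] by simp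
qed

text \<open>The factor 1 / (2 pi i) makes this derivative multiply the monomial with exponents p by
  the integer fst p - snd p.\<close>

definition DD :: "(complex \<Rightarrow> complex \<Rightarrow> complex) \<Rightarrow> complex \<Rightarrow> complex \<Rightarrow> complex" where
  "DD G t z = deriv (G t) z / (tpi)"

lemma has_intexp_DD:
  assumes "has_intexp a G"
  shows "has_intexp (\<lambda>p. a p * (int (fst p) - int (snd p))) (DD G)"
  unfolding has_intexp_def
proof (intro allI impI)
  fix t z :: complex assume z: "0 < Im z" "Im z < Im t"
  define r where "r = min (Im z) (Im t - Im z) / 2"
  have r: "r > 0" "r < Im z" "r < Im t - Im z" using z by (auto simp: r_def min_def)
  let ?f = "\<lambda>p z. of_int (a p) * (ee z ^ fst p * ee (t - z) ^ snd p)"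
  \<comment> \<open>The majorant is the expansion itself at other arguments: z' = i (Im z - r) and
    t' = i (Im t - 2r). There ee z' and ee (t' - z') attain the largest norms that ee w and ee (t -
    w) have on the disc.\<close>
  let ?M = "\<lambda>p. norm (of_int (a p) * (ee (\<i> * of_real (Im z - r)) ^ fst p * ee (\<i> * of_real (Im t - 2 * r) - \<i> * of_real (Im z - r)) ^ snd p))"
  have Mle: "norm (?f p w) \<le> ?M p" if "w \<in> cball z r" for p w
  proof -
    have "\<bar>Im (z - w)\<bar> \<le> r" using that abs_Im_le_cmod[of "z - w"] by (auto simp: dist_norm)
    hence "Im w \<ge> Im z - r" "Im t - Im w \<ge> Im t - Im z - r" by auto
    hence "norm (ee w) \<le> norm (ee (\<i> * of_real (Im z - r)))" 
      "norm (ee (t - w)) \<le> norm (ee (\<i> * of_real (Im t - 2 * r) - \<i> * of_real (Im z - r)))"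
      by (auto simp: norm_ee)
    thus ?thesis unfolding norm_mult norm_power by (intro mult_left_mono mult_mono power_mono) auto
  qed
  have "(\<lambda>p. of_int (a p) * (ee (\<i> * of_real (Im z - r)) ^ fst p * ee (\<i> * of_real (Im t - 2 * r) - \<i> * of_real (Im z - r)) ^ snd p)) summable_on UNIV"
    using assms[unfolded has_intexp_def, rule_format, of "\<i> * of_real (Im z - r)" "\<i> * of_real (Im t - 2 * r)"] r
    by (intro has_sum_imp_summable) auto
  hence M: "?M summable_on UNIV" by (simp add: summable_on_iff_abs_summable_on_complex)
  have D: "(?f p has_field_derivative tpi * (of_int (a p * (int (fst p) - int (snd p))) * (ee w ^ fst p * ee (t - w) ^ snd p))) (at w)" for p w
  proof -
    have eq: "?f p = (\<lambda>z. (of_int (a p) * ee (of_nat (snd p) * t)) * ee ((of_nat (fst p) - of_nat (snd p)) * z))"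
      by (simp add: fun_eq_iff ee_power ee_add[symmetric] algebra_simps)
    have "(?f p has_field_derivative (of_int (a p) * ee (of_nat (snd p) * t)) * (tpi * (of_nat (fst p) - of_nat (snd p)) * ee ((of_nat (fst p) - of_nat (snd p)) * w))) (at w)"
      unfolding eq by (rule DERIV_cmult[OF ee_has_field_derivative])
    note D' = this
    have X: "ee w ^ fst p * ee (t - w) ^ snd p = ee (of_nat (snd p) * t) * ee ((of_nat (fst p) - of_nat (snd p)) * w)"
      by (simp add: ee_power ee_add[symmetric] algebra_simps)
    show ?thesis by (rule DERIV_cong[OF D']) (simp add: X mult_ac algebra_simps)
  qed
  obtain g' where g': "((\<lambda>z. \<Sum>\<^sub>\<infinity>p. ?f p z) has_field_derivative g') (at z)"
    "((\<lambda>p. tpi * (of_int (a p * (int (fst p) - int (snd p))) * (ee z ^ fst p * ee (t - z) ^ snd p))) has_sum g') UNIV"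
    by (rule infsum_has_field_derivative[OF r(1) D M Mle]) auto
  have Gf: "(\<Sum>\<^sub>\<infinity>p. ?f p w) = G t w" if "w \<in> ball z r" for w
  proof -
    have "\<bar>Im (z - w)\<bar> < r" using that abs_Im_le_cmod[of "z - w"] by (auto simp: dist_norm)
    hence "0 < Im w" "Im w < Im t" using r by auto
    thus ?thesis using assms unfolding has_intexp_def by (auto intro: infsumI)
  qed
  have "(G t has_field_derivative g') (at z)"
    by (rule has_field_derivative_transform_within_open[OF g'(1), of "ball z r"]) (use r Gf in auto)
  hence "DD G t z = g' / (tpi)" by (simp add: DD_def DERIV_imp_deriv)
  with has_sum_cmult_right[OF g'(2), of "1 / (tpi)"]
  show "((\<lambda>p. of_int (a p * (int (fst p) - int (snd p))) * (ee z ^ fst p * ee (t - z) ^ snd p)) has_sum DD G t z) UNIV"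
    by simp
qed

lemma intexp_DD: "intexp G \<Longrightarrow> intexp (DD G)"
  using has_intexp_DD by (auto simp: intexp_def)

text \<open>On a monomial the operator acts by d - d^2 with d = fst p - snd p, which is even for
  every integer d.\<close>

lemma intexp_half: 
  assumes "intexp G"
  shows "intexp (\<lambda>t z. (DD G t z - DD (DD G) t z) / 2)"
proof -
  from assms obtain a where a: "has_intexp a G" by (auto simp: intexp_def)
  let ?m = "\<lambda>p. int (fst p) - int (snd p)"
  note 1 = has_intexp_DD[OF a] and 2 = has_intexp_DD[OF has_intexp_DD[OF a]]
  have ev: "2 * ((x - x * x) div 2) = x - x * x" for x :: int by (simp add: even_diff)
  have "has_intexp (\<lambda>p. a p * ((?m p - ?m p * ?m p) div 2)) (\<lambda>t z. (DD G t z - DD (DD G) t z) / 2)"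
    unfolding has_intexp_def
  proof (intro allI impI)
    fix t z :: complex assume z: "0 < Im z" "Im z < Im t"
    let ?f = "\<lambda>p. ee z ^ fst p * ee (t - z) ^ snd p"
    have "((\<lambda>p. (of_int (a p * ?m p) * ?f p - of_int (a p * ?m p * ?m p) * ?f p) / 2) has_sum (DD G t z - DD (DD G) t z) / 2) UNIV"
      using 1 2 z unfolding has_intexp_def by (intro has_sum_divide_const has_sum_diff) auto
    moreover have "(of_int (a p * ?m p) * ?f p - of_int (a p * ?m p * ?m p) * ?f p) / 2 = of_int (a p * ((?m p - ?m p * ?m p) div 2)) * ?f p" for p
    proof -
      have "of_int (a p * ?m p) * ?f p - of_int (a p * ?m p * ?m p) * ?f p = of_int (a p * (?m p - ?m p * ?m p)) * ?f p"
        by (simp add: algebra_simps)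
      also have "\<dots> = of_int (a p * (2 * ((?m p - ?m p * ?m p) div 2))) * ?f p" by (simp only: ev)
      finally have E: "of_int (a p * ?m p) * ?f p - of_int (a p * ?m p * ?m p) * ?f p = of_int (a p * (2 * ((?m p - ?m p * ?m p) div 2))) * ?f p" .
      have "(of_int (x * (2 * d)) * y) / 2 = of_int (x * d) * y" for x d :: int and y :: complex by simp
      thus ?thesis unfolding E .
    qed
    ultimately show "((\<lambda>p. of_int (a p * ((?m p - ?m p * ?m p) div 2)) * ?f p) has_sum (DD G t z - DD (DD G) t z) / 2) UNIV"
      by simp
  qed
  thus ?thesis by (auto simp: intexp_def)
qed

section \<open>Lambert series\<close>

text \<open>The Lambert kernel, the sum of d X^d over d >= 1. Its invariance under inversion of X
  allows an expansion on either side of the unit circle.\<close>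

definition xf :: "complex \<Rightarrow> complex" where "xf X = X / (1 - X)^2"

lemma xf_inverse: "xf (inverse X) = xf X"
proof (cases "X = 0 \<or> X = 1")
  case False
  thus ?thesis by (simp add: xf_def field_simps power2_eq_square)
qed (auto simp: xf_def)

lemma xf_of_real: "xf (of_real t) = of_real (t / (1 - t)^2)"
  by (simp add: xf_def)

lemma has_sum_xf:
  assumes "norm X < 1"
  shows "((\<lambda>d. of_nat d * X ^ d) has_sum xf X) {1..}"
proof -
  have "(\<lambda>n. of_nat (Suc n) * X ^ n) sums (1 / (1 - X)^2)" using geometric_deriv_sums[OF assms] by simp
  hence s: "(\<lambda>n. X * (of_nat (Suc n) * X ^ n)) sums (X * (1 / (1 - X)^2))" by (rule sums_mult)
  have "(\<lambda>n. of_nat (Suc n) * (norm X) ^ n) sums (1 / (1 - norm X)^2)" using geometric_deriv_sums[of "norm X"] assms by simp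
  from sums_summable[OF sums_mult[OF this, of "norm X"]]
  have "summable (\<lambda>n. norm (X * (of_nat (Suc n) * X ^ n)))" by (simp add: norm_mult norm_power del: of_nat_Suc)
  from norm_summable_imp_has_sum[OF this s]
  have "((\<lambda>n. of_nat (Suc n) * X ^ Suc n) has_sum xf X) UNIV" by (simp add: xf_def mult_ac)
  thus ?thesis by (subst has_sum_reindex_bij_witness[where i="\<lambda>n. Suc n" and j="\<lambda>n. n - 1" and T=UNIV]) (auto simp: Suc_le_eq power_eq_if)
qed

lemma norm_xf_le: assumes "norm X \<le> \<rho>" "\<rho> < 1" shows "norm (xf X) \<le> norm X / (1 - \<rho>)^2"
proof -
  have "1 - \<rho> \<le> norm (1 - X)" using assms norm_triangle_ineq2[of 1 X] by simp
  hence "(1 - \<rho>)^2 \<le> norm (1 - X) ^ 2" using assms by (intro power_mono) auto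
  moreover have "(1 - \<rho>)^2 > 0" using assms by simp
  ultimately show ?thesis by (simp add: xf_def norm_divide norm_power frac_le)
qed

lemma has_sum_lambert:
  fixes X :: "nat \<Rightarrow> complex"
  assumes "\<And>n. norm (X n) \<le> \<rho>" "\<rho> < 1" "(\<lambda>n. norm (X n)) summable_on UNIV"
  shows "((\<lambda>(n, d). of_nat d * X n ^ d) has_sum (\<Sum>\<^sub>\<infinity>n. xf (X n))) (UNIV \<times> {1..})"
    and "(\<lambda>n. xf (X n)) summable_on UNIV"
proof -
  have "(\<lambda>n. norm (X n) / (1 - \<rho>)^2) summable_on UNIV"
    using summable_on_cmult_left[OF assms(3), of "1 / (1 - \<rho>)^2"] by simp
  hence "(\<lambda>n. norm (xf (X n))) summable_on UNIV"
    by (rule summable_on_comparison_test) (use norm_xf_le assms in auto)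
  thus s: "(\<lambda>n. xf (X n)) summable_on UNIV" by (simp add: summable_on_iff_abs_summable_on_complex)
  show "((\<lambda>(n, d). of_nat d * X n ^ d) has_sum (\<Sum>\<^sub>\<infinity>n. xf (X n))) (UNIV \<times> {1..})"
  proof (rule has_sum_SigmaI)
    show "((\<lambda>d. case (n, d) of (n, d) \<Rightarrow> of_nat d * X n ^ d) has_sum xf (X n)) {1..}" for n
      using has_sum_xf[of "X n"] assms(1)[of n] assms(2) by simp
    show "((\<lambda>n. xf (X n)) has_sum (\<Sum>\<^sub>\<infinity>n. xf (X n))) UNIV" using s by simp
    have "((\<lambda>d. norm (of_nat d * X n ^ d)) has_sum Re (xf (of_real (norm (X n))))) {1..}" for n
      using has_sum_Re[OF has_sum_xf[of "of_real (norm (X n))"]] assms(1)[of n] assms(2)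
      by (simp add: norm_mult norm_power flip: of_real_power)
    moreover have "(\<lambda>n. Re (xf (of_real (norm (X n))))) summable_on UNIV"
    proof (rule summable_on_comparison_test)
      show "(\<lambda>n. norm (X n) / (1 - \<rho>)^2) summable_on UNIV" by fact
      show "Re (xf (of_real (norm (X n)))) \<le> norm (X n) / (1 - \<rho>)^2" for n
        using norm_xf_le[of "of_real (norm (X n))" \<rho>] assms(1)[of n] assms(2) complex_Re_le_cmod[of "xf (of_real (norm (X n)))"] by simp
      show "0 \<le> Re (xf (of_real (norm (X n))))" for n
        by (simp add: xf_of_real)
    qed
    ultimately have "(\<lambda>(n, d). norm (of_nat d * X n ^ d)) summable_on (UNIV \<times> {1..})"
      by (intro summable_on_SigmaI[where g="\<lambda>n. Re (xf (of_real (norm (X n))))"]) auto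
    thus "(\<lambda>(n, d). of_nat d * X n ^ d) summable_on (UNIV \<times> {1..})"
      by (simp add: summable_on_iff_abs_summable_on_complex case_prod_unfold)
  qed
qed

lemma summable_geometric_norm: "0 \<le> \<rho> \<Longrightarrow> \<rho> < 1 \<Longrightarrow> (\<lambda>n::nat. C * (\<rho>::real) ^ n) summable_on UNIV"
  by (intro summable_on_cmult_right norm_summable_imp_summable_on) (auto simp: summable_geometric)

text \<open>Total degree at least n + 1 in the n-th argument serves twice: it gives a geometric
  majorant, and it lets only finitely many pairs (n, d) contribute to a given monomial.\<close>

lemma intexp_lambert:
  fixes e :: "nat \<Rightarrow> nat \<times> nat"
  assumes "\<And>n. fst (e n) + snd (e n) \<ge> Suc n"
  shows "intexp (\<lambda>t z. \<Sum>\<^sub>\<infinity>n. xf (ee z ^ fst (e n) * ee (t - z) ^ snd (e n)))"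
    and "0 < Im z \<Longrightarrow> Im z < Im t \<Longrightarrow> (\<lambda>n. xf (ee z ^ fst (e n) * ee (t - z) ^ snd (e n))) summable_on UNIV"
proof -
  have L: "((\<lambda>(n, d). of_nat d * (ee z ^ fst (e n) * ee (t - z) ^ snd (e n)) ^ d) has_sum (\<Sum>\<^sub>\<infinity>n. xf (ee z ^ fst (e n) * ee (t - z) ^ snd (e n)))) (UNIV \<times> {1..})
     \<and> (\<lambda>n. xf (ee z ^ fst (e n) * ee (t - z) ^ snd (e n))) summable_on UNIV"
    if z: "0 < Im z" "Im z < Im t" for t z
  proof -
    define \<rho> where "\<rho> = max (norm (ee z)) (norm (ee (t - z)))"
    have \<rho>: "0 \<le> \<rho>" "\<rho> < 1" using z by (auto simp: \<rho>_def norm_ee le_max_iff_disj)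
    have le: "norm (ee z ^ fst (e n) * ee (t - z) ^ snd (e n)) \<le> \<rho> * \<rho> ^ n" for n
    proof -
      have "norm (ee z ^ fst (e n) * ee (t - z) ^ snd (e n)) \<le> \<rho> ^ fst (e n) * \<rho> ^ snd (e n)"
        unfolding norm_mult norm_power using \<rho>(1) by (intro mult_mono power_mono) (auto simp: \<rho>_def)
      also have "\<dots> = \<rho> ^ (fst (e n) + snd (e n))" by (simp add: power_add)
      also have "\<dots> \<le> \<rho> ^ Suc n" using \<rho> assms by (intro power_decreasing) auto
      finally show ?thesis by simp
    qed
    have le': "norm (ee z ^ fst (e n) * ee (t - z) ^ snd (e n)) \<le> \<rho>" for n
      using le[of n] power_le_one[of \<rho> n] \<rho> mult_left_le[of "\<rho> ^ n" \<rho>] by linarith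
    have "(\<lambda>n. norm (ee z ^ fst (e n) * ee (t - z) ^ snd (e n))) summable_on UNIV"
      by (rule summable_on_comparison_test[OF summable_geometric_norm[OF \<rho>, of \<rho>]]) (use le in auto)
    from has_sum_lambert[OF le' \<rho>(2) this] show ?thesis by blast
  qed
  show "0 < Im z \<Longrightarrow> Im z < Im t \<Longrightarrow> (\<lambda>n. xf (ee z ^ fst (e n) * ee (t - z) ^ snd (e n))) summable_on UNIV" using L by blast
  show "intexp (\<lambda>t z. \<Sum>\<^sub>\<infinity>n. xf (ee z ^ fst (e n) * ee (t - z) ^ snd (e n)))"
  proof (rule intexpI[of "UNIV \<times> {1..}" "\<lambda>(n, d). (fst (e n) * d, snd (e n) * d)" "\<lambda>(n, d). int d"])
    fix p :: "nat \<times> nat"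
    have "n \<le> fst p + snd p \<and> d \<le> fst p + snd p" if "d \<ge> 1" "(fst (e n) * d, snd (e n) * d) = p" for n d
    proof -
      have "fst p + snd p = (fst (e n) + snd (e n)) * d" using that by (auto simp: algebra_simps)
      moreover have "(fst (e n) + snd (e n)) * d \<ge> Suc n * d" using assms by (intro mult_right_mono) auto
      moreover have "Suc n * d \<ge> n" "Suc n * d \<ge> d" using that(1) by (cases d; simp)+
      ultimately show ?thesis by linarith
    qed
    hence "{x \<in> UNIV \<times> {1..}. (case x of (n, d) \<Rightarrow> (fst (e n) * d, snd (e n) * d)) = p} \<subseteq> {..fst p + snd p} \<times> {..fst p + snd p}" by auto
    thus "finite {x \<in> UNIV \<times> {1..}. (case x of (n, d) \<Rightarrow> (fst (e n) * d, snd (e n) * d)) = p}" by (rule finite_subset) auto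
  next
    fix t z :: complex assume "0 < Im z" "Im z < Im t"
    from L[OF this]
    show "((\<lambda>x. of_int (case x of (n, d) \<Rightarrow> int d) * (ee z ^ fst (case x of (n, d) \<Rightarrow> (fst (e n) * d, snd (e n) * d)) *
        ee (t - z) ^ snd (case x of (n, d) \<Rightarrow> (fst (e n) * d, snd (e n) * d)))) has_sum (\<Sum>\<^sub>\<infinity>n. xf (ee z ^ fst (e n) * ee (t - z) ^ snd (e n)))) (UNIV \<times> {1..})"
      by (simp add: case_prod_unfold power_mult_distrib power_mult[symmetric])
  qed
qed

section \<open>Lattices\<close>

definition lat :: "complex \<Rightarrow> complex set" where
  "lat t = {of_int a * t + of_int b | a b. True}"

lemma latI: "of_int a * t + of_int b \<in> lat t" by (auto simp: lat_def)

lemma lat_add: "x \<in> lat t \<Longrightarrow> y \<in> lat t \<Longrightarrow> x + y \<in> lat t"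
proof -
  assume "x \<in> lat t" "y \<in> lat t"
  then obtain a b c d where "x = of_int a * t + of_int b" "y = of_int c * t + of_int d" by (auto simp: lat_def)
  hence "x + y = of_int (a + c) * t + of_int (b + d)" by (simp add: algebra_simps)
  thus ?thesis using latI by metis
qed

lemma lat_minus: "x \<in> lat t \<Longrightarrow> - x \<in> lat t"
proof -
  assume "x \<in> lat t"
  then obtain a b where "x = of_int a * t + of_int b" by (auto simp: lat_def)
  hence "- x = of_int (- a) * t + of_int (- b)" by (simp add: algebra_simps)
  thus ?thesis using latI by metis
qed

lemma lat_0 [simp]: "0 \<in> lat t" using latI[of 0 t 0] by simp
lemma lat_1 [simp]: "1 \<in> lat t" using latI[of 0 t 1] by simp
lemma lat_tau [simp]: "t \<in> lat t" using latI[of 1 t 0] by simp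

lemma lat_add_iff: "w \<in> lat t \<Longrightarrow> z + w \<in> lat t \<longleftrightarrow> z \<in> lat t"
  using lat_add[of z t w] lat_add[of "z + w" t "- w"] lat_minus[of w t] by auto

lemma lat_minus_iff [simp]: "- z \<in> lat t \<longleftrightarrow> z \<in> lat t"
  using lat_minus[of z] lat_minus[of "-z"] by auto

lemma lat_add_1 [simp]: "z + 1 \<in> lat t \<longleftrightarrow> z \<in> lat t" by (rule lat_add_iff) simp
lemma lat_add_tau [simp]: "z + t \<in> lat t \<longleftrightarrow> z \<in> lat t" by (rule lat_add_iff) simp

lemma lat_T: "lat (t + 1) = lat t"
proof -
  have *: "x \<in> lat t'" if "x \<in> lat t" "t' = t + of_int k" for x t t' k
  proof -
    from that obtain a b where "x = of_int a * t + of_int b" by (auto simp: lat_def)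
    hence "x = of_int a * t' + of_int (b - a * k)" using that by (simp add: algebra_simps)
    thus ?thesis using latI by metis
  qed
  show ?thesis
  proof (intro equalityI subsetI)
    show "x \<in> lat t" if "x \<in> lat (t + 1)" for x using *[OF that, of t "-1"] by simp
    show "x \<in> lat (t + 1)" if "x \<in> lat t" for x using *[OF that, of "t + 1" 1] by simp
  qed
qed

lemma lat_S: assumes "t \<in> uhp" shows "z / t \<in> lat (- 1 / t) \<longleftrightarrow> z \<in> lat t"
proof
  have nz: "t \<noteq> 0" using uhp_nonzero[OF assms] .
  {
    assume "z \<in> lat t"
    then obtain a b where "z = of_int a * t + of_int b" by (auto simp: lat_def)
    hence "z / t = of_int (- b) * (- 1 / t) + of_int a" using nz by (simp add: field_simps)
    thus "z / t \<in> lat (- 1 / t)" using latI by metis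
  next
    assume "z / t \<in> lat (- 1 / t)"
    then obtain a b where "z / t = of_int a * (- 1 / t) + of_int b" by (auto simp: lat_def)
    hence "z = of_int b * t + of_int (- a)" using nz by (simp add: field_simps)
    thus "z \<in> lat t" using latI by metis
  }
qed

lemma lat_small: assumes "t \<in> uhp" "z \<in> lat t" "norm z < min 1 (Im t)" shows "z = 0"
proof -
  from assms obtain a b where z: "z = of_int a * t + of_int b" by (auto simp: lat_def)
  have v: "Im t > 0" using assms by (simp add: uhp_def)
  have "\<bar>of_int a * Im t\<bar> < Im t" using abs_Im_le_cmod[of z] assms(3) by (simp add: z)
  hence "\<bar>of_int a\<bar> < (1::real)" using v by (simp add: abs_mult)
  hence a: "a = 0" by linarith
  hence "\<bar>of_int b\<bar> < (1::real)" using assms(3) by (simp add: z)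
  hence "b = 0" by linarith
  with a z show ?thesis by simp
qed

lemma closed_lat: assumes "t \<in> uhp" shows "closed (lat t)"
proof (rule discrete_imp_closed[of "min 1 (Im t)"])
  show "0 < min 1 (Im t)" using assms by (simp add: uhp_def)
  have "y = x" if "x \<in> lat t" "y \<in> lat t" "dist y x < min 1 (Im t)" for x y
    using lat_small[OF assms, of "y - x"] lat_add[OF that(2) lat_minus[OF that(1)]] that(3) by (simp add: dist_norm)
  thus "\<forall>x\<in>lat t. \<forall>y\<in>lat t. dist y x < min 1 (Im t) \<longrightarrow> y = x" by blast
qed

lemma open_lat: "t \<in> uhp \<Longrightarrow> open (- lat t)"
  using closed_lat by (simp add: open_Compl)

lemma lat_eq_iff:
  shows "z \<in> lat t \<longleftrightarrow> (\<exists>n::int. ee (z + of_int n * t) = 1)"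
proof
  assume "z \<in> lat t"
  then obtain a b where "z = of_int a * t + of_int b" by (auto simp: lat_def)
  hence "ee (z + of_int (- a) * t) = 1" by simp
  thus "\<exists>n::int. ee (z + of_int n * t) = 1" ..
next
  assume "\<exists>n::int. ee (z + of_int n * t) = 1"
  then obtain n b :: int where "z + of_int n * t = of_int b" by (auto simp: ee_eq_1_iff elim: Ints_cases)
  hence "z = of_int (- n) * t + of_int b" by (simp add: algebra_simps)
  thus "z \<in> lat t" using latI by metis
qed

lemma lat_induct:
  assumes "w \<in> lat t" "P 0" "\<And>w. w \<in> lat t \<Longrightarrow> P w \<longleftrightarrow> P (w + 1)" "\<And>w. w \<in> lat t \<Longrightarrow> P w \<longleftrightarrow> P (w + t)"
  shows "P w"
proof -
  obtain a b where w: "w = of_int a * t + of_int b" using assms(1) by (auto simp: lat_def)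
  have 1: "P (of_int b)" for b
  proof (induction b rule: int_induct[of _ 0])
    case (step1 i) thus ?case using assms(3)[of "of_int i"] latI[of 0 t i] by simp
  next
    case (step2 i) thus ?case using assms(3)[of "of_int (i - 1)"] latI[of 0 t "i - 1"] by simp
  qed (use assms(2) in simp)
  have "P (of_int a * t + of_int b)"
  proof (induction a rule: int_induct[of _ 0])
    case (step1 i) thus ?case using assms(4)[OF latI[of i t b]] by (simp add: algebra_simps)
  next
    case (step2 i) thus ?case using assms(4)[OF latI[of "i - 1" t b]] by (simp add: algebra_simps)
  qed (use 1 in simp)
  thus ?thesis by (simp add: w)
qed

section \<open>Extension across discrete singularities, and Liouville's theorem for elliptic
  functions\<close>

lemma eventually_off_separated:
  fixes \<Lambda> :: "complex set"
  assumes "\<delta> > 0" "\<And>x y. x \<in> \<Lambda> \<Longrightarrow> y \<in> \<Lambda> \<Longrightarrow> dist x y < \<delta> \<Longrightarrow> x = y"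
  shows "\<forall>\<^sub>F z in at w. z \<notin> \<Lambda>"
proof -
  have "closed (\<Lambda> - {w})" by (rule discrete_imp_closed[OF assms(1)]) (use assms(2) in auto)
  hence "\<forall>\<^sub>F z in nhds w. z \<in> - (\<Lambda> - {w})" by (intro eventually_nhds_in_open) (simp_all only: open_Compl, simp)
  thus ?thesis by (auto simp: eventually_at_filter elim: eventually_mono)
qed

lemma isCont_eq_eventually:
  fixes f g :: "complex \<Rightarrow> complex"
  assumes "isCont f z" "isCont g z" and eq: "\<forall>\<^sub>F w in at z. f w = g w"
  shows "f z = g z"
proof (rule tendsto_unique[OF trivial_limit_at])
  show "(f \<longlongrightarrow> f z) (at z)" using assms by (simp add: isCont_def)
  have "(g \<longlongrightarrow> g z) (at z)" using assms by (simp add: isCont_def)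
  thus "(f \<longlongrightarrow> g z) (at z)" by (rule Lim_transform_eventually) (use eq in \<open>simp add: eq_commute\<close>)
qed

lemma entire_isCont: "f holomorphic_on UNIV \<Longrightarrow> isCont f z"
  using holomorphic_on_imp_continuous_on[of f UNIV] by (simp add: continuous_on_eq_continuous_at)

text \<open>Uniform separation makes every subset of the singular set closed. Around each point
  there is thus an open set meeting it in at most that point, and Riemann's theorem gives a local
  extension that must coincide with \<open>remove_sings\<close>.\<close>

lemma remove_sings_separated:
  fixes \<Lambda> :: "complex set"
  assumes \<delta>: "\<delta> > 0" and sep: "\<And>x y. x \<in> \<Lambda> \<Longrightarrow> y \<in> \<Lambda> \<Longrightarrow> dist x y < \<delta> \<Longrightarrow> x = y"
    and hol: "f holomorphic_on (- \<Lambda>)" and lim: "\<And>w. w \<in> \<Lambda> \<Longrightarrow> ((\<lambda>z. (z - w) * f z) \<longlongrightarrow> 0) (at w)"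
  shows "remove_sings f holomorphic_on UNIV" "z \<notin> \<Lambda> \<Longrightarrow> remove_sings f z = f z"
proof -
  have op: "open (- A)" if "A \<subseteq> \<Lambda>" for A using discrete_imp_closed[OF \<delta>, of A] sep that by (auto simp: open_Compl)
  show eq: "remove_sings f z = f z" if "z \<notin> \<Lambda>" for z
    by (rule remove_sings_at_analytic) (use hol op[OF order_refl] that in \<open>auto simp: analytic_at\<close>)
  have "remove_sings f analytic_on {w}" for w
  proof -
    define S where "S = - (\<Lambda> - {w})"
    have S: "open S" "w \<in> S" using op[of "\<Lambda> - {w}"] by (auto simp: S_def)
    have h: "f holomorphic_on S - {w}" using hol by (rule holomorphic_on_subset) (auto simp: S_def)
    have "\<exists>g. g holomorphic_on S \<and> (\<forall>z\<in>S - {w}. g z = f z)"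
    proof (cases "w \<in> \<Lambda>")
      case True
      thus ?thesis using holomorphic_on_extend_lim[OF h] S lim by (simp add: interior_open)
    next
      case False
      thus ?thesis using hol by (intro exI[of _ f]) (simp add: S_def)
    qed
    then obtain g where g: "g holomorphic_on S" "\<And>z. z \<in> S - {w} \<Longrightarrow> g z = f z" by blast
    have "g z = remove_sings f z" if "z \<in> S" for z
    proof (cases "z = w")
      case True
      have "(g \<longlongrightarrow> g w) (at w)"
        using holomorphic_on_imp_continuous_on[OF g(1)] S by (simp add: continuous_on_eq_continuous_at isCont_def)
      hence "(f \<longlongrightarrow> g w) (at w)"
        by (rule Lim_transform_eventually) (use eventually_at_in_open[OF S] in eventually_elim, simp add: g(2))
      thus ?thesis using True remove_sings_eqI by metis
    next
      case False
      thus ?thesis using that g(2)[of z] eq[of z] by (simp add: S_def)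
    qed
    hence "remove_sings f holomorphic_on S" by (rule holomorphic_transform[OF g(1)])
    thus ?thesis using S by (auto simp: analytic_at)
  qed
  hence "remove_sings f analytic_on UNIV" using analytic_on_analytic_at by blast
  thus "remove_sings f holomorphic_on UNIV" by (rule analytic_imp_holomorphic)
qed

lemma lat_separated: assumes "t \<in> uhp" "x \<in> lat t" "y \<in> lat t" "dist x y < min 1 (Im t)" shows "x = y"
  using lat_small[OF assms(1), of "x - y"] lat_add[OF assms(2) lat_minus[OF assms(3)]] assms(4) by (simp add: dist_norm)

lemma eventually_not_lat: assumes "t \<in> uhp" shows "\<forall>\<^sub>F w in at z. w \<notin> lat t"
proof -
  have "min 1 (Im t) > 0" using assms by (simp add: uhp_def)
  from eventually_off_separated[OF this lat_separated[OF assms]] show ?thesis .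
qed

text \<open>Quasi-periodicity with a continuous zero-free multiplier transports removability from 0
  to every lattice point, so only the behaviour at 0 has to be examined. The functional equations
  survive on the lattice by continuity.\<close>

lemma lattice_extension:
  assumes t: "t \<in> uhp" and hol: "f holomorphic_on (- lat t)"
    and f1: "\<And>z. z \<notin> lat t \<Longrightarrow> f (z + 1) = f z"
    and ft: "\<And>z. z \<notin> lat t \<Longrightarrow> f (z + t) = m z * f z"
    and m: "\<And>z. isCont m z" "\<And>z. m z \<noteq> 0"
    and lim: "((\<lambda>z. z * f z) \<longlongrightarrow> 0) (at 0)"
  defines "F \<equiv> remove_sings f"
  shows "F holomorphic_on UNIV" "\<And>z. z \<notin> lat t \<Longrightarrow> F z = f z"
    "\<And>z. F (z + 1) = F z" "\<And>z. F (z + t) = m z * F z"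
proof -
  note ev = eventually_not_lat[OF t]
  define P where "P = (\<lambda>w. ((\<lambda>z. (z - w) * f z) \<longlongrightarrow> 0) (at w))"
  have shift: "((\<lambda>z. g z) \<longlongrightarrow> 0) (at (w + c)) \<longleftrightarrow> ((\<lambda>z. g (z + c)) \<longlongrightarrow> 0) (at w)" for g :: "complex \<Rightarrow> complex" and w c
    using filterlim_shift_iff[of g c "nhds 0" "w + c"] by (simp add: o_def add.commute[of c])
  have P: "P w" if "w \<in> lat t" for w
  proof (rule lat_induct[OF that])
    show "P 0" using lim by (simp add: P_def)
    fix w
    have "P (w + 1) \<longleftrightarrow> ((\<lambda>z. (z + 1 - (w + 1)) * f (z + 1)) \<longlongrightarrow> 0) (at w)" unfolding P_def by (rule shift)
    also have "\<dots> \<longleftrightarrow> P w" unfolding P_def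
      by (intro tendsto_cong eventually_mono[OF ev[of w]]) (simp add: f1)
    finally show "P w \<longleftrightarrow> P (w + 1)" by simp
    have "P (w + t) \<longleftrightarrow> ((\<lambda>z. (z + t - (w + t)) * f (z + t)) \<longlongrightarrow> 0) (at w)" unfolding P_def by (rule shift)
    also have "\<dots> \<longleftrightarrow> ((\<lambda>z. m z * ((z - w) * f z)) \<longlongrightarrow> 0) (at w)"
      by (intro tendsto_cong eventually_mono[OF ev[of w]]) (simp add: ft)
    also have "\<dots> \<longleftrightarrow> P w"
    proof
      have mc: "(m \<longlongrightarrow> m w) (at w)" using m(1)[of w] by (simp add: isCont_def)
      {
        assume "((\<lambda>z. m z * ((z - w) * f z)) \<longlongrightarrow> 0) (at w)"
        from tendsto_divide[OF this mc m(2)] show "P w" unfolding P_def using m(2) by simp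
      }
      assume "P w"
      from tendsto_mult[OF mc this[unfolded P_def]] show "((\<lambda>z. m z * ((z - w) * f z)) \<longlongrightarrow> 0) (at w)" by simp
    qed
    finally show "P w \<longleftrightarrow> P (w + t)" by simp
  qed
  have "min 1 (Im t) > 0" using t by (simp add: uhp_def)
  note F = remove_sings_separated[OF this lat_separated[OF t] hol P[unfolded P_def], folded F_def]
  show Fh: "F holomorphic_on UNIV" and Ff: "\<And>z. z \<notin> lat t \<Longrightarrow> F z = f z" using F by auto
  note Fc = entire_isCont[OF Fh]
  show "F (z + 1) = F z" for z
    by (rule isCont_eq_eventually[of z "\<lambda>z. F (z + 1)"])
       (auto simp: Ff f1 intro!: continuous_intros isCont_o2[OF _ Fc] Fc eventually_mono[OF ev])
  show "F (z + t) = m z * F z" for z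
    by (rule isCont_eq_eventually[of z "\<lambda>z. F (z + t)"])
       (auto simp: Ff ft intro!: continuous_intros isCont_o2[OF _ Fc] Fc m eventually_mono[OF ev])
qed

text \<open>The extension is doubly periodic, so it takes all its values on a disc of radius |t| +
  1, which contains a fundamental parallelogram. It is therefore bounded and constant, and the limit
  at 0 identifies the constant.\<close>

lemma elliptic_Liouville:
  assumes t: "t \<in> uhp" and hol: "f holomorphic_on (- lat t)"
    and f1: "\<And>z. z \<notin> lat t \<Longrightarrow> f (z + 1) = f z"
    and ft: "\<And>z. z \<notin> lat t \<Longrightarrow> f (z + t) = f z"
    and lim: "(f \<longlongrightarrow> l) (at 0)" and z: "z \<notin> lat t"
  shows "f z = l"
proof -
  have lim': "((\<lambda>z. z * f z) \<longlongrightarrow> 0) (at 0)" using tendsto_mult[OF tendsto_ident_at lim] by simp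
  define F where "F = remove_sings f"
  have F: "F holomorphic_on UNIV" "\<And>z. z \<notin> lat t \<Longrightarrow> F z = f z"
    "\<And>z. F (z + 1) = F z" "\<And>z. F (z + t) = 1 * F z"
    unfolding F_def using lattice_extension[OF t hol f1, of "\<lambda>_. 1"] ft lim' by auto
  have per: "F (z + w) = F z" if "w \<in> lat t" for w z
    by (rule lat_induct[OF that]) (use F(3)[of "z + _"] F(4)[of "z + _"] in \<open>auto simp: add.assoc\<close>)
  have v: "Im t > 0" using t by (simp add: uhp_def)
  define K where "K = cball (0::complex) (norm t + 1)"
  have "F z \<in> F ` K" for z
  proof -
    define s where "s = Im z / Im t"
    define r where "r = Re z - s * Re t"
    have zst: "z = of_real s * t + of_real r" using v by (simp add: complex_eq_iff s_def r_def)
    define w where "w = of_real (frac s) * t + of_real (frac r)"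
    have "z = w + (of_int \<lfloor>s\<rfloor> * t + of_int \<lfloor>r\<rfloor>)" unfolding w_def zst by (simp add: frac_def algebra_simps)
    hence "F z = F w" using per[OF latI] by metis
    moreover have "norm w \<le> norm (of_real (frac s) * t) + norm (of_real (frac r) :: complex)" unfolding w_def by (rule norm_triangle_ineq)
    moreover have "\<dots> \<le> 1 * norm t + 1" unfolding norm_mult norm_of_real
      by (intro add_mono mult_right_mono) (auto simp: frac_lt_1 less_imp_le)
    ultimately show ?thesis by (auto simp: K_def)
  qed
  hence "range F \<subseteq> F ` K" by auto
  moreover have "compact (F ` K)" unfolding K_def
    by (intro compact_continuous_image holomorphic_on_imp_continuous_on holomorphic_on_subset[OF F(1)]) auto
  ultimately have "bounded (range F)" using bounded_subset compact_imp_bounded by blast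
  from Liouville_theorem[OF F(1) this] obtain k where k: "\<And>z. F z = k" by (auto simp: constant_on_def)
  have "\<forall>\<^sub>F z in at 0. z \<notin> lat t"
  proof -
    have "eventually (\<lambda>z. z \<in> ball 0 (min 1 (Im t)) - {0}) (at 0)" using v by (intro eventually_at_in_open) auto
    thus ?thesis by eventually_elim (use lat_small[OF t] in auto)
  qed
  hence "\<forall>\<^sub>F z in at 0. f z = k" by eventually_elim (use F(2) k in metis)
  hence "(f \<longlongrightarrow> k) (at 0)" by (rule tendsto_eventually)
  with lim have "l = k" using tendsto_unique[OF trivial_limit_at] by blast
  thus ?thesis using F(2)[OF z] k[of z] by simp
qed

section \<open>The Weierstrass function\<close>

text \<open>The Weierstrass function over (2 pi i)^2 up to an additive constant, summed row by row
  over the lattice.\<close>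

definition LL :: "complex \<Rightarrow> complex \<Rightarrow> complex" where
  "LL t z = (\<Sum>\<^sub>\<infinity>n\<in>(UNIV::int set). xf (ee (z + of_int n * t)))"

text \<open>This is -E_2 / 12, the constant term at z = 0 of \<open>LL\<close> minus its double
  pole.\<close>

definition ec :: "complex \<Rightarrow> complex" where
  "ec t = - 1 / 12 + 2 * (\<Sum>\<^sub>\<infinity>n\<in>(UNIV::nat set). xf (ee (of_nat (Suc n) * t)))"

text \<open>The Weierstrass function divided by (2 pi i)^2.\<close>

definition WW :: "complex \<Rightarrow> complex \<Rightarrow> complex" where
  "WW t z = LL t z - ec t"

lemma bij_int_nonneg: "bij_betw int UNIV {0..}"
  by (rule bij_betwI[where g=nat]) auto

lemma bij_int_neg: "bij_betw (\<lambda>n. - int n - 1) UNIV {..<0}"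
  by (rule bij_betwI[where g="\<lambda>n. nat (- n - 1)"]) auto

lemma int_UNIV_split: "(UNIV :: int set) = {0..} \<union> {..<0}" by auto

lemma summable_int_geometric:
  assumes "0 \<le> \<rho>" "\<rho> < (1::real)"
  shows "(\<lambda>n::int. C * \<rho> ^ nat \<bar>n\<bar>) summable_on UNIV"
  unfolding int_UNIV_split
proof (rule summable_on_Un_disjoint)
  show "(\<lambda>n::int. C * \<rho> ^ nat \<bar>n\<bar>) summable_on {0..}"
    using summable_geometric_norm[OF assms, of C]
    by (subst summable_on_reindex_bij_betw[OF bij_int_nonneg, symmetric]) simp
  have "nat \<bar>- int n - 1\<bar> = Suc n" for n by simp
  thus "(\<lambda>n::int. C * \<rho> ^ nat \<bar>n\<bar>) summable_on {..<0}"
    using summable_geometric_norm[OF assms, of "C * \<rho>"]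
    by (subst summable_on_reindex_bij_betw[OF bij_int_neg, symmetric]) (simp add: mult_ac)
qed auto

text \<open>For large |n| either ee (z + n t) or its inverse is small, uniformly on the compact set,
  and \<open>xf\<close> does not distinguish the two. The finitely many other n are bounded by
  continuity.\<close>

lemma LL_majorant:
  fixes I :: "int set"
  assumes t: "t \<in> uhp" and K: "compact K" "\<And>n z. n \<in> I \<Longrightarrow> z \<in> K \<Longrightarrow> ee (z + of_int n * t) \<noteq> 1"
  shows "\<exists>M. M summable_on I \<and> (\<forall>n\<in>I. \<forall>z\<in>K. norm (xf (ee (z + of_int n * t))) \<le> M n)"
proof -
  have v: "Im t > 0" using t by (simp add: uhp_def)
  from compact_imp_bounded[OF K(1)] obtain Y where Y: "\<And>z. z \<in> K \<Longrightarrow> norm z \<le> Y" by (auto simp: bounded_iff)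
  define \<rho> where "\<rho> = exp (- 2 * pi * Im t)"
  have \<rho>: "0 \<le> \<rho>" "\<rho> < 1" using v by (auto simp: \<rho>_def)
  define C where "C = exp (2 * pi * Y)"
  have "(\<lambda>n. C * \<rho> ^ n) \<longlonglongrightarrow> C * 0" using \<rho> by (intro tendsto_intros LIMSEQ_realpow_zero) auto
  hence "\<forall>\<^sub>F n in sequentially. C * \<rho> ^ n < 1 / 2" by (rule order_tendstoD) simp
  then obtain n0 where n0: "\<And>n. n \<ge> n0 \<Longrightarrow> C * \<rho> ^ n < 1 / 2" by (auto simp: eventually_sequentially)
  have big: "norm (xf (ee w)) \<le> 4 * C * \<rho> ^ n" if "n \<ge> n0" "Im w \<ge> of_nat n * Im t - Y" for n w
  proof -
    have "norm (ee w) \<le> C * \<rho> ^ n"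
    proof -
      have "- 2 * pi * Im w \<le> 2 * pi * Y + of_nat n * (- 2 * pi * Im t)"
        using mult_left_mono[OF that(2), of "2 * pi"] by (simp add: algebra_simps)
      thus ?thesis unfolding norm_ee C_def \<rho>_def exp_of_nat_mult[symmetric] exp_add[symmetric] by simp
    qed
    with n0[OF that(1)] norm_xf_le[of "ee w" "1 / 2"] show ?thesis by (simp add: power2_eq_square)
  qed
  have "\<exists>B. \<forall>n\<in>I. \<forall>z\<in>K. norm (xf (ee (z + of_int n * t))) \<le> B n"
  proof (rule bchoice)
    show "\<forall>n\<in>I. \<exists>B. \<forall>z\<in>K. norm (xf (ee (z + of_int n * t))) \<le> B"
    proof
      fix n assume n: "n \<in> I"
      have "continuous_on K (\<lambda>z. xf (ee (z + of_int n * t)))"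
        unfolding xf_def ee_def using K(2)[OF n] by (intro continuous_intros) (auto simp: ee_def)
      hence "bounded ((\<lambda>z. xf (ee (z + of_int n * t))) ` K)" using K(1) by (intro compact_imp_bounded compact_continuous_image)
      thus "\<exists>B. \<forall>z\<in>K. norm (xf (ee (z + of_int n * t))) \<le> B" by (auto simp: bounded_iff)
    qed
  qed
  then obtain B where B: "\<And>n z. n \<in> I \<Longrightarrow> z \<in> K \<Longrightarrow> norm (xf (ee (z + of_int n * t))) \<le> B n" by blast
  define M where "M = (\<lambda>n. (if nat \<bar>n\<bar> < n0 then \<bar>B n\<bar> else 0) + 4 * C * \<rho> ^ nat \<bar>n\<bar>)"
  have "(\<lambda>n. if nat \<bar>n\<bar> < n0 then \<bar>B n\<bar> else 0) summable_on I"
  proof (rule finite_nonzero_values_imp_summable_on)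
    have "{x \<in> I. (if nat \<bar>x\<bar> < n0 then \<bar>B x\<bar> else 0) \<noteq> 0} \<subseteq> {- int n0..int n0}" by (auto split: if_splits)
    thus "finite {x \<in> I. (if nat \<bar>x\<bar> < n0 then \<bar>B x\<bar> else 0) \<noteq> 0}" by (rule finite_subset) auto
  qed
  hence "M summable_on I" unfolding M_def
    by (intro summable_on_add) (auto intro!: summable_on_subset[OF summable_int_geometric] \<rho>)
  moreover have "norm (xf (ee (z + of_int n * t))) \<le> M n" if n: "n \<in> I" and z: "z \<in> K" for n z
  proof (cases "nat \<bar>n\<bar> < n0")
    case True
    have "0 \<le> 4 * C * \<rho> ^ nat \<bar>n\<bar>" using \<rho> by (simp add: C_def)
    thus ?thesis using B[OF n z] True by (simp add: M_def)
  next
    case False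
    have Yz: "\<bar>Im z\<bar> \<le> Y" using Y[OF z] abs_Im_le_cmod[of z] by linarith
    have "norm (xf (ee (z + of_int n * t))) \<le> 4 * C * \<rho> ^ nat \<bar>n\<bar>"
    proof (cases "n \<ge> 0")
      case True
      thus ?thesis using False Yz by (intro big) auto
    next
      case n: False
      have "xf (ee (z + of_int n * t)) = xf (ee (- (z + of_int n * t)))" by (simp only: ee_minus xf_inverse)
      also have "norm \<dots> \<le> 4 * C * \<rho> ^ nat \<bar>n\<bar>" using False Yz n by (intro big) auto
      finally show ?thesis .
    qed
    thus ?thesis using False by (simp add: M_def)
  qed
  ultimately show ?thesis by blast
qed

lemma LL_term_holomorphic: "(\<And>z. z \<in> S \<Longrightarrow> ee (z + of_int n * t) \<noteq> 1) \<Longrightarrow> (\<lambda>z. xf (ee (z + of_int n * t))) holomorphic_on S"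
  unfolding xf_def ee_def by (intro holomorphic_intros) auto

lemma LL_summable: assumes "t \<in> uhp" "\<And>n. n \<in> I \<Longrightarrow> ee (z + of_int n * t) \<noteq> 1"
  shows "(\<lambda>n. xf (ee (z + of_int n * t))) summable_on I"
proof -
  obtain M where "M summable_on I" "\<forall>n\<in>I. norm (xf (ee (z + of_int n * t))) \<le> M n"
    using LL_majorant[OF assms(1), of "{z}" I] assms(2) by auto
  thus ?thesis unfolding summable_on_iff_abs_summable_on_complex
    by (elim summable_on_comparison_test) auto
qed

lemma LL_holomorphic_gen:
  assumes t: "t \<in> uhp" and S: "open S" "\<And>n z. n \<in> I \<Longrightarrow> z \<in> S \<Longrightarrow> ee (z + of_int n * t) \<noteq> 1"
  shows "(\<lambda>z. \<Sum>\<^sub>\<infinity>n\<in>I. xf (ee (z + of_int n * t))) holomorphic_on S"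
proof (rule infsum_holomorphic[OF S(1)])
  show "(\<lambda>z. xf (ee (z + of_int n * t))) holomorphic_on S" if "n \<in> I" for n using S(2)[OF that] by (rule LL_term_holomorphic)
  fix z assume "z \<in> S"
  then obtain r where r: "r > 0" "cball z r \<subseteq> S" using S(1) open_contains_cball by metis
  from LL_majorant[OF t compact_cball, of I z r] S(2) r(2)
  obtain M where "M summable_on I" "\<forall>n\<in>I. \<forall>w\<in>cball z r. norm (xf (ee (w + of_int n * t))) \<le> M n" by blast
  with r show "\<exists>r>0. \<exists>M. cball z r \<subseteq> S \<and> M summable_on I \<and> (\<forall>i\<in>I. \<forall>w\<in>cball z r. norm (xf (ee (w + of_int i * t))) \<le> M i)" by blast
qed

lemma not_lat: "z \<notin> lat t \<Longrightarrow> ee (z + of_int n * t) \<noteq> 1"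
  using lat_eq_iff by blast

lemma LL_holomorphic: "t \<in> uhp \<Longrightarrow> LL t holomorphic_on (- lat t)"
  using LL_holomorphic_gen[OF _ open_lat, of t t UNIV] not_lat by (auto simp: LL_def[abs_def])

lemma WW_holomorphic: "t \<in> uhp \<Longrightarrow> WW t holomorphic_on (- lat t)"
  unfolding WW_def[abs_def] by (intro holomorphic_intros LL_holomorphic)

lemma LL_add_1: "LL t (z + 1) = LL t z"
proof -
  have "ee (z + 1 + w) = ee (z + w)" for w using ee_add[of "z + w" 1] by (simp add: add_ac)
  thus ?thesis by (simp add: LL_def)
qed

lemma LL_add_tau: "LL t (z + t) = LL t z"
  unfolding LL_def
  by (rule infsum_reindex_bij_witness[where i="\<lambda>n. n - 1" and j="\<lambda>n. n + 1"]) (auto simp: algebra_simps)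

lemma LL_minus: "LL t (- z) = LL t z"
  unfolding LL_def
proof (rule infsum_reindex_bij_witness[where i="\<lambda>n. - n" and j="\<lambda>n. - n"])
  fix n :: int
  have "ee (z + of_int (- n) * t) = inverse (ee (- z + of_int n * t))" by (simp add: ee_minus[symmetric])
  thus "xf (ee (z + of_int (- n) * t)) = xf (ee (- z + of_int n * t))" by (simp add: xf_inverse)
qed auto

lemma ee_T: "ee (z + of_int n * (t + 1)) = ee (z + of_int n * t)"
proof -
  have "z + of_int n * (t + 1) = (z + of_int n * t) + of_int n" by (simp add: algebra_simps)
  thus ?thesis by (simp add: ee_add)
qed

lemma LL_T: "LL (t + 1) z = LL t z" by (simp only: LL_def ee_T)

lemma ec_T: "ec (t + 1) = ec t"
  using ee_T[of 0 "int (Suc n)" t for n] by (simp add: ec_def)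

text \<open>With exp Z = 1 + Z A and A = 1 + Z/2 + Z^2/6 + ..., the difference equals (1 + Z A -
  A^2) / (Z A)^2, and the numerator starts with - Z^2 / 12.\<close>

lemma xf_limit: "((\<lambda>z. xf (ee z) - 1 / (tpi * z)^2) \<longlongrightarrow> - 1 / 12) (at 0)"
proof -
  \<comment> \<open>The third order Taylor remainder over Z^4. It is bounded near 0, and since only
    Z * R Z enters below, boundedness is enough for all limits.\<close>
  define R where "R = (\<lambda>Z::complex. (exp Z - (1 + Z + Z^2/2 + Z^3/6)) / Z ^ 4)"
  define A where "A = (\<lambda>Z::complex. 1 + Z/2 + Z^2/6 + Z^3 * R Z)"
  have Rb: "norm (R Z) \<le> exp 1" if "norm Z < 1" for Z
  proof (cases "Z = 0")
    case False
    have "(\<Sum>k\<le>3. Z ^ k / fact k) = 1 + Z + Z^2/2 + Z^3/6" by (simp add: numeral_3_eq_3 numeral_2_eq_2 fact_Suc)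
    hence "norm (exp Z - (1 + Z + Z^2/2 + Z^3/6)) \<le> exp \<bar>Re Z\<bar> * norm Z ^ Suc 3 / fact 3" using Taylor_exp[of Z 3] by simp
    also have "\<dots> \<le> exp \<bar>Re Z\<bar> * norm Z ^ Suc 3 / 1" by (intro divide_left_mono) (auto simp: fact_numeral)
    also have "\<dots> \<le> exp 1 * norm Z ^ 4"
      using abs_Re_le_cmod[of Z] that by (simp add: mult_right_mono)
    finally show ?thesis unfolding R_def norm_divide norm_power using False by (simp add: field_simps)
  qed (simp add: R_def)
  have ZR: "((\<lambda>Z. Z * R Z) \<longlongrightarrow> 0) (at 0)"
  proof (rule Lim_null_comparison)
    have "\<forall>\<^sub>F Z::complex in at 0. Z \<in> ball 0 1 - {0}" by (intro eventually_at_in_open) auto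
    thus "\<forall>\<^sub>F Z::complex in at 0. norm (Z * R Z) \<le> norm Z * exp 1"
      by eventually_elim (use Rb in \<open>auto simp: norm_mult intro!: mult_left_mono\<close>)
    show "((\<lambda>Z::complex. norm Z * exp 1) \<longlongrightarrow> 0) (at 0)" by (auto intro!: tendsto_eq_intros)
  qed
  have expA: "exp Z = 1 + Z * A Z" if "Z \<noteq> 0" for Z
    using that by (simp add: A_def R_def field_simps power2_eq_square power3_eq_cube power4_eq_xxxx)
  have id: "(1 + Z * A Z) / (A Z)^2 / Z^2 - 1 / Z^2 = (- 1/12 - 2 * (Z * R Z) - Z^2/36 - Z^2 * (Z * R Z)/3 - Z^2 * (Z * R Z)^2) / (A Z)^2"
    if "Z \<noteq> 0" "A Z \<noteq> 0" for Z
  proof -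
    have "1 + Z * A Z - (A Z)^2 = Z^2 * (- 1/12 - 2 * (Z * R Z) - Z^2/36 - Z^2 * (Z * R Z)/3 - Z^2 * (Z * R Z)^2)"
      unfolding A_def by (simp add: field_simps power2_eq_square power3_eq_cube)
    moreover have "(1 + Z * A Z) / (A Z)^2 / Z^2 - 1 / Z^2 = (1 + Z * A Z - (A Z)^2) / (Z^2 * (A Z)^2)"
      using that by (simp add: field_simps)
    ultimately show ?thesis using that by simp
  qed
  have A1: "(A \<longlongrightarrow> 1) (at 0)"
  proof -
    have "((\<lambda>Z. 1 + Z/2 + Z^2/6 + Z^2 * (Z * R Z)) \<longlongrightarrow> 1 + 0/2 + 0^2/6 + 0^2 * 0) (at 0)"
      by (intro tendsto_intros ZR) auto
    moreover have "(\<lambda>Z. 1 + Z/2 + Z^2/6 + Z^2 * (Z * R Z)) = A" by (simp add: A_def fun_eq_iff power2_eq_square power3_eq_cube)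
    ultimately show ?thesis by simp
  qed
  have "((\<lambda>Z. (- 1/12 - 2 * (Z * R Z) - Z^2/36 - Z^2 * (Z * R Z)/3 - Z^2 * (Z * R Z)^2) / (A Z)^2) \<longlongrightarrow>
     (- 1/12 - 2 * 0 - 0^2/36 - 0^2 * 0/3 - 0^2 * 0^2) / 1^2) (at 0)"
    by (intro tendsto_intros ZR A1) auto
  hence lim: "((\<lambda>Z. (- 1/12 - 2 * (Z * R Z) - Z^2/36 - Z^2 * (Z * R Z)/3 - Z^2 * (Z * R Z)^2) / (A Z)^2) \<longlongrightarrow> - 1/12) (at 0)" by simp
  have "\<forall>\<^sub>F Z in at 0. A Z \<noteq> 0" using A1 by (rule tendsto_imp_eventually_ne) simp
  moreover have "\<forall>\<^sub>F Z::complex in at 0. Z \<noteq> 0" by (simp add: eventually_at_filter)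
  ultimately have "\<forall>\<^sub>F Z in at 0. (- 1/12 - 2 * (Z * R Z) - Z^2/36 - Z^2 * (Z * R Z)/3 - Z^2 * (Z * R Z)^2) / (A Z)^2 = xf (exp Z) - 1 / Z^2"
  proof eventually_elim
    case (elim Z)
    have "xf (exp Z) = (1 + Z * A Z) / (A Z)^2 / Z^2" using elim by (simp add: xf_def expA power_mult_distrib field_simps)
    thus ?case using id[OF elim(2,1)] by simp
  qed
  from Lim_transform_eventually[OF lim this] have *: "((\<lambda>Z. xf (exp Z) - 1 / Z^2) \<longlongrightarrow> - 1/12) (at 0)" .
  have "filterlim (\<lambda>z. tpi * z) (at 0) (at 0)"
    by (intro filterlim_atI) (auto intro!: tendsto_eq_intros simp: eventually_at_filter)
  from filterlim_compose[OF * this] show ?thesis by (simp add: ee_def)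
qed

lemma small_not_lat:
  assumes "t \<in> uhp" "z \<in> ball 0 (min 1 (Im t))" "n \<noteq> 0" shows "ee (z + of_int n * t) \<noteq> 1"
proof
  assume *: "ee (z + of_int n * t) = 1"
  hence "z \<in> lat t" using lat_eq_iff by blast
  hence "z = 0" using lat_small[OF assms(1)] assms(2) by simp
  with * have "of_int n * t \<in> \<int>" by (simp add: ee_eq_1_iff)
  then obtain k where "of_int n * t = of_int k" by (auto elim: Ints_cases)
  hence "Im (of_int n * t) = 0" by simp
  with assms show False by (simp add: uhp_def)
qed

text \<open>The term n = 0 carries the double pole and the constant -1/12. The other terms are
  regular at 0, where the rows n and -n contribute equally by inversion invariance;
  \<open>ec\<close> removes exactly this total constant.\<close>

lemma WW_expansion:
  assumes t: "t \<in> uhp"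
  obtains V where "V holomorphic_on ball 0 (min 1 (Im t))" "V 0 = 0"
    "\<And>z. z \<in> ball 0 (min 1 (Im t)) - {0} \<Longrightarrow> WW t z = 1 / (tpi * z)^2 + V z"
proof -
  define \<delta> where "\<delta> = min 1 (Im t)"
  have \<delta>: "\<delta> > 0" using t by (simp add: \<delta>_def uhp_def)
  define L0 where "L0 = (\<lambda>z. \<Sum>\<^sub>\<infinity>n\<in>UNIV - {0}. xf (ee (z + of_int n * t)))"
  have hol: "L0 holomorphic_on ball 0 \<delta>" unfolding L0_def
    by (rule LL_holomorphic_gen[OF t]) (use small_not_lat[OF t] in \<open>auto simp: \<delta>_def\<close>)
  have split: "LL t z = xf (ee z) + L0 z" if "z \<in> ball 0 \<delta>" for z
  proof -
    have "(\<lambda>n. xf (ee (z + of_int n * t))) summable_on (UNIV - {0})"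
      by (rule LL_summable[OF t]) (use small_not_lat[OF t] that in \<open>auto simp: \<delta>_def\<close>)
    from infsum_insert[OF this, of 0] have "(\<Sum>\<^sub>\<infinity>n\<in>insert 0 (UNIV - {0}). xf (ee (z + of_int n * t))) = xf (ee z) + L0 z"
      by (simp add: L0_def)
    moreover have "insert 0 (UNIV - {0::int}) = UNIV" by auto
    ultimately show ?thesis by (simp add: LL_def)
  qed
  have L00: "L0 0 = 2 * (\<Sum>\<^sub>\<infinity>n\<in>(UNIV::nat set). xf (ee (of_nat (Suc n) * t)))"
  proof -
    have bp: "bij_betw (\<lambda>n. int n + 1) UNIV {0<..}" by (rule bij_betwI[where g="\<lambda>n. nat (n - 1)"]) auto
    have s: "(\<lambda>n. xf (ee (0 + of_int n * t))) summable_on I" if "0 \<notin> I" for I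
      by (rule LL_summable[OF t], rule small_not_lat[OF t]) (use that t in \<open>auto simp: uhp_def\<close>)
    have U: "UNIV - {0::int} = {0<..} \<union> {..<0}" by auto
    have "L0 0 = (\<Sum>\<^sub>\<infinity>n\<in>{0<..}. xf (ee (0 + of_int n * t))) + (\<Sum>\<^sub>\<infinity>n\<in>{..<0}. xf (ee (0 + of_int n * t)))"
      unfolding L0_def U by (rule infsum_Un_disjoint[OF s s]) auto
    also have "(\<Sum>\<^sub>\<infinity>n\<in>{0<..}. xf (ee (0 + of_int n * t))) = (\<Sum>\<^sub>\<infinity>n\<in>(UNIV::nat set). xf (ee (of_nat (Suc n) * t)))"
      by (subst infsum_reindex_bij_betw[OF bp, symmetric]) (simp add: add.commute)
    also have "(\<Sum>\<^sub>\<infinity>n\<in>{..<0}. xf (ee (0 + of_int n * t))) = (\<Sum>\<^sub>\<infinity>n\<in>(UNIV::nat set). xf (ee (of_nat (Suc n) * t)))"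
    proof (subst infsum_reindex_bij_betw[OF bij_int_neg, symmetric], rule infsum_cong)
      fix n :: nat
      have "ee (0 + of_int (- int n - 1) * t) = inverse (ee (of_nat (Suc n) * t))"
        by (subst ee_minus[symmetric], rule arg_cong[of _ _ ee]) (simp add: algebra_simps)
      thus "xf (ee (0 + of_int (- int n - 1) * t)) = xf (ee (of_nat (Suc n) * t))" by (simp only: xf_inverse)
    qed
    finally show ?thesis by simp
  qed
  define g where "g = (\<lambda>z. xf (ee z) - 1 / (tpi * z)^2)"
  have "g holomorphic_on (ball 0 \<delta> - {0})"
  proof -
    have "ee z \<noteq> 1" if "z \<in> ball 0 \<delta> - {0}" for z
      using that lat_small[OF t, of z] lat_eq_iff[of z t] by (auto simp: \<delta>_def intro: exI[of _ 0])
    hence "(\<lambda>z. xf (ee (z + of_int 0 * t))) holomorphic_on (ball 0 \<delta> - {0})" by (intro LL_term_holomorphic) simp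
    thus ?thesis unfolding g_def by (intro holomorphic_intros) auto
  qed
  moreover have "((\<lambda>z. (z - 0) * g z) \<longlongrightarrow> 0) (at 0)"
    using tendsto_mult[OF tendsto_ident_at xf_limit] by (simp add: g_def)
  ultimately obtain G where G: "G holomorphic_on ball 0 \<delta>" "\<And>z. z \<in> ball 0 \<delta> - {0} \<Longrightarrow> G z = g z"
    using holomorphic_on_extend_lim[of g "ball 0 \<delta>" 0] \<delta> by auto
  have ev: "\<forall>\<^sub>F z in at 0. z \<in> ball 0 \<delta> - {0}" using \<delta> by (intro eventually_at_in_open) auto
  have "isCont G 0" using holomorphic_on_imp_continuous_on[OF G(1)] \<delta> by (simp add: continuous_on_eq_continuous_at)
  hence "(G \<longlongrightarrow> G 0) (at 0)" by (simp add: isCont_def)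
  moreover have "(G \<longlongrightarrow> - 1/12) (at 0)"
  proof (rule Lim_transform_eventually[OF xf_limit])
    show "\<forall>\<^sub>F z in at 0. xf (ee z) - 1 / (tpi * z)^2 = G z"
      using ev by eventually_elim (use G(2) in \<open>simp add: g_def\<close>)
  qed
  ultimately have G0: "G 0 = - 1/12" using tendsto_unique[OF trivial_limit_at] by blast
  show ?thesis
  proof (rule that[of "\<lambda>z. G z + L0 z - ec t"], unfold \<delta>_def[symmetric])
    show "(\<lambda>z. G z + L0 z - ec t) holomorphic_on ball 0 \<delta>" by (intro holomorphic_intros G hol)
    show "G 0 + L0 0 - ec t = 0" by (simp add: G0 L00 ec_def)
    show "WW t z = 1 / (tpi * z)^2 + (G z + L0 z - ec t)" if "z \<in> ball 0 \<delta> - {0}" for z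
      using that split[of z] G(2)[OF that] by (simp add: WW_def g_def)
  qed
qed

lemma WW_limit:
  assumes t: "t \<in> uhp"
  shows "((\<lambda>z. WW t z - 1 / (tpi * z)^2) \<longlongrightarrow> 0) (at 0)"
proof -
  obtain V where V: "V holomorphic_on ball 0 (min 1 (Im t))" "V 0 = 0"
    "\<And>z. z \<in> ball 0 (min 1 (Im t)) - {0} \<Longrightarrow> WW t z = 1 / (tpi * z)^2 + V z" by (rule WW_expansion[OF t]) blast
  have d: "min 1 (Im t) > 0" using t by (simp add: uhp_def)
  have "isCont V 0" using holomorphic_on_imp_continuous_on[OF V(1)] d by (simp add: continuous_on_eq_continuous_at)
  hence "(V \<longlongrightarrow> 0) (at 0)" using V(2) by (simp add: isCont_def)
  moreover have "\<forall>\<^sub>F z in at 0. z \<in> ball 0 (min 1 (Im t)) - {0}" using d by (intro eventually_at_in_open) auto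
  hence "\<forall>\<^sub>F z in at 0. V z = WW t z - 1 / (tpi * z)^2" by eventually_elim (use V(3) in simp)
  ultimately show ?thesis by (rule Lim_transform_eventually)
qed

lemma WW_add_1: "WW t (z + 1) = WW t z" and WW_add_tau: "WW t (z + t) = WW t z"
  and WW_minus: "WW t (- z) = WW t z" and WW_T: "WW (t + 1) z = WW t z"
  by (simp_all add: WW_def LL_add_1 LL_add_tau LL_minus LL_T ec_T)

text \<open>The difference of the two sides is elliptic, and as neither function has a constant term
  at 0 it tends to 0 there. The transformation behaviour of E_2 never enters.\<close>

lemma WW_S:
  assumes t: "t \<in> uhp" and z: "z \<notin> lat t"
  shows "WW (- 1 / t) (z / t) = t^2 * WW t z"
proof -
  have nz: "t \<noteq> 0" using uhp_nonzero[OF t] .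
  have t': "- 1 / t \<in> uhp" by (rule minus_inverse_in_uhp[OF t])
  define f where "f = (\<lambda>z. WW (- 1 / t) (z / t) - t^2 * WW t z)"
  have "f z = 0"
  proof (rule elliptic_Liouville[OF t _ _ _ _ z])
    have "(WW (- 1 / t) \<circ> (\<lambda>z. z / t)) holomorphic_on (- lat t)"
      by (rule holomorphic_on_compose_gen[OF _ WW_holomorphic[OF t']]) (use nz lat_S[OF t] in \<open>auto intro!: holomorphic_intros\<close>)
    thus "f holomorphic_on (- lat t)" unfolding f_def by (intro holomorphic_intros WW_holomorphic[OF t]) (simp add: o_def)
    show "f (z + 1) = f z" for z
      using WW_add_tau[of "- 1 / t" "(z + 1) / t"] by (simp add: f_def WW_add_1 add_divide_distrib)
    show "f (z + t) = f z" for z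
      using nz WW_add_1[of "- 1 / t" "z / t"] by (simp add: f_def WW_add_tau add_divide_distrib)
    have "filterlim (\<lambda>z. z / t) (at 0) (at 0)"
      using nz by (intro filterlim_atI) (auto intro!: tendsto_eq_intros simp: eventually_at_filter)
    from filterlim_compose[OF WW_limit[OF t'] this]
    have "((\<lambda>z. (WW (- 1 / t) (z / t) - 1 / (tpi * (z / t))^2) - t^2 * (WW t z - 1 / (tpi * z)^2)) \<longlongrightarrow> 0 - t^2 * 0) (at 0)"
      by (intro tendsto_intros WW_limit[OF t])
    moreover have "(WW (- 1 / t) (z / t) - 1 / (tpi * (z / t))^2) - t^2 * (WW t z - 1 / (tpi * z)^2) = f z" for z
      using nz by (simp add: f_def power_mult_distrib power_divide algebra_simps)
    ultimately show "(f \<longlongrightarrow> 0) (at 0)" by simp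
  qed
  thus ?thesis by (simp add: f_def)
qed

section \<open>Integral elliptic functions\<close>

text \<open>One chain rule for all laws in \<open>ell\<close>: both translations, t + 1, reflection
  and S are all of this affine form.\<close>

lemma deriv_affine:
  fixes f g :: "complex \<Rightarrow> complex"
  assumes "open S" "z \<in> S" "f field_differentiable at (a * z + b)" "g field_differentiable at z"
    and eq: "\<And>w. w \<in> S \<Longrightarrow> f (a * w + b) = k * g w"
  shows "a * deriv f (a * z + b) = k * deriv g z"
proof -
  have "(f has_field_derivative deriv f (a * z + b)) (at (a * z + b))"
    using assms(3) by (simp add: field_differentiable_derivI)
  moreover have "((\<lambda>w. a * w + b) has_field_derivative a) (at z)" by (auto intro!: derivative_eq_intros)
  ultimately have "((\<lambda>w. f (a * w + b)) has_field_derivative deriv f (a * z + b) * a) (at z)"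
    by (rule DERIV_chain2)
  hence "((\<lambda>w. k * g w) has_field_derivative deriv f (a * z + b) * a) (at z)"
    by (rule has_field_derivative_transform_within_open[OF _ assms(1,2)]) (use eq in auto)
  moreover have "((\<lambda>w. k * g w) has_field_derivative k * deriv g z) (at z)"
    by (rule DERIV_cmult) (use assms(4) in \<open>simp add: field_differentiable_derivI\<close>)
  ultimately show ?thesis using DERIV_unique by (metis mult.commute)
qed

text \<open>Jacobi forms of weight M and index 0 with poles at lattice points only. The values at
  the poles are arbitrary, so every law is imposed off the lattice.\<close>

definition ell :: "nat \<Rightarrow> (complex \<Rightarrow> complex \<Rightarrow> complex) \<Rightarrow> bool" where
  "ell M G \<longleftrightarrow> (\<forall>t\<in>uhp. G t holomorphic_on (- lat t) \<and> (\<forall>z. z \<notin> lat t \<longrightarrow>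
     G t (z + 1) = G t z \<and> G t (z + t) = G t z \<and> G (t + 1) z = G t z \<and>
     G t (- z) = (- 1) ^ M * G t z \<and> G (- 1 / t) (z / t) = t ^ M * G t z))"

lemma ellD:
  assumes "ell M G" "t \<in> uhp"
  shows "G t holomorphic_on (- lat t)" "z \<notin> lat t \<Longrightarrow> G t (z + 1) = G t z"
    "z \<notin> lat t \<Longrightarrow> G t (z + t) = G t z" "z \<notin> lat t \<Longrightarrow> G (t + 1) z = G t z"
    "z \<notin> lat t \<Longrightarrow> G t (- z) = (- 1) ^ M * G t z" "z \<notin> lat t \<Longrightarrow> G (- 1 / t) (z / t) = t ^ M * G t z"
  using assms unfolding ell_def by blast+

lemma uhp_T: "t \<in> uhp \<Longrightarrow> t + 1 \<in> uhp" by (simp add: uhp_def)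

lemma ell_differentiable:
  assumes "ell M G" "t \<in> uhp" "z \<notin> lat t" shows "G t field_differentiable at z"
  using holomorphic_on_imp_differentiable_at[OF ellD(1)[OF assms(1,2)] open_lat[OF assms(2)]] assms(3) by simp

lemma ell_DD:
  assumes G: "ell M G" shows "ell (Suc M) (DD G)"
  unfolding ell_def
proof (intro ballI conjI allI impI)
  fix t assume t: "t \<in> uhp"
  show "DD G t holomorphic_on (- lat t)" unfolding DD_def[abs_def]
    by (intro holomorphic_intros holomorphic_deriv ellD(1)[OF G t] open_lat[OF t]) auto
  fix z assume z: "z \<notin> lat t"
  note S = open_lat[OF t]
  have zS: "z \<in> - lat t" using z by simp
  have z1: "z + 1 \<notin> lat t" "z + t \<notin> lat t" "- z \<notin> lat t" "z \<notin> lat (t + 1)" "z / t \<notin> lat (- 1 / t)"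
    using z lat_T lat_S[OF t] by auto
  have nz: "t \<noteq> 0" using uhp_nonzero[OF t] .
  note D = ell_differentiable[OF G] 
  have "1 * deriv (G t) (1 * z + 1) = 1 * deriv (G t) z"
    by (rule deriv_affine[OF S zS]) (use z1 z ellD(2)[OF G t] in \<open>auto intro!: D t\<close>)
  thus "DD G t (z + 1) = DD G t z" by (simp add: DD_def)
  have "1 * deriv (G t) (1 * z + t) = 1 * deriv (G t) z"
    by (rule deriv_affine[OF S zS]) (use z1 z ellD(3)[OF G t] in \<open>auto intro!: D t\<close>)
  thus "DD G t (z + t) = DD G t z" by (simp add: DD_def)
  have "1 * deriv (G (t + 1)) (1 * z + 0) = 1 * deriv (G t) z"
    by (rule deriv_affine[OF S zS]) (use z1 z ellD(4)[OF G t] in \<open>auto intro!: D t uhp_T\<close>)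
  thus "DD G (t + 1) z = DD G t z" by (simp add: DD_def)
  have "(- 1) * deriv (G t) ((- 1) * z + 0) = (- 1) ^ M * deriv (G t) z"
    by (rule deriv_affine[OF S zS]) (use z1 z ellD(5)[OF G t] in \<open>auto intro!: D t\<close>)
  hence "deriv (G t) (- z) = - ((- 1) ^ M * deriv (G t) z)" by (simp add: minus_equation_iff[of "deriv _ _"])
  thus "DD G t (- z) = (- 1) ^ Suc M * DD G t z" by (simp add: DD_def)
  have "(1 / t) * deriv (G (- 1 / t)) ((1 / t) * z + 0) = t ^ M * deriv (G t) z"
    by (rule deriv_affine[OF S zS]) (use z1 z ellD(6)[OF G t] in \<open>auto intro!: D[simplified] D t minus_inverse_in_uhp[OF t, simplified]\<close>)
  hence "deriv (G (- 1 / t)) (z / t) = t ^ Suc M * deriv (G t) z" using nz by (simp add: field_simps)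
  thus "DD G (- 1 / t) (z / t) = t ^ Suc M * DD G t z" by (simp add: DD_def)
qed

lemma ell_mult: "ell M G \<Longrightarrow> ell M' H \<Longrightarrow> ell (M + M') (\<lambda>t z. G t z * H t z)"
  unfolding ell_def by (auto simp: power_add intro!: holomorphic_intros)

lemma ell_add: "ell M G \<Longrightarrow> ell M H \<Longrightarrow> ell M (\<lambda>t z. G t z + H t z)"
  unfolding ell_def by (auto simp: algebra_simps intro!: holomorphic_intros)

lemma ell_cmult: "ell M G \<Longrightarrow> ell M (\<lambda>t z. k * G t z)"
  unfolding ell_def by (auto intro!: holomorphic_intros)

text \<open>The order of the pole is tied to the weight, and c is the leading Laurent coefficient in
  the variable 2 pi i z, the same for all t.\<close>

definition EE :: "nat \<Rightarrow> int \<Rightarrow> (complex \<Rightarrow> complex \<Rightarrow> complex) \<Rightarrow> bool" where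
  "EE M c G \<longleftrightarrow> ell M G \<and> intexp G \<and> (\<forall>t\<in>uhp. ((\<lambda>z. (tpi * z) ^ M * G t z) \<longlongrightarrow> of_int c) (at 0))"

lemma EE_mult: "EE M c G \<Longrightarrow> EE M' c' H \<Longrightarrow> EE (M + M') (c * c') (\<lambda>t z. G t z * H t z)"
  unfolding EE_def
proof (intro conjI ballI; (elim conjE)?)
  fix t assume "t \<in> uhp" "\<forall>t\<in>uhp. ((\<lambda>z. (tpi * z) ^ M * G t z) \<longlongrightarrow> of_int c) (at 0)"
    "\<forall>t\<in>uhp. ((\<lambda>z. (tpi * z) ^ M' * H t z) \<longlongrightarrow> of_int c') (at 0)"
  hence "((\<lambda>z. ((tpi * z) ^ M * G t z) * ((tpi * z) ^ M' * H t z)) \<longlongrightarrow> of_int c * of_int c') (at 0)"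
    by (intro tendsto_mult) auto
  moreover have "((tpi * z) ^ M * G t z) * ((tpi * z) ^ M' * H t z) = (tpi * z) ^ (M + M') * (G t z * H t z)" for z
    by (simp only: power_add mult_ac)
  ultimately show "((\<lambda>z. (tpi * z) ^ (M + M') * (G t z * H t z)) \<longlongrightarrow> of_int (c * c')) (at 0)" by (simp only: of_int_mult)
qed (auto intro: ell_mult intexp_mult)

lemma EE_comb: "EE M c G \<Longrightarrow> EE M c' H \<Longrightarrow> EE M (k * c + k' * c') (\<lambda>t z. of_int k * G t z + of_int k' * H t z)"
  unfolding EE_def
proof (intro conjI ballI; (elim conjE)?)
  fix t assume "t \<in> uhp" "\<forall>t\<in>uhp. ((\<lambda>z. (tpi * z) ^ M * G t z) \<longlongrightarrow> of_int c) (at 0)"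
    "\<forall>t\<in>uhp. ((\<lambda>z. (tpi * z) ^ M * H t z) \<longlongrightarrow> of_int c') (at 0)"
  hence "((\<lambda>z. of_int k * ((tpi * z) ^ M * G t z) + of_int k' * ((tpi * z) ^ M * H t z)) \<longlongrightarrow> of_int k * of_int c + of_int k' * of_int c') (at 0)"
    by (intro tendsto_intros) auto
  moreover have "of_int k * ((tpi * z) ^ M * G t z) + of_int k' * ((tpi * z) ^ M * H t z) = (tpi * z) ^ M * (of_int k * G t z + of_int k' * H t z)" for z
    by (simp only: distrib_left mult_ac)
  ultimately show "((\<lambda>z. (tpi * z) ^ M * (of_int k * G t z + of_int k' * H t z)) \<longlongrightarrow> of_int (k * c + k' * c')) (at 0)" by (simp only: of_int_mult of_int_add)
qed (auto intro: ell_add ell_cmult intexp_add intexp_cmult)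

text \<open>Only the attainable leading coefficients matter later. For fixed weight they are closed
  under integer combinations, and they multiply when weights add, so the search for a small one is
  pure arithmetic.\<close>

definition IE :: "nat \<Rightarrow> int \<Rightarrow> bool" where "IE M c \<longleftrightarrow> (\<exists>G. EE M c G)"

lemma IE_mult: "IE M c \<Longrightarrow> IE M' c' \<Longrightarrow> IE (M + M') (c * c')"
  unfolding IE_def using EE_mult by blast

lemma IE_comb: "IE M c \<Longrightarrow> IE M c' \<Longrightarrow> IE M (k * c + k' * c')"
  unfolding IE_def using EE_comb by blast

lemma IE_0: "IE 0 1"
proof -
  have "intexp (\<lambda>t z. 1)" using intexp_const[of 1] by simp
  hence "EE 0 1 (\<lambda>t z. 1)" unfolding EE_def ell_def by auto
  thus ?thesis by (auto simp: IE_def)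
qed

lemma IE_power: "IE M c \<Longrightarrow> IE (k * M) (c ^ k)"
  by (induction k) (use IE_0 IE_mult in auto)

lemma IE_cmult: "IE M c \<Longrightarrow> IE M (k * c)" using IE_comb[of M c c k 0] by simp

subsection \<open>The generators\<close>

lemma strip_not_lat: assumes "0 < Im z" "Im z < Im t" shows "z \<notin> lat t"
proof
  assume "z \<in> lat t"
  then obtain a b where z: "z = of_int a * t + of_int b" by (auto simp: lat_def)
  have "0 < of_int a * Im t" "of_int a * Im t < 1 * Im t" using assms by (auto simp: z)
  hence "0 < (of_int a :: real)" "(of_int a :: real) < 1" using assms
    by (auto simp: zero_less_mult_iff mult_less_cancel_right)
  hence "0 < a" "a < 1" by simp_all
  thus False by simp
qed

lemma uhp_strip: "0 < Im z \<Longrightarrow> Im z < Im t \<Longrightarrow> t \<in> uhp" by (simp add: uhp_def)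

definition sig :: "complex \<Rightarrow> complex" where "sig t = (\<Sum>\<^sub>\<infinity>n\<in>(UNIV::nat set). xf (ee (of_nat (Suc n) * t)))"

text \<open>Row n >= 0 has argument (ee z)^(n+1) (ee (t - z))^n. A negative row is inverted first,
  which exchanges the two exponents.\<close>

lemma intexp_LL: "intexp LL"
proof -
  let ?A = "\<lambda>t z. \<Sum>\<^sub>\<infinity>n. xf (ee z ^ fst (Suc n, n) * ee (t - z) ^ snd (Suc n, n))"
  let ?B = "\<lambda>t z. \<Sum>\<^sub>\<infinity>n. xf (ee z ^ fst (n, Suc n) * ee (t - z) ^ snd (n, Suc n))"
  have "intexp (\<lambda>t z. ?A t z + ?B t z)" by (intro intexp_add intexp_lambert(1)) auto
  thus ?thesis
  proof (rule intexp_cong)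
    fix t z assume z: "0 < Im z" "Im z < Im t"
    have s: "(\<lambda>n. xf (ee (z + of_int n * t))) summable_on I" for I
      by (rule LL_summable[OF uhp_strip[OF z] not_lat[OF strip_not_lat[OF z]]])
    have "LL t z = (\<Sum>\<^sub>\<infinity>n\<in>{0..}. xf (ee (z + of_int n * t))) + (\<Sum>\<^sub>\<infinity>n\<in>{..<0}. xf (ee (z + of_int n * t)))"
      unfolding LL_def int_UNIV_split by (rule infsum_Un_disjoint[OF s s]) auto
    also have "(\<Sum>\<^sub>\<infinity>n\<in>{0..}. xf (ee (z + of_int n * t))) = ?A t z"
    proof (subst infsum_reindex_bij_betw[OF bij_int_nonneg, symmetric], rule infsum_cong)
      fix n :: nat
      have "ee (z + of_int (int n) * t) = ee z ^ fst (Suc n, n) * ee (t - z) ^ snd (Suc n, n)"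
        unfolding ee_power ee_add[symmetric] by (rule arg_cong[of _ _ ee]) (simp add: algebra_simps)
      thus "xf (ee (z + of_int (int n) * t)) = xf (ee z ^ fst (Suc n, n) * ee (t - z) ^ snd (Suc n, n))" by (simp only:)
    qed
    also have "(\<Sum>\<^sub>\<infinity>n\<in>{..<0}. xf (ee (z + of_int n * t))) = ?B t z"
    proof (subst infsum_reindex_bij_betw[OF bij_int_neg, symmetric], rule infsum_cong)
      fix n :: nat
      have "ee (z + of_int (- int n - 1) * t) = inverse (ee z ^ fst (n, Suc n) * ee (t - z) ^ snd (n, Suc n))"
        unfolding ee_power ee_add[symmetric] ee_minus[symmetric] by (rule arg_cong[of _ _ ee]) (simp add: algebra_simps)
      thus "xf (ee (z + of_int (- int n - 1) * t)) = xf (ee z ^ fst (n, Suc n) * ee (t - z) ^ snd (n, Suc n))" by (simp only: xf_inverse)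
    qed
    finally show "?A t z + ?B t z = LL t z" by simp
  qed
qed

lemma intexp_sig: "intexp (\<lambda>t z. sig t)"
proof -
  have "intexp (\<lambda>t z. \<Sum>\<^sub>\<infinity>n. xf (ee z ^ fst (Suc n, Suc n) * ee (t - z) ^ snd (Suc n, Suc n)))"
    by (rule intexp_lambert(1)) simp
  moreover have "ee z ^ fst (Suc n, Suc n) * ee (t - z) ^ snd (Suc n, Suc n) = ee (of_nat (Suc n) * t)" for z t n
    unfolding ee_power ee_add[symmetric] by (rule arg_cong[of _ _ ee]) (simp add: algebra_simps)
  ultimately show ?thesis by (simp only: sig_def)
qed

lemma ell_WW: "ell 2 WW"
  unfolding ell_def using WW_holomorphic WW_S by (auto simp: WW_add_1 WW_add_tau WW_T WW_minus)

text \<open>The factor 12 clears the only denominator of \<open>WW\<close>, the constant 1/12 in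
  \<open>ec\<close>. This is the origin of the 12 in the final bounds.\<close>

lemma WW_eq: "12 * WW t z = 12 * (LL t z - 2 * sig t) + 1"
  by (simp add: WW_def ec_def sig_def)

lemma intexp_12WW: "intexp (\<lambda>t z. 12 * WW t z)"
proof -
  have "intexp (\<lambda>t z. of_int 12 * (LL t z - of_int 2 * sig t) + of_int 1)"
    by (intro intexp_add intexp_cmult intexp_diff intexp_LL intexp_sig intexp_const)
  thus ?thesis unfolding WW_eq by simp
qed

text \<open>Differentiation kills \<open>ec\<close>, so the derivatives of \<open>WW\<close> are
  integral without the factor 12.\<close>

lemma DD_WW: assumes "t \<in> uhp" "z \<notin> lat t" shows "DD WW t z = DD LL t z" "DD (DD WW) t z = DD (DD LL) t z"
proof -
  have 1: "DD WW t w = DD LL t w" if "w \<in> - lat t" for w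
  proof -
    have "(LL t has_field_derivative deriv (LL t) w) (at w)"
      by (rule holomorphic_derivI[OF LL_holomorphic[OF assms(1)] open_lat[OF assms(1)] that])
    hence "((\<lambda>z. LL t z - ec t) has_field_derivative deriv (LL t) w - 0) (at w)" by (intro DERIV_diff) auto
    hence "deriv (WW t) w = deriv (LL t) w" unfolding WW_def[abs_def] by (simp add: DERIV_imp_deriv)
    thus ?thesis by (simp add: DD_def)
  qed
  thus "DD WW t z = DD LL t z" using assms by simp
  have "deriv (DD WW t) z = deriv (DD LL t) z"
    by (rule deriv_cong_ev) (use 1 eventually_nhds_in_open[OF open_lat[OF assms(1)], of z] assms(2) in \<open>auto elim!: eventually_mono\<close>)
  thus "DD (DD WW) t z = DD (DD LL) t z" by (simp add: DD_def)
qed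

lemma DD_WW_limits:
  assumes t: "t \<in> uhp"
  shows "((\<lambda>z. (tpi * z) ^ 2 * WW t z) \<longlongrightarrow> 1) (at 0)"
    "((\<lambda>z. (tpi * z) ^ 3 * DD WW t z) \<longlongrightarrow> - 2) (at 0)"
    "((\<lambda>z. (tpi * z) ^ 4 * DD (DD WW) t z) \<longlongrightarrow> 6) (at 0)"
proof -
  define \<delta> where "\<delta> = min 1 (Im t)"
  have \<delta>: "\<delta> > 0" using t by (simp add: \<delta>_def uhp_def)
  obtain V where V: "V holomorphic_on ball 0 \<delta>"
    "\<And>z. z \<in> ball 0 \<delta> - {0} \<Longrightarrow> WW t z = 1 / (tpi * z)^2 + V z"
    unfolding \<delta>_def by (rule WW_expansion[OF t]) blast
  define c where "c = tpi"
  have c: "c \<noteq> 0" by (simp add: c_def)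
  have Vd: "deriv V holomorphic_on ball 0 \<delta>" "deriv (deriv V) holomorphic_on ball 0 \<delta>" using V(1) by (auto intro!: holomorphic_deriv)
  have lim: "(f \<longlongrightarrow> f 0) (at 0)" if "f holomorphic_on ball 0 \<delta>" for f
  proof -
    have "isCont f 0" using holomorphic_on_imp_continuous_on[OF that] \<delta> by (simp add: continuous_on_eq_continuous_at)
    thus ?thesis by (simp add: isCont_def)
  qed
  have op: "open (ball 0 \<delta> - {0::complex})" by auto
  have d1: "DD WW t z = - 2 / (c * z) ^ 3 + deriv V z / c" if "z \<in> ball 0 \<delta> - {0}" for z
  proof -
    have "((\<lambda>z. 1 / (c * z)^2 + V z) has_field_derivative - 2 * c / (c * z) ^ 3 + deriv V z) (at z)"
    proof (rule DERIV_add)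
      show "(V has_field_derivative deriv V z) (at z)" using V(1) that by (intro holomorphic_derivI[of _ "ball 0 \<delta>"]) auto
      show "((\<lambda>z. 1 / (c * z)^2) has_field_derivative - 2 * c / (c * z) ^ 3) (at z)"
        using that c by (auto intro!: derivative_eq_intros simp: field_simps power2_eq_square power3_eq_cube power4_eq_xxxx)
    qed
    hence "(WW t has_field_derivative - 2 * c / (c * z) ^ 3 + deriv V z) (at z)"
      by (rule has_field_derivative_transform_within_open[OF _ op that]) (use V(2) in \<open>auto simp: c_def\<close>)
    hence "DD WW t z = (- 2 * c / (c * z) ^ 3 + deriv V z) / c" unfolding DD_def c_def by (simp add: DERIV_imp_deriv)
    thus ?thesis using c by (simp add: add_divide_distrib diff_divide_distrib)
  qed
  have d2: "DD (DD WW) t z = 6 / (c * z) ^ 4 + deriv (deriv V) z / c^2" if "z \<in> ball 0 \<delta> - {0}" for z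
  proof -
    have "((\<lambda>z. - 2 / (c * z)^3 + deriv V z / c) has_field_derivative 6 * c / (c * z) ^ 4 + deriv (deriv V) z / c) (at z)"
    proof (rule DERIV_add)
      show "((\<lambda>z. deriv V z / c) has_field_derivative deriv (deriv V) z / c) (at z)"
        by (rule DERIV_cdivide) (use Vd(1) that in \<open>auto intro!: holomorphic_derivI[of _ "ball 0 \<delta>"]\<close>)
      show "((\<lambda>z. - 2 / (c * z)^3) has_field_derivative 6 * c / (c * z) ^ 4) (at z)"
        using that c by (auto intro!: derivative_eq_intros simp: field_simps power2_eq_square power3_eq_cube power4_eq_xxxx)
    qed
    hence "(DD WW t has_field_derivative 6 * c / (c * z) ^ 4 + deriv (deriv V) z / c) (at z)"
      by (rule has_field_derivative_transform_within_open[OF _ op that]) (use d1 in auto)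
    hence "DD (DD WW) t z = (6 * c / (c * z) ^ 4 + deriv (deriv V) z / c) / c"
      unfolding DD_def[of "DD WW"] c_def by (simp add: DERIV_imp_deriv)
    thus ?thesis using c by (simp add: add_divide_distrib power2_eq_square)
  qed
  have ev: "\<forall>\<^sub>F z in at 0. z \<in> ball 0 \<delta> - {0}" using \<delta> by (intro eventually_at_in_open) auto
  have tr: "(g \<longlongrightarrow> l) (at 0)" if "(f \<longlongrightarrow> l') (at 0)" "l' = l" "\<And>z. z \<in> ball 0 \<delta> - {0} \<Longrightarrow> f z = g z" for f g :: "complex \<Rightarrow> complex" and l l'
    using Lim_transform_eventually[OF that(1) eventually_mono[OF ev that(3)]] that(2) by simp
  have "((\<lambda>z. 1 + (c * z)^2 * V z) \<longlongrightarrow> 1 + (c * 0)^2 * V 0) (at 0)" by (intro tendsto_intros lim[OF V(1)])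
  thus "((\<lambda>z. (tpi * z) ^ 2 * WW t z) \<longlongrightarrow> 1) (at 0)"
    unfolding c_def[symmetric] by (rule tr) (use V(2)[folded c_def] c in \<open>auto simp: field_simps\<close>)
  have "((\<lambda>z. - 2 + (c * z)^3 * (deriv V z / c)) \<longlongrightarrow> - 2 + (c * 0)^3 * (deriv V 0 / c)) (at 0)" by (intro tendsto_intros lim[OF Vd(1)] c)
  thus "((\<lambda>z. (tpi * z) ^ 3 * DD WW t z) \<longlongrightarrow> - 2) (at 0)"
    unfolding c_def[symmetric] by (rule tr) (use d1 c in \<open>auto simp: field_simps\<close>)
  have "((\<lambda>z. 6 + (c * z)^4 * (deriv (deriv V) z / c^2)) \<longlongrightarrow> 6 + (c * 0)^4 * (deriv (deriv V) 0 / c^2)) (at 0)"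
    by (intro tendsto_intros lim[OF Vd(2)]) (use c in simp)
  thus "((\<lambda>z. (tpi * z) ^ 4 * DD (DD WW) t z) \<longlongrightarrow> 6) (at 0)"
    unfolding c_def[symmetric] by (rule tr) (use d2 c in \<open>auto simp: field_simps\<close>)
qed

lemma EE_WW: "EE 2 12 (\<lambda>t z. 12 * WW t z)"
  unfolding EE_def
proof (intro conjI ballI)
  show "ell 2 (\<lambda>t z. 12 * WW t z)" by (rule ell_cmult[OF ell_WW])
  show "intexp (\<lambda>t z. 12 * WW t z)" by (rule intexp_12WW)
  fix t assume "t \<in> uhp"
  from tendsto_mult[OF tendsto_const[of 12] DD_WW_limits(1)[OF this]]
  show "((\<lambda>z. (tpi * z) ^ 2 * (12 * WW t z)) \<longlongrightarrow> of_int 12) (at 0)" by (simp add: mult_ac)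
qed

lemma intexp_DWW: "intexp (DD WW)" "intexp (DD (DD WW))"
  by (rule intexp_cong[OF intexp_DD[OF intexp_LL]], simp add: DD_WW uhp_strip strip_not_lat)
     (rule intexp_cong[OF intexp_DD[OF intexp_DD[OF intexp_LL]]], simp add: DD_WW uhp_strip strip_not_lat)

lemma EE_DWW: "EE 3 (- 2) (DD WW)"
  unfolding EE_def using ell_DD[OF ell_WW] intexp_DWW(1) DD_WW_limits(2) by (simp add: numeral_3_eq_3 numeral_2_eq_2)

lemma EE_DDWW: "EE 4 6 (DD (DD WW))"
  unfolding EE_def using ell_DD[OF ell_DD[OF ell_WW]] intexp_DWW(2) DD_WW_limits(3) by (simp add: eval_nat_numeral)

text \<open>This is \<open>K(3z) / K(z)\<^sup>9\<close> for \<open>K = \<theta>\<^sub>1 / \<eta>\<^sup>3\<close>. It is integral because \<open>d\<^sup>2 \<equiv> d\<^sup>3\<close> modulo 2.\<close>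

lemma EE_8: "EE 8 3 (\<lambda>t z. (12 * WW t z * (DD WW t z * DD WW t z) - DD (DD WW) t z * DD (DD WW) t z) / 4)" (is "EE 8 3 ?s")
  unfolding EE_def
proof (intro conjI ballI)
  have 1: "EE (2 + (3 + 3)) (12 * ((- 2) * (- 2))) (\<lambda>t z. (12 * WW t z) * (DD WW t z * DD WW t z))"
    by (intro EE_mult EE_WW EE_DWW)
  have 2: "EE (4 + 4) (6 * 6) (\<lambda>t z. DD (DD WW) t z * DD (DD WW) t z)" by (intro EE_mult EE_DDWW)
  have 3: "EE 8 (1 * 48 + (- 1) * 36) (\<lambda>t z. of_int 1 * ((12 * WW t z) * (DD WW t z * DD WW t z)) + of_int (- 1) * (DD (DD WW) t z * DD (DD WW) t z))"
    by (rule EE_comb) (use 1 2 in auto)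
  have eq: "?s = (\<lambda>t z. (1/4) * (of_int 1 * ((12 * WW t z) * (DD WW t z * DD WW t z)) + of_int (- 1) * (DD (DD WW) t z * DD (DD WW) t z)))"
    by (simp add: fun_eq_iff)
  from 3 show "ell 8 ?s" unfolding eq EE_def by (intro ell_cmult) auto
  {
    fix t assume "t \<in> uhp"
    with 3 have "((\<lambda>z. (tpi * z) ^ 8 * (of_int 1 * ((12 * WW t z) * (DD WW t z * DD WW t z)) + of_int (- 1) * (DD (DD WW) t z * DD (DD WW) t z))) \<longlongrightarrow> of_int (1 * 48 + (- 1) * 36)) (at 0)"
      unfolding EE_def by blast
    from tendsto_mult[OF tendsto_const[of "1/4"] this]
    show "((\<lambda>z. (tpi * z) ^ 8 * ?s t z) \<longlongrightarrow> of_int 3) (at 0)"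
      by (rule Lim_transform_eventually[THEN tendsto_eq_rhs]) (auto simp: mult_ac)
  }
  let ?U = "DD LL" and ?H = "\<lambda>t z. (DD LL t z - DD (DD LL) t z) / 2"
  have "intexp (\<lambda>t z. of_int 3 * (LL t z - of_int 2 * sig t) * (?U t z * ?U t z) + ?U t z * ?H t z - ?H t z * ?H t z)"
    by (intro intexp_add intexp_diff intexp_mult intexp_cmult intexp_LL intexp_sig intexp_DD intexp_half intexp_const)
  thus "intexp ?s"
  proof (rule intexp_cong)
    fix t z :: complex assume z: "0 < Im z" "Im z < Im t"
    \<comment> \<open>With u = \<open>DD LL\<close> and h integral, the second derivative is u - 2h
      and 12 \<open>WW\<close> is 12 times an integral series plus 1. The two copies of u^2 cancel
      and every remaining term is divisible by 4.\<close>
    have H: "DD (DD WW) t z = ?U t z - 2 * ?H t z" using DD_WW(2)[OF uhp_strip[OF z] strip_not_lat[OF z]] by (simp add: field_simps)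
    have U: "DD WW t z = ?U t z" by (rule DD_WW(1)[OF uhp_strip[OF z] strip_not_lat[OF z]])
    define u where "u = ?U t z"
    define h where "h = ?H t z"
    have "?s t z = ((12 * (LL t z - 2 * sig t) + 1) * (u * u) - (u - 2 * h) * (u - 2 * h)) / 4"
      unfolding H U WW_eq u_def h_def ..
    also have "\<dots> = 3 * (LL t z - 2 * sig t) * (u * u) + u * h - h * h" by (simp add: field_simps)
    finally show "of_int 3 * (LL t z - of_int 2 * sig t) * (?U t z * ?U t z) + ?U t z * ?H t z - ?H t z * ?H t z = ?s t z"
      unfolding u_def h_def by simp
  qed
qed

text \<open>Splitting off weight 6 factors with coefficient 4 leaves a remainder in {0, 2, 4}, and
  splitting off weight 8 factors with coefficient 3 leaves one in {0, 2, 4, 6}; in each of these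
  small weights 12 itself occurs. Bezout for the coprime powers of 4 and 3 then combines the
  two.\<close>

lemma IE_12: assumes "even M" shows "IE M 12"
proof -
  have p: "IE 2 12" and d: "IE 3 (- 2)" and s: "IE 4 6" and t: "IE 8 3"
    using EE_WW EE_DWW EE_DDWW EE_8 by (auto simp: IE_def)
  have dd: "IE 6 4" using IE_mult[OF d d] by simp
  have r0: "IE 0 12" using IE_cmult[OF IE_0, of 12] by simp
  have r4: "IE 4 12" using IE_cmult[OF s, of 2] by simp
  have r6: "IE 6 12" using IE_cmult[OF dd, of 3] by simp
  have A: "IE M (12 * 4 ^ (M div 6))"
  proof -
    have "IE (M mod 6) 12"
    proof -
      have "M mod 6 \<in> {0, 2, 4}" using assms by simp presburger
      thus ?thesis using p r0 r4 by auto
    qed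
    from IE_mult[OF this IE_power[OF dd, of "M div 6"]] show ?thesis by simp
  qed
  have B: "IE M (12 * 3 ^ (M div 8))"
  proof -
    have "IE (M mod 8) 12"
    proof -
      have "M mod 8 \<in> {0, 2, 4, 6}" using assms by simp presburger
      thus ?thesis using p r0 r4 r6 by auto
    qed
    from IE_mult[OF this IE_power[OF t, of "M div 8"]] show ?thesis by simp
  qed
  have "coprime (4 ^ (M div 6)) (3 ^ (M div 8) :: int)"
  proof -
    have "coprime (4::int) 3"
    proof (rule coprimeI)
      fix c :: int assume "c dvd 4" "c dvd 3"
      hence "c dvd 4 - 3" by (rule dvd_diff)
      thus "is_unit c" by simp
    qed
    thus ?thesis by simp
  qed
  then obtain u v :: int where "u * 4 ^ (M div 6) + v * 3 ^ (M div 8) = 1"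
    using bezout_int[of "4 ^ (M div 6)" "3 ^ (M div 8)"] by (auto simp: coprime_iff_gcd_eq_1)
  hence "u * (12 * 4 ^ (M div 6)) + v * (12 * 3 ^ (M div 8)) = 12" by (simp add: algebra_simps)
  with IE_comb[OF A B, of u v] show ?thesis by simp
qed

section \<open>The product \<open>K\<^sup>2\<close>\<close>

text \<open>Multiplying out the product indexes terms by finite sets of chosen factors. Partial
  products of 1 + |x n| are bounded by the exponential of the sum, giving absolute convergence;
  along the sets \<open>Pow {..<k}\<close> the sum is the k-th partial product.\<close>

lemma has_sum_prod_finite_subsets:
  fixes x :: "nat \<Rightarrow> complex"
  assumes "summable (\<lambda>n. norm (x n))"
  shows "((\<lambda>S. \<Prod>n\<in>S. x n) has_sum (\<Prod>n. 1 + x n)) (Collect finite)"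
proof -
  have conv: "convergent_prod (\<lambda>n. 1 + x n)"
    by (rule abs_convergent_prod_imp_convergent_prod, rule summable_imp_abs_convergent_prod) (use assms in simp)
  have fin: "(\<Sum>S\<in>Pow {..<k}. \<Prod>n\<in>S. y n) = (\<Prod>n<k. 1 + y n)" for k and y :: "nat \<Rightarrow> 'b::comm_ring_1"
    using prod_add[of "{..<k}" y "\<lambda>_. 1"] by (simp add: add.commute)
  have "(\<lambda>S. norm (\<Prod>n\<in>S. x n)) summable_on (Collect finite)"
  proof (rule nonneg_bdd_above_summable_on)
    show "bdd_above (sum (\<lambda>S. norm (\<Prod>n\<in>S. x n)) ` {F. F \<subseteq> Collect finite \<and> finite F})"
    proof (rule bdd_aboveI2)
      fix F :: "nat set set" assume F: "F \<in> {F. F \<subseteq> Collect finite \<and> finite F}"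
      hence "finite (\<Union>F)" by auto
      then obtain k where k: "\<Union>F \<subseteq> {..<k}" using finite_nat_iff_bounded by auto
      have "sum (\<lambda>S. norm (\<Prod>n\<in>S. x n)) F \<le> sum (\<lambda>S. norm (\<Prod>n\<in>S. x n)) (Pow {..<k})"
        using F k by (intro sum_mono2) auto
      also have "\<dots> = (\<Sum>S\<in>Pow {..<k}. \<Prod>n\<in>S. norm (x n))" by (simp add: prod_norm)
      also have "\<dots> = (\<Prod>n<k. 1 + norm (x n))" by (rule fin)
      also have "\<dots> \<le> exp (\<Sum>n<k. norm (x n))" by (rule prod_le_exp_sum) auto
      also have "\<dots> \<le> exp (\<Sum>n. norm (x n))" using sum_le_suminf[OF assms, of "{..<k}"] by simp
      finally show "sum (\<lambda>S. norm (\<Prod>n\<in>S. x n)) F \<le> exp (\<Sum>n. norm (x n))" .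
    qed
  qed auto
  hence "(\<lambda>S. \<Prod>n\<in>S. x n) summable_on (Collect finite)" by (simp add: summable_on_iff_abs_summable_on_complex)
  then obtain s where s: "((\<lambda>S. \<Prod>n\<in>S. x n) has_sum s) (Collect finite)" by (auto simp: summable_on_def)
  have "filterlim (\<lambda>k. Pow {..<k}) (finite_subsets_at_top (Collect finite)) sequentially"
    unfolding filterlim_finite_subsets_at_top
  proof (intro allI impI)
    fix X :: "nat set set" assume X: "finite X \<and> X \<subseteq> Collect finite"
    hence "finite (\<Union>X)" by auto
    then obtain k where k: "\<Union>X \<subseteq> {..<k}" using finite_nat_iff_bounded by auto
    have "\<forall>k'\<ge>k. finite (Pow {..<k'}) \<and> X \<subseteq> Pow {..<k'} \<and> Pow {..<k'} \<subseteq> Collect finite"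
      using k by (auto intro: finite_subset[OF _ finite_lessThan])
    thus "\<forall>\<^sub>F k in sequentially. finite (Pow {..<k}) \<and> X \<subseteq> Pow {..<k} \<and> Pow {..<k} \<subseteq> Collect finite"
      unfolding eventually_sequentially by blast
  qed
  from filterlim_compose[OF s[unfolded has_sum_def] this]
  have "(\<lambda>k. \<Prod>n<k. 1 + x n) \<longlonglongrightarrow> s" by (simp add: fin)
  hence "(\<lambda>k. \<Prod>n<Suc k. 1 + x n) \<longlonglongrightarrow> s" by (rule LIMSEQ_Suc)
  moreover have "(\<lambda>k. \<Prod>n<Suc k. 1 + x n) \<longlonglongrightarrow> (\<Prod>n. 1 + x n)"
    using convergent_prod_LIMSEQ[OF conv] by (simp add: lessThan_Suc_atMost)
  ultimately have "s = (\<Prod>n. 1 + x n)" by (rule LIMSEQ_unique)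
  with s show ?thesis by simp
qed

lemma intexp_prod:
  fixes e :: "nat \<Rightarrow> nat \<times> nat"
  assumes "\<And>n. fst (e n) + snd (e n) \<ge> Suc n"
  shows "intexp (\<lambda>t z. \<Prod>n. 1 - ee z ^ fst (e n) * ee (t - z) ^ snd (e n))"
proof (rule intexpI[of "Collect finite" "\<lambda>S. (\<Sum>n\<in>S. fst (e n), \<Sum>n\<in>S. snd (e n))" "\<lambda>S. (- 1) ^ card S"])
  fix p :: "nat \<times> nat"
  have "S \<subseteq> {..fst p + snd p}" if "finite S" "(\<Sum>n\<in>S. fst (e n), \<Sum>n\<in>S. snd (e n)) = p" for S
  proof
    fix n assume n: "n \<in> S"
    have "n \<le> fst (e n) + snd (e n)" using assms[of n] by simp
    also have "\<dots> \<le> (\<Sum>n\<in>S. fst (e n)) + (\<Sum>n\<in>S. snd (e n))"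
      using n that(1) by (intro add_mono member_le_sum) auto
    finally show "n \<in> {..fst p + snd p}" using that(2) by auto
  qed
  hence "{S \<in> Collect finite. (\<Sum>n\<in>S. fst (e n), \<Sum>n\<in>S. snd (e n)) = p} \<subseteq> Pow {..fst p + snd p}" by auto
  thus "finite {S \<in> Collect finite. (\<Sum>n\<in>S. fst (e n), \<Sum>n\<in>S. snd (e n)) = p}" by (rule finite_subset) auto
next
  fix t z :: complex assume z: "0 < Im z" "Im z < Im t"
  define \<rho> where "\<rho> = max (norm (ee z)) (norm (ee (t - z)))"
  have \<rho>: "0 \<le> \<rho>" "\<rho> < 1" using z by (auto simp: \<rho>_def norm_ee le_max_iff_disj)
  have le: "norm (ee z ^ fst (e n) * ee (t - z) ^ snd (e n)) \<le> \<rho> * \<rho> ^ n" for n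
  proof -
    have "norm (ee z ^ fst (e n) * ee (t - z) ^ snd (e n)) \<le> \<rho> ^ fst (e n) * \<rho> ^ snd (e n)"
      unfolding norm_mult norm_power using \<rho>(1) by (intro mult_mono power_mono) (auto simp: \<rho>_def)
    also have "\<dots> = \<rho> ^ (fst (e n) + snd (e n))" by (simp add: power_add)
    also have "\<dots> \<le> \<rho> ^ Suc n" using \<rho> assms by (intro power_decreasing) auto
    finally show ?thesis by simp
  qed
  have "summable (\<lambda>n. norm (- (ee z ^ fst (e n) * ee (t - z) ^ snd (e n))))"
    by (rule summable_comparison_test[OF _ summable_mult[OF summable_geometric, of \<rho> \<rho>]]) (use le \<rho> in auto)
  from has_sum_prod_finite_subsets[OF this]
  have *: "((\<lambda>S. \<Prod>n\<in>S. - (ee z ^ fst (e n) * ee (t - z) ^ snd (e n))) has_sum (\<Prod>n. 1 - ee z ^ fst (e n) * ee (t - z) ^ snd (e n))) (Collect finite)"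
    by simp
  have "(\<Prod>n\<in>S. - (ee z ^ fst (e n) * ee (t - z) ^ snd (e n))) = of_int ((- 1) ^ card S) * (ee z ^ (\<Sum>n\<in>S. fst (e n)) * ee (t - z) ^ (\<Sum>n\<in>S. snd (e n)))" for S
    by (simp add: prod_uminus prod.distrib power_sum)
  thus "((\<lambda>x. of_int ((- 1) ^ card x) * (ee z ^ fst (\<Sum>n\<in>x. fst (e n), \<Sum>n\<in>x. snd (e n)) * ee (t - z) ^ snd (\<Sum>n\<in>x. fst (e n), \<Sum>n\<in>x. snd (e n)))) has_sum
       (\<Prod>n. 1 - ee z ^ fst (e n) * ee (t - z) ^ snd (e n))) (Collect finite)" using * by simp
qed

text \<open>The infinite q-Pochhammer symbol with argument ee z and base ee t.\<close>

definition Pr :: "complex \<Rightarrow> complex \<Rightarrow> complex" where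
  "Pr t z = (\<Prod>n. 1 - ee (z + of_nat n * t))"

lemma norm_ee_shift: "norm (ee (z + of_nat n * t)) = norm (ee z) * norm (ee t) ^ n"
  by (simp add: ee_add norm_mult ee_power[symmetric] norm_power)

lemma norm_ee_uhp: "t \<in> uhp \<Longrightarrow> norm (ee t) < 1" by (simp add: norm_ee uhp_def)

lemma Pr_convergent: assumes "t \<in> uhp" shows "convergent_prod (\<lambda>n. 1 - ee (z + of_nat n * t))"
proof (rule abs_convergent_prod_imp_convergent_prod, rule summable_imp_abs_convergent_prod)
  show "summable (\<lambda>n. norm (1 - ee (z + of_nat n * t) - 1))"
    using norm_ee_uhp[OF assms] by (simp add: norm_ee_shift summable_geometric summable_mult)
qed

lemma Pr_holomorphic: assumes t: "t \<in> uhp" shows "Pr t holomorphic_on UNIV"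
proof (rule holomorphic_uniform_sequence[OF open_UNIV, where f="\<lambda>N z. \<Prod>n<N. 1 - ee (z + of_nat n * t)"])
  show "(\<lambda>z. \<Prod>n<N. 1 - ee (z + of_nat n * t)) holomorphic_on UNIV" for N
    unfolding ee_def by (intro holomorphic_intros)
  fix z :: complex
  have "uniformly_convergent_on (cball z 1) (\<lambda>N w. \<Prod>n<N. 1 - ee (w + of_nat n * t))"
  proof (rule uniformly_convergent_on_prod')
    show "continuous_on (cball z 1) (\<lambda>w. 1 - ee (w + of_nat n * t))" for n
      unfolding ee_def by (intro continuous_intros)
    define C where "C = exp (2 * pi * (1 - Im z))"
    have "norm (norm (1 - ee (w + of_nat n * t) - 1)) \<le> C * norm (ee t) ^ n" if "w \<in> cball z 1" for n w
    proof -
      have "\<bar>Im (z - w)\<bar> \<le> 1" using that abs_Im_le_cmod[of "z - w"] by (auto simp: dist_norm)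
      hence "2 * pi * (Im z - 1) \<le> 2 * pi * Im w" by (intro mult_left_mono) auto
      hence "norm (ee w) \<le> C" by (simp add: C_def norm_ee algebra_simps)
      thus ?thesis by (simp add: norm_ee_shift mult_right_mono)
    qed
    thus "uniformly_convergent_on (cball z 1) (\<lambda>N x. \<Sum>n<N. norm (1 - ee (x + of_nat n * t) - 1))"
      by (rule Weierstrass_m_test') (use norm_ee_uhp[OF t] in \<open>auto intro!: summable_mult summable_geometric\<close>)
  qed auto
  hence ul: "uniform_limit (cball z 1) (\<lambda>N w. \<Prod>n<N. 1 - ee (w + of_nat n * t)) (\<lambda>w. lim (\<lambda>N. \<Prod>n<N. 1 - ee (w + of_nat n * t))) sequentially"
    by (simp add: uniformly_convergent_uniform_limit_iff)
  have "lim (\<lambda>N. \<Prod>n<N. 1 - ee (w + of_nat n * t)) = Pr t w" for w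
  proof (rule limI)
    have "(\<lambda>N. \<Prod>n<Suc N. 1 - ee (w + of_nat n * t)) \<longlonglongrightarrow> Pr t w"
      using convergent_prod_LIMSEQ[OF Pr_convergent[OF t]] by (simp add: lessThan_Suc_atMost Pr_def)
    thus "(\<lambda>N. \<Prod>n<N. 1 - ee (w + of_nat n * t)) \<longlonglongrightarrow> Pr t w" by (rule LIMSEQ_imp_Suc)
  qed
  with ul show "\<exists>d>0. cball z d \<subseteq> UNIV \<and> uniform_limit (cball z d) (\<lambda>N w. \<Prod>n<N. 1 - ee (w + of_nat n * t)) (Pr t) sequentially"
    by (intro exI[of _ 1]) simp
qed

lemma Pr_shift: assumes t: "t \<in> uhp" shows "Pr t z = (1 - ee z) * Pr t (z + t)"
proof -
  have "(\<lambda>N. \<Prod>n<Suc (Suc N). 1 - ee (z + of_nat n * t)) \<longlonglongrightarrow> Pr t z"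
    using LIMSEQ_Suc[OF convergent_prod_LIMSEQ[OF Pr_convergent[OF t]]] by (simp add: lessThan_Suc_atMost Pr_def)
  moreover have "(\<Prod>n<Suc (Suc N). 1 - ee (z + of_nat n * t)) = (1 - ee z) * (\<Prod>n<Suc N. 1 - ee (z + t + of_nat n * t))" for N
    by (subst prod.lessThan_Suc_shift) (simp add: algebra_simps)
  moreover have "(\<lambda>N. (1 - ee z) * (\<Prod>n<Suc N. 1 - ee (z + t + of_nat n * t))) \<longlonglongrightarrow> (1 - ee z) * Pr t (z + t)"
    using convergent_prod_LIMSEQ[OF Pr_convergent[OF t], of "z + t"]
    by (intro tendsto_intros) (simp add: lessThan_Suc_atMost Pr_def)
  ultimately show ?thesis using LIMSEQ_unique by simp
qed

lemma Pr_eq_0_iff: assumes t: "t \<in> uhp" shows "Pr t z = 0 \<longleftrightarrow> (\<exists>n. ee (z + of_nat n * t) = 1)"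
proof -
  have "(\<lambda>n. 1 - ee (z + of_nat n * t)) has_prod Pr t z"
    using Pr_convergent[OF t] unfolding Pr_def by (rule convergent_prod_has_prod)
  from has_prod_eq_0_iff[OF this] show ?thesis by (auto simp: image_iff)
qed

lemma Pr_add_1: "Pr t (z + 1) = Pr t z"
proof -
  have "ee (z + 1 + w) = ee (z + w)" for w using ee_add[of "z + w" 1] by (simp add: add_ac)
  thus ?thesis by (simp add: Pr_def)
qed

lemma Pr_T: "Pr (t + 1) z = Pr t z"
  unfolding Pr_def using ee_T[of z "int n" t for n] by simp

lemma Pr_tau_nonzero: assumes t: "t \<in> uhp" shows "Pr t t \<noteq> 0"
proof
  assume "Pr t t = 0"
  then obtain n where "ee (t + of_nat n * t) = 1" using Pr_eq_0_iff[OF t] by blast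
  hence "norm (ee (t + of_nat n * t)) = 1" by simp
  hence "- 2 * pi * Im (t + of_nat n * t) = 0" unfolding norm_ee by simp
  thus False using t by (simp add: uhp_def) (metis add_pos_nonneg less_irrefl mult_nonneg_nonneg of_nat_0_le_iff less_imp_le)
qed

text \<open>By the Jacobi triple product this is the square of theta_1 / eta^3 up to sign. The
  product form makes both translation laws and the zeros elementary.\<close>

definition Q :: "complex \<Rightarrow> complex \<Rightarrow> complex" where
  "Q t z = inverse (ee z) * (Pr t z)^2 * (Pr t (t - z))^2 / Pr t t ^ 4"

lemma Q_holomorphic: assumes t: "t \<in> uhp" shows "Q t holomorphic_on UNIV"
proof -
  have "(Pr t \<circ> (\<lambda>z. t - z)) holomorphic_on UNIV"
    by (rule holomorphic_on_compose_gen[OF _ Pr_holomorphic[OF t]]) (auto intro!: holomorphic_intros)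
  thus ?thesis unfolding Q_def[abs_def] using Pr_tau_nonzero[OF t] Pr_holomorphic[OF t]
    by (intro holomorphic_intros) (auto simp: o_def ee_def[abs_def] intro!: holomorphic_intros)
qed

lemma Q_add_1: "Q t (z + 1) = Q t z"
  using Pr_add_1[of t "t - z - 1"] Pr_add_1[of t z] by (simp add: Q_def ee_add algebra_simps)

lemma Q_add_tau: assumes t: "t \<in> uhp" shows "Q t (z + t) = ee (- t - 2 * z) * Q t z"
proof -
  have 1: "(Pr t (t - (z + t)))^2 = (1 - inverse (ee z))^2 * (Pr t (t - z))^2"
    using Pr_shift[OF t, of "- z"] by (simp add: ee_minus power_mult_distrib add.commute)
  have 2: "(Pr t z)^2 = (1 - ee z)^2 * (Pr t (z + t))^2" using Pr_shift[OF t, of z] by (simp add: power_mult_distrib)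
  have 3: "(1 - inverse (ee z))^2 = inverse (ee z) ^ 2 * (1 - ee z)^2" by (simp add: field_simps power2_eq_square)
  have 4: "ee (- t - 2 * z) = inverse (ee t) * inverse (ee z) ^ 2"
    by (simp add: power2_eq_square flip: ee_minus ee_add)
  show ?thesis unfolding Q_def 1 2 3 4 ee_add by (simp add: mult_ac)
qed

lemma Q_eq: assumes t: "t \<in> uhp"
  shows "Q t z = inverse (ee z) * (1 - ee z)^2 * ((Pr t (z + t))^2 * (Pr t (t - z))^2) / Pr t t ^ 4"
  unfolding Q_def using Pr_shift[OF t, of z] by (simp add: power_mult_distrib mult_ac)

lemma Q_minus: assumes t: "t \<in> uhp" shows "Q t (- z) = Q t z"
proof -
  have "inverse (ee (- z)) * (1 - ee (- z))^2 = inverse (ee z) * (1 - ee z)^2"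
    by (simp add: ee_minus field_simps power2_eq_square)
  thus ?thesis unfolding Q_eq[OF t] by (simp add: mult_ac add.commute)
qed

lemma Q_T: "Q (t + 1) z = Q t z"
proof -
  have "t + 1 - z = (t - z) + 1" by simp
  thus ?thesis by (simp only: Q_def Pr_T Pr_add_1)
qed

lemma Q_nonzero: assumes t: "t \<in> uhp" "z \<notin> lat t" shows "Q t z \<noteq> 0"
proof -
  have "Pr t z \<noteq> 0" using Pr_eq_0_iff[OF t(1)] not_lat[OF t(2), of "int n" for n] by auto
  moreover have "Pr t (t - z) \<noteq> 0"
  proof
    assume "Pr t (t - z) = 0"
    then obtain n where n: "ee (t - z + of_nat n * t) = 1" using Pr_eq_0_iff[OF t(1)] by blast
    have "ee (z + of_int (- int (Suc n)) * t) = inverse (ee (t - z + of_nat n * t))"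
      unfolding ee_minus[symmetric] by (rule arg_cong[of _ _ ee]) (simp add: algebra_simps)
    with n not_lat[OF t(2), of "- int (Suc n)"] show False by (simp only: inverse_1)
  qed
  ultimately show ?thesis using Pr_tau_nonzero[OF t(1)] by (simp add: Q_def)
qed

lemma Q_limit: assumes t: "t \<in> uhp" shows "((\<lambda>z. Q t z / (tpi * z)^2) \<longlongrightarrow> 1) (at 0)"
proof -
  have cP: "isCont (Pr t) z" for z
    using holomorphic_on_imp_continuous_on[OF Pr_holomorphic[OF t]] by (simp add: continuous_on_eq_continuous_at)
  have "((\<lambda>z. (exp z - 1) / z) \<longlongrightarrow> 1) (at (0::complex))" using lim_exp_minus_1 .
  moreover have "filterlim (\<lambda>z. tpi * z) (at 0) (at 0)"
    by (intro filterlim_atI) (auto intro!: tendsto_eq_intros simp: eventually_at_filter)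
  ultimately have e: "((\<lambda>z. (ee z - 1) / (tpi * z)) \<longlongrightarrow> 1) (at 0)"
    unfolding ee_def by (rule filterlim_compose)
  have P1: "((\<lambda>z. Pr t (z + t)) \<longlongrightarrow> Pr t (0 + t)) (at 0)" by (rule isCont_tendsto_compose[OF cP]) (auto intro!: tendsto_eq_intros)
  have P2: "((\<lambda>z. Pr t (t - z)) \<longlongrightarrow> Pr t (t - 0)) (at 0)" by (rule isCont_tendsto_compose[OF cP]) (auto intro!: tendsto_eq_intros)
  have i: "((\<lambda>z. inverse (ee z)) \<longlongrightarrow> inverse (ee 0)) (at 0)" unfolding ee_def by (auto intro!: tendsto_eq_intros)
  have "((\<lambda>z. inverse (ee z) * ((ee z - 1) / (tpi * z))^2 * ((Pr t (z + t))^2 * (Pr t (t - z))^2) / Pr t t ^ 4) \<longlongrightarrow>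
     inverse (ee 0) * 1^2 * ((Pr t (0 + t))^2 * (Pr t (t - 0))^2) / Pr t t ^ 4) (at 0)"
    using Pr_tau_nonzero[OF t] by (intro tendsto_intros e P1 P2 i) auto
  moreover have "inverse (ee 0) * 1^2 * ((Pr t (0 + t))^2 * (Pr t (t - 0))^2) / Pr t t ^ 4 = 1"
    using Pr_tau_nonzero[OF t] by (simp add: power2_eq_square power4_eq_xxxx)
  moreover have "inverse (ee z) * ((ee z - 1) / (tpi * z))^2 * ((Pr t (z + t))^2 * (Pr t (t - z))^2) / Pr t t ^ 4
     = Q t z / (tpi * z)^2" for z
    unfolding Q_eq[OF t] power_divide power2_commute[of "ee z" 1] by simp
  ultimately show ?thesis by simp
qed

text \<open>After a Gaussian correction the quotient of the two sides has equal multipliers and no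
  zeros or poles, hence is constant. The normalisation \<open>Q_limit\<close> evaluates the
  constant, so no transformation formula for eta or theta is involved.\<close>

lemma Q_S:
  assumes t: "t \<in> uhp" and z: "z \<notin> lat t"
  shows "Q (- 1 / t) (z / t) = ee (z^2 / t) / t^2 * Q t z"
proof -
  have nz: "t \<noteq> 0" using uhp_nonzero[OF t] .
  have t': "- 1 / t \<in> uhp" by (rule minus_inverse_in_uhp[OF t])
  define f where "f = (\<lambda>z. Q (- 1 / t) (z / t) * ee (- (z^2 / t)) / Q t z)"
  have "f z = 1 / t^2"
  proof (rule elliptic_Liouville[OF t _ _ _ _ z])
    have "(Q (- 1 / t) \<circ> (\<lambda>z. z / t)) holomorphic_on (- lat t)"
      by (rule holomorphic_on_compose_gen[OF _ Q_holomorphic[OF t']]) (use nz in \<open>auto intro!: holomorphic_intros\<close>)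
    moreover have "Q t holomorphic_on (- lat t)" by (rule holomorphic_on_subset[OF Q_holomorphic[OF t]]) auto
    ultimately show "f holomorphic_on (- lat t)" unfolding f_def ee_def
      using Q_nonzero[OF t] nz by (intro holomorphic_intros) (auto simp: o_def)
    fix z assume z: "z \<notin> lat t"
    show "f (z + 1) = f z"
    proof -
      define w where "w = (z + 1) / t"
      have "z / t = w + (- 1 / t)" by (simp add: w_def add_divide_distrib)
      hence "Q (- 1 / t) (z / t) = ee (- (- 1 / t) - 2 * w) * Q (- 1 / t) w"
        using Q_add_tau[OF t', of w] by simp
      moreover have "ee (- (z^2 / t)) * ee (- (- 1 / t) - 2 * w) = ee (- ((z + 1)^2 / t))"
        unfolding ee_add[symmetric] w_def by (rule arg_cong[of _ _ ee]) (use nz in \<open>simp add: field_simps power2_eq_square\<close>)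
      ultimately have "Q (- 1 / t) (z / t) * ee (- (z^2 / t)) = Q (- 1 / t) w * ee (- ((z + 1)^2 / t))" by (simp add: mult_ac)
      thus ?thesis by (simp add: f_def Q_add_1 w_def)
    qed
    show "f (z + t) = f z"
    proof -
      have "(z + t) / t = z / t + 1" using nz by (simp add: add_divide_distrib)
      moreover have "ee (- ((z + t)^2 / t)) = ee (- (z^2 / t)) * ee (- t - 2 * z)"
        unfolding ee_add[symmetric] by (rule arg_cong[of _ _ ee]) (use nz in \<open>simp add: field_simps power2_eq_square\<close>)
      ultimately show ?thesis unfolding f_def Q_add_tau[OF t] by (simp add: Q_add_1)
    qed
  next
    have "filterlim (\<lambda>z. z / t) (at 0) (at 0)"
      using nz by (intro filterlim_atI) (auto intro!: tendsto_eq_intros simp: eventually_at_filter)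
    from filterlim_compose[OF Q_limit[OF t'] this]
    have "((\<lambda>z. Q (- 1 / t) (z / t) / (tpi * (z / t))^2) \<longlongrightarrow> 1) (at 0)" .
    moreover have "((\<lambda>z. ee (- (z^2 / t))) \<longlongrightarrow> 1) (at 0)" unfolding ee_def using nz by (auto intro!: tendsto_eq_intros)
    ultimately have "((\<lambda>z. (Q (- 1 / t) (z / t) / (tpi * (z / t))^2) * ee (- (z^2 / t)) / (Q t z / (tpi * z)^2) / t^2) \<longlongrightarrow> 1 * 1 / 1 / t^2) (at 0)"
      using nz by (intro tendsto_intros Q_limit[OF t]) auto
    moreover have "\<forall>\<^sub>F z in at 0. (Q (- 1 / t) (z / t) / (tpi * (z / t))^2) * ee (- (z^2 / t)) / (Q t z / (tpi * z)^2) / t^2 = f z"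
    proof -
      have "\<forall>\<^sub>F z::complex in at 0. z \<noteq> 0" by (simp add: eventually_at_filter)
      thus ?thesis by eventually_elim (use nz in \<open>simp add: f_def power_divide power_mult_distrib\<close>)
    qed
    ultimately show "(f \<longlongrightarrow> 1 / t^2) (at 0)" using Lim_transform_eventually by fastforce
  qed
  thus ?thesis using Q_nonzero[OF t z] nz by (simp add: f_def ee_minus field_simps)
qed

subsection \<open>Integrality of the product\<close>

lemma fps_inverse_Ints:
  fixes F :: "complex fps"
  assumes "\<And>n. fps_nth F n \<in> \<int>" "fps_nth F 0 = 1"
  shows "fps_nth (inverse F) n \<in> \<int>"
proof (induction n rule: less_induct)
  case (less n)
  show ?case
  proof (cases "n = 0")
    case True thus ?thesis using assms(2) by simp
  next
    case False
    have "F * inverse F = 1" using assms(2) by (simp add: inverse_mult_eq_1')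
    hence "(\<Sum>i=0..n. fps_nth F i * fps_nth (inverse F) (n - i)) = 0" using False by (simp add: fps_eq_iff fps_mult_nth)
    hence "fps_nth (inverse F) n = - (\<Sum>i=1..n. fps_nth F i * fps_nth (inverse F) (n - i))"
      using assms(2) by (simp add: sum.atLeast_Suc_atMost eq_neg_iff_add_eq_0)
    also have "\<dots> \<in> \<int>" using less assms(1) False by (intro Ints_minus Ints_sum Ints_mult) auto
    finally show ?thesis .
  qed
qed

definition eulerp :: "complex \<Rightarrow> complex" where "eulerp q = (\<Prod>n. 1 - q ^ Suc n)"

lemma Pr_eulerp: "Pr t t = eulerp (ee t)"
  unfolding Pr_def eulerp_def by (rule prodinf_cong) (simp add: ee_power ee_add[symmetric] algebra_simps del: power_Suc)

lemma ee_surj: assumes "q \<noteq> 0" "norm q < 1" obtains t where "t \<in> uhp" "ee t = q"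
proof (rule that[of "Ln q / (tpi)"])
  show "ee (Ln q / (tpi)) = q" using assms by (simp add: ee_def)
  hence "norm (ee (Ln q / (tpi))) < 1" using assms by simp
  thus "Ln q / (tpi) \<in> uhp" unfolding norm_ee by (simp add: uhp_def zero_less_mult_iff del: Im_divide_of_real)
qed

text \<open>This is the partition generating function. Its Taylor coefficients are those of the
  formal inverse of the Euler product, an integral series with constant term 1; convergence on the
  whole disc follows because the Euler product has no zeros there.\<close>

lemma intexp_inverse_Pr: "intexp (\<lambda>t z. inverse (Pr t t))"
proof -
  define cs where "cs = (\<lambda>k. \<Sum>S\<in>{S. finite S \<and> (\<Sum>n\<in>S. Suc n) = k}. (- 1 :: complex) ^ card S)"
  have finS: "finite {S. finite S \<and> (\<Sum>n\<in>S. Suc n) = k}" for k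
  proof -
    have "S \<subseteq> {..k}" if "finite S" "(\<Sum>n\<in>S. Suc n) = k" for S
    proof
      fix n assume "n \<in> S"
      hence "Suc n \<le> (\<Sum>n\<in>S. Suc n)" using that(1) by (intro member_le_sum) auto
      thus "n \<in> {..k}" using that(2) by simp
    qed
    hence "{S. finite S \<and> (\<Sum>n\<in>S. Suc n) = k} \<subseteq> Pow {..k}" by auto
    thus ?thesis by (rule finite_subset) auto
  qed
  have E: "((\<lambda>k. cs k * q ^ k) has_sum eulerp q) UNIV" if q: "norm q < 1" for q
  proof -
    have "summable (\<lambda>n. norm (- (q ^ Suc n)))" using q by (simp add: norm_mult norm_power summable_mult summable_geometric)
    from has_sum_prod_finite_subsets[OF this] have *: "((\<lambda>S. \<Prod>n\<in>S. - (q ^ Suc n)) has_sum eulerp q) (Collect finite)" by (simp add: eulerp_def)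
    have bij: "bij_betw (\<lambda>S. (\<Sum>n\<in>S. Suc n, S)) (Collect finite) (Sigma UNIV (\<lambda>k. {S. finite S \<and> (\<Sum>n\<in>S. Suc n) = k}))"
      by (rule bij_betwI') auto
    have "((\<lambda>p. \<Prod>n\<in>snd p. - (q ^ Suc n)) has_sum eulerp q) (Sigma UNIV (\<lambda>k. {S. finite S \<and> (\<Sum>n\<in>S. Suc n) = k}))"
      using * by (subst has_sum_reindex_bij_betw[OF bij, symmetric]) simp
    thus ?thesis
    proof (rule has_sum_SigmaD)
      fix k
      have "(\<Prod>n\<in>S. - (q ^ Suc n)) = (- 1) ^ card S * q ^ k" if "S \<in> {S. finite S \<and> (\<Sum>n\<in>S. Suc n) = k}" for S
        using that by (simp add: prod_uminus power_sum[symmetric] del: power_Suc)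
      hence "(\<Sum>S\<in>{S. finite S \<and> (\<Sum>n\<in>S. Suc n) = k}. \<Prod>n\<in>S. - (q ^ Suc n)) = cs k * q ^ k"
        unfolding cs_def sum_distrib_right by (intro sum.cong) auto
      thus "((\<lambda>S. \<Prod>n\<in>snd (k, S). - (q ^ Suc n)) has_sum cs k * q ^ k) {S. finite S \<and> (\<Sum>n\<in>S. Suc n) = k}"
        by (intro has_sum_finiteI finS) simp
    qed
  qed
  have sums: "(\<lambda>k. cs k * q ^ k) sums eulerp q" if "norm q < 1" for q
    using has_sum_imp_sums[OF E[OF that]] .
  have hol: "eulerp holomorphic_on ball 0 1"
    by (rule power_series_holomorphic[of 0 1 cs]) (use sums in auto)
  have nz: "eulerp q \<noteq> 0" if q1: "norm q < 1" for q
  proof (cases "q = 0")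
    case False
    obtain t where "t \<in> uhp" "ee t = q" using ee_surj[OF False q1] by metis
    thus ?thesis using Pr_tau_nonzero[of t] by (simp add: Pr_eulerp)
  qed (simp add: eulerp_def)
  define F where "F = Abs_fps cs"
  have "eulerp has_fps_expansion F"
    unfolding has_fps_expansion_def
  proof
    have "summable (\<lambda>k. fps_nth F k * of_real (1/2) ^ k)" using sums_summable[OF sums[of "1/2"]] by (simp add: F_def)
    hence "fps_conv_radius F \<ge> norm (of_real (1/2) :: complex)" unfolding fps_conv_radius_def by (rule conv_radius_geI)
    moreover have "norm (of_real (1/2) :: complex) = 1/2" by simp
    ultimately have "ereal (1/2) \<le> fps_conv_radius F" by simp
    moreover have "(0::ereal) < ereal (1/2)" by simp
    ultimately show "0 < fps_conv_radius F" by (rule less_le_trans[rotated])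
    have "\<forall>\<^sub>F z in nhds 0. z \<in> ball (0::complex) 1" by (intro eventually_nhds_in_open) auto
    thus "\<forall>\<^sub>F z in nhds 0. eval_fps F z = eulerp z"
      by eventually_elim (use sums in \<open>auto simp: eval_fps_def F_def sums_iff\<close>)
  qed
  moreover have F0: "fps_nth F 0 = 1"
  proof -
    have "{S::nat set. finite S \<and> (\<Sum>n\<in>S. Suc n) = 0} = {{}}" by auto
    thus ?thesis by (simp add: F_def cs_def)
  qed
  ultimately have inv: "(\<lambda>q. inverse (eulerp q)) has_fps_expansion inverse F" by (intro has_fps_expansion_inverse) simp_all
  have holi: "(\<lambda>q. inverse (eulerp q)) holomorphic_on ball 0 1" by (intro holomorphic_on_inverse hol) (use nz in auto)
  have ints: "fps_nth (inverse F) k \<in> \<int>" for k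
    by (rule fps_inverse_Ints[OF _ F0]) (auto simp: F_def cs_def intro!: Ints_sum Ints_power)
  have coeff: "(deriv ^^ k) (\<lambda>q. inverse (eulerp q)) 0 / fact k = fps_nth (inverse F) k" for k
    using fps_nth_fps_expansion[OF inv, of k] by simp
  have "\<forall>k. \<exists>m::int. fps_nth (inverse F) k = of_int m" using ints by (auto elim: Ints_cases)
  then obtain b :: "nat \<Rightarrow> int" where b: "\<And>k. fps_nth (inverse F) k = of_int (b k)" by metis
  have S: "((\<lambda>k. of_int (b k) * q ^ k) has_sum inverse (eulerp q)) UNIV" if q: "norm q < 1" for q
  proof -
    have s: "(\<lambda>k. of_int (b k) * w ^ k) sums inverse (eulerp w)" if "norm w < 1" for w
      using holomorphic_power_series[OF holi, of w] that by (simp add: coeff b)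
    \<comment> \<open>\<open>has_sum\<close> needs absolute convergence at q, which follows from
      mere convergence at the larger radius r.\<close>
    obtain r where r: "norm q < r" "r < 1" using q dense by blast
    have "r \<ge> 0" using r norm_ge_zero[of q] by linarith
    hence "summable (\<lambda>k. of_int (b k) * of_real r ^ k :: complex)" using sums_summable[OF s[of "of_real r"]] r by simp
    hence "summable (\<lambda>k. norm (of_int (b k) * q ^ k :: complex))" by (rule powser_insidea) (use r \<open>r \<ge> 0\<close> in simp)
    thus ?thesis by (rule norm_summable_imp_has_sum[OF _ s[OF q]])
  qed
  show ?thesis
  proof (rule intexpI[of UNIV "\<lambda>k. (k, k)" b])
    have "{k \<in> UNIV. (k, k) = p} \<subseteq> {fst p}" for p :: "nat \<times> nat" by auto
    thus "finite {k \<in> UNIV. (k, k) = p}" for p :: "nat \<times> nat" by (rule finite_subset) simp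
    fix t z :: complex assume z: "0 < Im z" "Im z < Im t"
    have "ee z ^ k * ee (t - z) ^ k = ee t ^ k" for k by (simp add: power_mult_distrib[symmetric] ee_add[symmetric])
    thus "((\<lambda>k. of_int (b k) * (ee z ^ fst (k, k) * ee (t - z) ^ snd (k, k))) has_sum inverse (Pr t t)) UNIV"
      using S[OF norm_ee_uhp[OF uhp_strip[OF z]]] by (simp add: Pr_eulerp)
  qed
qed

text \<open>The factor ee z clears the only negative exponent of \<open>Q\<close>.\<close>

lemma intexp_Q: "intexp (\<lambda>t z. ee z * Q t z)"
proof -
  have "intexp (\<lambda>t z. \<Prod>n. 1 - ee z ^ fst (Suc n, n) * ee (t - z) ^ snd (Suc n, n))" by (rule intexp_prod) simp
  moreover have "ee z ^ fst (Suc n, n) * ee (t - z) ^ snd (Suc n, n) = ee (z + of_nat n * t)" for z t n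
    unfolding ee_power ee_add[symmetric] by (rule arg_cong[of _ _ ee]) (simp add: algebra_simps)
  ultimately have 1: "intexp Pr" by (simp only: Pr_def[abs_def])
  have "intexp (\<lambda>t z. \<Prod>n. 1 - ee z ^ fst (n, Suc n) * ee (t - z) ^ snd (n, Suc n))" by (rule intexp_prod) simp
  moreover have "ee z ^ fst (n, Suc n) * ee (t - z) ^ snd (n, Suc n) = ee (t - z + of_nat n * t)" for z t n
    unfolding ee_power ee_add[symmetric] by (rule arg_cong[of _ _ ee]) (simp add: algebra_simps)
  ultimately have 2: "intexp (\<lambda>t z. Pr t (t - z))" by (simp only: Pr_def[abs_def])
  have "intexp (\<lambda>t z. (Pr t z)^2 * (Pr t (t - z))^2 * inverse (Pr t t) ^ 4)"
    by (intro intexp_mult intexp_power 1 2 intexp_inverse_Pr)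
  moreover have "ee z * Q t z = (Pr t z)^2 * (Pr t (t - z))^2 * inverse (Pr t t) ^ 4" for t z
    by (simp add: Q_def divide_inverse power_inverse)
  ultimately show ?thesis by simp
qed

section \<open>The Poincare series\<close>

definition wl :: "complex \<Rightarrow> int \<times> int \<Rightarrow> complex" where
  "wl t p = of_int (fst p) * t + of_int (snd p)"

text \<open>For w = a t + b this is exp (- pi N (z + w)^2 / v) / (z + w)^k times ee (N a (2z + w)):
  the seed exp (- pi N z^2 / v) / z^k moved by w with the index N automorphy factor. It is
  holomorphic in z, although not in t.\<close>

definition pterm :: "nat \<Rightarrow> nat \<Rightarrow> complex \<Rightarrow> complex \<Rightarrow> complex \<Rightarrow> complex" where
  "pterm N k t w z = exp (- of_real (pi * real N / Im t) * (z^2 + 2 * z * cnj w + w * cnj w)) / (z + w) ^ k"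

definition PP :: "nat \<Rightarrow> nat \<Rightarrow> complex \<Rightarrow> complex \<Rightarrow> complex" where
  "PP N k t z = (\<Sum>\<^sub>\<infinity>p\<in>UNIV. pterm N k t (wl t p) z)"

lemma wl_lat: "wl t p \<in> lat t" by (simp add: wl_def latI)

lemma summable_on_times_nonneg:
  fixes f :: "'a \<Rightarrow> real" and g :: "'b \<Rightarrow> real"
  assumes "f summable_on A" "g summable_on B" "\<And>x. x \<in> A \<Longrightarrow> f x \<ge> 0" "\<And>y. y \<in> B \<Longrightarrow> g y \<ge> 0"
  shows "(\<lambda>p. f (fst p) * g (snd p)) summable_on (A \<times> B)"
proof (rule summable_on_SigmaI[where g="\<lambda>x. f x * infsum g B"])
  show "((\<lambda>y. f (fst (x, y)) * g (snd (x, y))) has_sum f x * infsum g B) B" for x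
    using has_sum_cmult_right[of g B "infsum g B" "f x"] assms(2) by simp
  show "(\<lambda>x. f x * infsum g B) summable_on A" by (rule summable_on_cmult_left[OF assms(1)])
qed (use assms in auto)

text \<open>Both coordinates of a lattice point are bounded by a constant times its norm, and an
  integer m satisfies m <= m^2. So the Gaussian is dominated by a product of two geometric terms in
  |a| and |b|.\<close>

lemma gauss_lattice_summable:
  assumes t: "t \<in> uhp" and c: "c > 0"
  shows "(\<lambda>p. exp (- c * (norm (wl t p))^2)) summable_on UNIV"
proof -
  have v: "Im t > 0" using t by (simp add: uhp_def)
  define C where "C = 1 + (1 + norm t) / Im t"
  have C: "C > 0" using v by (auto simp: C_def intro!: add_pos_nonneg divide_nonneg_pos)
  define \<rho> where "\<rho> = exp (- c / C^2)"
  have \<rho>: "0 \<le> \<rho>" "\<rho> < 1" using c C by (auto simp: \<rho>_def)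
  have le: "exp (- c * (norm (wl t p))^2) \<le> \<rho> ^ nat \<bar>fst p\<bar> * \<rho> ^ nat \<bar>snd p\<bar>" for p
  proof -
    obtain a b where p: "p = (a, b)" by (cases p)
    define w where "w = wl t p"
    have "\<bar>of_int a\<bar> * Im t \<le> norm w" using abs_Im_le_cmod[of w] v by (simp add: w_def wl_def p abs_mult)
    hence a: "\<bar>of_int a\<bar> \<le> norm w / Im t" using v by (simp add: field_simps)
    have "norm (of_int b :: complex) = norm (w - of_int a * t)" by (simp add: w_def wl_def p)
    also have "\<dots> \<le> norm w + \<bar>of_int a\<bar> * norm t" by (rule order_trans[OF norm_triangle_ineq4]) (simp add: norm_mult)
    also have "\<dots> \<le> norm w + norm w / Im t * norm t" using a by (intro add_left_mono mult_right_mono) auto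
    finally have b: "\<bar>of_int b\<bar> \<le> norm w + norm w / Im t * norm t" by simp
    define m where "m = nat \<bar>a\<bar> + nat \<bar>b\<bar>"
    have m: "real m = \<bar>of_int a\<bar> + \<bar>of_int b\<bar>" by (simp add: m_def)
    have "real m \<le> norm w * C" unfolding m C_def using a b by (simp add: algebra_simps add_divide_distrib)
    hence "(real m)^2 \<le> (norm w * C)^2" by (intro power_mono) auto
    moreover have "real m \<le> (real m)^2" by (simp add: power2_eq_square) (metis le_square of_nat_le_iff of_nat_mult)
    ultimately have "real m \<le> (norm w)^2 * C^2" unfolding power_mult_distrib by linarith
    hence "real m / C^2 \<le> (norm w)^2" using C by (simp add: field_simps)
    hence "c * (real m / C^2) \<le> c * (norm w)^2" using c by (intro mult_left_mono) auto
    hence "exp (- c * (norm w)^2) \<le> exp (real m * (- c / C^2))" by (simp add: field_simps)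
    also have "\<dots> = \<rho> ^ m" unfolding \<rho>_def by (rule exp_of_nat_mult)
    finally show ?thesis by (simp add: w_def m_def power_add p)
  qed
  have "(\<lambda>p. (1 * \<rho> ^ nat \<bar>fst p\<bar>) * (1 * \<rho> ^ nat \<bar>snd p\<bar>)) summable_on (UNIV \<times> UNIV)"
    by (rule summable_on_times_nonneg[OF summable_int_geometric summable_int_geometric]) (use \<rho> in auto)
  hence "(\<lambda>p. \<rho> ^ nat \<bar>fst p\<bar> * \<rho> ^ nat \<bar>snd p\<bar>) summable_on UNIV" by simp
  thus ?thesis by (rule summable_on_comparison_test) (use le in auto)
qed

lemma PP_majorant:
  assumes t: "t \<in> uhp" and \<epsilon>: "\<epsilon> > 0" and N: "N > 0"
  shows "\<exists>M. M summable_on I \<and> (\<forall>p\<in>I. \<forall>z. norm z \<le> R \<longrightarrow> \<epsilon> \<le> norm (z + wl t p) \<longrightarrow> norm (pterm N k t (wl t p) z) \<le> M p)"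
proof -
  have v: "Im t > 0" using t by (simp add: uhp_def)
  define \<alpha> where "\<alpha> = pi * real N / Im t"
  have \<alpha>: "\<alpha> > 0" using v N by (simp add: \<alpha>_def)
  define M where "M = (\<lambda>p. exp (3 * \<alpha> * R^2) / \<epsilon> ^ k * exp (- (\<alpha> / 2) * (norm (wl t p))^2))"
  have "(\<lambda>p. exp (- (\<alpha> / 2) * (norm (wl t p))^2)) summable_on UNIV"
    by (rule gauss_lattice_summable[OF t]) (use \<alpha> in simp)
  hence "M summable_on I" unfolding M_def by (intro summable_on_cmult_right) (rule summable_on_subset, auto)
  moreover have "norm (pterm N k t (wl t p) z) \<le> M p" if z: "norm z \<le> R" "\<epsilon> \<le> norm (z + wl t p)" for p z
  proof -
    define w where "w = wl t p"
    \<comment> \<open>The cross term is split by 2 R |w| <= 2 R^2 + |w|^2 / 2, which leaves half of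
      the Gaussian in w.\<close>
    have Re: "Re (- of_real \<alpha> * (z^2 + 2 * z * cnj w + w * cnj w)) \<le> 3 * \<alpha> * R^2 + - (\<alpha> / 2) * (norm w)^2"
    proof -
      have R0: "R \<ge> 0" using z(1) norm_ge_zero[of z] by linarith
      have "- Re (z^2) \<le> R^2"
        using abs_Re_le_cmod[of "z^2"] power_mono[OF z(1), of 2] by (simp add: norm_power)
      moreover have "- Re (2 * z * cnj w) \<le> 2 * R^2 + (norm w)^2 / 2"
      proof -
        have "- Re (2 * z * cnj w) \<le> norm (2 * z * cnj w)" using abs_Re_le_cmod[of "2 * z * cnj w"] by linarith
        also have "\<dots> = 2 * norm z * norm w" by (simp add: norm_mult)
        also have "\<dots> \<le> 2 * R * norm w" using z(1) by (intro mult_right_mono) auto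
        also have "\<dots> \<le> 2 * R^2 + (norm w)^2 / 2" using sum_squares_bound[of "2 * R" "norm w"] by (simp add: power2_eq_square)
        finally show ?thesis .
      qed
      moreover have "Re (w * cnj w) = (norm w)^2" by (simp add: complex_mult_cnj cmod_power2)
      ultimately have "- Re (z^2 + 2 * z * cnj w + w * cnj w) \<le> 3 * R^2 - (norm w)^2 / 2" unfolding plus_complex.sel by linarith
      hence "\<alpha> * (- Re (z^2 + 2 * z * cnj w + w * cnj w)) \<le> \<alpha> * (3 * R^2 - (norm w)^2 / 2)" using \<alpha> by (intro mult_left_mono) auto
      thus ?thesis by (simp add: algebra_simps)
    qed
    have "norm (pterm N k t w z) = exp (Re (- of_real \<alpha> * (z^2 + 2 * z * cnj w + w * cnj w))) / norm (z + w) ^ k"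
      unfolding pterm_def \<alpha>_def norm_divide norm_exp_eq_Re norm_power ..
    also have "\<dots> \<le> exp (3 * \<alpha> * R^2 + - (\<alpha> / 2) * (norm w)^2) / \<epsilon> ^ k"
      using Re z(2) \<epsilon> by (intro frac_le power_mono) (auto simp: w_def)
    also have "\<dots> = M p" unfolding exp_add by (simp add: M_def w_def)
    finally show ?thesis by (simp add: w_def)
  qed
  ultimately show ?thesis by blast
qed

lemma lat_dist: assumes t: "t \<in> uhp" "z \<notin> lat t"
  obtains r where "r > 0" "cball z r \<subseteq> - lat t" "\<And>w p. w \<in> cball z r \<Longrightarrow> r \<le> norm (w + wl t p)"
proof -
  obtain e where e: "e > 0" "cball z e \<subseteq> - lat t" using open_contains_cball[of "- lat t"] open_lat[OF t(1)] t(2) by auto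
  show ?thesis
  proof (rule that[of "e / 2"])
    show "cball z (e / 2) \<subseteq> - lat t" using e by (auto simp: subset_iff)
    fix w p assume w: "w \<in> cball z (e / 2)"
    have "- wl t p \<in> lat t" by (simp add: wl_lat)
    hence "- wl t p \<notin> cball z e" using e by auto
    hence "e < norm (z + wl t p)" by (simp add: dist_norm)
    moreover have "norm (z + wl t p) \<le> norm (z - w) + norm (w + wl t p)" using norm_triangle_ineq[of "z - w" "w + wl t p"] by simp
    moreover have "norm (z - w) \<le> e / 2" using w by (simp add: dist_norm)
    ultimately show "e / 2 \<le> norm (w + wl t p)" by linarith
  qed (use e in auto)
qed

lemma pterm_holomorphic: "(\<And>z. z \<in> S \<Longrightarrow> z + w \<noteq> 0) \<Longrightarrow> pterm N k t w holomorphic_on S"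
  unfolding pterm_def[abs_def] by (intro holomorphic_intros) auto

lemma PP_local_majorant:
  assumes t: "t \<in> uhp" and N: "N > 0" and z: "z \<notin> lat t"
  shows "\<exists>r>0. \<exists>M. cball z r \<subseteq> - lat t \<and> M summable_on UNIV \<and> (\<forall>p\<in>UNIV. \<forall>w\<in>cball z r. norm (pterm N k t (wl t p) w) \<le> M p)"
proof -
  obtain r where r: "r > 0" "cball z r \<subseteq> - lat t" "\<And>w p. w \<in> cball z r \<Longrightarrow> r \<le> norm (w + wl t p)" by (rule lat_dist[OF t z]) blast
  have R: "norm w \<le> norm z + r" if "w \<in> cball z r" for w
    using that norm_triangle_ineq2[of w z] by (simp add: dist_norm norm_minus_commute)
  obtain M where M: "M summable_on UNIV" "\<And>p w. norm w \<le> norm z + r \<Longrightarrow> r \<le> norm (w + wl t p) \<Longrightarrow> norm (pterm N k t (wl t p) w) \<le> M p"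
    using PP_majorant[OF t r(1) N, of UNIV "norm z + r" k] by blast
  show ?thesis using r M R by (intro exI[of _ r] conjI exI[of _ M]) auto
qed

lemma PP_holomorphic:
  assumes t: "t \<in> uhp" and N: "N > 0"
  shows "PP N k t holomorphic_on (- lat t)"
  unfolding PP_def[abs_def]
proof (rule infsum_holomorphic[OF open_lat[OF t]])
  fix p
  show "pterm N k t (wl t p) holomorphic_on (- lat t)"
  proof (rule pterm_holomorphic)
    fix z assume "z \<in> - lat t"
    thus "z + wl t p \<noteq> 0" using wl_lat[of t p] lat_minus[of "wl t p" t] by (metis ComplD eq_neg_iff_add_eq_0)
  qed
qed (use PP_local_majorant[OF t N] in auto)

text \<open>Near 0 the terms with w different from 0 have a common summable majorant, so their sum
  is bounded and z^k kills it; the term w = 0 gives 1.\<close>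

lemma PP_limit:
  assumes t: "t \<in> uhp" and N: "N > 0" and k: "k > 0"
  shows "((\<lambda>z. z ^ k * PP N k t z) \<longlongrightarrow> 1) (at 0)"
proof -
  define \<delta> where "\<delta> = min 1 (Im t)"
  have \<delta>: "\<delta> > 0" using t by (simp add: \<delta>_def uhp_def)
  define I where "I = UNIV - {(0::int, 0::int)}"
  have wl0: "wl t (0, 0) = 0" by (simp add: wl_def)
  have wln: "norm (wl t p) \<ge> \<delta>" if "p \<in> I" for p
  proof (rule ccontr)
    assume "\<not> norm (wl t p) \<ge> \<delta>"
    hence "norm (wl t p) < min 1 (Im t)" by (simp only: \<delta>_def not_le)
    hence "wl t p = 0" by (rule lat_small[OF t wl_lat])
    hence "of_int (fst p) * Im t = 0" "wl t p = 0" by (auto simp: wl_def complex_eq_iff)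
    hence "fst p = 0" using t by (simp add: uhp_def)
    with \<open>wl t p = 0\<close> have "snd p = 0" by (simp add: wl_def)
    with \<open>fst p = 0\<close> that show False by (auto simp: I_def prod_eq_iff)
  qed
  obtain M where M: "M summable_on I" "\<And>p z. p \<in> I \<Longrightarrow> norm z \<le> \<delta> / 2 \<Longrightarrow> \<delta> / 2 \<le> norm (z + wl t p) \<Longrightarrow> norm (pterm N k t (wl t p) z) \<le> M p"
    using PP_majorant[OF t _ N, of "\<delta> / 2" I "\<delta> / 2" k] \<delta> by auto
  have Mle: "norm (pterm N k t (wl t p) z) \<le> M p" if "p \<in> I" "norm z \<le> \<delta> / 2" for p z
    using M(2)[OF that] wln[OF that(1)] that(2) norm_triangle_ineq2[of "wl t p" "- z"] by (simp add: add.commute)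
  define B where "B = infsum M I"
  have rest: "norm (PP N k t z - pterm N k t 0 z) \<le> B" if z: "z \<in> ball 0 (\<delta> / 2) - {0}" for z
  proof -
    have "norm z < \<delta>" using z \<delta> by auto
    hence zl: "z \<notin> lat t" using lat_small[OF t, of z] z unfolding \<delta>_def by auto
    have s: "(\<lambda>p. norm (pterm N k t (wl t p) z)) summable_on I"
      by (rule summable_on_comparison_test[OF M(1)]) (use Mle z in auto)
    hence s': "(\<lambda>p. pterm N k t (wl t p) z) summable_on I" by (simp add: summable_on_iff_abs_summable_on_complex)
    have "insert (0, 0) I = UNIV" by (auto simp: I_def)
    hence "PP N k t z = pterm N k t 0 z + (\<Sum>\<^sub>\<infinity>p\<in>I. pterm N k t (wl t p) z)"
      using infsum_insert[OF s', of "(0, 0)"] by (simp add: PP_def I_def wl0)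
    moreover have "norm (\<Sum>\<^sub>\<infinity>p\<in>I. pterm N k t (wl t p) z) \<le> (\<Sum>\<^sub>\<infinity>p\<in>I. norm (pterm N k t (wl t p) z))"
      by (rule norm_infsum_bound[OF s])
    moreover have "\<dots> \<le> B" unfolding B_def by (rule infsum_mono[OF s M(1)]) (use Mle z in auto)
    ultimately show ?thesis by simp
  qed
  have ev: "\<forall>\<^sub>F z in at 0. z \<in> ball 0 (\<delta> / 2) - {0}" using \<delta> by (intro eventually_at_in_open) auto
  have "((\<lambda>z. z ^ k * (PP N k t z - pterm N k t 0 z)) \<longlongrightarrow> 0) (at 0)"
  proof (rule Lim_null_comparison)
    show "\<forall>\<^sub>F z in at 0. norm (z ^ k * (PP N k t z - pterm N k t 0 z)) \<le> norm z ^ k * B"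
      using ev by eventually_elim (use rest in \<open>auto simp: norm_mult norm_power intro!: mult_left_mono\<close>)
    show "((\<lambda>z::complex. norm z ^ k * B) \<longlongrightarrow> 0) (at 0)" using k by (auto intro!: tendsto_eq_intros)
  qed
  moreover have "((\<lambda>z. z ^ k * pterm N k t 0 z) \<longlongrightarrow> 1) (at 0)"
  proof (rule Lim_transform_eventually)
    show "((\<lambda>z::complex. exp (- of_real (pi * real N / Im t) * z^2)) \<longlongrightarrow> 1) (at 0)"
      using t by (auto intro!: tendsto_eq_intros simp: uhp_def)
    show "\<forall>\<^sub>F z in at 0. exp (- of_real (pi * real N / Im t) * z^2) = z ^ k * pterm N k t 0 z"
      using ev by eventually_elim (simp add: pterm_def)
  qed
  ultimately have "((\<lambda>z. z ^ k * (PP N k t z - pterm N k t 0 z) + z ^ k * pterm N k t 0 z) \<longlongrightarrow> 0 + 1) (at 0)" by (rule tendsto_add)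
  thus ?thesis by (simp add: algebra_simps)
qed

lemma pterm_shift:
  assumes "Im t \<noteq> 0"
  shows "pterm N k t (w - a) (z + a) = exp (- of_real (pi * real N / Im t) * (2 * z * (a - cnj a) + a * (a - cnj a) + (a * cnj w - w * cnj a))) * pterm N k t w z"
proof -
  have "(z + a)^2 + 2 * (z + a) * cnj (w - a) + (w - a) * cnj (w - a) =
     (2 * z * (a - cnj a) + a * (a - cnj a) + (a * cnj w - w * cnj a)) + (z^2 + 2 * z * cnj w + w * cnj w)"
    by (simp add: power2_eq_square algebra_simps)
  thus ?thesis unfolding pterm_def by (simp add: distrib_left exp_add)
qed

lemma exp_pi_N: assumes "v \<noteq> 0" shows "exp (- of_real (pi * real N / v) * (2 * \<i> * of_real v * x)) = ee (- (of_nat N * x))"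
  unfolding ee_def using assms by (intro arg_cong[of _ _ exp]) (simp add: field_simps)

lemma diff_cnj: "t - cnj t = 2 * \<i> * of_real (Im t)" by (simp add: complex_eq_iff)

lemma PP_add_1: assumes t: "t \<in> uhp" shows "PP N k t (z + 1) = PP N k t z"
  unfolding PP_def
proof (rule infsum_reindex_bij_witness[where i="\<lambda>p. (fst p, snd p - 1)" and j="\<lambda>p. (fst p, snd p + 1)"])
  fix p :: "int \<times> int"
  have v: "Im t \<noteq> 0" using t by (auto simp: uhp_def)
  define w where "w = wl t (fst p, snd p + 1)"
  have w1: "w - 1 = wl t p" by (simp add: w_def wl_def)
  have "cnj w - w = - (of_int (fst p) * (t - cnj t))" by (simp add: w_def wl_def algebra_simps)
  hence "2 * z * (1 - cnj 1) + 1 * (1 - cnj 1) + (1 * cnj w - w * cnj 1) = 2 * \<i> * of_real (Im t) * (- of_int (fst p))"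
    by (simp add: diff_cnj)
  hence "exp (- of_real (pi * real N / Im t) * (2 * z * (1 - cnj 1) + 1 * (1 - cnj 1) + (1 * cnj w - w * cnj 1))) = ee (- (of_nat N * (- of_int (fst p))))"
    by (simp only: exp_pi_N[OF v])
  also have "\<dots> = 1" using ee_of_int[of "int N * fst p"] by simp
  finally show "pterm N k t (wl t (fst p, snd p + 1)) z = pterm N k t (wl t p) (z + 1)"
    using pterm_shift[OF v, of N k w 1 z] unfolding w1 by (simp add: w_def)
qed auto

lemma PP_add_tau: assumes t: "t \<in> uhp" shows "PP N k t (z + t) = ee (- (of_nat N * t) - of_nat (2 * N) * z) * PP N k t z"
  unfolding PP_def infsum_cmult_right'[symmetric]
proof (rule infsum_reindex_bij_witness[where i="\<lambda>p. (fst p - 1, snd p)" and j="\<lambda>p. (fst p + 1, snd p)"])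
  fix p :: "int \<times> int"
  have v: "Im t \<noteq> 0" using t by (auto simp: uhp_def)
  define w where "w = wl t (fst p + 1, snd p)"
  have w1: "w - t = wl t p" by (simp add: w_def wl_def algebra_simps)
  have "t * cnj w - w * cnj t = of_int (snd p) * (t - cnj t)" by (simp add: w_def wl_def algebra_simps)
  hence "2 * z * (t - cnj t) + t * (t - cnj t) + (t * cnj w - w * cnj t) = 2 * \<i> * of_real (Im t) * (2 * z + t + of_int (snd p))"
    by (simp add: diff_cnj algebra_simps)
  hence "exp (- of_real (pi * real N / Im t) * (2 * z * (t - cnj t) + t * (t - cnj t) + (t * cnj w - w * cnj t))) = ee (- (of_nat N * (2 * z + t + of_int (snd p))))"
    by (simp only: exp_pi_N[OF v])
  also have "- (of_nat N * (2 * z + t + of_int (snd p))) = (- (of_nat N * t) - of_nat (2 * N) * z) + of_int (- (int N * snd p))" by (simp add: algebra_simps)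
  also have "ee \<dots> = ee (- (of_nat N * t) - of_nat (2 * N) * z)" by (simp only: ee_add ee_of_int mult_1_right)
  finally show "ee (- (of_nat N * t) - of_nat (2 * N) * z) * pterm N k t (wl t (fst p + 1, snd p)) z = pterm N k t (wl t p) (z + t)"
    using pterm_shift[OF v, of N k w t z] unfolding w1 by (simp add: w_def)
qed auto

lemma PP_minus: "PP N k t (- z) = (- 1) ^ k * PP N k t z"
  unfolding PP_def infsum_cmult_right'[symmetric]
proof (rule infsum_reindex_bij_witness[where i="\<lambda>p. (- fst p, - snd p)" and j="\<lambda>p. (- fst p, - snd p)"])
  fix p :: "int \<times> int"
  have w: "wl t (- fst p, - snd p) = - wl t p" by (simp add: wl_def)
  have "- z + wl t p = - (z - wl t p)" by simp
  hence "(- z + wl t p) ^ k = (- 1) ^ k * (z - wl t p) ^ k" by (metis power_minus)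
  moreover have "((- 1) ^ k :: complex) * (- 1) ^ k = 1" by (simp flip: power_mult_distrib)
  ultimately show "(- 1) ^ k * pterm N k t (wl t (- fst p, - snd p)) z = pterm N k t (wl t p) (- z)"
    unfolding w pterm_def by (auto simp: divide_simps minus_one_power_iff)
qed auto

lemma PP_T: "PP N k (t + 1) z = PP N k t z"
  unfolding PP_def
proof (rule infsum_reindex_bij_witness[where i="\<lambda>p. (fst p, snd p - fst p)" and j="\<lambda>p. (fst p, snd p + fst p)"])
  fix p :: "int \<times> int"
  have "wl (t + 1) p = wl t (fst p, snd p + fst p)" by (simp add: wl_def algebra_simps)
  thus "pterm N k t (wl t (fst p, snd p + fst p)) z = pterm N k (t + 1) (wl (t + 1) p) z" by (simp add: pterm_def)
qed auto

text \<open>The lattice of -1/t is that of t divided by t, and Im (-1/t) = v / |t|^2 makes the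
  Gaussians match. The mismatch between cnj t and t in the z^2 term is 2 i v (- z^2 / t), which
  produces the theta factor.\<close>

lemma PP_S:
  assumes t: "t \<in> uhp"
  shows "PP N k (- 1 / t) (z / t) = t ^ k * ee (of_nat N * z^2 / t) * PP N k t z"
  unfolding PP_def infsum_cmult_right'[symmetric]
proof (rule infsum_reindex_bij_witness[where i="\<lambda>p. (- snd p, fst p)" and j="\<lambda>p. (snd p, - fst p)"])
  fix p :: "int \<times> int"
  have nz: "t \<noteq> 0" using uhp_nonzero[OF t] .
  have v: "Im t > 0" using t by (simp add: uhp_def)
  define w where "w = wl t (snd p, - fst p)"
  have w': "wl (- 1 / t) p = w / t" using nz by (simp add: w_def wl_def field_simps)
  have ImS: "Im (- 1 / t) = Im t / (norm t)^2" by (simp add: Im_divide cmod_power2)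
  have c: "complex_of_real (pi * real N / Im (- 1 / t)) = of_real (pi * real N / Im t) * (t * cnj t)"
    unfolding ImS by (simp add: complex_norm_square[symmetric])
  have e: "- of_real (pi * real N / Im (- 1 / t)) * ((z / t)^2 + 2 * (z / t) * cnj (w / t) + w / t * cnj (w / t)) =
     - of_real (pi * real N / Im t) * (z^2 + 2 * z * cnj w + w * cnj w) + - of_real (pi * real N / Im t) * (2 * \<i> * of_real (Im t) * (- (z^2 / t)))"
  proof -
    have "t * cnj t * ((z / t)^2 + 2 * (z / t) * cnj (w / t) + w / t * cnj (w / t)) =
       z^2 * cnj t / t + 2 * z * cnj w + w * cnj w" using nz by (simp add: field_simps power2_eq_square)
    also have "z^2 * cnj t / t = z^2 + (t - cnj t) * (- (z^2 / t))" using nz by (simp add: field_simps)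
    finally have "t * cnj t * ((z / t)^2 + 2 * (z / t) * cnj (w / t) + w / t * cnj (w / t)) =
       (z^2 + 2 * z * cnj w + w * cnj w) + (2 * \<i> * of_real (Im t)) * (- (z^2 / t))" unfolding diff_cnj by simp
    moreover have "- (K * T) * X = - K * Y + - K * Z" if "T * X = Y + Z" for K T X Y Z :: complex
    proof -
      have "- (K * T) * X = - K * (T * X)" by simp
      thus ?thesis unfolding that by (simp add: distrib_left)
    qed
    ultimately show ?thesis unfolding c by blast
  qed
  have "exp (- of_real (pi * real N / Im t) * (2 * \<i> * of_real (Im t) * (- (z^2 / t)))) = ee (- (of_nat N * (- (z^2 / t))))"
    by (rule exp_pi_N) (use v in simp)
  also have "- (of_nat N * (- (z^2 / t))) = of_nat N * z^2 / t" by simp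
  finally have E: "exp (- of_real (pi * real N / Im (- 1 / t)) * ((z / t)^2 + 2 * (z / t) * cnj (w / t) + w / t * cnj (w / t))) =
     exp (- of_real (pi * real N / Im t) * (z^2 + 2 * z * cnj w + w * cnj w)) * ee (of_nat N * z^2 / t)" unfolding e exp_add by simp
  have "z / t + w / t = (z + w) / t" by (simp add: add_divide_distrib)
  hence "(z / t + w / t) ^ k = (z + w) ^ k / t ^ k" by (simp add: power_divide)
  thus "t ^ k * ee (of_nat N * z^2 / t) * pterm N k t (wl t (snd p, - fst p)) z = pterm N k (- 1 / t) (wl (- 1 / t) p) (z / t)"
    unfolding w' w_def[symmetric] pterm_def E using nz by simp
qed auto

section \<open>Fourier expansions\<close>

text \<open>The mean value of G along the segment from z to z + p.\<close>

definition pint :: "(complex \<Rightarrow> complex) \<Rightarrow> complex \<Rightarrow> complex \<Rightarrow> complex" where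
  "pint G z p = integral {0..1} (\<lambda>x. G (z + of_real x * p))"

lemma pint_continuous:
  assumes "G holomorphic_on UNIV"
  shows "continuous_on A (\<lambda>x::real. G (z + of_real x * p))"
  by (rule continuous_on_compose2[OF holomorphic_on_imp_continuous_on[OF assms]]) (auto intro!: continuous_intros)

text \<open>A primitive H turns the mean into (H (z + p) - H z) / p, whose derivative in z vanishes
  by periodicity. This replaces contour shifting arguments.\<close>

lemma pint_const:
  assumes G: "G holomorphic_on UNIV" and p: "p \<noteq> 0" and per: "\<And>z. G (z + p) = G z"
  shows "pint G z p = pint G w p"
proof -
  obtain H where H: "\<And>z. (H has_field_derivative G z) (at z)"
    using holomorphic_convex_primitive'[OF convex_UNIV open_UNIV G] by auto
  have 1: "pint G z p = (H (z + p) - H z) / p" for z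
  proof -
    have "((\<lambda>x. H (z + of_real x * p) / p) has_vector_derivative G (z + of_real x * p)) (at x within {0..1})" for x
    proof -
      have "((\<lambda>w. H (z + w * p) / p) has_field_derivative G (z + of_real x * p)) (at (of_real x))"
        using p by (auto intro!: derivative_eq_intros DERIV_chain2[OF H])
      from has_vector_derivative_real_field[OF this] show ?thesis by (rule has_vector_derivative_at_within)
    qed
    hence "((\<lambda>x. G (z + of_real x * p)) has_integral (H (z + of_real 1 * p) / p - H (z + of_real 0 * p) / p)) {0..1}"
      by (intro fundamental_theorem_of_calculus) auto
    thus ?thesis unfolding pint_def by (simp add: integral_unique diff_divide_distrib)
  qed
  have "\<exists>c. \<forall>z\<in>UNIV. H (z + p) - H z = c"
  proof (rule has_field_derivative_zero_constant)
    fix z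
    have "((\<lambda>z. H (z + p) - H z) has_field_derivative G (z + p) - G z) (at z)"
    proof (rule DERIV_diff[OF _ H])
      have "((\<lambda>x. H (x + p)) has_field_derivative G (z + p) * 1) (at z)"
        by (rule DERIV_chain2[OF H]) (auto intro!: derivative_eq_intros)
      thus "((\<lambda>x. H (x + p)) has_field_derivative G (z + p)) (at z)" by simp
    qed
    thus "((\<lambda>z. H (z + p) - H z) has_field_derivative 0) (at z within UNIV)" using per by simp
  qed auto
  then obtain c where "\<And>z. H (z + p) - H z = c" by blast
  thus ?thesis unfolding 1 by simp
qed

definition fc :: "(complex \<Rightarrow> complex) \<Rightarrow> int \<Rightarrow> complex" where
  "fc F n = pint (\<lambda>z. F z * ee (- (of_int n * z))) 0 1"

lemma ee_holomorphic: "f holomorphic_on S \<Longrightarrow> (\<lambda>z. ee (f z)) holomorphic_on S"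
  unfolding ee_def by (intro holomorphic_intros)

lemma fc_height:
  assumes F: "F holomorphic_on UNIV" and per: "\<And>z. F (z + 1) = F z"
  shows "fc F n = pint (\<lambda>z. F z * ee (- (of_int n * z))) w 1"
  unfolding fc_def
proof (rule pint_const)
  show "(\<lambda>z. F z * ee (- (of_int n * z))) holomorphic_on UNIV" by (intro holomorphic_intros F ee_holomorphic)
  fix z :: complex
  have "- (of_int n * (z + 1)) = - (of_int n * z) + of_int (- n)" by (simp add: algebra_simps)
  thus "F (z + 1) * ee (- (of_int n * (z + 1))) = F z * ee (- (of_int n * z))" by (simp only: per ee_add ee_of_int mult_1_right)
qed simp

lemma norm_pint_le: assumes "G holomorphic_on UNIV" "\<And>x. x \<in> {0..1} \<Longrightarrow> norm (G (z + of_real x * p)) \<le> B"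
  shows "norm (pint G z p) \<le> B"
  unfolding pint_def using integral_bound[of 0 1 "\<lambda>x. G (z + of_real x * p)" B] pint_continuous[OF assms(1)] assms(2) by simp

lemma pint_cmult: "pint (\<lambda>z. c * G z) z p = c * pint G z p" by (simp add: pint_def)

lemma pint_diff: assumes "G holomorphic_on UNIV" "H holomorphic_on UNIV" shows "pint (\<lambda>z. G z - H z) z p = pint G z p - pint H z p"
  unfolding pint_def by (intro integral_diff integrable_continuous_interval pint_continuous assms)

lemma fc_diff: assumes "F holomorphic_on UNIV" "G holomorphic_on UNIV"
  shows "fc (\<lambda>z. F z - G z) n = fc F n - fc G n"
proof -
  have h: "(\<lambda>z. H z * ee (- (of_int n * z))) holomorphic_on UNIV" if "H holomorphic_on UNIV" for H
    by (intro holomorphic_intros that ee_holomorphic)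
  show ?thesis unfolding fc_def left_diff_distrib by (rule pint_diff[OF h[OF assms(1)] h[OF assms(2)]])
qed

lemma fc_exp: "fc (\<lambda>z. ee (of_int m * z)) n = (if m = n then 1 else 0)"
proof -
  have "fc (\<lambda>z. ee (of_int m * z)) n = integral {0..1} (\<lambda>x. ee (of_int (m - n) * of_real x))"
    unfolding fc_def pint_def by (simp add: ee_add[symmetric] algebra_simps)
  also have "\<dots> = (if m = n then 1 else 0)"
  proof (cases "m = n")
    case False
    define c where "c = tpi * of_int (m - n)"
    have c: "c \<noteq> 0" using False by (simp add: c_def)
    have "((\<lambda>x. ee (of_int (m - n) * of_real x) / c) has_vector_derivative ee (of_int (m - n) * of_real x)) (at x within {0..1})" for x
    proof -
      have "((\<lambda>w. ee (of_int (m - n) * w) / c) has_field_derivative ee (of_int (m - n) * of_real x)) (at (of_real x))"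
        using DERIV_cdivide[OF ee_has_field_derivative[of "of_int (m - n)" "of_real x" UNIV], of c] c by (simp add: c_def)
      from has_vector_derivative_real_field[OF this] show ?thesis by (rule has_vector_derivative_at_within)
    qed
    hence "((\<lambda>x. ee (of_int (m - n) * of_real x)) has_integral (ee (of_int (m - n) * of_real 1) / c - ee (of_int (m - n) * of_real 0) / c)) {0..1}"
      by (intro fundamental_theorem_of_calculus) auto
    moreover have "ee (of_int (m - n) * of_real 1) = 1" using ee_of_int[of "m - n"] by simp
    ultimately show ?thesis using False by (simp add: integral_unique del: of_int_diff)
  qed simp
  finally show ?thesis .
qed

lemma ee_eq_iff: "ee z = ee w \<longleftrightarrow> z - w \<in> \<int>"
  using ee_eq_1_iff[of "z - w"] by (simp add: ee_diff)

text \<open>With \<open>H(z) = (D(z) - D(z\<^sub>0)) / (e(z) - e(z\<^sub>0))\<close>, the coefficients of \<open>H\<close> satisfy a first order recursion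
  whose only solution compatible with their decay is \<open>0\<close>.\<close>

lemma fourier_zero:
  assumes D: "D holomorphic_on UNIV" and per: "\<And>z. D (z + 1) = D z" and z: "\<And>n. fc D n = 0"
  shows "D z0 = 0"
proof -
  define \<Lambda> where "\<Lambda> = {z. z - z0 \<in> \<int>}"
  have \<Lambda>: "w - w' \<in> \<int>" if "w \<in> \<Lambda>" "w' \<in> \<Lambda>" for w w'
    using Ints_diff[of "w - z0" "w' - z0"] that by (simp add: \<Lambda>_def)
  have sep: "w = w'" if "w \<in> \<Lambda>" "w' \<in> \<Lambda>" "dist w w' < 1" for w w'
  proof -
    from \<Lambda>[OF that(1,2)] obtain k :: int where k: "w - w' = of_int k" by (auto elim: Ints_cases)
    have "\<bar>of_int k\<bar> < (1::real)" using that(3) by (simp add: dist_norm k)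
    hence "k = 0" by linarith
    with k show ?thesis by simp
  qed
  have Dper: "D (z + of_int k) = D z" for z k
  proof (induction k rule: int_induct[of _ 0])
    case (step1 i) thus ?case using per[of "z + of_int i"] by (simp add: add.assoc)
  next
    case (step2 i) thus ?case using per[of "z + of_int (i - 1)"] by (simp add: add.assoc)
  qed simp
  have D\<Lambda>: "D w = D z0" if "w \<in> \<Lambda>" for w
  proof -
    from that obtain k :: int where "w - z0 = of_int k" by (auto simp: \<Lambda>_def elim: Ints_cases)
    hence "w = z0 + of_int k" by (simp add: algebra_simps)
    thus ?thesis using Dper by simp
  qed
  have ee\<Lambda>: "ee w = ee z0 \<longleftrightarrow> w \<in> \<Lambda>" for w by (simp add: ee_eq_iff \<Lambda>_def)
  define h where "h = (\<lambda>z. (D z - D z0) / (ee z - ee z0))"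
  have hh: "h holomorphic_on (- \<Lambda>)"
  proof -
    have "D holomorphic_on (- \<Lambda>)" by (rule holomorphic_on_subset[OF D]) auto
    thus ?thesis unfolding h_def using ee\<Lambda> by (intro holomorphic_intros ee_holomorphic[of "\<lambda>z. z"]) auto
  qed
  have lim: "((\<lambda>z. (z - w) * h z) \<longlongrightarrow> 0) (at w)" if w: "w \<in> \<Lambda>" for w
  proof -
    have "isCont D w" using holomorphic_on_imp_continuous_on[OF D] by (simp add: continuous_on_eq_continuous_at)
    hence "((\<lambda>z. D z - D z0) \<longlongrightarrow> D w - D z0) (at w)" by (intro tendsto_intros) (simp add: isCont_def)
    hence 1: "((\<lambda>z. D z - D z0) \<longlongrightarrow> 0) (at w)" using D\<Lambda>[OF w] by simp
    have "((\<lambda>z. ee (1 * z)) has_field_derivative tpi * 1 * ee (1 * w)) (at w)" by (rule ee_has_field_derivative)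
    hence "((\<lambda>z. (ee z - ee w) / (z - w)) \<longlongrightarrow> tpi * ee w) (at w)" by (simp add: has_field_derivative_iff)
    from tendsto_divide[OF 1 this] have "((\<lambda>z. (D z - D z0) / ((ee z - ee w) / (z - w))) \<longlongrightarrow> 0) (at w)" by simp
    moreover have "ee w = ee z0" using ee\<Lambda> w by simp
    ultimately show ?thesis by (simp add: h_def mult.commute)
  qed
  have one: "(0::real) < 1" by simp
  define H where "H = remove_sings h"
  have H: "H holomorphic_on UNIV" "\<And>z. z \<notin> \<Lambda> \<Longrightarrow> H z = h z"
    unfolding H_def by (rule remove_sings_separated[OF one _ hh]; blast intro: sep lim)+
  have ev: "\<forall>\<^sub>F z in at w. z \<notin> \<Lambda>" for w by (rule eventually_off_separated[OF one sep])
  note Hc = entire_isCont[OF H(1)] and Dc = entire_isCont[OF D]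
  have Hper: "H (z + 1) = H z" for z
  proof (rule isCont_eq_eventually[of z "\<lambda>z. H (z + 1)" H])
    have "z + 1 \<in> \<Lambda> \<longleftrightarrow> z \<in> \<Lambda>" for z
      using Ints_add[of "z - z0" 1] Ints_diff[of "z + 1 - z0" 1] by (auto simp: \<Lambda>_def algebra_simps)
    thus "\<forall>\<^sub>F z in at z. H (z + 1) = H z" using ev[of z] by (auto simp: H(2) h_def per ee_add elim: eventually_mono)
  qed (auto intro!: isCont_o2[OF _ Hc] continuous_intros Hc)
  have rel: "ee z * H z - ee z0 * H z = D z - D z0" for z
  proof (rule isCont_eq_eventually[of z "\<lambda>z. ee z * H z - ee z0 * H z" "\<lambda>z. D z - D z0"])
    show "\<forall>\<^sub>F z in at z. ee z * H z - ee z0 * H z = D z - D z0" using ev[of z]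
    proof eventually_elim
      case (elim z)
      hence "H z * (ee z - ee z0) = D z - D z0" using ee\<Lambda>[of z] by (simp add: H(2) h_def)
      thus ?case by (simp add: algebra_simps)
    qed
  qed (auto intro!: continuous_intros Hc Dc simp: ee_def)
  define a where "a = fc H"
  have rec: "a (n - 1) - ee z0 * a n = (if n = 0 then - D z0 else 0)" for n
  proof -
    have hol: "(\<lambda>z. ee z * H z) holomorphic_on UNIV" "(\<lambda>z. ee z0 * H z) holomorphic_on UNIV"
      by (intro holomorphic_intros H(1) ee_holomorphic[of "\<lambda>z. z"])+
    have "fc (\<lambda>z. ee z * H z - ee z0 * H z) n = fc (\<lambda>z. ee z * H z) n - fc (\<lambda>z. ee z0 * H z) n"
      by (rule fc_diff[OF hol])
    also have "fc (\<lambda>z. ee z * H z) n = a (n - 1)"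
    proof -
      have "ee z * H z * ee (- (of_int n * z)) = H z * ee (- (of_int (n - 1) * z))" for z
      proof -
        have "ee z * ee (- (of_int n * z)) = ee (- (of_int (n - 1) * z))" by (simp add: ee_add[symmetric] algebra_simps)
        thus ?thesis by (metis mult.assoc mult.commute)
      qed
      thus ?thesis unfolding a_def fc_def by (simp only:)
    qed
    also have "fc (\<lambda>z. ee z0 * H z) n = ee z0 * a n" unfolding a_def fc_def mult.assoc by (rule pint_cmult)
    finally have "a (n - 1) - ee z0 * a n = fc (\<lambda>z. D z - D z0 * ee (of_int 0 * z)) n" unfolding rel by simp
    also have "\<dots> = fc D n - fc (\<lambda>z. D z0 * ee (of_int 0 * z)) n"
      by (rule fc_diff[OF D]) (intro holomorphic_intros ee_holomorphic)
    also have "fc (\<lambda>z. D z0 * ee (of_int 0 * z)) n = D z0 * fc (\<lambda>z. ee (of_int 0 * z)) n"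
      unfolding fc_def mult.assoc by (rule pint_cmult)
    finally show ?thesis unfolding fc_exp z by simp
  qed
  have bound: "\<exists>M. \<forall>n. norm (a n) \<le> M * exp (2 * pi * of_int n * Y)" for Y
  proof -
    have "compact ((\<lambda>x. H (\<i> * of_real Y + of_real x * 1)) ` {0..1::real})"
      by (intro compact_continuous_image pint_continuous[OF H(1)]) auto
    from compact_imp_bounded[OF this] obtain M where M: "\<And>x. x \<in> {0..1::real} \<Longrightarrow> norm (H (\<i> * of_real Y + of_real x * 1)) \<le> M"
      unfolding bounded_iff by (meson imageI)
    have "norm (a n) \<le> M * exp (2 * pi * of_int n * Y)" for n
      unfolding a_def fc_height[OF H(1) Hper, of n "\<i> * of_real Y"]
    proof (rule norm_pint_le)
      show "(\<lambda>z. H z * ee (- (of_int n * z))) holomorphic_on UNIV" by (intro holomorphic_intros H(1) ee_holomorphic)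
      fix x :: real assume "x \<in> {0..1}"
      from M[OF this] show "norm (H (\<i> * of_real Y + of_real x * 1) * ee (- (of_int n * (\<i> * of_real Y + of_real x * 1)))) \<le> M * exp (2 * pi * of_int n * Y)"
        by (simp add: norm_mult norm_ee mult_right_mono mult.assoc)
    qed
    thus ?thesis by blast
  qed
  have zero: "x = 0" if "\<And>n::nat. norm x \<le> M * exp (- 2 * pi * real n)" for x :: complex and M
  proof -
    have "(\<lambda>n. M * exp (- 2 * pi) ^ n) \<longlonglongrightarrow> M * 0" by (intro tendsto_intros LIMSEQ_realpow_zero) auto
    moreover have "exp (- 2 * pi) ^ n = exp (- 2 * pi * real n)" for n by (simp add: exp_of_nat_mult[symmetric] mult.commute)
    ultimately have "norm x \<le> M * 0" by (intro LIMSEQ_le_const) (use that in auto)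
    thus ?thesis by simp
  qed
  have a0: "a 0 = 0"
  proof -
    have pos: "a (int n) = inverse (ee z0) ^ n * a 0" for n
    proof (induction n)
      case (Suc n)
      have "a (int n) = ee z0 * a (int (Suc n))" using rec[of "int (Suc n)"] by simp
      hence "a (int (Suc n)) = inverse (ee z0) * a (int n)" by simp
      thus ?case using Suc.IH by simp
    qed simp
    obtain M where M: "\<And>n. norm (a n) \<le> M * exp (2 * pi * of_int n * (Im z0 - 1))" using bound by blast
    show ?thesis
    proof (rule zero)
      fix n :: nat
      have "norm (ee z0) ^ n * norm (a (int n)) = norm (a 0)" unfolding pos by (simp add: norm_mult norm_power norm_inverse power_inverse)
      moreover have "norm (ee z0) ^ n * norm (a (int n)) \<le> norm (ee z0) ^ n * (M * exp (2 * pi * of_int (int n) * (Im z0 - 1)))"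
        by (intro mult_left_mono M) auto
      moreover have "norm (ee z0) ^ n * exp (2 * pi * of_int (int n) * (Im z0 - 1)) = exp (- 2 * pi * real n)"
        unfolding norm_ee exp_of_nat_mult[symmetric] exp_add[symmetric] by (simp add: algebra_simps)
      ultimately show "norm (a 0) \<le> M * exp (- 2 * pi * real n)" by (simp add: mult.left_commute)
    qed
  qed
  have a1: "a (- 1) = 0"
  proof -
    have neg: "a (- 1 - int n) = ee z0 ^ n * a (- 1)" for n
    proof (induction n)
      case (Suc n)
      have "a (- 1 - int (Suc n)) = ee z0 * a (- 1 - int n)" using rec[of "- 1 - int n"] by (simp add: algebra_simps)
      thus ?case using Suc.IH by simp
    qed simp
    obtain M where M: "\<And>n. norm (a n) \<le> M * exp (2 * pi * of_int n * (Im z0 + 1))" using bound by blast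
    show ?thesis
    proof (rule zero)
      fix n :: nat
      have nz: "norm (ee z0) > 0" by simp
      have "inverse (norm (ee z0)) ^ n * norm (a (- 1 - int n)) = norm (a (- 1))" unfolding neg using nz
        by (simp add: norm_mult norm_power field_simps)
      moreover have "inverse (norm (ee z0)) ^ n * norm (a (- 1 - int n)) \<le> inverse (norm (ee z0)) ^ n * (M * exp (2 * pi * of_int (- 1 - int n) * (Im z0 + 1)))"
        by (intro mult_left_mono M) auto
      moreover have "inverse (norm (ee z0)) ^ n * exp (2 * pi * of_int (- 1 - int n) * (Im z0 + 1)) = exp (- 2 * pi * (Im z0 + 1)) * exp (- 2 * pi * real n)"
        unfolding norm_ee exp_minus[symmetric] exp_of_nat_mult[symmetric] exp_add[symmetric] by (simp add: algebra_simps)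
      ultimately show "norm (a (- 1)) \<le> M * exp (- 2 * pi * (Im z0 + 1)) * exp (- 2 * pi * real n)" by (simp add: mult.left_commute mult.assoc)
    qed
  qed
  \<comment> \<open>The value D z0 is the inhomogeneity of the recursion, present only at n = 0,
    where it links a (-1) and a 0.\<close>
  show ?thesis using rec[of 0] a0 a1 by simp
qed

section \<open>Interchanging sums with integrals, and unfolding unit intervals to the real
  line\<close>

lemma infsum_integral:
  fixes f :: "'i \<Rightarrow> real \<Rightarrow> complex"
  assumes cont: "\<And>i. i \<in> I \<Longrightarrow> continuous_on {0..1} (f i)"
    and M: "M summable_on I" "\<And>i x. i \<in> I \<Longrightarrow> x \<in> {0..1} \<Longrightarrow> norm (f i x) \<le> M i"
  shows "((\<lambda>i. integral {0..1} (f i)) has_sum integral {0..1} (\<lambda>x. \<Sum>\<^sub>\<infinity>i\<in>I. f i x)) I"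
proof -
  let ?F = "finite_subsets_at_top I"
  have ul: "uniform_limit {0..1} (\<lambda>X x. \<Sum>i\<in>X. f i x) (\<lambda>x. \<Sum>\<^sub>\<infinity>i\<in>I. f i x) ?F"
    by (rule Weierstrass_m_test_general[OF M(2,1)])
  have ev: "\<forall>\<^sub>F X in ?F. finite X \<and> X \<subseteq> I" by (rule eventually_finite_subsets_at_top_weakI) auto
  have evc: "\<forall>\<^sub>F X in ?F. continuous_on {0..1} (\<lambda>x. \<Sum>i\<in>X. f i x)"
    using ev by eventually_elim (auto intro!: continuous_on_sum cont)
  have c: "continuous_on {0..1} (\<lambda>x. \<Sum>\<^sub>\<infinity>i\<in>I. f i x)"
    by (rule uniform_limit_theorem[OF evc ul]) simp
  have int: "((\<lambda>X. integral {0..1} (\<lambda>x. \<Sum>i\<in>X. f i x)) \<longlongrightarrow> integral {0..1} (\<lambda>x. \<Sum>\<^sub>\<infinity>i\<in>I. f i x)) ?F"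
  proof (rule tendstoI)
    fix e :: real assume e: "e > 0"
    have "\<forall>\<^sub>F X in ?F. \<forall>x\<in>{0..1}. dist (\<Sum>i\<in>X. f i x) (\<Sum>\<^sub>\<infinity>i\<in>I. f i x) < e / 2"
      using uniform_limitD[OF ul, of "e / 2"] e by simp
    with evc show "\<forall>\<^sub>F X in ?F. dist (integral {0..1} (\<lambda>x. \<Sum>i\<in>X. f i x)) (integral {0..1} (\<lambda>x. \<Sum>\<^sub>\<infinity>i\<in>I. f i x)) < e"
    proof eventually_elim
      case (elim X)
      have "integral {0..1} (\<lambda>x. \<Sum>i\<in>X. f i x) - integral {0..1} (\<lambda>x. \<Sum>\<^sub>\<infinity>i\<in>I. f i x) = integral {0..1} (\<lambda>x. (\<Sum>i\<in>X. f i x) - (\<Sum>\<^sub>\<infinity>i\<in>I. f i x))"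
        by (rule integral_diff[symmetric]) (intro integrable_continuous_interval elim c)+
      also have "norm \<dots> \<le> e / 2 * (1 - 0)"
        by (rule integral_bound) (use elim c in \<open>auto intro!: continuous_on_diff simp: dist_norm less_imp_le\<close>)
      finally show ?case using e by (simp add: dist_norm)
    qed
  qed
  have "\<forall>\<^sub>F X in ?F. integral {0..1} (\<lambda>x. \<Sum>i\<in>X. f i x) = (\<Sum>i\<in>X. integral {0..1} (f i))"
    using ev by eventually_elim (rule integral_sum, auto intro!: integrable_continuous_interval cont)
  from Lim_transform_eventually[OF int this] show ?thesis by (simp add: has_sum_def)
qed

lemma has_sum_int_limit:
  assumes "(f has_sum s) (UNIV :: int set)"
  shows "(\<lambda>m. \<Sum>j\<in>{- int m..<int m}. f j) \<longlonglongrightarrow> s"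
proof -
  have "filterlim (\<lambda>m. {- int m..<int m}) (finite_subsets_at_top UNIV) sequentially"
    unfolding filterlim_finite_subsets_at_top
  proof (intro allI impI)
    fix X :: "int set" assume "finite X \<and> X \<subseteq> UNIV"
    then obtain K where K: "\<And>x. x \<in> X \<Longrightarrow> \<bar>x\<bar> \<le> K" using finite_has_maximal[of "abs ` X"]
      by (metis bdd_above_def bdd_above_finite finite_imageI imageI)
    have "\<forall>m\<ge>nat (K + 1). finite {- int m..<int m} \<and> X \<subseteq> {- int m..<int m} \<and> {- int m..<int m} \<subseteq> UNIV"
      using K by force
    thus "\<forall>\<^sub>F m in sequentially. finite {- int m..<int m} \<and> X \<subseteq> {- int m..<int m} \<and> {- int m..<int m} \<subseteq> UNIV"
      unfolding eventually_sequentially by blast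
  qed
  from filterlim_compose[OF assms[unfolded has_sum_def] this] show ?thesis .
qed

lemma sum_unit_integrals:
  fixes g :: "real \<Rightarrow> complex"
  assumes "continuous_on UNIV g"
  shows "(\<Sum>j\<in>{- int m..<int m}. integral {0..1} (\<lambda>x. g (x + c + of_int j))) = integral {c - real m..c + real m} g"
proof (induction m)
  case (Suc m)
  have i: "g integrable_on {a..b}" for a b by (rule integrable_continuous_interval) (rule continuous_on_subset[OF assms], simp)
  have sh: "integral {0..1} (\<lambda>x. g (x + t)) = integral {t..t + 1} g" for t
    using integral_shift[of 0 t 1 g] continuous_on_subset[OF assms] by (simp add: add.commute o_def)
  have "{- int (Suc m)..<int (Suc m)} = insert (- int (Suc m)) (insert (int m) {- int m..<int m})" by auto
  hence "(\<Sum>j\<in>{- int (Suc m)..<int (Suc m)}. integral {0..1} (\<lambda>x. g (x + c + of_int j))) =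
     integral {0..1} (\<lambda>x. g (x + c + of_int (- int (Suc m)))) + (integral {0..1} (\<lambda>x. g (x + c + of_int (int m))) + integral {c - real m..c + real m} g)"
    using Suc.IH by simp
  also have "integral {0..1} (\<lambda>x. g (x + c + of_int (- int (Suc m)))) = integral {c - real (Suc m)..c - real m} g"
    using sh[of "c - real (Suc m)"] by (simp add: algebra_simps)
  also have "integral {0..1} (\<lambda>x. g (x + c + of_int (int m))) = integral {c + real m..c + real (Suc m)} g"
    using sh[of "c + real m"] by (simp add: algebra_simps)
  also have "integral {c - real (Suc m)..c - real m} g + (integral {c + real m..c + real (Suc m)} g + integral {c - real m..c + real m} g) = integral {c - real (Suc m)..c + real (Suc m)} g"
  proof -
    have "integral {c - real (Suc m)..c - real m} g + integral {c - real m..c + real m} g = integral {c - real (Suc m)..c + real m} g"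
      by (rule Henstock_Kurzweil_Integration.integral_combine) (auto intro!: i)
    moreover have "integral {c - real (Suc m)..c + real m} g + integral {c + real m..c + real (Suc m)} g = integral {c - real (Suc m)..c + real (Suc m)} g"
      by (rule Henstock_Kurzweil_Integration.integral_combine) (auto intro!: i)
    ultimately show ?thesis by (metis add.assoc add.commute)
  qed
  finally show ?case .
qed simp

lemma tendsto_integral_UNIV:
  fixes g :: "real \<Rightarrow> complex"
  assumes "integrable lborel g"
  shows "(\<lambda>m. integral {c - real m..c + real m} g) \<longlonglongrightarrow> (LINT x|lborel. g x)"
proof -
  have "(\<lambda>m. LINT x|lborel. indicator {c - real m..c + real m} x *\<^sub>R g x) \<longlonglongrightarrow> (LINT x|lborel. g x)"
  proof (rule integral_dominated_convergence[where w="\<lambda>x. norm (g x)"])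
    show "AE x in lborel. (\<lambda>m. indicator {c - real m..c + real m} x *\<^sub>R g x) \<longlonglongrightarrow> g x"
    proof (rule AE_I2)
      fix x
      obtain m0 :: nat where m0: "\<bar>x - c\<bar> \<le> real m0" using real_arch_simple by blast
      have "\<forall>\<^sub>F m in sequentially. indicator {c - real m..c + real m} x *\<^sub>R g x = g x"
        using eventually_ge_at_top[of m0] by eventually_elim (use m0 in \<open>auto split: split_indicator simp: abs_le_iff\<close>)
      thus "(\<lambda>m. indicator {c - real m..c + real m} x *\<^sub>R g x) \<longlonglongrightarrow> g x" by (rule tendsto_eventually)
    qed
  qed (use assms in \<open>auto split: split_indicator\<close>)
  moreover have "(LINT x|lborel. indicator {c - real m..c + real m} x *\<^sub>R g x) = integral {c - real m..c + real m} g" for m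
    using set_borel_integral_eq_integral(2)[of "{c - real m..c + real m}" g] integrable_mult_indicator[OF _ assms, of "{c - real m..c + real m}"]
    by (simp add: set_lebesgue_integral_def set_integrable_def)
  ultimately show ?thesis by simp
qed

text \<open>The sum is known to exist, so it may be evaluated along symmetric ranges of j, where the
  unit intervals fit together to a growing interval about c.\<close>

lemma has_sum_unfold:
  fixes g :: "real \<Rightarrow> complex"
  assumes "continuous_on UNIV g" "integrable lborel g" "((\<lambda>j. integral {0..1} (\<lambda>x. g (x + c + of_int j))) has_sum s) (UNIV :: int set)"
  shows "s = (LINT x|lborel. g x)"
  using has_sum_int_limit[OF assms(3)] tendsto_integral_UNIV[OF assms(2), of c]
  unfolding sum_unit_integrals[OF assms(1)] by (rule LIMSEQ_unique)

subsection \<open>Gaussian integrals\<close>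

lemma gaussian_real: assumes "a > 0" shows "integrable lborel (\<lambda>x::real. exp (- a * x^2))" "(LINT x|lborel. exp (- a * x^2)) = sqrt (pi / a)"
proof -
  have e: "exp (- (0 + sqrt a * x)\<^sup>2) = exp (- a * x^2)" for x using assms by (simp add: power_mult_distrib)
  show "integrable lborel (\<lambda>x::real. exp (- a * x^2))"
    using lborel_integrable_real_affine[of "\<lambda>x::real. exp (- x\<^sup>2)" "sqrt a" 0] integrable_gauss assms unfolding e by auto
  have "sqrt pi = sqrt a * (LINT x|lborel. exp (- a * x^2))"
    using lborel_integral_real_affine[of "sqrt a" "\<lambda>x::real. exp (- x\<^sup>2)" 0] integral_gauss assms unfolding e by simp
  thus "(LINT x|lborel. exp (- a * x^2)) = sqrt (pi / a)" using assms by (simp add: real_sqrt_divide field_simps)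
qed

lemma norm_exp_gauss: "norm (exp (- a * of_real (x^2))) = exp (- Re a * x^2)" for x :: real
  by (simp add: norm_exp_eq_Re)

lemma integrable_gauss_complex: assumes "Re a > 0" shows "integrable lborel (\<lambda>x::real. exp (- a * of_real (x^2)))"
proof (rule Bochner_Integration.integrable_bound[OF gaussian_real(1)[OF assms]])
  show "(\<lambda>x::real. exp (- a * of_real (x^2))) \<in> borel_measurable lborel"
    by measurable
qed (simp add: norm_exp_gauss)

text \<open>Both sides are holomorphic on the right half plane and agree on the positive reals.
  Analytic continuation thus also settles the branch of the square root.\<close>

lemma gaussian_complex:
  assumes a: "Re a > 0"
  shows "(LINT x|lborel. exp (- a * of_real ((x::real)^2))) = csqrt (of_real pi / a)"
proof -
  define S where "S = {a::complex. Re a > 0}"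
  define J where "J = (\<lambda>a::complex. LINT x|lborel. exp (- a * of_real ((x::real)^2)))"
  define Jn where "Jn = (\<lambda>(n::nat) (a::complex). integral {- real n..real n} (\<lambda>x. exp (- a * of_real ((x::real)^2))))"
  have S: "open S" "connected S" by (auto simp: S_def open_halfspace_Re_gt convex_halfspace_Re_gt convex_connected)
  have Jn_hol: "Jn n holomorphic_on S" for n
  proof -
    have "(\<lambda>a. integral (cbox (- real n) (real n)) (\<lambda>x. exp (- a * of_real ((x::real)^2)))) holomorphic_on S"
    proof (rule leibniz_rule_holomorphic[where fx="\<lambda>a x. - of_real (x^2) * exp (- a * of_real (x^2))"])
      show "((\<lambda>a. exp (- a * of_real (t^2))) has_field_derivative - of_real (t^2) * exp (- a * of_real (t^2))) (at a within S)" for a t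
        by (auto intro!: derivative_eq_intros)
      show "continuous_on (S \<times> cbox (- real n) (real n)) (\<lambda>(a, x). - of_real (x^2) * exp (- a * of_real (x^2)))"
        unfolding case_prod_unfold by (intro continuous_intros)
      show "(\<lambda>x. exp (- a * of_real (x^2))) integrable_on cbox (- real n) (real n)" for a :: complex
        by (intro integrable_continuous continuous_intros)
    qed (use S in \<open>auto simp: S_def convex_halfspace_Re_gt\<close>)
    thus ?thesis by (simp add: Jn_def)
  qed
  have J_hol: "J holomorphic_on S"
  proof (rule holomorphic_uniform_sequence[OF S(1) Jn_hol])
    fix a assume "a \<in> S"
    define d where "d = Re a / 2"
    have d: "d > 0" using \<open>a \<in> S\<close> by (simp add: d_def S_def)
    have Re: "Re b \<ge> d" if "b \<in> cball a d" for b
      using that abs_Re_le_cmod[of "a - b"] by (auto simp: dist_norm d_def)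
    \<comment> \<open>The truncation error at the real parameter d = Re a / 2. It dominates the
      error at every b in the disc, because Re b >= d there.\<close>
    define r where "r = (\<lambda>n::nat. (LINT x|lborel. exp (- d * x^2)) - integral {- real n..real n} (\<lambda>x. exp (- d * x^2)))"
    have le: "norm (Jn n b - J b) \<le> r n" if b: "b \<in> cball a d" for n b
    proof -
      let ?A = "{- real n..real n}"
      have Rb: "Re b > 0" using Re[OF b] d by linarith
      have ib: "integrable lborel (\<lambda>x. exp (- b * of_real (x^2)))" by (rule integrable_gauss_complex[OF Rb])
      have id: "integrable lborel (\<lambda>x. exp (- d * x^2))" by (rule gaussian_real(1)[OF d])
      have 1: "Jn n b = (LINT x|lborel. indicator ?A x *\<^sub>R exp (- b * of_real (x^2)))" unfolding Jn_def
        using set_borel_integral_eq_integral(2)[of ?A "\<lambda>x. exp (- b * of_real (x^2))"] integrable_mult_indicator[OF _ ib, of ?A]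
        by (simp add: set_lebesgue_integral_def set_integrable_def)
      have 2: "integral ?A (\<lambda>x. exp (- d * x^2)) = (LINT x|lborel. indicator ?A x *\<^sub>R exp (- d * x^2))"
        using set_borel_integral_eq_integral(2)[of ?A "\<lambda>x. exp (- d * x^2)"] integrable_mult_indicator[OF _ id, of ?A]
        by (simp add: set_lebesgue_integral_def set_integrable_def)
      have iA: "integrable lborel (\<lambda>x. indicator ?A x *\<^sub>R exp (- b * of_real (x^2)))" "integrable lborel (\<lambda>x. indicator ?A x *\<^sub>R exp (- d * x^2))"
        by (rule integrable_mult_indicator[OF _ ib], simp) (rule integrable_mult_indicator[OF _ id], simp)
      have "norm (J b - Jn n b) = norm (LINT x|lborel. exp (- b * of_real (x^2)) - indicator ?A x *\<^sub>R exp (- b * of_real (x^2)))"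
        unfolding 1 J_def using Bochner_Integration.integral_diff[OF ib iA(1)] by simp
      also have "\<dots> \<le> (LINT x|lborel. exp (- d * x^2) - indicator ?A x *\<^sub>R exp (- d * x^2))"
      proof (rule Bochner_Integration.integral_norm_bound_integral)
        fix x :: real
        have "norm (exp (- b * of_real (x^2))) \<le> exp (- d * x^2)"
          unfolding norm_exp_gauss using mult_right_mono[OF Re[OF b], of "x^2"] by simp
        thus "norm (exp (- b * of_real (x^2)) - indicator ?A x *\<^sub>R exp (- b * of_real (x^2))) \<le> exp (- d * x^2) - indicator ?A x *\<^sub>R exp (- d * x^2)"
          by (auto split: split_indicator)
      qed (intro Bochner_Integration.integrable_diff ib id iA)+
      also have "\<dots> = r n" unfolding r_def 2 by (rule Bochner_Integration.integral_diff[OF id iA(2)])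
      finally show ?thesis by (simp add: norm_minus_commute)
    qed
    have "r \<longlonglongrightarrow> 0"
    proof -
      have "(\<lambda>n. integral {0 - real n..0 + real n} (\<lambda>x. complex_of_real (exp (- d * x^2)))) \<longlonglongrightarrow> (LINT x|lborel. complex_of_real (exp (- d * x^2)))"
        by (rule tendsto_integral_UNIV) (use gaussian_real(1)[OF d] in simp)
      moreover have "integral {- real n..real n} (\<lambda>x. complex_of_real (exp (- d * x^2))) = of_real (integral {- real n..real n} (\<lambda>x. exp (- d * x^2)))" for n
        by (intro integral_unique has_integral_of_real integrable_integral integrable_continuous_interval continuous_intros)
      ultimately have "(\<lambda>n. complex_of_real (integral {- real n..real n} (\<lambda>x. exp (- d * x^2)))) \<longlonglongrightarrow> of_real (LINT x|lborel. exp (- d * x^2))"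
        by simp
      hence "(\<lambda>n. integral {- real n..real n} (\<lambda>x. exp (- d * x^2))) \<longlonglongrightarrow> (LINT x|lborel. exp (- d * x^2))" by (simp only: tendsto_of_real_iff)
      from tendsto_diff[OF tendsto_const this, of "LINT x|lborel. exp (- d * x^2)"] show ?thesis unfolding r_def by simp
    qed
    hence "uniform_limit (cball a d) Jn J sequentially"
    proof (intro uniform_limitI)
      fix e :: real assume "e > 0"
      with \<open>r \<longlonglongrightarrow> 0\<close> have "\<forall>\<^sub>F n in sequentially. r n < e" by (rule order_tendstoD)
      thus "\<forall>\<^sub>F n in sequentially. \<forall>b\<in>cball a d. dist (Jn n b) (J b) < e"
      proof eventually_elim
        case (elim n)
        show ?case
        proof
          fix b assume "b \<in> cball a d"
          from le[OF this, of n] elim show "dist (Jn n b) (J b) < e" by (simp add: dist_norm)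
        qed
      qed
    qed
    moreover have "cball a d \<subseteq> S" using Re d by (force simp: S_def)
    ultimately show "\<exists>d>0. cball a d \<subseteq> S \<and> uniform_limit (cball a d) Jn J sequentially" using d by blast
  qed
  have c_hol: "(\<lambda>a. csqrt (of_real pi / a)) holomorphic_on S"
  proof (rule holomorphic_on_csqrt')
    fix a assume "a \<in> S"
    hence "Re (of_real pi / a) > 0" by (simp add: S_def Re_divide divide_pos_pos sum_power2_gt_zero_iff)
    thus "of_real pi / a \<notin> \<real>\<^sub>\<le>\<^sub>0" by (auto simp: complex_nonpos_Reals_iff)
  qed (auto intro!: holomorphic_intros simp: S_def)
  have "J a - csqrt (of_real pi / a) = 0"
  proof (rule analytic_continuation[of "\<lambda>a. J a - csqrt (of_real pi / a)" S "{x. Im x = 0 \<and> Re x > 0}" 1])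
    show "(\<lambda>a. J a - csqrt (of_real pi / a)) holomorphic_on S" by (intro holomorphic_intros J_hol c_hol)
    show "1 islimpt {x. Im x = 0 \<and> Re x > 0}"
      unfolding islimpt_approachable
    proof (intro allI impI)
      fix e :: real assume "e > 0"
      thus "\<exists>x'\<in>{x. Im x = 0 \<and> Re x > 0}. x' \<noteq> 1 \<and> dist x' (1::complex) < e"
        by (intro bexI[of _ "of_real (1 + e / 2)"]) (auto simp: dist_norm complex_eq_iff cmod_def)
    qed
    fix x :: complex assume "x \<in> {x. Im x = 0 \<and> Re x > 0}"
    then obtain t where t: "x = of_real t" "t > 0" by (auto simp: complex_eq_iff intro!: that[of "Re x"])
    have "J x = (LINT y|lborel. complex_of_real (exp (- t * y^2)))" unfolding J_def t(1)
      by (intro Bochner_Integration.integral_cong refl) (simp flip: exp_of_real)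
    also have "\<dots> = of_real (sqrt (pi / t))" using gaussian_real(2)[OF t(2)] by simp
    also have "\<dots> = csqrt (of_real pi / x)" using t by (simp flip: of_real_divide of_real_sqrt)
    finally show "J x - csqrt (of_real pi / x) = 0" by simp
  qed (use S a in \<open>auto simp: S_def\<close>)
  thus ?thesis by (simp add: J_def)
qed

section \<open>Theta decomposition\<close>

text \<open>The Fourier coefficient with its Gaussian q^(n^2/4N) removed. For functions with the
  index N translation law it depends only on n modulo 2N and is the theta coefficient.\<close>

definition tc :: "nat \<Rightarrow> complex \<Rightarrow> (complex \<Rightarrow> complex) \<Rightarrow> int \<Rightarrow> complex" where
  "tc N t F n = ee (- (of_int (n^2) / of_nat (4 * N) * t)) * fc F n"

lemma fc_tc: "fc F n = ee (of_int (n^2) / of_nat (4 * N) * t) * tc N t F n"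
  unfolding tc_def by (simp add: ee_minus)

context
  fixes N :: nat and t :: complex and F :: "complex \<Rightarrow> complex"
  assumes N: "N > 0" and t: "t \<in> uhp" and F: "F holomorphic_on UNIV"
    and F1: "\<And>z. F (z + 1) = F z" and Ft: "\<And>z. F (z + t) = ee (- (of_nat N * t) - of_nat (2 * N) * z) * F z"
begin

text \<open>The coefficient is computed on the line through t instead of the line through 0, and the
  translation law brings it back with the index raised by 2N.\<close>

lemma fc_shift: "fc F (n + 2 * int N) = ee ((of_nat N + of_int n) * t) * fc F n"
proof -
  have "fc F n = pint (\<lambda>z. F z * ee (- (of_int n * z))) t 1" by (rule fc_height[OF F F1])
  also have "\<dots> = pint (\<lambda>z. ee (- ((of_nat N + of_int n) * t)) * (F z * ee (- (of_int (n + 2 * int N) * z)))) 0 1"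
    unfolding pint_def
  proof (rule integral_cong)
    fix x :: real
    define z where "z = 0 + of_real x * (1::complex)"
    have 1: "t + of_real x * 1 = z + t" by (simp add: z_def)
    have "ee (- (of_nat N * t) - of_nat (2 * N) * z) * ee (- (of_int n * (z + t))) = ee (- ((of_nat N + of_int n) * t)) * ee (- (of_int (n + 2 * int N) * z))"
      unfolding ee_add[symmetric] by (rule arg_cong[of _ _ ee]) (simp add: algebra_simps)
    thus "F (t + of_real x * 1) * ee (- (of_int n * (t + of_real x * 1))) =
      ee (- ((of_nat N + of_int n) * t)) * (F (0 + of_real x * 1) * ee (- (of_int (n + 2 * int N) * (0 + of_real x * 1))))"
      unfolding 1 Ft z_def[symmetric] by (simp add: mult_ac)
  qed
  also have "\<dots> = ee (- ((of_nat N + of_int n) * t)) * fc F (n + 2 * int N)" unfolding pint_cmult fc_def ..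
  finally show ?thesis by (simp add: ee_minus)
qed

lemma tc_shift: "tc N t F (n + 2 * int N) = tc N t F n"
proof -
  have "ee (- (of_int ((n + 2 * int N)^2) / of_nat (4 * N) * t)) * ee ((of_nat N + of_int n) * t) = ee (- (of_int (n^2) / of_nat (4 * N) * t))"
    unfolding ee_add[symmetric] using N by (intro arg_cong[of _ _ ee]) (simp add: field_simps power2_eq_square)
  thus ?thesis unfolding tc_def fc_shift by (simp add: mult.assoc[symmetric])
qed

lemma tc_shift_mult: "tc N t F (n + 2 * int N * j) = tc N t F n"
proof (induction j rule: int_induct[of _ 0])
  case (step1 i) thus ?case using tc_shift[of "n + 2 * int N * i"] by (simp add: algebra_simps)
next
  case (step2 i) thus ?case using tc_shift[of "n + 2 * int N * (i - 1)"] by (simp add: algebra_simps)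
qed simp

lemma tc_mod: "tc N t F n = tc N t F (n mod (2 * int N))"
  using tc_shift_mult[of "n mod (2 * int N)" "n div (2 * int N)"] by simp

lemma tc_bounded: "\<exists>C\<ge>0. \<forall>n. norm (tc N t F n) \<le> C"
proof -
  define C where "C = Max ((\<lambda>n. norm (tc N t F n)) ` {0..<2 * int N})"
  have "norm (tc N t F n) \<le> C" for n
  proof -
    have "n mod (2 * int N) \<in> {0..<2 * int N}" using N by simp
    hence "norm (tc N t F (n mod (2 * int N))) \<le> C" unfolding C_def by (intro Max_ge) auto
    thus ?thesis using tc_mod[of n] by simp
  qed
  moreover from this[of 0] have "C \<ge> 0" using norm_ge_zero order_trans by blast
  ultimately show ?thesis by blast
qed

text \<open>By periodicity there are only finitely many values of \<open>tc\<close>, so a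
  coefficient decays like a Gaussian in n. Completing the square absorbs the exponential growth of
  ee (n z) into the constant D.\<close>

lemma fc_majorant: "\<exists>M. M summable_on UNIV \<and> (\<forall>n. \<forall>z. norm z \<le> R \<longrightarrow> norm (fc F n * ee (of_int n * z)) \<le> M n)"
proof -
  obtain C where C: "C \<ge> 0" "\<And>n. norm (tc N t F n) \<le> C" using tc_bounded by blast
  have v: "Im t > 0" using t by (simp add: uhp_def)
  define b where "b = pi * Im t / (2 * real N)"
  have b: "b > 0" using v N by (simp add: b_def)
  define D where "D = (2 * pi * R)^2 / (2 * b)"
  define M where "M = (\<lambda>n. C * exp D * exp (- b / 2) ^ nat \<bar>n\<bar>)"
  have "M summable_on UNIV" unfolding M_def by (rule summable_int_geometric) (use b in auto)
  moreover have "norm (fc F n * ee (of_int n * z)) \<le> M n" if z: "norm z \<le> R" for n z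
  proof -
    define m where "m = \<bar>real_of_int n\<bar>"
    have m2: "(real_of_int n)^2 = m^2" by (simp add: m_def)
    have "norm (fc F n * ee (of_int n * z)) = norm (tc N t F n) * exp (- b * m^2 - 2 * pi * (of_int n * Im z))"
      unfolding fc_tc[of F n N t] norm_mult norm_ee using N by (simp add: b_def exp_add[symmetric] m2[symmetric] field_simps flip: exp_minus)
    also have "\<dots> \<le> C * exp (- b * m^2 - 2 * pi * (of_int n * Im z))" by (intro mult_right_mono C) auto
    also have "- b * m^2 - 2 * pi * (of_int n * Im z) \<le> D + real (nat \<bar>n\<bar>) * (- b / 2)"
    proof -
      have "- (of_int n * Im z) \<le> m * R"
      proof -
        have "- (of_int n * Im z) \<le> \<bar>of_int n * Im z\<bar>" by simp
        also have "\<dots> \<le> m * R" unfolding abs_mult m_def using abs_Im_le_cmod[of z] z by (intro mult_left_mono) auto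
        finally show ?thesis .
      qed
      hence 1: "- 2 * pi * (of_int n * Im z) \<le> 2 * pi * (m * R)" using mult_left_mono[of _ _ "2 * pi"] by fastforce
      have 2: "m * (2 * pi * R) \<le> b / 2 * m^2 + D"
      proof -
        have "0 \<le> (b * m - 2 * pi * R)^2 / (2 * b)" using b by simp
        also have "\<dots> = b / 2 * m^2 + D - m * (2 * pi * R)" using b by (simp add: D_def field_simps power2_eq_square)
        finally show ?thesis by simp
      qed
      have 3: "m \<le> m^2"
      proof -
        have "\<bar>n\<bar> \<le> \<bar>n\<bar> * \<bar>n\<bar>" using mult_left_mono[of 1 "\<bar>n\<bar>" "\<bar>n\<bar>"] by (cases "n = 0") auto
        hence "real_of_int \<bar>n\<bar> \<le> real_of_int (\<bar>n\<bar> * \<bar>n\<bar>)" by (simp only: of_int_le_iff)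
        thus ?thesis by (simp add: m_def power2_eq_square)
      qed
      have 4: "b / 2 * m \<le> b / 2 * m^2" using 3 b by (intro mult_left_mono) auto
      have "real (nat \<bar>n\<bar>) = m" by (simp add: m_def)
      thus ?thesis using 1 2 4 by (simp add: algebra_simps)
    qed
    hence "C * exp (- b * m^2 - 2 * pi * (of_int n * Im z)) \<le> C * exp (D + real (nat \<bar>n\<bar>) * (- b / 2))" using C(1) by (intro mult_left_mono) auto
    also have "\<dots> = M n" unfolding M_def exp_add exp_of_nat_mult by simp
    finally show ?thesis by simp
  qed
  ultimately show ?thesis by blast
qed

text \<open>The series converges to an entire function with the same coefficients as F, and
  \<open>fourier_zero\<close> identifies the two.\<close>

lemma fourier_expansion: "F z = (\<Sum>\<^sub>\<infinity>n. fc F n * ee (of_int n * z))"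
proof -
  define G where "G = (\<lambda>z. \<Sum>\<^sub>\<infinity>n. fc F n * ee (of_int n * z))"
  have G: "G holomorphic_on UNIV" unfolding G_def
  proof (rule infsum_holomorphic[OF open_UNIV])
    show "(\<lambda>z. fc F n * ee (of_int n * z)) holomorphic_on UNIV" for n by (intro holomorphic_intros ee_holomorphic)
    fix z :: complex
    obtain M where M: "M summable_on UNIV" "\<And>n w. norm w \<le> norm z + 1 \<Longrightarrow> norm (fc F n * ee (of_int n * w)) \<le> M n"
      using fc_majorant[of "norm z + 1"] by blast
    have "norm w \<le> norm z + 1" if "w \<in> cball z 1" for w
      using that norm_triangle_ineq2[of w z] by (simp add: dist_norm norm_minus_commute)
    with M show "\<exists>r>0. \<exists>M. cball z r \<subseteq> UNIV \<and> M summable_on UNIV \<and> (\<forall>n\<in>UNIV. \<forall>w\<in>cball z r. norm (fc F n * ee (of_int n * w)) \<le> M n)"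
      by (intro exI[of _ 1] conjI exI[of _ M]) auto
  qed
  have G1: "G (z + 1) = G z" for z
  proof -
    have "ee (of_int n * (z + 1)) = ee (of_int n * z)" for n by (simp add: distrib_left ee_add)
    thus ?thesis by (simp add: G_def)
  qed
  have fcG: "fc G m = fc F m" for m
  proof -
    obtain M where M: "M summable_on UNIV" "\<And>n w. norm w \<le> 1 \<Longrightarrow> norm (fc F n * ee (of_int n * w)) \<le> M n"
      using fc_majorant[of 1] by blast
    let ?f = "\<lambda>n x. fc F n * ee (of_int n * of_real x) * ee (- (of_int m * of_real x))"
    have "((\<lambda>n. integral {0..1} (?f n)) has_sum integral {0..1} (\<lambda>x. \<Sum>\<^sub>\<infinity>n\<in>UNIV. ?f n x)) UNIV"
    proof (rule infsum_integral[OF _ M(1)])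
      show "continuous_on {0..1} (?f n)" for n unfolding ee_def by (intro continuous_intros)
      fix n :: int and x :: real assume "x \<in> {0..1}"
      thus "norm (?f n x) \<le> M n" using M(2)[of "of_real x" n] by (simp add: norm_mult norm_ee)
    qed
    moreover have "integral {0..1} (\<lambda>x. \<Sum>\<^sub>\<infinity>n\<in>UNIV. ?f n x) = fc G m"
      unfolding fc_def pint_def G_def by (simp add: infsum_cmult_left')
    moreover have "integral {0..1} (?f n) = (if n = m then fc F m else 0)" for n
    proof -
      have "integral {0..1} (?f n) = fc F n * fc (\<lambda>z. ee (of_int n * z)) m" unfolding fc_def[of "\<lambda>z. ee (of_int n * z)"] pint_def by (simp add: mult.assoc)
      thus ?thesis by (simp add: fc_exp)
    qed
    ultimately have "((\<lambda>n. if n = m then fc F m else 0) has_sum fc G m) UNIV" by simp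
    moreover have "((\<lambda>n. if n = m then fc F m else 0) has_sum fc F m) UNIV"
      by (rule has_sum_finite_neutralI[of "{m}"]) auto
    ultimately show ?thesis by (rule has_sum_unique)
  qed
  have "F z - G z = 0"
  proof (rule fourier_zero[of "\<lambda>z. F z - G z"])
    show "(\<lambda>z. F z - G z) holomorphic_on UNIV" by (intro holomorphic_intros F G)
    show "fc (\<lambda>z. F z - G z) n = 0" for n using fc_diff[OF F G] fcG by simp
  qed (simp add: F1 G1)
  thus ?thesis by (simp add: G_def)
qed

text \<open>Inserting the Fourier expansion and completing the square turns the n-th term into a
  fixed Gaussian at x + n / 2N. Within a residue class modulo 2N these translates tile the line, so
  each class yields one full Gaussian integral, the same for all classes.\<close>

lemma theta_S_integral:
  fixes l :: nat
  shows "integral {0..1} (\<lambda>x. ee (of_nat N * t * of_real (x^2)) * F (of_nat l / of_nat (2 * N) + of_real x * t)) =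
    csqrt (of_real pi / (- 2 * of_real pi * \<i> * of_nat N * t)) * (\<Sum>\<mu><2*N. ee (of_nat (l * \<mu>) / of_nat (2 * N)) * tc N t F (int \<mu>))"
proof -
  define z where "z = (\<lambda>x::real. of_nat l / of_nat (2 * N) + of_real x * t)"
  define a where "a = - 2 * of_real pi * \<i> * of_nat N * t"
  have a: "Re a > 0" using t N by (simp add: a_def uhp_def)
  define g where "g = (\<lambda>x::real. exp (- a * of_real (x^2)))"
  have gee: "g x = ee (of_nat N * t * of_real (x^2))" for x by (simp add: g_def a_def ee_def mult_ac)
  let ?f = "\<lambda>n x. ee (of_nat N * t * of_real (x^2)) * (fc F n * ee (of_int n * z x))"
  have zR: "norm (z x) \<le> real l + norm t" if "x \<in> {0..1}" for x
  proof -
    have "norm (z x) \<le> norm (of_nat l / of_nat (2 * N) :: complex) + norm (of_real x * t)" unfolding z_def by (rule norm_triangle_ineq)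
    also have "norm (of_nat l / of_nat (2 * N) :: complex) = real l / real (2 * N)" by (simp add: norm_divide norm_mult)
    also have "\<dots> \<le> real l / 1" using N by (intro divide_left_mono) auto
    also have "norm (of_real x * t) \<le> 1 * norm t" unfolding norm_mult using that by (intro mult_right_mono) auto
    finally show ?thesis by simp
  qed
  obtain M where M: "M summable_on UNIV" "\<And>n w. norm w \<le> real l + norm t \<Longrightarrow> norm (fc F n * ee (of_int n * w)) \<le> M n"
    using fc_majorant[of "real l + norm t"] by blast
  have sum: "((\<lambda>n. integral {0..1} (?f n)) has_sum integral {0..1} (\<lambda>x. \<Sum>\<^sub>\<infinity>n\<in>UNIV. ?f n x)) UNIV"
  proof (rule infsum_integral[OF _ M(1)])
    show "continuous_on {0..1} (?f n)" for n unfolding ee_def z_def by (intro continuous_intros)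
    fix n :: int and x :: real assume x: "x \<in> {0..1}"
    have "norm (ee (of_nat N * t * of_real (x^2))) \<le> 1" using t by (simp add: norm_ee uhp_def)
    hence "norm (?f n x) \<le> 1 * M n" unfolding norm_mult[of "ee _"] using M(2)[OF zR[OF x], of n] by (intro mult_mono) auto
    thus "norm (?f n x) \<le> M n" by simp
  qed
  have "(\<Sum>\<^sub>\<infinity>n\<in>UNIV. ?f n x) = ee (of_nat N * t * of_real (x^2)) * F (z x)" for x
    unfolding infsum_cmult_right' fourier_expansion[of "z x", symmetric] ..
  hence sum1: "((\<lambda>n. integral {0..1} (?f n)) has_sum integral {0..1} (\<lambda>x. ee (of_nat N * t * of_real (x^2)) * F (z x))) UNIV"
    using sum by simp
  have trm: "integral {0..1} (?f n) = ee (of_int n * of_nat l / of_nat (2 * N)) * tc N t F n * integral {0..1} (\<lambda>x. g (x + of_int n / of_nat (2 * N)))" for n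
  proof -
    have "?f n x = ee (of_int n * of_nat l / of_nat (2 * N)) * tc N t F n * g (x + of_int n / of_nat (2 * N))" for x
    proof -
      have "ee (of_nat N * t * of_real (x^2)) * (ee (of_int (n^2) / of_nat (4 * N) * t) * ee (of_int n * z x)) =
        ee (of_int n * of_nat l / of_nat (2 * N)) * ee (of_nat N * t * of_real ((x + of_int n / of_nat (2 * N))^2))"
        unfolding ee_add[symmetric] z_def using N by (intro arg_cong[of _ _ ee]) (simp add: field_simps power2_eq_square)
      thus ?thesis unfolding gee fc_tc[of F n N t] by (simp add: mult_ac)
    qed
    thus ?thesis by simp
  qed
  have bij: "bij_betw (\<lambda>(\<mu>, j). int \<mu> + 2 * int N * j) ({..<2 * N} \<times> UNIV) (UNIV :: int set)"
  proof (rule bij_betwI[where g="\<lambda>n. (nat (n mod (2 * int N)), n div (2 * int N))"])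
    show "(\<lambda>(\<mu>, j). int \<mu> + 2 * int N * j) \<in> {..<2 * N} \<times> UNIV \<rightarrow> UNIV" by simp
    show "(\<lambda>n. (nat (n mod (2 * int N)), n div (2 * int N))) \<in> UNIV \<rightarrow> {..<2 * N} \<times> UNIV"
      using N by (auto simp: nat_less_iff)
  qed (use N in \<open>auto simp: div_mult_self2 mod_mult_self2\<close>)
  have gc: "continuous_on UNIV g" unfolding g_def by (intro continuous_intros)
  have gi: "integrable lborel g" unfolding g_def by (rule integrable_gauss_complex[OF a])
  define J where "J = (LINT x|lborel. g x)"
  have sum2: "((\<lambda>p. integral {0..1} (?f (case p of (\<mu>, j) \<Rightarrow> int \<mu> + 2 * int N * j))) has_sum integral {0..1} (\<lambda>x. ee (of_nat N * t * of_real (x^2)) * F (z x))) ({..<2 * N} \<times> UNIV)"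
    using sum1 by (subst has_sum_reindex_bij_betw[OF bij])
  define r where "r = (\<lambda>\<mu>::nat. ee (of_nat (l * \<mu>) / of_nat (2 * N)) * tc N t F (int \<mu>))"
  have term2: "integral {0..1} (?f (int \<mu> + 2 * int N * j)) = r \<mu> * integral {0..1} (\<lambda>x. g (x + of_nat \<mu> / of_nat (2 * N) + of_int j))" for \<mu> j
  proof -
    have "of_int (int \<mu> + 2 * int N * j) * of_nat l / of_nat (2 * N) = of_nat (l * \<mu>) / of_nat (2 * N) + (of_int (j * int l) :: complex)"
      using N by (simp add: field_simps)
    hence "ee (of_int (int \<mu> + 2 * int N * j) * of_nat l / of_nat (2 * N)) = ee (of_nat (l * \<mu>) / of_nat (2 * N))" by (simp only: ee_add ee_of_int mult_1_right)
    moreover have "x + of_int (int \<mu> + 2 * int N * j) / of_nat (2 * N) = x + of_nat \<mu> / of_nat (2 * N) + of_int j" for x :: real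
      using N by (simp add: field_simps)
    ultimately show ?thesis unfolding trm tc_shift_mult r_def by (simp only:)
  qed
  have "((\<lambda>\<mu>. r \<mu> * J) has_sum integral {0..1} (\<lambda>x. ee (of_nat N * t * of_real (x^2)) * F (z x))) {..<2 * N}"
  proof (rule has_sum_SigmaD[OF sum2])
    fix \<mu> assume "\<mu> \<in> {..<2 * N}"
    define I where "I = (\<lambda>j. integral {0..1} (\<lambda>x. g (x + of_nat \<mu> / of_nat (2 * N) + of_int j)))"
    have "((\<lambda>j. r \<mu> * I j) has_sum r \<mu> * J) UNIV"
    \<comment> \<open>Summability of \<open>I\<close> is available only after multiplication by r;
      it is recovered by division, and for r = 0 both sides are trivially 0.\<close>
    proof (cases "r \<mu> = 0")
      case False
      have "(\<lambda>p. integral {0..1} (?f (case p of (\<mu>, j) \<Rightarrow> int \<mu> + 2 * int N * j))) summable_on ({..<2 * N} \<times> UNIV)"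
        using sum2 has_sum_imp_summable by blast
      hence "(\<lambda>p. integral {0..1} (?f (case p of (\<mu>, j) \<Rightarrow> int \<mu> + 2 * int N * j))) summable_on (Pair \<mu> ` UNIV)"
        by (rule summable_on_subset) (use \<open>\<mu> \<in> {..<2 * N}\<close> in auto)
      hence "((\<lambda>p. integral {0..1} (?f (case p of (\<mu>, j) \<Rightarrow> int \<mu> + 2 * int N * j))) \<circ> Pair \<mu>) summable_on UNIV"
        by (subst (asm) summable_on_reindex) (auto simp: inj_on_def)
      hence "(\<lambda>j. r \<mu> * I j) summable_on UNIV" by (simp only: o_def prod.case term2 I_def)
      hence "(\<lambda>j. inverse (r \<mu>) * (r \<mu> * I j)) summable_on UNIV" by (rule summable_on_cmult_right)
      hence "I summable_on UNIV" using False by (simp add: mult.assoc[symmetric])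
      then obtain s where s: "(I has_sum s) UNIV" by (auto simp: summable_on_def)
      hence "s = J" unfolding J_def I_def by (rule has_sum_unfold[OF gc gi])
      with s show ?thesis by (auto intro: has_sum_cmult_right)
    qed simp
    thus "((\<lambda>j. integral {0..1} (?f (case (\<mu>, j) of (\<mu>, j) \<Rightarrow> int \<mu> + 2 * int N * j))) has_sum r \<mu> * J) UNIV"
      by (simp only: prod.case term2 I_def)
  qed
  hence "integral {0..1} (\<lambda>x. ee (of_nat N * t * of_real (x^2)) * F (z x)) = (\<Sum>\<mu><2*N. r \<mu> * J)"
    using has_sum_unique has_sum_finite[of "{..<2 * N}" "\<lambda>\<mu>. r \<mu> * J"] by blast
  also have "\<dots> = J * (\<Sum>\<mu><2*N. r \<mu>)" by (simp add: sum_distrib_left mult.commute)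
  also have "J = csqrt (of_real pi / a)" unfolding J_def g_def by (rule gaussian_complex[OF a])
  finally show ?thesis unfolding z_def r_def a_def .
qed

end

text \<open>The squares agree up to ee (1/8)^2, so only a sign is in question. Both
  \<open>csqrt t\<close> times ee (-1/8) and the other root have squares with positive real part and
  lie in the sector |Im| < Re, hence their product has positive real part.\<close>

lemma csqrt_factor:
  assumes t: "t \<in> uhp" and N: "N > 0"
  shows "csqrt (of_real pi / (- 2 * of_real pi * \<i> * of_nat N * t)) * csqrt t = ee (1 / 8) / of_real (sqrt (real (2 * N)))"
proof -
  define G where "G = csqrt (of_real pi / (- 2 * of_real pi * \<i> * of_nat N * t))"
  have nz: "t \<noteq> 0" using uhp_nonzero[OF t] .
  have v: "Im t > 0" using t by (simp add: uhp_def)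
  have G2: "G^2 = \<i> / (2 * of_nat N * t)" unfolding G_def power2_csqrt using nz N by (simp add: field_simps)
  define x where "x = csqrt t * ee (- 1 / 8)"
  have e8: "(ee (- 1 / 8))^2 = - \<i>"
  proof -
    have "(ee (- 1 / 8))^2 = exp (- (of_real (pi / 2) * \<i>))" by (simp add: ee_def power2_eq_square exp_add[symmetric] mult.commute)
    also have "\<dots> = cis (- (pi / 2))" by (simp add: cis_conv_exp mult.commute)
    finally show ?thesis by (simp add: complex_eq_iff)
  qed
  have x2: "x^2 = - \<i> * t" by (simp only: x_def power_mult_distrib e8 power2_csqrt mult.commute)
  have e8': "ee (- 1 / 8) = of_real (1 / sqrt 2) * (1 - \<i>)"
  proof -
    have "ee (- 1 / 8) = cis (- (pi / 4))" by (simp add: ee_def cis_conv_exp mult_ac)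
    moreover have "1 / sqrt 2 = sqrt 2 / 2" using real_sqrt_mult_self[of 2] by (simp add: field_simps)
    moreover have "cis (- (pi / 4)) = of_real (sqrt 2 / 2) * (1 - \<i>)" by (simp add: complex_eq_iff cos_45 sin_45)
    ultimately show ?thesis by (simp only:)
  qed
  define c where "c = csqrt t"
  have R0: "Re (csqrt w) \<ge> 0" for w using csqrt_principal[of w] by linarith
  have "2 * Re c * Im c = Im t"
    using arg_cong[OF power2_csqrt[of t], of Im] unfolding c_def[symmetric] by (simp add: power2_eq_square mult_ac)
  hence "Re c * Im c > 0" using v by simp
  hence pos: "Re c > 0" "Im c > 0" using R0[of t] unfolding c_def[symmetric] zero_less_mult_iff by auto
  have Rx: "Re x > 0" unfolding x_def e8' c_def[symmetric] using pos by (simp add: algebra_simps add_pos_pos)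
  have sq: "\<bar>Im w\<bar> < Re w" if "Re (w^2) > 0" "Re w > 0" for w :: complex
  proof -
    have "(Im w)^2 < (Re w)^2" using that(1) by (simp add: power2_eq_square)
    hence "\<bar>Im w\<bar>\<^sup>2 < (Re w)^2" by simp
    thus ?thesis by (rule power2_less_imp_less) (use that(2) in simp)
  qed
  have 1: "\<bar>Im x\<bar> < Re x" by (rule sq) (use x2 v Rx in auto)
  have RG2: "Re (G^2) > 0" unfolding G2 using v N nz by (simp add: Re_divide mult_pos_pos divide_pos_pos sum_power2_gt_zero_iff complex_eq_iff add_pos_nonneg)
  have "Re G \<ge> 0" unfolding G_def by (rule R0)
  moreover have "Re G \<noteq> 0"
  proof
    assume "Re G = 0"
    hence "Re (G^2) = - (Im G)\<^sup>2" by (simp add: power2_eq_square)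
    with RG2 show False using zero_le_power2[of "Im G"] by linarith
  qed
  ultimately have RG: "Re G > 0" by simp
  have 2: "\<bar>Im G\<bar> < Re G" by (rule sq[OF RG2 RG])
  have "(x * G)^2 = (of_real (1 / sqrt (real (2 * N))))^2"
  proof -
    have "(x * G)^2 = 1 / (2 * of_nat N)" unfolding power_mult_distrib x2 G2 using nz by (simp add: field_simps)
    also have "\<dots> = of_real ((1 / sqrt (real (2 * N)))^2)" by (simp add: power_divide)
    finally show ?thesis by simp
  qed
  moreover have "Re (x * G) > 0"
  proof -
    have "Im x * Im G \<le> \<bar>Im x\<bar> * \<bar>Im G\<bar>" by (simp flip: abs_mult)
    also have "\<dots> < Re x * Re G" using 1 2 by (intro mult_strict_mono') auto
    finally show ?thesis by simp
  qed
  moreover have "x * G \<noteq> - of_real (1 / sqrt (real (2 * N)))"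
  proof
    assume "x * G = - of_real (1 / sqrt (real (2 * N)))"
    hence "Re (x * G) = - (1 / sqrt (real (2 * N)))" by (simp only: uminus_complex.sel Re_complex_of_real)
    moreover have "1 / sqrt (real (2 * N)) \<ge> 0" by simp
    ultimately show False using \<open>Re (x * G) > 0\<close> by linarith
  qed
  ultimately have "x * G = of_real (1 / sqrt (real (2 * N)))" unfolding power2_eq_iff by blast
  hence "G * csqrt t * ee (- 1 / 8) = of_real (1 / sqrt (real (2 * N)))" by (simp add: x_def mult_ac)
  hence "G * csqrt t * ee (- 1 / 8) * ee (1 / 8) = of_real (1 / sqrt (real (2 * N))) * ee (1 / 8)" by simp
  moreover have "ee (- 1 / 8) * ee (1 / 8) = 1" by (simp flip: ee_add)
  ultimately show ?thesis unfolding G_def[symmetric] by (simp add: mult.assoc)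
qed

section \<open>Mordell integrals\<close>

text \<open>The value does not depend on b. Instead of shifting a contour, the characteristic
  function of the standard normal distribution is used; the scaling c = sqrt (2 alpha) turns its
  density into the given Gaussian.\<close>

lemma gaussian_shifted:
  assumes a: "\<alpha> > 0"
  shows "(LINT t|lborel. exp (- of_real \<alpha> * (of_real t + \<i> * of_real b)^2)) = complex_of_real (sqrt (pi / \<alpha>))"
proof -
  define c where "c = sqrt (2 * \<alpha>)"
  have c: "c > 0" "c * c = 2 * \<alpha>" using a by (auto simp: c_def)
  let ?J = "LINT t|lborel. exp (- of_real \<alpha> * (of_real t + \<i> * of_real b)^2)"
  have "complex_of_real (exp (- (- c * b)\<^sup>2 / 2)) = (LINT x|std_normal_distribution. iexp (- c * b * x))"
    using fun_cong[OF char_std_normal_distribution, of "- c * b"] unfolding char_def by simp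
  also have "\<dots> = (LINT x|lborel. std_normal_density x *\<^sub>R iexp (- c * b * x))"
    by (rule integral_density) auto
  also have "\<dots> = \<bar>c\<bar> *\<^sub>R (LINT s|lborel. std_normal_density (0 + c * s) *\<^sub>R iexp (- c * b * (0 + c * s)))"
    by (rule lborel_integral_real_affine) (use c in auto)
  also have "(\<lambda>s. std_normal_density (0 + c * s) *\<^sub>R iexp (- c * b * (0 + c * s))) =
     (\<lambda>s. of_real (exp (- \<alpha> * b^2) / sqrt (2 * pi)) * exp (- of_real \<alpha> * (of_real s + \<i> * of_real b)^2))"
  proof
    fix s
    have 1: "(0 + c * s)^2 = 2 * \<alpha> * s^2" "- c * b * (0 + c * s) = - 2 * \<alpha> * b * s"
      using c(2)  by (simp_all add: power2_eq_square mult.assoc[symmetric])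
    have "- of_real \<alpha> * (of_real s + \<i> * of_real b)^2 = of_real (- \<alpha> * s^2) + of_real (\<alpha> * b^2) + \<i> * of_real (- 2 * \<alpha> * b * s)"
      by (simp add: complex_eq_iff power2_eq_square algebra_simps)
    hence "exp (- of_real \<alpha> * (of_real s + \<i> * of_real b)^2) = of_real (exp (- \<alpha> * s^2)) * of_real (exp (\<alpha> * b^2)) * iexp (- 2 * \<alpha> * b * s)"
      by (simp only: exp_add exp_of_real)
    hence "of_real (exp (- \<alpha> * b^2) / sqrt (2 * pi)) * exp (- of_real \<alpha> * (of_real s + \<i> * of_real b)^2) =
        of_real (exp (- \<alpha> * b^2) * exp (\<alpha> * b^2) * (exp (- \<alpha> * s^2) / sqrt (2 * pi))) * iexp (- 2 * \<alpha> * b * s)"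
      by (simp add: mult_ac)
    also have "exp (- \<alpha> * b^2) * exp (\<alpha> * b^2) = 1" by (simp flip: exp_add)
    also have "1 * (exp (- \<alpha> * s^2) / sqrt (2 * pi)) = std_normal_density (0 + c * s)"
      unfolding std_normal_density_def 1 by simp
    finally show "std_normal_density (0 + c * s) *\<^sub>R iexp (- c * b * (0 + c * s)) =
       of_real (exp (- \<alpha> * b^2) / sqrt (2 * pi)) * exp (- of_real \<alpha> * (of_real s + \<i> * of_real b)^2)"
      unfolding 1(2) scaleR_conv_of_real by simp
  qed
  also have "(LINT s|lborel. of_real (exp (- \<alpha> * b^2) / sqrt (2 * pi)) * exp (- of_real \<alpha> * (of_real s + \<i> * of_real b)^2)) =
     of_real (exp (- \<alpha> * b^2) / sqrt (2 * pi)) * ?J" by (rule integral_mult_right_zero)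
  also have "(- c * b)^2 / 2 = \<alpha> * b^2" using c(2) by (simp add: power2_eq_square mult_ac)
  hence "- (- c * b)\<^sup>2 / 2 = - \<alpha> * b^2" by simp
  finally have "complex_of_real (exp (- \<alpha> * b^2)) = of_real (exp (- \<alpha> * b^2)) * (of_real (c / sqrt (2 * pi)) * ?J)"
    using c(1) by (simp add: scaleR_conv_of_real mult_ac)
  hence "of_real (c / sqrt (2 * pi)) * ?J = 1" unfolding mult_cancel_left1 of_real_eq_0_iff by (metis exp_not_eq_zero)
  moreover have "c / sqrt (2 * pi) * sqrt (pi / \<alpha>) = 1" unfolding c_def using a by (simp add: real_sqrt_mult real_sqrt_divide)
  hence "complex_of_real (c / sqrt (2 * pi)) * of_real (sqrt (pi / \<alpha>)) = 1" by (metis of_real_1 of_real_mult)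
  moreover have "x = y" if "a * x = 1" "a * y = 1" for a x y :: complex
  proof -
    have "a \<noteq> 0" using that by auto
    thus ?thesis using that by (metis mult_left_cancel)
  qed
  ultimately show ?thesis by blast
qed

definition gw :: "real \<Rightarrow> real \<Rightarrow> real \<Rightarrow> real \<Rightarrow> complex" where
  "gw \<alpha> r Y t = exp (- of_real \<alpha> * (of_real t + \<i> * of_real Y)^2) * ee (of_real r * (of_real t + \<i> * of_real Y))"

text \<open>A Mordell integral along the horizontal line at height Y. For k = 1 and k = 2 the
  evaluations below depend on Y only through the side on which the line passes the pole at
  0.\<close>

definition mord :: "real \<Rightarrow> nat \<Rightarrow> real \<Rightarrow> real \<Rightarrow> complex" where
  "mord \<alpha> k r Y = (LINT t|lborel. gw \<alpha> r Y t / (of_real t + \<i> * of_real Y) ^ k)"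

lemma norm_gw: "norm (gw \<alpha> r Y t) = exp (\<alpha> * Y^2 - 2 * pi * (r * Y)) * exp (- \<alpha> * t^2)"
proof -
  have "Re (- of_real \<alpha> * (of_real t + \<i> * of_real Y)^2) = - \<alpha> * t^2 + \<alpha> * Y^2" by (simp add: power2_eq_square algebra_simps)
  thus ?thesis unfolding gw_def norm_mult norm_exp_eq_Re norm_ee by (simp flip: exp_add)
qed

lemma gw_measurable [measurable]: "gw \<alpha> r Y \<in> borel_measurable borel"
  unfolding gw_def[abs_def] ee_def by measurable

lemma gw_continuous: "continuous_on A (gw \<alpha> r Y)"
  unfolding gw_def[abs_def] ee_def by (intro continuous_intros)

lemma line_nz: "Y \<noteq> 0 \<Longrightarrow> of_real t + \<i> * of_real Y \<noteq> 0"
  by (simp add: complex_eq_iff)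

lemma mord_integrable:
  assumes a: "\<alpha> > 0" and Y: "Y \<noteq> 0 \<or> k = 0"
  shows "integrable lborel (\<lambda>t. gw \<alpha> r Y t / (of_real t + \<i> * of_real Y) ^ k)"
proof (rule Bochner_Integration.integrable_bound)
  show "integrable lborel (\<lambda>t. exp (\<alpha> * Y^2 - 2 * pi * (r * Y)) / \<bar>Y\<bar> ^ k * exp (- \<alpha> * t^2))"
    by (rule integrable_mult_right) (rule gaussian_real(1)[OF a])
  show "AE t in lborel. norm (gw \<alpha> r Y t / (of_real t + \<i> * of_real Y) ^ k) \<le> norm (exp (\<alpha> * Y^2 - 2 * pi * (r * Y)) / \<bar>Y\<bar> ^ k * exp (- \<alpha> * t^2))"
  proof (rule AE_I2)
    fix t
    have "\<bar>Y\<bar> \<le> norm (of_real t + \<i> * of_real Y)" using abs_Im_le_cmod[of "of_real t + \<i> * of_real Y"] by simp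
    hence "\<bar>Y\<bar> ^ k \<le> norm (of_real t + \<i> * of_real Y) ^ k" by (rule power_mono) simp
    moreover have "\<bar>Y\<bar> ^ k > 0" using Y by auto
    ultimately have "norm (gw \<alpha> r Y t) / norm (of_real t + \<i> * of_real Y) ^ k \<le> norm (gw \<alpha> r Y t) / \<bar>Y\<bar> ^ k"
      by (intro divide_left_mono mult_pos_pos norm_ge_zero) linarith+
    thus "norm (gw \<alpha> r Y t / (of_real t + \<i> * of_real Y) ^ k) \<le> norm (exp (\<alpha> * Y^2 - 2 * pi * (r * Y)) / \<bar>Y\<bar> ^ k * exp (- \<alpha> * t^2))"
      unfolding norm_divide norm_power norm_gw by simp
  qed
qed measurable

lemma gw_integrable: "\<alpha> > 0 \<Longrightarrow> integrable lborel (gw \<alpha> r Y)"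
  using mord_integrable[of \<alpha> Y 0 r] by simp

lemma gw_integral:
  assumes a: "\<alpha> > 0"
  shows "(LINT t|lborel. gw \<alpha> r Y t) = of_real (sqrt (pi / \<alpha>) * exp (- pi\<^sup>2 * r^2 / \<alpha>))"
proof -
  have "gw \<alpha> r Y t = of_real (exp (- pi\<^sup>2 * r^2 / \<alpha>)) * exp (- of_real \<alpha> * (of_real t + \<i> * of_real (Y - pi * r / \<alpha>))^2)" for t
  proof -
    define w where "w = of_real t + \<i> * of_real Y"
    have "w - \<i> * of_real (pi * r / \<alpha>) = of_real t + \<i> * of_real (Y - pi * r / \<alpha>)" by (simp add: w_def algebra_simps)
    moreover have "- of_real \<alpha> * w^2 + tpi * (of_real r * w) = of_real (- pi\<^sup>2 * r^2 / \<alpha>) + - of_real \<alpha> * (w - \<i> * of_real (pi * r / \<alpha>))^2"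
      using a by (simp add: power2_eq_square field_simps)
    ultimately have "- of_real \<alpha> * w^2 + tpi * (of_real r * w) = of_real (- pi\<^sup>2 * r^2 / \<alpha>) + - of_real \<alpha> * (of_real t + \<i> * of_real (Y - pi * r / \<alpha>))^2" by simp
    thus ?thesis unfolding gw_def ee_def exp_of_real[symmetric] exp_add[symmetric] w_def by (rule arg_cong)
  qed
  hence "(LINT t|lborel. gw \<alpha> r Y t) = of_real (exp (- pi\<^sup>2 * r^2 / \<alpha>)) * of_real (sqrt (pi / \<alpha>))"
    by (simp only: integral_mult_right_zero gaussian_shifted[OF a])
  thus ?thesis by (simp add: mult.commute)
qed

text \<open>Writes 1/w as a superposition of exponentials. Inside a Mordell integral this trades the
  pole for a shift of the frequency r.\<close>

lemma integral_ee_half_line: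
  assumes "Im w > 0"
  shows "(LINT s|lborel. indicator {0<..} s *\<^sub>R ee (of_real s * w)) = - 1 / (tpi * w)"
proof -
  define c where "c = tpi * w"
  have nz: "c \<noteq> 0" using assms by (auto simp: c_def)
  have n: "norm (ee (of_real s * w)) = exp (- (s * (2 * pi * Im w)))" for s :: real by (simp add: norm_ee mult_ac)
  have int: "integrable lborel (\<lambda>s. indicator {0<..} s *\<^sub>R exp (- (s * (2 * pi * Im w))))"
    using integrable_I0i_exp_mscale[of "2 * pi * Im w"] assms by (simp add: set_integrable_def)
  have si: "set_integrable lborel (einterval (ereal 0) \<infinity>) (\<lambda>s. ee (of_real s * w))"
    unfolding set_integrable_def
  proof (rule Bochner_Integration.integrable_bound[OF int])
    show "(\<lambda>s. indicator (einterval (ereal 0) \<infinity>) s *\<^sub>R ee (of_real s * w)) \<in> borel_measurable lborel"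
      unfolding ee_def by measurable
    show "AE s in lborel. norm (indicator (einterval (ereal 0) \<infinity>) s *\<^sub>R ee (of_real s * w)) \<le> norm (indicator {0<..} s *\<^sub>R exp (- (s * (2 * pi * Im w))))"
      by (rule AE_I2) (auto simp: n einterval_def split: split_indicator)
  qed
  have "(LBINT s=ereal 0..\<infinity>. ee (of_real s * w)) = 0 - 1 / c"
  proof (rule interval_integral_FTC_integrable[where F="\<lambda>s. ee (of_real s * w) / c"])
    show "((\<lambda>s. ee (of_real s * w) / c) has_vector_derivative ee (of_real x * w)) (at x)" for x :: real
    proof -
      have "((\<lambda>s. ee (w * s) / c) has_field_derivative ee (w * of_real x)) (at (of_real x))"
        using DERIV_cdivide[OF ee_has_field_derivative[of w "of_real x" UNIV], of c] nz by (simp add: c_def)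
      from has_vector_derivative_real_field[OF this] show ?thesis by (simp add: mult.commute)
    qed
    show "isCont (\<lambda>s. ee (of_real s * w)) x" for x :: real unfolding ee_def by (intro continuous_intros)
    have "isCont (\<lambda>s::real. ee (of_real s * w) / c) 0" using nz unfolding ee_def by (intro continuous_intros)
    hence "((\<lambda>s::real. ee (of_real s * w) / c) \<longlongrightarrow> 1 / c) (at 0)" by (simp add: isCont_def ee_def)
    thus "(((\<lambda>s. ee (of_real s * w) / c) \<circ> real_of_ereal) \<longlongrightarrow> 1 / c) (at_right (ereal 0))"
      unfolding ereal_tendsto_simps by (rule filterlim_mono) (auto simp: at_within_le_at)
    have "((\<lambda>s::real. ee (of_real s * w) / c) \<longlongrightarrow> 0) at_top"
    proof (rule Lim_null_comparison)
      show "\<forall>\<^sub>F s in at_top. norm (ee (of_real s * w) / c) \<le> exp (- (s * (2 * pi * Im w))) / norm c"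
        by (simp add: norm_divide n)
      have "((\<lambda>s::real. exp (- (s * u))) \<longlongrightarrow> 0) at_top" if "u > 0" for u :: real using that by real_asymp
      from tendsto_mult_left_zero[OF this[of "2 * pi * Im w"], of "inverse (norm c)"]
      show "((\<lambda>s::real. exp (- (s * (2 * pi * Im w))) / norm c) \<longlongrightarrow> 0) at_top" using assms by (simp add: divide_inverse)
    qed
    thus "(((\<lambda>s. ee (of_real s * w) / c) \<circ> real_of_ereal) \<longlongrightarrow> 0) (at_left \<infinity>)"
      unfolding ereal_tendsto_simps .
  qed (use si in auto)
  thus ?thesis unfolding zero_ereal_def[symmetric] interval_lebesgue_integral_0_infty set_lebesgue_integral_def c_def by simp
qed

lemma integral_half_line_er:
  assumes a: "\<alpha> > 0"
  shows "(LINT s|lborel. indicator {0<..} s *\<^sub>R (sqrt (pi / \<alpha>) * exp (- pi\<^sup>2 * (r + s)^2 / \<alpha>))) = er (r * pi / sqrt \<alpha>) / 2"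
proof -
  define c where "c = pi / sqrt \<alpha>"
  have c: "c > 0" using a by (simp add: c_def)
  have s: "sqrt (pi / \<alpha>) = c / sqrt pi" using a by (simp add: c_def real_sqrt_divide field_simps)
  have c2: "c^2 = pi^2 / \<alpha>" using a by (simp add: c_def power_divide)
  let ?J = "LINT s|lborel. indicator {0<..} s *\<^sub>R exp (- pi\<^sup>2 * (r + s)^2 / \<alpha>)"
  have "er (r * c) = 2 / sqrt pi * (LINT s|lborel. indicator {0..} s *\<^sub>R exp (- (r * c + s)\<^sup>2))" by (rule er_shift)
  also have "(LINT s|lborel. indicator {0..} s *\<^sub>R exp (- (r * c + s)\<^sup>2)) = \<bar>c\<bar> *\<^sub>R (LINT s|lborel. indicator {0..} (0 + c * s) *\<^sub>R exp (- (r * c + (0 + c * s))\<^sup>2))"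
    by (rule lborel_integral_real_affine) (use c in auto)
  also have "(LINT s|lborel. indicator {0..} (0 + c * s) *\<^sub>R exp (- (r * c + (0 + c * s))\<^sup>2)) = ?J"
  proof (rule integral_cong_AE)
    show "AE s in lborel. indicator {0..} (0 + c * s) *\<^sub>R exp (- (r * c + (0 + c * s))\<^sup>2) = indicator {0<..} s *\<^sub>R exp (- pi\<^sup>2 * (r + s)^2 / \<alpha>)"
      using AE_lborel_singleton[of 0]
    proof eventually_elim
      case (elim s)
      have "(r * c + (0 + c * s))^2 = c^2 * (r + s)^2" by (simp add: power2_eq_square algebra_simps)
      hence "- (r * c + (0 + c * s))\<^sup>2 = - pi\<^sup>2 * (r + s)^2 / \<alpha>" unfolding c2 by simp
      thus ?case using elim c by (auto split: split_indicator simp: zero_le_mult_iff)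
    qed
  qed auto
  finally have er: "er (r * c) = 2 / sqrt pi * (c * ?J)" using c by simp
  have "(LINT s|lborel. indicator {0<..} s *\<^sub>R (sqrt (pi / \<alpha>) * exp (- pi\<^sup>2 * (r + s)^2 / \<alpha>))) = (LINT s|lborel. sqrt (pi / \<alpha>) * (indicator {0<..} s *\<^sub>R exp (- pi\<^sup>2 * (r + s)^2 / \<alpha>)))"
    by (simp add: mult.left_commute)
  also have "\<dots> = sqrt (pi / \<alpha>) * ?J" by (rule integral_mult_right_zero)
  also have "\<dots> = er (r * c) / 2" unfolding er s by simp
  also have "\<dots> = er (r * pi / sqrt \<alpha>) / 2" by (simp add: c_def)
  finally show ?thesis .
qed

text \<open>With 1/w replaced by a half line integral, Fubini leaves for each s a Gaussian integral
  of frequency r + s without a pole. Integrating its value over s > 0 gives the error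
  function.\<close>

lemma mord_1_pos:
  assumes a: "\<alpha> > 0" and Y: "Y > 0"
  shows "mord \<alpha> 1 r Y = - (of_real pi * \<i>) * of_real (er (r * pi / sqrt \<alpha>))"
proof -
  let ?w = "\<lambda>t. complex_of_real t + \<i> * of_real Y"
  define f where "f = (\<lambda>s t. indicator {0<..} s *\<^sub>R gw \<alpha> (r + s) Y t)"
  have nf: "norm (f s t) = indicator {0<..} s * (exp (\<alpha> * Y^2 - 2 * pi * (r * Y)) * exp (- (s * (2 * pi * Y)))) * exp (- \<alpha> * t^2)" for s t
    unfolding f_def norm_scaleR norm_gw by (simp add: algebra_simps exp_add[symmetric] exp_diff[symmetric] flip: exp_add)
  have fint: "integrable (lborel \<Otimes>\<^sub>M lborel) (case_prod f)"
  proof (rule lborel_pair.Fubini_integrable)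
    show "case_prod f \<in> borel_measurable (lborel \<Otimes>\<^sub>M lborel)" unfolding f_def gw_def ee_def by measurable
    have "(LINT t|lborel. norm (case_prod f (s, t))) = sqrt (pi / \<alpha>) * exp (\<alpha> * Y^2 - 2 * pi * (r * Y)) * (indicator {0<..} s *\<^sub>R exp (- (s * (2 * pi * Y))))" for s
      unfolding prod.case nf integral_mult_right_zero gaussian_real(2)[OF a] by simp
    moreover have "integrable lborel (\<lambda>s. indicator {0<..} s *\<^sub>R exp (- (s * (2 * pi * Y))))"
      using integrable_I0i_exp_mscale[of "2 * pi * Y"] Y by (simp add: set_integrable_def)
    ultimately show "integrable lborel (\<lambda>s. LINT t|lborel. norm (case_prod f (s, t)))" by (simp only: integrable_mult_right)
    show "AE s in lborel. integrable lborel (\<lambda>t. case_prod f (s, t))"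
      unfolding f_def prod.case by (intro AE_I2 integrable_scaleR_right gw_integrable a)
  qed
  have inner: "(LINT s|lborel. f s t) = - 1 / (tpi) * (gw \<alpha> r Y t / ?w t ^ 1)" for t
  proof -
    have "f s t = gw \<alpha> r Y t * (indicator {0<..} s *\<^sub>R ee (of_real s * ?w t))" for s
      unfolding f_def gw_def of_real_add distrib_right[of "of_real r"] ee_add by simp
    hence "(LINT s|lborel. f s t) = gw \<alpha> r Y t * (- 1 / (tpi * ?w t))"
      using integral_ee_half_line[of "?w t"] Y by (simp only: integral_mult_right_zero) simp
    thus ?thesis by simp
  qed
  have "- 1 / (tpi) * mord \<alpha> 1 r Y = (LINT t|lborel. LINT s|lborel. f s t)"
    unfolding inner mord_def by (rule integral_mult_right_zero[symmetric])
  also have "\<dots> = (LINT s|lborel. LINT t|lborel. f s t)" by (rule lborel_pair.Fubini_integral[OF fint])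
  also have "\<dots> = (LINT s|lborel. complex_of_real (indicator {0<..} s *\<^sub>R (sqrt (pi / \<alpha>) * exp (- pi\<^sup>2 * (r + s)^2 / \<alpha>))))"
    unfolding f_def integral_scaleR_right gw_integral[OF a] by (simp add: scaleR_conv_of_real)
  also have "\<dots> = of_real (er (r * pi / sqrt \<alpha>) / 2)" unfolding integral_complex_of_real integral_half_line_er[OF a] ..
  finally have "- 1 / (tpi) * mord \<alpha> 1 r Y = of_real (er (r * pi / sqrt \<alpha>) / 2)" .
  hence "- (tpi) * (- 1 / (tpi) * mord \<alpha> 1 r Y) = - (tpi) * of_real (er (r * pi / sqrt \<alpha>) / 2)" by (rule arg_cong)
  thus ?thesis by simp
qed

lemma mord_uminus: "mord \<alpha> k r (- Y) = (- 1) ^ k * mord \<alpha> k (- r) Y"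
proof -
  have "mord \<alpha> k r (- Y) = \<bar>- 1\<bar> *\<^sub>R (LINT t|lborel. gw \<alpha> r (- Y) (0 + - 1 * t) / (of_real (0 + - 1 * t) + \<i> * of_real (- Y)) ^ k)"
    unfolding mord_def by (rule lborel_integral_real_affine) auto
  also have "(\<lambda>t. gw \<alpha> r (- Y) (0 + - 1 * t) / (of_real (0 + - 1 * t) + \<i> * of_real (- Y)) ^ k) = (\<lambda>t. (- 1) ^ k * (gw \<alpha> (- r) Y t / (of_real t + \<i> * of_real Y) ^ k))"
  proof
    fix t
    define w where "w = of_real t + \<i> * of_real Y"
    have w: "of_real (0 + - 1 * t) + \<i> * of_real (- Y) = - w" by (simp add: w_def)
    have "gw \<alpha> r (- Y) (0 + - 1 * t) = gw \<alpha> (- r) Y t" unfolding gw_def w w_def[symmetric] by simp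
    moreover have "(- w) ^ k = (- 1) ^ k * w ^ k" by (rule power_minus)
    ultimately show "gw \<alpha> r (- Y) (0 + - 1 * t) / (of_real (0 + - 1 * t) + \<i> * of_real (- Y)) ^ k = (- 1) ^ k * (gw \<alpha> (- r) Y t / (of_real t + \<i> * of_real Y) ^ k)"
      unfolding w w_def[symmetric] by (auto simp: minus_one_power_iff)
  qed
  finally show ?thesis unfolding mord_def[of \<alpha> k "- r" Y] by (simp only: integral_mult_right_zero abs_minus_cancel abs_one scaleR_one)
qed

text \<open>Integration by parts: gw / w vanishes at both ends of the line, and its derivative
  contains the integrand with the double pole.\<close>

lemma mord_2:
  assumes a: "\<alpha> > 0" and Y: "Y \<noteq> 0"
  shows "mord \<alpha> 2 r Y = - 2 * of_real \<alpha> * of_real (sqrt (pi / \<alpha>) * exp (- pi\<^sup>2 * r^2 / \<alpha>)) + tpi * of_real r * mord \<alpha> 1 r Y"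
proof -
  let ?w = "\<lambda>t. complex_of_real t + \<i> * of_real Y"
  define F where "F = (\<lambda>t. gw \<alpha> r Y t / ?w t ^ 1)"
  define F' where "F' = (\<lambda>t. - 2 * of_real \<alpha> * gw \<alpha> r Y t + tpi * of_real r * (gw \<alpha> r Y t / ?w t ^ 1) - gw \<alpha> r Y t / ?w t ^ 2)"
  have nz: "?w t \<noteq> 0" for t by (rule line_nz[OF Y])
  have i: "integrable lborel (gw \<alpha> r Y)" "integrable lborel (\<lambda>t. gw \<alpha> r Y t / ?w t ^ 1)" "integrable lborel (\<lambda>t. gw \<alpha> r Y t / ?w t ^ 2)"
    using gw_integrable[OF a] mord_integrable[OF a] Y by blast+
  have F'i: "integrable lborel F'" unfolding F'_def
    by (intro Bochner_Integration.integrable_diff Bochner_Integration.integrable_add integrable_mult_right i)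
  have D: "(F has_vector_derivative F' t) (at t)" for t
  proof -
    let ?z = "complex_of_real t"
    define G where "G = (\<lambda>z. exp (- of_real \<alpha> * (z + \<i> * of_real Y)^2) * ee (of_real r * (z + \<i> * of_real Y)))"
    have G: "(G has_field_derivative (- 2 * of_real \<alpha> * (?z + \<i> * of_real Y) + tpi * of_real r) * G ?z) (at ?z)"
      unfolding G_def ee_def by (auto intro!: derivative_eq_intros simp: algebra_simps)
    have "((\<lambda>z. G z / (z + \<i> * of_real Y)) has_field_derivative F' t) (at ?z)"
    proof (rule DERIV_cong)
      show "((\<lambda>z. G z / (z + \<i> * of_real Y)) has_field_derivative (((- 2 * of_real \<alpha> * ?w t + tpi * of_real r) * G ?z) * ?w t - G ?z * 1) / (?w t * ?w t)) (at ?z)"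
        by (rule DERIV_divide[OF G]) (use nz in \<open>auto intro!: derivative_eq_intros\<close>)
      have "G ?z = gw \<alpha> r Y t" by (simp add: G_def gw_def)
      thus "(((- 2 * of_real \<alpha> * ?w t + tpi * of_real r) * G ?z) * ?w t - G ?z * 1) / (?w t * ?w t) = F' t"
        unfolding F'_def using nz[of t] by (simp add: divide_simps) (simp add: algebra_simps power2_eq_square)
    qed
    from has_vector_derivative_real_field[OF this] show ?thesis by (simp add: F_def G_def gw_def)
  qed
  have "(\<lambda>m. integral {0 - real m..0 + real m} F') \<longlonglongrightarrow> (LINT t|lborel. F' t)" by (rule tendsto_integral_UNIV[OF F'i])
  moreover have "integral {0 - real m..0 + real m} F' = F (real m) - F (- real m)" for m
  proof -
    have "(F' has_integral F (real m) - F (- real m)) {- real m..real m}"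
      by (rule fundamental_theorem_of_calculus) (auto intro: has_vector_derivative_at_within D)
    thus ?thesis by (simp add: integral_unique)
  qed
  moreover have "(\<lambda>m. F (real m) - F (- real m)) \<longlonglongrightarrow> 0"
  proof -
    have F: "(\<lambda>m. F (s * real m)) \<longlonglongrightarrow> 0" if s: "\<bar>s\<bar> = 1" for s :: real
    proof (rule Lim_null_comparison)
      define C where "C = exp (\<alpha> * Y^2 - 2 * pi * (r * Y)) / \<bar>Y\<bar>"
      show "(\<lambda>m. C * exp (- \<alpha> * (real m)^2)) \<longlonglongrightarrow> 0" using a by real_asymp
      have "norm (F (s * real m)) \<le> C * exp (- \<alpha> * (real m)^2)" for m
      proof -
        have "\<bar>Y\<bar> \<le> norm (?w (s * real m))" using abs_Im_le_cmod[of "?w (s * real m)"] by simp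
        hence "norm (gw \<alpha> r Y (s * real m)) / norm (?w (s * real m)) \<le> norm (gw \<alpha> r Y (s * real m)) / \<bar>Y\<bar>"
          using Y by (intro divide_left_mono) (auto intro!: mult_pos_pos nz simp: complex_eq_iff)
        moreover have "(s * real m)^2 = (real m)^2" using s by (metis abs_mult mult_1 power2_abs)
        ultimately show ?thesis unfolding F_def norm_divide norm_gw C_def by simp
      qed
      thus "\<forall>\<^sub>F m in sequentially. norm (F (s * real m)) \<le> C * exp (- \<alpha> * (real m)^2)" by simp
    qed
    from tendsto_diff[OF F[of 1] F[of "- 1"]] show ?thesis by simp
  qed
  ultimately have "(LINT t|lborel. F' t) = 0" using LIMSEQ_unique by simp
  moreover have "(LINT t|lborel. F' t) = - 2 * of_real \<alpha> * (LINT t|lborel. gw \<alpha> r Y t) + tpi * of_real r * mord \<alpha> 1 r Y - mord \<alpha> 2 r Y"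
    unfolding F'_def mord_def
    by (simp only: Bochner_Integration.integral_diff Bochner_Integration.integral_add Bochner_Integration.integrable_add integrable_mult_right i integral_mult_right_zero)
  ultimately show ?thesis unfolding gw_integral[OF a] by (simp add: algebra_simps)
qed

text \<open>On a horizontal line the term for (a, b) is a Mordell integrand at height y + a v with
  frequency 2Na - l, and b enters only as an integer translation of the variable. Summing over b
  therefore unfolds [0, 1] to the real line.\<close>

lemma pterm_gw:
  fixes l :: int
  assumes t: "t \<in> uhp" and N: "N > 0"
  shows "pterm N k t (wl t (a, b)) (\<i> * of_real y + of_real x * 1) * ee (- (of_int l * (\<i> * of_real y + of_real x * 1))) =
    ee (of_int (l^2 - (2 * int N * a - l)^2) / of_nat (4 * N) * t) *
    (gw (pi * real N / Im t) (of_int (2 * int N * a - l)) (y + of_int a * Im t) (x + of_int a * Re t + of_int b) /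
      (of_real (x + of_int a * Re t + of_int b) + \<i> * of_real (y + of_int a * Im t)) ^ k)"
proof -
  define z where "z = \<i> * complex_of_real y + of_real x * 1"
  define \<omega> where "\<omega> = wl t (a, b)"
  define \<alpha> where "\<alpha> = pi * real N / Im t"
  define r where "r = 2 * int N * a - l"
  have v: "Im t \<noteq> 0" using t by (auto simp: uhp_def)
  have w: "of_real (x + of_int a * Re t + of_int b) + \<i> * of_real (y + of_int a * Im t) = z + \<omega>"
    by (simp add: z_def \<omega>_def wl_def complex_eq_iff)
  have "\<omega> - cnj \<omega> = 2 * \<i> * of_real (Im t) * of_int a" unfolding diff_cnj by (simp add: \<omega>_def wl_def)
  hence "cnj \<omega> = \<omega> - 2 * \<i> * of_real (Im t) * of_int a" by (simp add: algebra_simps)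
  hence "z^2 + 2 * z * cnj \<omega> + \<omega> * cnj \<omega> = (z + \<omega>)^2 + 2 * \<i> * of_real (Im t) * (- (of_int a * (2 * z + \<omega>)))"
    by (simp only:) (simp add: power2_eq_square algebra_simps)
  hence "exp (- of_real \<alpha> * (z^2 + 2 * z * cnj \<omega> + \<omega> * cnj \<omega>)) = exp (- of_real \<alpha> * (z + \<omega>)^2) * exp (- of_real \<alpha> * (2 * \<i> * of_real (Im t) * (- (of_int a * (2 * z + \<omega>)))))"
    by (simp only: distrib_left exp_add)
  also have "exp (- of_real \<alpha> * (2 * \<i> * of_real (Im t) * (- (of_int a * (2 * z + \<omega>))))) = ee (of_nat N * (of_int a * (2 * z + \<omega>)))"
    unfolding \<alpha>_def exp_pi_N[OF v] by simp
  finally have e: "exp (- of_real \<alpha> * (z^2 + 2 * z * cnj \<omega> + \<omega> * cnj \<omega>)) = exp (- of_real \<alpha> * (z + \<omega>)^2) * ee (of_nat N * (of_int a * (2 * z + \<omega>)))" .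
  have "of_nat N * (of_int a * (2 * z + \<omega>)) + - (of_int l * z) =
     of_int (l^2 - r^2) / of_nat (4 * N) * t + of_real (of_int r) * (z + \<omega>) + of_int (l * b - int N * a * b)"
    using N by (simp add: r_def \<omega>_def wl_def field_simps power2_eq_square)
  hence ee1: "ee (of_nat N * (of_int a * (2 * z + \<omega>))) * ee (- (of_int l * z)) =
     ee (of_int (l^2 - r^2) / of_nat (4 * N) * t) * ee (of_real (of_int r) * (z + \<omega>))"
    by (simp only: ee_add[symmetric]) (simp only: ee_add ee_of_int mult_1_right)
  show ?thesis unfolding z_def[symmetric] \<omega>_def[symmetric] r_def[symmetric] \<alpha>_def[symmetric] gw_def w pterm_def e
    using ee1 by (simp add: mult_ac)
qed

text \<open>Each row a of the lattice contributes one Mordell integral. Since 0 < y < Im t, none of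
  the lines at height y + a v meets the pole.\<close>

lemma PP_coefficient:
  fixes l :: int
  assumes t: "t \<in> uhp" and N: "N > 0" and y: "0 < y" "y < Im t"
  shows "((\<lambda>a. ee (- (of_int ((2 * int N * a - l)^2) / of_nat (4 * N) * t)) *
      mord (pi * real N / Im t) k (of_int (2 * int N * a - l)) (y + of_int a * Im t)) has_sum
    ee (- (of_int (l^2) / of_nat (4 * N) * t)) * pint (\<lambda>z. PP N k t z * ee (- (of_int l * z))) (\<i> * of_real y) 1) UNIV"
proof -
  have v: "Im t > 0" using t by (simp add: uhp_def)
  define \<alpha> where "\<alpha> = pi * real N / Im t"
  have \<alpha>: "\<alpha> > 0" using v N by (simp add: \<alpha>_def)
  define z where "z = (\<lambda>x::real. \<i> * of_real y + of_real x * 1)"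
  \<comment> \<open>The distance from the path to the nearest row of lattice points.\<close>
  define \<epsilon> where "\<epsilon> = min y (Im t - y)"
  have \<epsilon>: "\<epsilon> > 0" using y by (simp add: \<epsilon>_def)
  have Yb: "\<epsilon> \<le> \<bar>y + of_int a * Im t\<bar>" for a :: int
  proof (cases "a \<ge> 0")
    case True
    hence "of_int a * Im t \<ge> 0" using v by simp
    thus ?thesis using y by (simp add: \<epsilon>_def)
  next
    case False
    hence "real_of_int (a + 1) \<le> 0" by linarith
    hence "of_int (a + 1) * Im t \<le> 0" using v by (intro mult_nonpos_nonneg) auto
    thus ?thesis using y by (simp add: \<epsilon>_def algebra_simps)
  qed
  have Y: "y + of_int a * Im t \<noteq> 0" for a :: int using Yb[of a] \<epsilon> by auto
  have low: "\<epsilon> \<le> norm (z x + wl t p)" for x p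
    using Yb[of "fst p"] abs_Im_le_cmod[of "z x + wl t p"] by (simp add: z_def wl_def)
  obtain M where M: "M summable_on UNIV" "\<And>p x. norm (z x) \<le> 1 + y \<Longrightarrow> norm (pterm N k t (wl t p) (z x)) \<le> M p"
    using PP_majorant[OF t \<epsilon> N, of UNIV "1 + y" k] low by blast
  define f where "f = (\<lambda>p x. pterm N k t (wl t p) (z x) * ee (- (of_int l * z x)))"
  have sum: "((\<lambda>p. integral {0..1} (f p)) has_sum integral {0..1} (\<lambda>x. \<Sum>\<^sub>\<infinity>p\<in>UNIV. f p x)) UNIV"
  proof (rule infsum_integral)
    show "(\<lambda>p. M p * exp (2 * pi * of_int l * y)) summable_on UNIV" by (rule summable_on_cmult_left[OF M(1)])
    fix p
    have nz: "z x + wl t p \<noteq> 0" for x using low[of x p] \<epsilon> by auto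
    have zc: "continuous_on {0..1} z" unfolding z_def by (intro continuous_intros)
    show "continuous_on {0..1} (f p)" unfolding f_def pterm_def ee_def using nz
      by (intro continuous_intros zc) auto
    fix x :: real assume x: "x \<in> {0..1}"
    have "norm (z x) \<le> norm (\<i> * complex_of_real y) + norm (complex_of_real x * 1)" unfolding z_def by (rule norm_triangle_ineq)
    hence "norm (z x) \<le> 1 + y" using x y by (simp add: norm_mult)
    hence "norm (pterm N k t (wl t p) (z x)) * exp (2 * pi * of_int l * y) \<le> M p * exp (2 * pi * of_int l * y)" by (intro mult_right_mono M) auto
    moreover have "norm (ee (- (of_int l * z x))) = exp (2 * pi * of_int l * y)" by (simp add: norm_ee z_def mult.assoc)
    ultimately show "norm (f p x) \<le> M p * exp (2 * pi * of_int l * y)" by (simp add: f_def norm_mult)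
  qed
  have tot: "integral {0..1} (\<lambda>x. \<Sum>\<^sub>\<infinity>p\<in>UNIV. f p x) = pint (\<lambda>z. PP N k t z * ee (- (of_int l * z))) (\<i> * of_real y) 1"
    unfolding pint_def f_def infsum_cmult_left' PP_def z_def ..
  define r where "r = (\<lambda>a::int. 2 * int N * a - l)"
  define g where "g = (\<lambda>a u. gw \<alpha> (of_int (r a)) (y + of_int a * Im t) u / (of_real u + \<i> * of_real (y + of_int a * Im t)) ^ k)"
  define I where "I = (\<lambda>a b. integral {0..1} (\<lambda>x. g a (x + of_int a * Re t + of_int b)))"
  define E where "E = (\<lambda>a. ee (of_int (l^2 - (r a)^2) / of_nat (4 * N) * t))"
  have fI: "integral {0..1} (f (a, b)) = E a * I a b" for a b
    unfolding f_def z_def pterm_gw[OF t N] I_def g_def E_def r_def \<alpha>_def by (simp only: integral_mult_right)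
  have sum2: "((\<lambda>(a, b). E a * I a b) has_sum pint (\<lambda>z. PP N k t z * ee (- (of_int l * z))) (\<i> * of_real y) 1) (UNIV \<times> UNIV)"
    using sum unfolding tot by (simp add: fI case_prod_unfold flip: UNIV_Times_UNIV) (metis (mono_tags, lifting) fI has_sum_cong prod.collapse)
  have "((\<lambda>a. E a * mord \<alpha> k (of_int (r a)) (y + of_int a * Im t)) has_sum pint (\<lambda>z. PP N k t z * ee (- (of_int l * z))) (\<i> * of_real y) 1) UNIV"
  proof (rule has_sum_SigmaD[OF sum2])
    fix a :: int assume "a \<in> UNIV"
    have "(\<lambda>(a, b). E a * I a b) summable_on (UNIV \<times> UNIV)" using sum2 has_sum_imp_summable by blast
    hence "(\<lambda>(a, b). E a * I a b) summable_on (Pair a ` UNIV)" by (rule summable_on_subset) auto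
    hence "((\<lambda>(a, b). E a * I a b) \<circ> Pair a) summable_on UNIV" by (subst (asm) summable_on_reindex) (auto simp: inj_on_def)
    hence "(\<lambda>b. E a * I a b) summable_on UNIV" by (simp add: o_def)
    hence "(\<lambda>b. inverse (E a) * (E a * I a b)) summable_on UNIV" by (rule summable_on_cmult_right)
    moreover have "E a \<noteq> 0" by (simp add: E_def ee_def)
    ultimately have "I a summable_on UNIV" by (simp add: mult.assoc[symmetric])
    then obtain s where s: "(I a has_sum s) UNIV" by (auto simp: summable_on_def)
    have "s = (LINT u|lborel. g a u)"
    proof (rule has_sum_unfold)
      show "continuous_on UNIV (g a)" unfolding g_def using line_nz[OF Y[of a]] by (intro continuous_intros gw_continuous) auto
      show "integrable lborel (g a)" unfolding g_def by (rule mord_integrable[OF \<alpha>]) (use Y in simp)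
      show "((\<lambda>j. integral {0..1} (\<lambda>x. g a (x + of_int a * Re t + of_int j))) has_sum s) UNIV" using s unfolding I_def .
    qed
    hence "s = mord \<alpha> k (of_int (r a)) (y + of_int a * Im t)" unfolding g_def mord_def .
    with has_sum_cmult_right[OF s, of "E a"] show "((\<lambda>b. case (a, b) of (a, b) \<Rightarrow> E a * I a b) has_sum E a * mord \<alpha> k (of_int (r a)) (y + of_int a * Im t)) UNIV" by simp
  qed
  from has_sum_cmult_right[OF this, of "ee (- (of_int (l^2) / of_nat (4 * N) * t))"]
  have "((\<lambda>a. ee (- (of_int (l^2) / of_nat (4 * N) * t)) * (E a * mord \<alpha> k (of_int (r a)) (y + of_int a * Im t))) has_sum
     ee (- (of_int (l^2) / of_nat (4 * N) * t)) * pint (\<lambda>z. PP N k t z * ee (- (of_int l * z))) (\<i> * of_real y) 1) UNIV" .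
  moreover have "ee (- (of_int (l^2) / of_nat (4 * N) * t)) * E a = ee (- (of_int ((r a)^2) / of_nat (4 * N) * t))" for a
    unfolding E_def ee_add[symmetric] by (simp add: diff_divide_distrib algebra_simps)
  hence "ee (- (of_int (l^2) / of_nat (4 * N) * t)) * (E a * m) = ee (- (of_int ((r a)^2) / of_nat (4 * N) * t)) * m" for a m
    by (simp only: mult.assoc[symmetric])
  ultimately show ?thesis unfolding r_def \<alpha>_def by (simp only:)
qed

section \<open>The completed Jacobi form\<close>

definition jac :: "nat \<Rightarrow> (complex \<Rightarrow> complex \<Rightarrow> complex) \<Rightarrow> complex \<Rightarrow> complex \<Rightarrow> complex" where
  "jac N G t z = Q t z ^ N * G t z"

text \<open>Near 0 the first summand behaves like c / (2 pi i z)^k and \<open>PP\<close> like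
  z^(-k), which fixes the factor c / (2 pi i)^k.\<close>

definition cjac :: "nat \<Rightarrow> nat \<Rightarrow> int \<Rightarrow> (complex \<Rightarrow> complex \<Rightarrow> complex) \<Rightarrow> complex \<Rightarrow> complex \<Rightarrow> complex" where
  "cjac N k c G t z = jac N G t z - of_int c / (tpi) ^ k * PP N k t z"

definition cjx :: "nat \<Rightarrow> nat \<Rightarrow> int \<Rightarrow> (complex \<Rightarrow> complex \<Rightarrow> complex) \<Rightarrow> complex \<Rightarrow> complex \<Rightarrow> complex" where
  "cjx N k c G t = remove_sings (cjac N k c G t)"

definition cvec :: "nat \<Rightarrow> nat \<Rightarrow> int \<Rightarrow> (complex \<Rightarrow> complex \<Rightarrow> complex) \<Rightarrow> nat \<Rightarrow> complex \<Rightarrow> complex" where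
  "cvec N k c G l t = tc N t (cjx N k c G t) (int l)"

context
  fixes N k :: nat and c :: int and G :: "complex \<Rightarrow> complex \<Rightarrow> complex"
  assumes N: "N > 0" and k: "k = 1 \<or> k = 2" and G: "EE (2 * N + k) c G"
begin

lemma ell_G: "ell (2 * N + k) G" using G by (simp add: EE_def)

lemma jac_holomorphic: "t \<in> uhp \<Longrightarrow> jac N G t holomorphic_on (- lat t)"
  unfolding jac_def[abs_def]
  by (intro holomorphic_intros ellD(1)[OF ell_G] holomorphic_on_subset[OF Q_holomorphic]) auto

lemma cjac_holomorphic: "t \<in> uhp \<Longrightarrow> cjac N k c G t holomorphic_on (- lat t)"
  unfolding cjac_def[abs_def] by (intro holomorphic_intros jac_holomorphic PP_holomorphic N)

lemma cjac_add_1: "t \<in> uhp \<Longrightarrow> z \<notin> lat t \<Longrightarrow> cjac N k c G t (z + 1) = cjac N k c G t z"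
  by (simp add: cjac_def jac_def Q_add_1 PP_add_1 ellD(2)[OF ell_G])

lemma cjac_add_tau:
  assumes "t \<in> uhp" "z \<notin> lat t"
  shows "cjac N k c G t (z + t) = ee (- (of_nat N * t) - of_nat (2 * N) * z) * cjac N k c G t z"
proof -
  have "ee (- t - 2 * z) ^ N = ee (- (of_nat N * t) - of_nat (2 * N) * z)"
    unfolding ee_power by (simp add: algebra_simps)
  thus ?thesis using assms
    by (simp add: cjac_def jac_def Q_add_tau PP_add_tau ellD(3)[OF ell_G] power_mult_distrib right_diff_distrib mult_ac)
qed

lemma cjac_T: "t \<in> uhp \<Longrightarrow> z \<notin> lat t \<Longrightarrow> cjac N k c G (t + 1) z = cjac N k c G t z"
  by (simp add: cjac_def jac_def Q_T PP_T ellD(4)[OF ell_G])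

lemma cjac_minus: "t \<in> uhp \<Longrightarrow> z \<notin> lat t \<Longrightarrow> cjac N k c G t (- z) = (- 1) ^ k * cjac N k c G t z"
  by (simp add: cjac_def jac_def Q_minus PP_minus ellD(5)[OF ell_G] power_add right_diff_distrib mult_ac)

lemma cjac_S:
  assumes t: "t \<in> uhp" and z: "z \<notin> lat t"
  shows "cjac N k c G (- 1 / t) (z / t) = t ^ k * ee (of_nat N * z^2 / t) * cjac N k c G t z"
proof -
  have nz: "t \<noteq> 0" using uhp_nonzero[OF t] .
  have "(ee (z^2 / t) / t^2) ^ N * t ^ (2 * N + k) = t ^ k * ee (of_nat N * z^2 / t)"
    using nz by (simp add: power_divide ee_power power_add power_mult)
  hence "jac N G (- 1 / t) (z / t) = t ^ k * ee (of_nat N * z^2 / t) * jac N G t z"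
    unfolding jac_def Q_S[OF t z] ellD(6)[OF ell_G t z] power_mult_distrib by (metis mult.assoc mult.commute)
  thus ?thesis unfolding cjac_def PP_S[OF t] by (simp add: right_diff_distrib mult_ac)
qed

lemma cjac_limit:
  assumes t: "t \<in> uhp"
  shows "((\<lambda>z. z ^ k * cjac N k c G t z) \<longlongrightarrow> 0) (at 0)"
proof -
  define C where "C = 2 * complex_of_real pi * \<i>"
  have C: "C \<noteq> 0" by (simp add: C_def)
  have "((\<lambda>z. (Q t z / (C * z)^2) ^ N * ((C * z) ^ (2 * N + k) * G t z)) \<longlongrightarrow> 1 ^ N * of_int c) (at 0)"
    using Q_limit[OF t] G t unfolding C_def[symmetric] EE_def by (intro tendsto_intros) auto
  hence L: "((\<lambda>z. (Q t z / (C * z)^2) ^ N * ((C * z) ^ (2 * N + k) * G t z)) \<longlongrightarrow> of_int c) (at 0)"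
    by (simp only: power_one mult_1_left)
  have "((\<lambda>z. (C * z) ^ k * jac N G t z) \<longlongrightarrow> of_int c) (at 0)"
  proof (rule Lim_transform_eventually[OF L])
    have "eventually (\<lambda>z::complex. z \<noteq> 0) (at 0)" by (simp add: eventually_at_filter)
    thus "\<forall>\<^sub>F z in at 0. (Q t z / (C * z)^2) ^ N * ((C * z) ^ (2 * N + k) * G t z) = (C * z) ^ k * jac N G t z"
    proof eventually_elim
      case (elim z)
      hence "C * z \<noteq> 0" using C by simp
      thus ?case by (simp add: jac_def power_divide power_add power_mult)
    qed
  qed
  from tendsto_divide[OF this tendsto_const, of "C ^ k"] have "((\<lambda>z. z ^ k * jac N G t z) \<longlongrightarrow> of_int c / C ^ k) (at 0)"
    using C by (simp add: power_mult_distrib mult.assoc)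
  moreover have "((\<lambda>z. of_int c / C ^ k * (z ^ k * PP N k t z)) \<longlongrightarrow> of_int c / C ^ k * 1) (at 0)"
    using k by (intro tendsto_intros PP_limit[OF t N]) auto
  ultimately have "((\<lambda>z. z ^ k * jac N G t z - of_int c / C ^ k * (z ^ k * PP N k t z)) \<longlongrightarrow> of_int c / C ^ k - of_int c / C ^ k * 1) (at 0)"
    by (rule tendsto_diff)
  thus ?thesis by (simp add: cjac_def C_def right_diff_distrib mult_ac)
qed

text \<open>For k = 2 the leading terms cancel, but a simple pole could remain. The function is
  even, so z times it is odd and its limit at 0 equals its own negative.\<close>

lemma cjac_limit_1:
  assumes t: "t \<in> uhp"
  shows "((\<lambda>z. z * cjac N k c G t z) \<longlongrightarrow> 0) (at 0)"
proof (cases "k = 1")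
  case True
  thus ?thesis using cjac_limit[OF t] by simp
next
  case False
  hence k2: "k = 2" using k by simp
  define h where "h = (\<lambda>z. z * cjac N k c G t z)"
  define \<delta> where "\<delta> = min 1 (Im t)"
  have \<delta>: "\<delta> > 0" using t by (simp add: \<delta>_def uhp_def)
  have nl: "z \<notin> lat t" if "z \<in> ball 0 \<delta> - {0}" for z
    using lat_small[OF t, of z] that by (auto simp: \<delta>_def)
  have hol: "h holomorphic_on (ball 0 \<delta> - {0})" unfolding h_def
    by (intro holomorphic_intros holomorphic_on_subset[OF cjac_holomorphic[OF t]]) (use nl in auto)
  have "((\<lambda>z. (z - 0) * h z) \<longlongrightarrow> 0) (at 0)" using cjac_limit[OF t] unfolding k2 h_def by (simp add: power2_eq_square mult.assoc)
  hence "\<exists>g. g holomorphic_on ball 0 \<delta> \<and> (\<forall>z\<in>ball 0 \<delta> - {0}. g z = h z)"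
    by (subst holomorphic_on_extend_lim) (use hol \<delta> in auto)
  then obtain g where g: "g holomorphic_on ball 0 \<delta>" "\<And>z. z \<in> ball 0 \<delta> - {0} \<Longrightarrow> g z = h z" by blast
  have "isCont g 0" using holomorphic_on_imp_continuous_on[OF g(1)] \<delta> by (simp add: continuous_on_eq_continuous_at)
  hence gl: "(g \<longlongrightarrow> g 0) (at 0)" by (simp add: isCont_def)
  have ev: "eventually (\<lambda>z. z \<in> ball 0 \<delta> - {0}) (at 0)" using \<delta> by (intro eventually_at_in_open) auto
  have hl: "(h \<longlongrightarrow> g 0) (at 0)"
    by (rule Lim_transform_eventually[OF gl]) (use ev in eventually_elim, simp add: g(2))
  have "filterlim (\<lambda>z::complex. - z) (at 0) (at 0)"
    unfolding filterlim_at by (auto intro!: tendsto_eq_intros simp: eventually_at_filter)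
  from filterlim_compose[OF hl this] have "((\<lambda>z. h (- z)) \<longlongrightarrow> g 0) (at 0)" .
  hence "((\<lambda>z. - h z) \<longlongrightarrow> g 0) (at 0)"
  proof (rule Lim_transform_eventually)
    show "\<forall>\<^sub>F z in at 0. h (- z) = - h z" using ev
    proof eventually_elim
      case (elim z)
      show ?case using cjac_minus[OF t nl[OF elim]] unfolding h_def k2 by simp
    qed
  qed
  moreover have "((\<lambda>z. - h z) \<longlongrightarrow> - g 0) (at 0)" by (rule tendsto_minus[OF hl])
  ultimately have "g 0 = - g 0" by (rule tendsto_unique[OF trivial_limit_at])
  hence "g 0 = 0" by simp
  with hl show ?thesis by (simp add: h_def)
qed

lemma cjx:
  assumes t: "t \<in> uhp"
  shows "cjx N k c G t holomorphic_on UNIV" "z \<notin> lat t \<Longrightarrow> cjx N k c G t z = cjac N k c G t z"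
    "cjx N k c G t (z + 1) = cjx N k c G t z"
    "cjx N k c G t (z + t) = ee (- (of_nat N * t) - of_nat (2 * N) * z) * cjx N k c G t z"
proof -
  have m: "isCont (\<lambda>z. ee (- (of_nat N * t) - of_nat (2 * N) * z)) z" for z unfolding ee_def by (intro continuous_intros)
  note L = lattice_extension[OF t cjac_holomorphic[OF t] cjac_add_1[OF t] cjac_add_tau[OF t] m ee_nonzero cjac_limit_1[OF t], folded cjx_def]
  show "cjx N k c G t holomorphic_on UNIV" by (rule L(1))
  show "z \<notin> lat t \<Longrightarrow> cjx N k c G t z = cjac N k c G t z" by (rule L(2))
  show "cjx N k c G t (z + 1) = cjx N k c G t z" by (rule L(3))
  show "cjx N k c G t (z + t) = ee (- (of_nat N * t) - of_nat (2 * N) * z) * cjx N k c G t z" by (rule L(4))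
qed

lemma uhp_add_1: "t \<in> uhp \<Longrightarrow> t + 1 \<in> uhp" by (simp add: uhp_def)

lemma cjx_T: assumes t: "t \<in> uhp" shows "cjx N k c G (t + 1) = cjx N k c G t"
proof
  fix z
  show "cjx N k c G (t + 1) z = cjx N k c G t z"
    by (rule isCont_eq_eventually, goal_cases)
       (use cjx[OF t] cjx[OF uhp_add_1[OF t]] cjac_T[OF t] lat_T in \<open>auto intro!: entire_isCont eventually_mono[OF eventually_not_lat[OF t]]\<close>)
qed

lemma cjx_S: assumes t: "t \<in> uhp"
  shows "cjx N k c G (- 1 / t) (z / t) = t ^ k * ee (of_nat N * z^2 / t) * cjx N k c G t z"
proof (rule isCont_eq_eventually[where f="\<lambda>z. cjx N k c G (- 1 / t) (z / t)" and g="\<lambda>z. t ^ k * ee (of_nat N * z^2 / t) * cjx N k c G t z"])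
  have t': "- 1 / t \<in> uhp" by (rule minus_inverse_in_uhp[OF t])
  show "isCont (\<lambda>z. cjx N k c G (- 1 / t) (z / t)) z"
    by (rule isCont_o2[OF _ entire_isCont[OF cjx(1)[OF t']]]) (use uhp_nonzero[OF t] in \<open>auto intro!: continuous_intros\<close>)
  show "isCont (\<lambda>z. t ^ k * ee (of_nat N * z^2 / t) * cjx N k c G t z) z"
    unfolding ee_def using uhp_nonzero[OF t] by (intro continuous_intros entire_isCont[OF cjx(1)[OF t]]) auto
  show "\<forall>\<^sub>F w in at z. cjx N k c G (- 1 / t) (w / t) = t ^ k * ee (of_nat N * w^2 / t) * cjx N k c G t w"
    using eventually_not_lat[OF t, of z]
  proof eventually_elim
    case (elim w)
    hence "w / t \<notin> lat (- 1 / t)" using lat_S[OF t] by simp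
    thus ?case using cjx(2)[OF t elim] cjx(2)[OF t'] cjac_S[OF t elim] by simp
  qed
qed

lemma cvec_T: assumes t: "t \<in> uhp"
  shows "cvec N k c G l (t + 1) = ee (- (of_nat (l^2) / of_nat (4 * N))) * cvec N k c G l t"
proof -
  have "- (a * (t + 1)) = - a + - (a * t)" for a by (simp add: algebra_simps)
  thus ?thesis unfolding cvec_def tc_def cjx_T[OF t] by (simp only: ee_add mult.assoc of_int_of_nat_eq of_nat_power of_int_power)
qed

text \<open>The S-law turns the coefficient at -1/t into the mean of H over the segment from 0 to t.
  H is t-periodic because the translation law cancels against the shifted Gaussian, so the segment
  may start at l / 2N, where \<open>theta_S_integral\<close> applies.\<close>

lemma cvec_S: assumes t: "t \<in> uhp"
  shows "cvec N k c G l (- 1 / t) = csqrt t ^ (2 * k - 1) *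
     (\<Sum>\<mu><2*N. ee (1 / 8) / of_real (sqrt (real (2 * N))) * ee (of_nat (l * \<mu>) / of_nat (2 * N)) * cvec N k c G \<mu> t)"
proof -
  have nz: "t \<noteq> 0" using uhp_nonzero[OF t] .
  define F where "F = cjx N k c G t"
  have Fh: "F holomorphic_on UNIV" unfolding F_def by (rule cjx(1)[OF t])
  define p where "p = complex_of_real (real l / real (2 * N))"
  \<comment> \<open>The Gaussian of the S-law, the character of index l and the factor from
    \<open>tc\<close> combine to a complete square centred at p = l / 2N.\<close>
  define H where "H = (\<lambda>z. ee (of_nat N * (z - p)^2 / t) * F z)"
  have Np: "of_nat (2 * N) * p = of_nat l" using N by (simp add: p_def)
  have Hh: "H holomorphic_on UNIV" unfolding H_def by (intro holomorphic_intros ee_holomorphic Fh) (use nz in auto)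
  have Hper: "H (z + t) = H z" for z
  proof -
    have "of_nat N * (z + t - p)^2 / t = of_nat N * (z - p)^2 / t + (of_nat (2 * N) * z + of_nat N * t - of_nat (2 * N) * p)"
      using nz by (simp add: field_simps power2_eq_square)
    hence "of_nat N * (z + t - p)^2 / t + (- (of_nat N * t) - of_nat (2 * N) * z) = of_nat N * (z - p)^2 / t + of_int (- int l)"
      unfolding Np by simp
    hence "ee (of_nat N * (z + t - p)^2 / t) * ee (- (of_nat N * t) - of_nat (2 * N) * z) = ee (of_nat N * (z - p)^2 / t)"
      by (simp only: ee_add[symmetric]) (simp only: ee_add ee_of_int mult_1_right)
    thus ?thesis unfolding H_def F_def cjx(4)[OF t] by (metis mult.assoc)
  qed
  have "cvec N k c G l (- 1 / t) = t ^ k * pint H 0 t"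
  proof -
    have "ee (- (of_int ((int l)^2) / of_nat (4 * N) * (- 1 / t))) * (cjx N k c G (- 1 / t) (0 + of_real x * 1) * ee (- (of_int (int l) * (0 + of_real x * 1)))) = t ^ k * H (0 + of_real x * t)" for x :: real
    proof -
      define z where "z = of_real x * t"
      have x: "of_real x = z / t" using nz by (simp add: z_def)
      have "- (of_int ((int l)^2) / of_nat (4 * N) * (- 1 / t)) + of_nat N * z^2 / t + - (of_int (int l) * (z / t)) = of_nat N * (z - p)^2 / t"
        using nz N by (simp add: p_def field_simps power2_eq_square)
      hence e: "ee (- (of_int ((int l)^2) / of_nat (4 * N) * (- 1 / t))) * ee (of_nat N * z^2 / t) * ee (- (of_int (int l) * (z / t))) = ee (of_nat N * (z - p)^2 / t)"
        by (simp only: ee_add[symmetric])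
      have m: "A * (t ^ k * B * f * C) = t ^ k * (A * B * C * f)" for A B C f :: complex by simp
      show ?thesis unfolding H_def F_def add_0 mult_1_right x unfolding z_def[symmetric] x[symmetric] unfolding x cjx_S[OF t] m e ..
    qed
    thus ?thesis unfolding cvec_def tc_def fc_def pint_def integral_mult_right[symmetric] by (simp only:)
  qed
  also have "pint H 0 t = pint H p t" by (rule pint_const[OF Hh nz Hper])
  also have "pint H p t = integral {0..1} (\<lambda>x. ee (of_nat N * t * of_real (x^2)) * F (of_nat l / of_nat (2 * N) + of_real x * t))"
  proof -
    have "of_nat N * (p + of_real x * t - p)^2 / t = of_nat N * t * of_real (x^2)" for x using nz by (simp add: power2_eq_square)
    moreover have "p = of_nat l / of_nat (2 * N)" by (simp add: p_def)
    ultimately show ?thesis unfolding pint_def H_def by simp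
  qed
  also have "\<dots> = csqrt (of_real pi / (- 2 * of_real pi * \<i> * of_nat N * t)) * (\<Sum>\<mu><2*N. ee (of_nat (l * \<mu>) / of_nat (2 * N)) * tc N t F (int \<mu>))"
    by (rule theta_S_integral[OF N t Fh]) (auto simp: F_def cjx[OF t])
  also have "t ^ k * (csqrt (of_real pi / (- 2 * of_real pi * \<i> * of_nat N * t)) * (\<Sum>\<mu><2*N. ee (of_nat (l * \<mu>) / of_nat (2 * N)) * tc N t F (int \<mu>))) =
     csqrt t ^ (2 * k - 1) * (ee (1 / 8) / of_real (sqrt (real (2 * N))) * (\<Sum>\<mu><2*N. ee (of_nat (l * \<mu>) / of_nat (2 * N)) * tc N t F (int \<mu>)))"
  proof -
    \<comment> \<open>One factor \<open>csqrt t\<close> is absorbed by the Gaussian integral,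
      leaving the half-integral weight k - 1/2.\<close>
    have 1: "t ^ k = csqrt t ^ (2 * k - 1) * csqrt t"
    proof -
      have "t ^ k = (csqrt t)\<^sup>2 ^ k" by (simp only: power2_csqrt)
      also have "\<dots> = csqrt t ^ Suc (2 * k - 1)" unfolding power_mult[symmetric] using k by (auto simp: numeral_eq_Suc)
      finally show ?thesis by (simp only: power_Suc2)
    qed
    have 2: "csqrt t * csqrt (of_real pi / (- 2 * of_real pi * \<i> * of_nat N * t)) = ee (1 / 8) / of_real (sqrt (real (2 * N)))"
      using csqrt_factor[OF t N] by (simp only: mult.commute)
    show ?thesis unfolding 1 2[symmetric] by (simp only: mult.assoc)
  qed
  finally show ?thesis unfolding sum_distrib_left F_def cvec_def by (simp only: mult.assoc)
qed

lemma cvec_modular: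
  assumes f: "\<And>l t. l < 2 * N \<Longrightarrow> t \<in> uhp \<Longrightarrow> f l t = s * cvec N k c G l t"
  shows "modular N (real k - 1 / 2) (conj_weil_rep N) f"
proof (rule modularI[OF N])
  fix t l assume t: "t \<in> uhp" and l: "l < 2 * N"
  show "f l (t + 1) = ee (- (of_nat (l^2) / of_nat (4 * N))) * f l t"
    unfolding f[OF l uhp_add_1[OF t]] f[OF l t] cvec_T[OF t] by (rule mult.left_commute)
  have "\<lfloor>2 * (real k - 1 / 2)\<rfloor> = int (2 * k - 1)" using k by auto
  moreover have "(\<Sum>\<mu><2*N. ee (1 / 8) / of_real (sqrt (real (2 * N))) * ee (of_nat (l * \<mu>) / of_nat (2 * N)) * f \<mu> t) =
     s * (\<Sum>\<mu><2*N. ee (1 / 8) / of_real (sqrt (real (2 * N))) * ee (of_nat (l * \<mu>) / of_nat (2 * N)) * cvec N k c G \<mu> t)"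
    unfolding sum_distrib_left by (intro sum.cong refl) (simp add: f[OF _ t])
  ultimately show "f l (- 1 / t) = csqrt t powi \<lfloor>2 * (real k - 1 / 2)\<rfloor> *
     (\<Sum>\<mu><2*N. ee (1 / 8) / of_real (sqrt (real (2 * N))) * ee (of_nat (l * \<mu>) / of_nat (2 * N)) * f \<mu> t)"
    unfolding f[OF l minus_inverse_in_uhp[OF t]] cvec_S[OF t] by (simp only: power_int_of_nat mult.left_commute)
qed

end

section \<open>Fourier coefficients\<close>

text \<open>At height \<open>Im t / 2\<close> the path of integration stays between the poles on \<open>\<real>\<close> and those on \<open>t + \<real>\<close>.\<close>

abbreviation mid_coeff :: "(complex \<Rightarrow> complex) \<Rightarrow> nat \<Rightarrow> complex \<Rightarrow> complex" where
  "mid_coeff F l t \<equiv> pint (\<lambda>z. F z * ee (- (of_int (int l) * z))) (\<i> * of_real (Im t / 2)) 1"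

abbreviation qinv :: "nat \<Rightarrow> nat \<Rightarrow> complex \<Rightarrow> complex" where
  "qinv N l t \<equiv> ee (- (of_int ((int l)^2) / of_nat (4 * N) * t))"

text \<open>Folds a sum over a residue class into one over m = |n|. Both m and -m may lie in the
  class, namely for l = 0 and l = N, while n = 0 occurs only for l = 0.\<close>

lemma class_split:
  fixes F :: "int \<Rightarrow> complex" and u :: "nat \<Rightarrow> complex" and s0 s1 s2 :: real and N l :: nat
  defines "S \<equiv> {n::int. [n = int l] (mod int (2 * N))}"
  assumes N: "N > 0" and l: "l < 2 * N" and sum: "(F has_sum s) S"
    and F2: "\<And>m. m > 0 \<Longrightarrow> int m \<in> S \<Longrightarrow> F (int m) = of_real s2 * u m"
    and F1: "\<And>m. m > 0 \<Longrightarrow> - int m \<in> S \<Longrightarrow> F (- int m) = of_real s1 * u m"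
    and F0: "l = 0 \<Longrightarrow> F 0 = of_real s0 * u 0"
    and c: "\<And>m. c m = (if m = 0 then (if l = 0 then s0 else 0) else (if - int m \<in> S then s1 else 0) + (if int m \<in> S then s2 else 0))"
  shows "((\<lambda>m. of_real (c m) * u m) has_sum s) UNIV"
proof -
  define T where "T = (\<lambda>m. {n \<in> S. nat \<bar>n\<bar> = m})"
  have "bij_betw (\<lambda>n. (nat \<bar>n\<bar>, n)) S (Sigma UNIV T)"
    by (rule bij_betwI[where g=snd]) (auto simp: T_def)
  from has_sum_reindex_bij_betw[OF this, of "\<lambda>p. F (snd p)"] sum
  have sum': "((\<lambda>p. F (snd p)) has_sum s) (Sigma UNIV T)" by simp
  show ?thesis
  proof (rule has_sum_SigmaD[OF sum'])
    fix m :: nat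
    have sub: "T m \<subseteq> {int m, - int m}" by (auto simp: T_def)
    hence fin: "finite (T m)" by (rule finite_subset) simp
    have "(\<Sum>n\<in>T m. F n) = of_real (c m) * u m"
    proof (cases "m = 0")
      case True
      have "0 \<in> S \<longleftrightarrow> l = 0"
      proof
        assume "0 \<in> S"
        hence "int (2 * N) dvd int l" by (simp add: S_def cong_iff_dvd_diff)
        hence "2 * N dvd l" by (simp only: of_nat_dvd_iff)
        with l show "l = 0" using nat_dvd_not_less by auto
      qed (simp add: S_def)
      hence "T m = (if l = 0 then {0} else {})" using True by (auto simp: T_def)
      thus ?thesis using F0 c[of m] True by auto
    next
      case False
      have "(\<Sum>n\<in>T m. F n) = (\<Sum>n\<in>{int m, - int m}. if n \<in> S then F n else 0)"
        by (rule sum.mono_neutral_cong_left) (use sub in \<open>auto simp: T_def\<close>)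
      also have "\<dots> = (if int m \<in> S then F (int m) else 0) + (if - int m \<in> S then F (- int m) else 0)" using False by simp
      also have "\<dots> = of_real (c m) * u m" using False F1[of m] F2[of m] unfolding c by (auto simp: distrib_right)
      finally show ?thesis .
    qed
    thus "((\<lambda>n. F (snd (m, n))) has_sum of_real (c m) * u m) (T m)" using has_sum_finite[OF fin, of F] by simp
  qed
qed

text \<open>Below 2N a residue class has at most one positive representative, so n = l is the only
  positive n <= l in the class.\<close>

lemma class_le: assumes "m \<le> int l" "l < 2 * N" "0 < m" "[m = int l] (mod int (2 * N))" shows "m = int l"
proof -
  have "m mod int (2 * N) = int l mod int (2 * N)" using assms(4) by (simp add: cong_def)
  thus ?thesis using assms by (simp del: of_nat_mult)
qed

text \<open>The multiplicity of m = |n| in the residue class, where s is the sign attached to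
  positive n: -1 for the odd theta function and 1 for the even one.\<close>

definition theta_coeff :: "nat \<Rightarrow> real \<Rightarrow> real \<Rightarrow> nat \<Rightarrow> nat \<Rightarrow> real" where
  "theta_coeff N s0 s l m = (if m = 0 then (if l = 0 then s0 else 0) else
     (if [- int m = int l] (mod int (2 * N)) then 1 else 0) + (if [int m = int l] (mod int (2 * N)) then s else 0))"

lemma theta_coeff_bound: "\<bar>theta_coeff N s0 s l m\<bar> \<le> \<bar>s0\<bar> + 1 + \<bar>s\<bar>"
  by (auto simp: theta_coeff_def)

text \<open>The rows are renumbered by n = l - 2Na. At half height row a sits at v/2 + a v, which is
  positive exactly for a >= 0, that is for n <= l.\<close>

lemma PP_class_sum:
  assumes t: "t \<in> uhp" and N: "N > 0" and l: "l < 2 * N"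
  defines "\<alpha> \<equiv> pi * real N / Im t"
  obtains Y :: "int \<Rightarrow> real" where
    "\<And>n. n \<le> int l \<Longrightarrow> Y n > 0" "\<And>n. n > int l \<Longrightarrow> [n = int l] (mod int (2 * N)) \<Longrightarrow> Y n < 0"
    "((\<lambda>n. ee (- (of_int (n^2) / of_nat (4 * N) * t)) * mord \<alpha> k (- of_int n) (Y n)) has_sum
       qinv N l t * mid_coeff (PP N k t) l t)
       {n. [n = int l] (mod int (2 * N))}"
proof -
  have v: "Im t > 0" using t by (simp add: uhp_def)
  define Y where "Y = (\<lambda>n. Im t / 2 + of_int ((int l - n) div (2 * int N)) * Im t)"
  define S where "S = {n. [n = int l] (mod int (2 * N))}"
  have bij: "bij_betw (\<lambda>a. int l - 2 * int N * a) UNIV S"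
    by (rule bij_betwI[where g="\<lambda>n. (int l - n) div (2 * int N)"])
       (use N in \<open>auto simp: S_def cong_iff_dvd_diff dvd_diff_commute\<close>)
  let ?F = "\<lambda>n. ee (- (of_int (n^2) / of_nat (4 * N) * t)) * mord \<alpha> k (- of_int n) (Y n)"
  have "((\<lambda>a. ?F (int l - 2 * int N * a)) has_sum
     qinv N l t * mid_coeff (PP N k t) l t) UNIV"
  proof -
    have "?F (int l - 2 * int N * a) = ee (- (of_int ((2 * int N * a - int l)^2) / of_nat (4 * N) * t)) * mord \<alpha> k (of_int (2 * int N * a - int l)) (Im t / 2 + of_int a * Im t)" for a
    proof -
      have "(int l - 2 * int N * a)^2 = (2 * int N * a - int l)^2" by (rule power2_commute)
      moreover have "Y (int l - 2 * int N * a) = Im t / 2 + of_int a * Im t" using N by (simp add: Y_def)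
      moreover have "- real_of_int (int l - 2 * int N * a) = of_int (2 * int N * a - int l)" by simp
      ultimately show ?thesis by (simp only:)
    qed
    thus ?thesis using PP_coefficient[OF t N, of "Im t / 2" "int l" k] v unfolding \<alpha>_def by (simp only:)
  qed
  hence sum: "(?F has_sum qinv N l t * mid_coeff (PP N k t) l t) S"
    using has_sum_reindex_bij_betw[OF bij, of ?F] by blast
  show ?thesis
  proof (rule that[OF _ _ sum[unfolded S_def]])
    fix n assume "n \<le> int l"
    hence "(int l - n) div (2 * int N) \<ge> 0" using N by (simp add: pos_imp_zdiv_nonneg_iff)
    thus "Y n > 0" using v unfolding Y_def by (intro add_pos_nonneg) auto
  next
    fix n assume "n > int l"
    hence "(int l - n) div (2 * int N) < 0" using N by (intro div_neg_pos_less0) auto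
    hence "real_of_int ((int l - n) div (2 * int N)) \<le> - 1" by linarith
    hence "of_int ((int l - n) div (2 * int N)) * Im t \<le> - 1 * Im t" using v by (intro mult_right_mono) auto
    thus "Y n < 0" using v unfolding Y_def by linarith
  qed
qed

lemma er_scale: assumes "t \<in> uhp" "N > 0" shows "pi / sqrt (pi * real N / Im t) = sqrt (pi * Im t / real N)"
proof -
  have v: "Im t > 0" using assms by (simp add: uhp_def)
  have "pi / sqrt (pi * real N / Im t) = (sqrt pi * sqrt pi) / (sqrt pi * sqrt (real N) / sqrt (Im t))"
    by (simp add: real_sqrt_mult real_sqrt_divide)
  also have "\<dots> = sqrt (pi * Im t / real N)" using v assms(2) by (simp del: real_sqrt_mult_self add: real_sqrt_mult real_sqrt_divide)
  finally show ?thesis .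
qed

text \<open>Terms with n <= l are integrated above the pole, the others below. Rewriting all of them
  by \<open>er\<close> at |n| uses er (-x) = 2 - er x for the single positive index n = l, and the 2
  is the explicit monomial; for l = 0 the value er 0 = 1 gives half of it.\<close>

lemma PP_1_coefficient:
  assumes t: "t \<in> uhp" and N: "N > 0" and l: "l < 2 * N"
  shows "qinv N l t * mid_coeff (PP N 1 t) l t =
    - (of_real pi * \<i>) * ((if l = 0 then 1 else 2) * ee (- (of_nat (l^2) / of_nat (4 * N) * t)) + Eser N (theta_coeff N 0 (- 1) l) 0 t)"
proof -
  define \<alpha> where "\<alpha> = pi * real N / Im t"
  have v: "Im t > 0" using t by (simp add: uhp_def)
  have \<alpha>: "\<alpha> > 0" using v N by (simp add: \<alpha>_def)
  define c0 where "c0 = sqrt (pi * Im t / real N)"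
  have c0: "x * pi / sqrt \<alpha> = x * c0" for x using er_scale[OF t N] by (simp add: c0_def \<alpha>_def flip: times_divide_eq_right)
  let ?S = "{n. [n = int l] (mod int (2 * N))}"
  define q where "q = (\<lambda>n::int. ee (- (of_int (n^2) / of_nat (4 * N) * t)))"
  define C where "C = qinv N l t * mid_coeff (PP N 1 t) l t"
  obtain Y where Y1: "\<And>n. n \<le> int l \<Longrightarrow> Y n > 0" and Y2: "\<And>n. n > int l \<Longrightarrow> [n = int l] (mod int (2 * N)) \<Longrightarrow> Y n < 0"
    and sum': "((\<lambda>n. ee (- (of_int (n^2) / of_nat (4 * N) * t)) * mord (pi * real N / Im t) 1 (- of_int n) (Y n)) has_sum
       qinv N l t * mid_coeff (PP N 1 t) l t) ?S"
    by (rule PP_class_sum[OF t N l, where k=1]) (rule that)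
  have Y: "Y n > 0" if "n \<le> int l" for n by (rule Y1[OF that])
  have Y': "Y n < 0" if "n > int l" "n \<in> ?S" for n using Y2 that by simp
  have sum: "((\<lambda>n. q n * mord \<alpha> 1 (- of_int n) (Y n)) has_sum C) ?S" using sum' unfolding q_def \<alpha>_def C_def .
  have pos: "mord \<alpha> 1 (- of_int n) (Y n) = - (of_real pi * \<i>) * of_real (er (- of_int n * c0))" if "n \<le> int l" for n
    using mord_1_pos[OF \<alpha> Y[OF that]] c0 by simp
  have neg: "mord \<alpha> 1 (- of_int n) (Y n) = of_real pi * \<i> * of_real (er (of_int n * c0))" if "n > int l" "n \<in> ?S" for n
    using mord_1_pos[OF \<alpha>, of "- Y n" "of_int n"] mord_uminus[of \<alpha> 1 "- of_int n" "- Y n"] Y'[OF that] c0 by simp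
  define u where "u = (\<lambda>m::nat. - (of_real pi * \<i>) * (of_real (er (real m * c0)) * q (int m)))"
  define X where "X = - (of_real pi * \<i>) * ((if l = 0 then 1 else 2) * q (int l))"
  have sumX: "((\<lambda>n. if n = int l then X else 0) has_sum X) ?S"
    by (rule has_sum_finite_neutralI[of "{int l}"]) auto
  have "((\<lambda>m. of_real (theta_coeff N 0 (- 1) l m) * u m) has_sum C - X) UNIV"
  proof (rule class_split[OF N l has_sum_diff[OF sum sumX], where ?s0.0=0 and ?s1.0=1 and ?s2.0="- 1"])
    fix m :: nat assume m: "m > 0" "int m \<in> ?S"
    show "q (int m) * mord \<alpha> 1 (- of_int (int m)) (Y (int m)) - (if int m = int l then X else 0) = of_real (- 1) * u m"
    proof (cases "int m \<le> int l")
      case True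
      with class_le[OF True l] m have ml: "m = l" by simp
      show ?thesis unfolding ml pos[OF order_refl] u_def X_def using m(1) ml by (simp add: er_minus algebra_simps)
    next
      case False
      thus ?thesis using neg[of "int m"] m(2) by (simp add: u_def mult_ac)
    qed
  next
    fix m :: nat assume m: "m > 0"
    have qm: "q (- int m) = q (int m)" by (simp add: q_def)
    show "q (- int m) * mord \<alpha> 1 (- of_int (- int m)) (Y (- int m)) - (if - int m = int l then X else 0) = of_real 1 * u m"
      using pos[of "- int m"] m unfolding qm by (simp add: u_def mult_ac)
  next
    assume l0: "l = 0"
    show "q 0 * mord \<alpha> 1 (- of_int 0) (Y 0) - (if 0 = int l then X else 0) = of_real 0 * u 0"
      using pos[of 0] l0 by (simp add: X_def q_def er_0)
  qed (auto simp: theta_coeff_def)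
  hence "(\<Sum>m. of_real (theta_coeff N 0 (- 1) l m) * u m) = C - X" by (rule sums_unique[OF has_sum_imp_sums, symmetric])
  moreover have "of_real (theta_coeff N 0 (- 1) l m) * u m = - (of_real pi * \<i>) * (of_real (theta_coeff N 0 (- 1) l m * real m ^ 0 * er (real m * sqrt (pi * Im t / real N))) *
      ee (- (of_nat (m^2) / of_nat (4 * N)) * t))" for m
    by (simp add: u_def q_def c0_def mult_ac)
  moreover have "(\<Sum>m. - (of_real pi * \<i>) * (of_real (theta_coeff N 0 (- 1) l m * real m ^ 0 * er (real m * sqrt (pi * Im t / real N))) *
      ee (- (of_nat (m^2) / of_nat (4 * N)) * t))) = - (of_real pi * \<i>) * Eser N (theta_coeff N 0 (- 1) l) 0 t"
    unfolding Eser_def by (rule suminf_mult, rule summable_norm_cancel, rule summable_Eterm[OF N theta_coeff_bound t])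
  ultimately have "C = X + - (of_real pi * \<i>) * Eser N (theta_coeff N 0 (- 1) l) 0 t" by (simp add: algebra_simps)
  thus ?thesis unfolding C_def[symmetric] X_def distrib_left q_def by simp
qed

text \<open>As in weight 1/2, but \<open>mord_2\<close> multiplies the error function by n and adds
  a Gaussian. The latter is the source of the conjugate theta series in the weight 3/2 form.\<close>

lemma PP_2_coefficient:
  assumes t: "t \<in> uhp" and N: "N > 0" and l: "l < 2 * N"
  shows "qinv N l t * mid_coeff (PP N 2 t) l t =
    2 * of_real (pi^2) * (- 2 * of_nat l * ee (- (of_nat (l^2) / of_nat (4 * N) * t)) +
      (Eser N (theta_coeff N 1 1 l) 1 t + of_real (- (real N / pi)) * (of_real (1 / sqrt (real N * Im t)) * Tser N (theta_coeff N 1 1 l) 0 t)))"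
proof -
  define \<alpha> where "\<alpha> = pi * real N / Im t"
  have v: "Im t > 0" using t by (simp add: uhp_def)
  have \<alpha>: "\<alpha> > 0" using v N by (simp add: \<alpha>_def)
  define c0 where "c0 = sqrt (pi * Im t / real N)"
  have c0: "x * pi / sqrt \<alpha> = x * c0" for x using er_scale[OF t N] by (simp add: c0_def \<alpha>_def flip: times_divide_eq_right)
  let ?S = "{n. [n = int l] (mod int (2 * N))}"
  define q where "q = (\<lambda>n::int. ee (- (of_int (n^2) / of_nat (4 * N) * t)))"
  define C where "C = qinv N l t * mid_coeff (PP N 2 t) l t"
  define \<kappa> where "\<kappa> = - (real N / pi) * (1 / sqrt (real N * Im t))"
  define r where "r = (\<lambda>m::nat. cnj (ee (of_nat (m^2) / of_nat (4 * N) * t)))"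
  define E where "E = (\<lambda>n::int. - 2 * of_real \<alpha> * of_real (sqrt (pi / \<alpha>) * exp (- pi\<^sup>2 * (of_int n)^2 / \<alpha>)) :: complex)"
  \<comment> \<open>Times the q-power, the Gaussian boundary term becomes a conjugate theta term, by
    \<open>exp_ee_cnj\<close>; comparing constants gives kappa = -(N / pi) / sqrt (N v).\<close>
  have qE: "q (int m) * E (int m) = 2 * of_real (pi^2) * (of_real \<kappa> * r m)" for m
  proof -
    have e: "- pi\<^sup>2 * (of_int (int m))^2 / \<alpha> = - (pi * (real m)^2 * Im t / real N)"
      using N v by (simp add: \<alpha>_def field_simps power2_eq_square)
    have tm: "r m = of_real (exp (- (pi * (real m)^2 * Im t / real N))) * q (int m)"
      unfolding r_def exp_ee_cnj[OF N, symmetric] by (simp add: q_def)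
    have "- 2 * \<alpha> * sqrt (pi / \<alpha>) = 2 * pi^2 * \<kappa>"
    proof -
      have 1: "sqrt (pi / \<alpha>) = sqrt (Im t) / sqrt (real N)" using N v by (simp add: \<alpha>_def real_sqrt_divide)
      have s: "sqrt (real N) * sqrt (real N) = real N" "sqrt (Im t) * sqrt (Im t) = Im t" using v by auto
      have "- 2 * \<alpha> * sqrt (pi / \<alpha>) = - 2 * pi * (sqrt (real N) * sqrt (real N)) / (sqrt (Im t) * sqrt (Im t)) * (sqrt (Im t) / sqrt (real N))"
        unfolding 1 s by (simp add: \<alpha>_def)
      also have "\<dots> = - 2 * pi * sqrt (real N) / sqrt (Im t)" using N v by (simp del: real_sqrt_mult_self)
      also have "\<dots> = - 2 * pi * (sqrt (real N) * sqrt (real N)) / (sqrt (real N) * sqrt (Im t))" using N by (simp del: real_sqrt_mult_self)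
      also have "\<dots> = 2 * pi^2 * \<kappa>" unfolding s(1) by (simp add: \<kappa>_def real_sqrt_mult power2_eq_square)
      finally show ?thesis .
    qed
    hence cc: "complex_of_real (- 2 * \<alpha> * sqrt (pi / \<alpha>)) = of_real (2 * pi^2 * \<kappa>)" by (rule arg_cong)
    define X where "X = exp (- (pi * (real m)^2 * Im t / real N))"
    have "E (int m) = of_real (- 2 * \<alpha> * sqrt (pi / \<alpha>)) * of_real X" unfolding E_def e X_def by simp
    thus ?thesis unfolding cc tm X_def[symmetric] by simp
  qed
  obtain Y where Y1: "\<And>n. n \<le> int l \<Longrightarrow> Y n > 0" and Y2: "\<And>n. n > int l \<Longrightarrow> [n = int l] (mod int (2 * N)) \<Longrightarrow> Y n < 0"
    and sum': "((\<lambda>n. ee (- (of_int (n^2) / of_nat (4 * N) * t)) * mord (pi * real N / Im t) 2 (- of_int n) (Y n)) has_sum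
       qinv N l t * mid_coeff (PP N 2 t) l t) ?S"
    by (rule PP_class_sum[OF t N l, where k=2]) (rule that)
  have Y: "Y n > 0" if "n \<le> int l" for n by (rule Y1[OF that])
  have Y': "Y n < 0" if "n > int l" "n \<in> ?S" for n using Y2 that by simp
  have sum: "((\<lambda>n. q n * mord \<alpha> 2 (- of_int n) (Y n)) has_sum C) ?S" using sum' unfolding q_def \<alpha>_def C_def .
  have pos: "mord \<alpha> 2 (- of_int n) (Y n) = E n - 2 * of_real (pi^2) * (of_int n * of_real (er (- of_int n * c0)))" if "n \<le> int l" for n
    using mord_2[OF \<alpha>, of "Y n" "- of_int n"] mord_1_pos[OF \<alpha> Y[OF that], of "- of_int n"] Y[OF that] c0[of "- of_int n"]
    by (simp add: E_def power2_eq_square mult_ac)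
  have neg: "mord \<alpha> 2 (- of_int n) (Y n) = E n + 2 * of_real (pi^2) * (of_int n * of_real (er (of_int n * c0)))" if "n > int l" "n \<in> ?S" for n
    using mord_2[OF \<alpha>, of "Y n" "- of_int n"] mord_1_pos[OF \<alpha>, of "- Y n" "of_int n"] mord_uminus[of \<alpha> 1 "- of_int n" "- Y n"] Y'[OF that] c0[of "of_int n"]
    by (simp add: E_def power2_eq_square mult_ac)
  define u where "u = (\<lambda>m::nat. 2 * of_real (pi^2) * (of_real (real m * er (real m * c0)) * q (int m) + of_real \<kappa> * r m))"
  \<comment> \<open>The exceptional contribution of n = l: the 2 in er (-x) = 2 - er x, times the
    factor -2 pi^2 l.\<close>
  define X where "X = - 4 * of_real (pi^2) * (of_nat l * q (int l))"
  have sumX: "((\<lambda>n. if n = int l then X else 0) has_sum X) ?S"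
    by (rule has_sum_finite_neutralI[of "{int l}"]) auto
  have "((\<lambda>m. of_real (theta_coeff N 1 1 l m) * u m) has_sum C - X) UNIV"
  proof (rule class_split[OF N l has_sum_diff[OF sum sumX], where ?s0.0=1 and ?s1.0=1 and ?s2.0=1])
    fix m :: nat assume m: "m > 0" "int m \<in> ?S"
    show "q (int m) * mord \<alpha> 2 (- of_int (int m)) (Y (int m)) - (if int m = int l then X else 0) = of_real 1 * u m"
    proof (cases "int m \<le> int l")
      case True
      with class_le[OF True l] m have ml: "m = l" by simp
      show ?thesis unfolding ml pos[OF order_refl] u_def X_def using qE[of l] by (simp add: er_minus algebra_simps)
    next
      case False
      thus ?thesis using neg[of "int m"] m(2) qE[of m] by (simp add: u_def distrib_left mult_ac)
    qed
  next
    fix m :: nat assume m: "m > 0"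
    have qm: "q (- int m) = q (int m)" "E (- int m) = E (int m)" by (simp_all add: q_def E_def)
    show "q (- int m) * mord \<alpha> 2 (- of_int (- int m)) (Y (- int m)) - (if - int m = int l then X else 0) = of_real 1 * u m"
      using pos[of "- int m"] m qE[of m] unfolding qm by (simp add: u_def distrib_left mult_ac)
  next
    assume l0: "l = 0"
    show "q 0 * mord \<alpha> 2 (- of_int 0) (Y 0) - (if 0 = int l then X else 0) = of_real 1 * u 0"
      using pos[of 0] qE[of 0] l0 by (simp add: X_def u_def)
  qed (auto simp: theta_coeff_def)
  hence sm: "(\<lambda>m. of_real (theta_coeff N 1 1 l m) * u m) sums (C - X)" by (rule has_sum_imp_sums)
  let ?e = "\<lambda>m. of_real (theta_coeff N 1 1 l m * real m ^ 1 * er (real m * sqrt (pi * Im t / real N))) * ee (- (of_nat (m^2) / of_nat (4 * N)) * t)"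
  let ?r = "\<lambda>m. of_real (theta_coeff N 1 1 l m * real m ^ 0) * cnj (ee (of_nat (m^2) / of_nat (4 * N) * t))"
  have "?e sums Eser N (theta_coeff N 1 1 l) 1 t" unfolding Eser_def
    by (rule summable_sums, rule summable_norm_cancel, rule summable_Eterm[OF N theta_coeff_bound t])
  moreover have "?r sums Tser N (theta_coeff N 1 1 l) 0 t" unfolding Tser_def
    by (rule summable_sums, rule summable_norm_cancel, rule summable_Tterm[OF N theta_coeff_bound t])
  ultimately have "(\<lambda>m. 2 * of_real (pi^2) * (?e m + of_real \<kappa> * ?r m)) sums (2 * of_real (pi^2) * (Eser N (theta_coeff N 1 1 l) 1 t + of_real \<kappa> * Tser N (theta_coeff N 1 1 l) 0 t))"
    by (intro sums_mult sums_add)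
  moreover have "2 * of_real (pi^2) * (?e m + of_real \<kappa> * ?r m) = of_real (theta_coeff N 1 1 l m) * u m" for m
    by (simp add: u_def q_def c0_def r_def distrib_left mult_ac)
  ultimately have "C - X = 2 * of_real (pi^2) * (Eser N (theta_coeff N 1 1 l) 1 t + of_real \<kappa> * Tser N (theta_coeff N 1 1 l) 0 t)"
    using sm by (simp only: sums_unique2)
  hence "C = 2 * of_real (pi^2) * (- 2 * of_nat l * q (int l) + (Eser N (theta_coeff N 1 1 l) 1 t + of_real \<kappa> * Tser N (theta_coeff N 1 1 l) 0 t))"
    by (simp add: X_def algebra_simps)
  thus ?thesis unfolding C_def[symmetric] \<kappa>_def q_def by (simp add: mult.assoc)
qed

context
  fixes N k :: nat and c :: int and G :: "complex \<Rightarrow> complex \<Rightarrow> complex"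
  assumes N: "N > 0" and k: "k = 1 \<or> k = 2" and G: "EE (2 * N + k) c G"
begin

text \<open>The factor (ee z)^N clears the negative exponents of \<open>Q\<close>^N and raises the
  index to N + l. The average along the path keeps the monomials whose exponents differ by N + l;
  what is left of them is a power of q.\<close>

lemma jac_coefficients:
  "\<exists>A :: nat \<Rightarrow> nat \<Rightarrow> int. \<forall>l. \<forall>t\<in>uhp. ((\<lambda>j. of_int (A l j) * ee (of_nat j * t)) has_sum
     mid_coeff (jac N G t) l t) UNIV"
proof -
  have "intexp (\<lambda>t z. (ee z * Q t z) ^ N * G t z)" using G by (intro intexp_mult intexp_power intexp_Q) (simp add: EE_def)
  then obtain a where a: "has_intexp a (\<lambda>t z. (ee z * Q t z) ^ N * G t z)" by (auto simp: intexp_def)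
  have "((\<lambda>j. of_int (a (j + N + l, j)) * ee (of_nat j * t)) has_sum
     mid_coeff (jac N G t) l t) UNIV" if t: "t \<in> uhp" for l t
  proof -
    have v: "Im t > 0" using t by (simp add: uhp_def)
    define z where "z = (\<lambda>x::real. \<i> * of_real (Im t / 2) + of_real x * 1)"
    have zI: "0 < Im (z x)" "Im (z x) < Im t" for x using v by (simp_all add: z_def)
    define f where "f = (\<lambda>p x. of_int (a p) * (ee (z x) ^ fst p * ee (t - z x) ^ snd p) * ee (- (of_nat (N + l) * z x)))"
    have fs: "((\<lambda>p. f p x) has_sum jac N G t (z x) * ee (- (of_int (int l) * z x))) UNIV" for x
    proof -
      have "((\<lambda>p. f p x) has_sum ((ee (z x) * Q t (z x)) ^ N * G t (z x)) * ee (- (of_nat (N + l) * z x))) UNIV"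
        unfolding f_def by (rule has_sum_cmult_left) (use a zI in \<open>simp add: has_intexp_def\<close>)
      moreover have "ee (z x) ^ N * ee (- (of_nat (N + l) * z x)) = ee (- (of_int (int l) * z x))"
        unfolding ee_power ee_add[symmetric] by (simp add: algebra_simps)
      hence "((ee (z x) * Q t (z x)) ^ N * G t (z x)) * ee (- (of_nat (N + l) * z x)) = jac N G t (z x) * ee (- (of_int (int l) * z x))"
        unfolding jac_def power_mult_distrib by (metis mult.assoc mult.commute)
      ultimately show ?thesis by simp
    qed
    have ee_per: "norm (ee (z x)) = norm (ee (z 0))" "norm (ee (t - z x)) = norm (ee (t - z 0))" "norm (ee (- (of_nat (N + l) * z x))) = norm (ee (- (of_nat (N + l) * z 0)))" for x
      by (simp_all add: norm_ee z_def)
    have "(\<lambda>p. norm (f p 0)) summable_on UNIV"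
      using has_sum_imp_summable[OF fs[of 0]] by (simp add: summable_on_iff_abs_summable_on_complex)
    moreover have "norm (f p x) \<le> norm (f p 0)" for p x
      unfolding f_def norm_mult norm_power ee_per[of x] by simp
    moreover have "continuous_on {0..1} (f p)" for p unfolding f_def z_def ee_def by (intro continuous_intros)
    ultimately have "((\<lambda>p. integral {0..1} (f p)) has_sum integral {0..1} (\<lambda>x. \<Sum>\<^sub>\<infinity>p\<in>UNIV. f p x)) UNIV"
      by (intro infsum_integral[where M="\<lambda>p. norm (f p 0)"]) auto
    hence sum: "((\<lambda>p. integral {0..1} (f p)) has_sum mid_coeff (jac N G t) l t) UNIV"
      unfolding infsumI[OF fs] pint_def z_def .
    have trm: "integral {0..1} (f p) = (if fst p = snd p + N + l then of_int (a p) * ee (of_nat (snd p) * t) else 0)" for p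
    proof -
      define m where "m = int (fst p) - int (snd p)"
      have "f p x = of_int (a p) * ee (of_nat (snd p) * t) * (ee (of_int m * z x) * ee (- (of_int (int (N + l)) * z x)))" for x
      proof -
        have "ee (z x) ^ fst p * ee (t - z x) ^ snd p = ee (of_nat (snd p) * t) * ee (of_int m * z x)"
          unfolding ee_power ee_add[symmetric] m_def by (simp add: algebra_simps)
        thus ?thesis unfolding f_def by (simp add: mult.assoc)
      qed
      hence "f p = (\<lambda>x. of_int (a p) * ee (of_nat (snd p) * t) * (ee (of_int m * z x) * ee (- (of_int (int (N + l)) * z x))))" by (rule ext)
      hence "integral {0..1} (f p) = of_int (a p) * ee (of_nat (snd p) * t) * pint (\<lambda>z. ee (of_int m * z) * ee (- (of_int (int (N + l)) * z))) (\<i> * of_real (Im t / 2)) 1"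
        unfolding pint_def z_def by (simp only: integral_mult_right)
      also have "pint (\<lambda>z. ee (of_int m * z) * ee (- (of_int (int (N + l)) * z))) (\<i> * of_real (Im t / 2)) 1 = fc (\<lambda>z. ee (of_int m * z)) (int (N + l))"
        by (rule fc_height[symmetric]) (auto intro!: holomorphic_intros ee_holomorphic simp: distrib_left ee_add)
      also have "\<dots> = (if fst p = snd p + N + l then 1 else 0)" unfolding fc_exp m_def by auto
      finally show ?thesis by simp
    qed
    define g where "g = (\<lambda>j. (j + N + l, j))"
    have "((\<lambda>p. if fst p = snd p + N + l then of_int (a p) * ee (of_nat (snd p) * t) else 0) has_sum
       mid_coeff (jac N G t) l t) (range g)"
      using sum unfolding trm by (subst has_sum_cong_neutral[where T=UNIV]) (auto simp: g_def image_iff)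
    hence "((\<lambda>p. if fst p = snd p + N + l then of_int (a p) * ee (of_nat (snd p) * t) else 0) \<circ> g has_sum
       mid_coeff (jac N G t) l t) UNIV"
      by (subst (asm) has_sum_reindex) (auto simp: g_def inj_on_def)
    thus ?thesis by (simp add: o_def g_def)
  qed
  thus ?thesis by (intro exI[of _ "\<lambda>l j. a (j + N + l, j)"]) blast
qed

text \<open>The coefficient of the entire function can be computed at any height. At half height the
  path misses the lattice, so the two summands with poles may be integrated separately.\<close>

lemma cvec_decomposition:
  assumes t: "t \<in> uhp"
  shows "cvec N k c G l t = qinv N l t * mid_coeff (jac N G t) l t
     - of_int c / (tpi) ^ k * (qinv N l t * mid_coeff (PP N k t) l t)"
proof -
  have v: "Im t > 0" using t by (simp add: uhp_def)
  define z where "z = (\<lambda>x::real. \<i> * of_real (Im t / 2) + of_real x * 1)"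
  have zl: "z x \<notin> lat t" for x by (rule strip_not_lat) (use v in \<open>auto simp: z_def\<close>)
  have zc: "continuous_on {0..1} z" unfolding z_def by (intro continuous_intros)
  define e where "e = (\<lambda>x. ee (- (of_int (int l) * z x)))"
  have ec: "continuous_on {0..1} e" unfolding e_def ee_def by (intro continuous_intros zc)
  have c1: "continuous_on {0..1} (\<lambda>x. F (z x))" if "F holomorphic_on (- lat t)" for F
    by (rule continuous_on_compose2[OF holomorphic_on_imp_continuous_on[OF that] zc]) (use zl in auto)
  have "fc (cjx N k c G t) (int l) = integral {0..1} (\<lambda>x. cjx N k c G t (z x) * e x)"
    unfolding fc_height[OF cjx(1,3)[OF N k G t], of "int l" "\<i> * of_real (Im t / 2)"] pint_def z_def e_def ..
  also have "\<dots> = integral {0..1} (\<lambda>x. jac N G t (z x) * e x - of_int c / (tpi) ^ k * (PP N k t (z x) * e x))"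
    by (simp only: cjx(2)[OF N k G t zl] cjac_def left_diff_distrib mult.assoc)
  also have "\<dots> = integral {0..1} (\<lambda>x. jac N G t (z x) * e x) - integral {0..1} (\<lambda>x. of_int c / (tpi) ^ k * (PP N k t (z x) * e x))"
    by (intro integral_diff integrable_continuous_interval continuous_on_mult continuous_on_const ec c1 jac_holomorphic[OF N k G t] PP_holomorphic[OF t N])
  also have "\<dots> = mid_coeff (jac N G t) l t -
     of_int c / (tpi) ^ k * mid_coeff (PP N k t) l t"
    unfolding pint_def z_def e_def integral_mult_right ..
  finally show ?thesis unfolding cvec_def tc_def by (simp add: right_diff_distrib mult_ac)
qed

end

section \<open>Mock modular forms from Jacobi forms\<close>

text \<open>Converts exponents j - l^2/4N to the numbering by n / 4N. The last clause says that no
  new coefficient values arise, which is how integrality is carried over.\<close>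

lemma q_expansionI:
  fixes B :: "nat \<Rightarrow> nat \<Rightarrow> complex"
  assumes N: "N > 0" and sum: "\<And>l t. l < 2 * N \<Longrightarrow> t \<in> uhp \<Longrightarrow>
      ((\<lambda>j. B l j * ee (of_int (int (4 * N * j) - (int l)^2) / of_nat (4 * N) * t)) has_sum F l t) UNIV"
  shows "\<exists>a. q_expansion N F a \<and> (\<forall>l n. a l n = 0 \<or> (\<exists>j. a l n = B l j))"
proof -
  define g where "g = (\<lambda>(l::nat) j. int (4 * N * j) - (int l)^2)"
  define a where "a = (\<lambda>l n. if n \<in> range (g l) then B l (inv_into UNIV (g l) n) else 0)"
  have inj: "inj (g l)" for l using N by (auto simp: g_def inj_on_def)
  have "a l n = 0" if "l < 2 * N" "n < - int ((2 * N)^2)" for l n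
  proof -
    have "(int l)^2 \<le> int ((2 * N)^2)" using that(1) power_mono[of l "2 * N" 2] by (simp flip: of_nat_power)
    hence "n \<noteq> g l j" for j using that(2) unfolding g_def by linarith
    thus ?thesis by (auto simp: a_def)
  qed
  moreover have "((\<lambda>n. a l n * ee (of_int n / of_nat (4 * N) * t)) has_sum F l t) UNIV" if "l < 2 * N" "t \<in> uhp" for l t
  proof -
    have aj: "a l (g l j) = B l j" for j using inv_f_f[OF inj[of l]] by (simp add: a_def)
    have "((\<lambda>n. a l n * ee (of_int n / of_nat (4 * N) * t)) \<circ> g l has_sum F l t) UNIV"
      unfolding o_def aj unfolding g_def by (rule sum[OF that])
    hence "((\<lambda>n. a l n * ee (of_int n / of_nat (4 * N) * t)) has_sum F l t) (range (g l))"
      by (subst has_sum_reindex[OF inj])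
    thus ?thesis by (subst has_sum_cong_neutral[where T="range (g l)"]) (auto simp: a_def)
  qed
  ultimately have "q_expansion N F a" unfolding q_expansion_def by blast
  moreover have "\<forall>l n. a l n = 0 \<or> (\<exists>j. a l n = B l j)" by (auto simp: a_def)
  ultimately show ?thesis by blast
qed

lemma nonhol_expansionI:
  fixes b :: "nat \<Rightarrow> nat \<Rightarrow> complex"
  assumes sum: "\<And>l t. l < 2 * N \<Longrightarrow> t \<in> uhp \<Longrightarrow> ((\<lambda>m. b l m * nonhol_term N k (- (int m)\<^sup>2) t) has_sum F l t) UNIV"
  shows "\<exists>b. nonhol_expansion N k F b"
proof -
  define g where "g = (\<lambda>m::nat. - (int m)\<^sup>2)"
  define a where "a = (\<lambda>l n. if n \<in> range g then b l (inv_into UNIV g n) else 0)"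
  have inj: "inj g" by (auto simp: g_def inj_on_def)
  have "a l n = 0" if "n > 0" for l n
  proof -
    have "n \<noteq> g j" for j using that zero_le_power2[of "int j"] unfolding g_def by linarith
    thus ?thesis by (auto simp: a_def)
  qed
  moreover have "((\<lambda>n. a l n * nonhol_term N k n t) has_sum F l t) UNIV" if "l < 2 * N" "t \<in> uhp" for l t
  proof -
    have "((\<lambda>n. a l n * nonhol_term N k n t) \<circ> g has_sum F l t) UNIV"
      using sum[OF that] inv_f_f[OF inj] by (simp add: o_def a_def g_def)
    hence "((\<lambda>n. a l n * nonhol_term N k n t) has_sum F l t) (range g)"
      by (subst has_sum_reindex[OF inj])
    thus ?thesis by (subst has_sum_cong_neutral[where T="range g"]) (auto simp: a_def)
  qed
  ultimately have "nonhol_expansion N k F a" unfolding nonhol_expansion_def by blast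
  thus ?thesis by blast
qed

text \<open>Convergence at the single point i y bounds the series absolutely and uniformly on Im t
  >= y, since the norms of the terms decrease with Im t.\<close>

lemma q_series:
  fixes B :: "nat \<Rightarrow> complex"
  assumes sum: "\<And>t. t \<in> uhp \<Longrightarrow> ((\<lambda>j. B j * ee (of_nat j * t)) has_sum C t) UNIV"
  shows "C holomorphic_on uhp" "\<exists>K. \<forall>t. Im t \<ge> 1 \<longrightarrow> norm (C t) \<le> K"
proof -
  define M where "M = (\<lambda>y j. norm (B j * ee (of_nat j * (\<i> * of_real y))))"
  have M: "M y summable_on UNIV" if "y > 0" for y
    using has_sum_imp_summable[OF sum[of "\<i> * of_real y"]] that
    by (simp add: M_def uhp_def summable_on_iff_abs_summable_on_complex)
  have le: "norm (B j * ee (of_nat j * t)) \<le> M y j" if "Im t \<ge> y" for j t y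
    unfolding M_def norm_mult norm_ee using that by (intro mult_left_mono) (auto intro!: mult_left_mono)
  have "(\<lambda>t. \<Sum>\<^sub>\<infinity>j. B j * ee (of_nat j * t)) holomorphic_on uhp"
  proof (rule infsum_holomorphic[OF open_uhp])
    show "(\<lambda>t. B j * ee (of_nat j * t)) holomorphic_on uhp" for j by (intro holomorphic_intros ee_holomorphic)
    fix t assume "t \<in> uhp"
    hence v: "Im t > 0" by (simp add: uhp_def)
    have Im: "Im w \<ge> Im t / 2" if "w \<in> cball t (Im t / 2)" for w
      using that abs_Im_le_cmod[of "t - w"] by (simp add: dist_norm)
    have "cball t (Im t / 2) \<subseteq> uhp" using Im v by (force simp: uhp_def)
    thus "\<exists>r>0. \<exists>M. cball t r \<subseteq> uhp \<and> M summable_on UNIV \<and> (\<forall>j\<in>UNIV. \<forall>w\<in>cball t r. norm (B j * ee (of_nat j * w)) \<le> M j)"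
      using v M[of "Im t / 2"] le[OF Im] by (intro exI[of _ "Im t / 2"] conjI exI[of _ "M (Im t / 2)"]) auto
  qed
  moreover have "(\<Sum>\<^sub>\<infinity>j. B j * ee (of_nat j * t)) = C t" if "t \<in> uhp" for t using infsumI[OF sum[OF that]] .
  ultimately show "C holomorphic_on uhp" by (rule holomorphic_transform)
  have "norm (C t) \<le> infsum (M 1) UNIV" if "Im t \<ge> 1" for t
  proof -
    have t: "t \<in> uhp" using that by (simp add: uhp_def)
    have s: "(\<lambda>j. norm (B j * ee (of_nat j * t))) summable_on UNIV"
      using has_sum_imp_summable[OF sum[OF t]] by (simp add: summable_on_iff_abs_summable_on_complex)
    have "norm (C t) \<le> (\<Sum>\<^sub>\<infinity>j. norm (B j * ee (of_nat j * t)))"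
      using norm_infsum_bound[OF s] infsumI[OF sum[OF t]] by simp
    also have "\<dots> \<le> infsum (M 1) UNIV" by (rule infsum_mono[OF s M]) (use le that in auto)
    finally show ?thesis .
  qed
  thus "\<exists>K. \<forall>t. Im t \<ge> 1 \<longrightarrow> norm (C t) \<le> K" by blast
qed

text \<open>Scaling by 2 / c gives the Poincare part the factor -2 / (2 pi i)^k, for which it splits
  into an integral monomial and the non-holomorphic part \<open>S\<close>. The holomorphic part then
  has coefficients 2A / c + x with integers A and x, so D clears the denominators as soon as c
  divides 2D.\<close>

lemma mock_form_exists:
  fixes S g :: "nat \<Rightarrow> complex \<Rightarrow> complex" and x :: "nat \<Rightarrow> int"
  assumes N: "N > 0" and k: "k = 1 \<or> k = 2" and G: "EE (2 * N + k) c G" and c: "c \<noteq> 0" "c dvd 2 * int D"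
    and PP: "\<And>l t. l < 2 * N \<Longrightarrow> t \<in> uhp \<Longrightarrow>
        - 2 / (tpi) ^ k * (qinv N l t * mid_coeff (PP N k t) l t)
         = of_int (x l) * qinv N l t + S l t"
    and smooth: "\<And>l h. h holomorphic_on uhp \<Longrightarrow> smooth_uhp (\<lambda>t. h t + S l t)"
    and laplace: "\<And>l h t. h holomorphic_on uhp \<Longrightarrow> t \<in> uhp \<Longrightarrow> laplacian (real k - 1 / 2) (\<lambda>t. h t + S l t) t = 0"
    and xi: "\<And>l h t. h holomorphic_on uhp \<Longrightarrow> t \<in> uhp \<Longrightarrow> l < 2 * N \<Longrightarrow> xi (real k - 1 / 2) (\<lambda>t. h t + S l t) t = g l t"
    and bound: "\<And>l. \<exists>K. \<forall>t. Im t > 1 \<longrightarrow> norm (S l t) \<le> K"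
    and nonhol: "\<exists>b. nonhol_expansion N (real k - 1 / 2) S b"
  shows "\<exists>\<Theta>. mock_modular_form N (real k - 1 / 2) (conj_weil_rep N) g \<Theta> \<and> integral_coefficients N (\<lambda>l t. of_nat D * \<Theta> l t)"
proof -
  define J where "J = (\<lambda>l t. mid_coeff (jac N G t) l t)"
  obtain A :: "nat \<Rightarrow> nat \<Rightarrow> int" where A: "\<And>l t. t \<in> uhp \<Longrightarrow> ((\<lambda>j. of_int (A l j) * ee (of_nat j * t)) has_sum J l t) UNIV"
    using jac_coefficients[OF N k G] unfolding J_def by blast
  define q where "q = (\<lambda>(l::nat) t. qinv N l t)"
  define h where "h = (\<lambda>l t. q l t * (2 / of_int c * J l t + of_int (x l)))"
  define f where "f = (\<lambda>l t. h l t + S l t)"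
  have f: "f l t = 2 / of_int c * cvec N k c G l t" if "l < 2 * N" "t \<in> uhp" for l t
  proof -
    have "2 / of_int c * cvec N k c G l t = 2 / of_int c * (q l t * J l t) +
       (2 / of_int c * of_int c) * (- 1 / (tpi) ^ k * (q l t * mid_coeff (PP N k t) l t))"
      unfolding cvec_decomposition[OF N k G that(2)] J_def q_def by (simp add: right_diff_distrib)
    also have "2 / of_int c * of_int c = (2::complex)" using c(1) by simp
    also have "2 * (- 1 / (tpi) ^ k * (q l t * mid_coeff (PP N k t) l t)) = of_int (x l) * q l t + S l t"
      using PP[OF that] unfolding q_def by simp
    finally show ?thesis by (simp add: f_def h_def algebra_simps)
  qed
  have Jh: "J l holomorphic_on uhp" for l by (rule q_series(1)[OF A])
  have hh: "h l holomorphic_on uhp" for l unfolding h_def q_def by (intro holomorphic_intros ee_holomorphic Jh)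
  have growth: "linear_exp_growth (f l)" for l
  proof -
    obtain K1 where K1: "\<And>t. Im t \<ge> 1 \<Longrightarrow> norm (J l t) \<le> K1" using q_series(2)[OF A, of l] by blast
    obtain K2 where K2: "\<And>t. Im t > 1 \<Longrightarrow> norm (S l t) \<le> K2" using bound[of l] by blast
    \<comment> \<open>The growth rate of q^(-l^2/4N), the only unbounded factor as v tends to
      infinity.\<close>
    define E where "E = 2 * pi * (real l)^2 / (4 * real N)"
    define K where "K = norm (2 / of_int c :: complex) * K1 + norm (of_int (x l) :: complex) + K2"
    have "norm (f l t) \<le> K * norm (exp (E * Im t))" if v: "Im t > 1" for t
    proof -
      have nq: "norm (q l t) = exp (E * Im t)" unfolding q_def norm_ee E_def by (simp add: Im_divide_of_nat)
      have e1: "1 \<le> exp (E * Im t)" using v by (simp add: E_def)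
      have "norm (2 / of_int c * J l t + of_int (x l)) \<le> norm (2 / of_int c :: complex) * K1 + norm (of_int (x l) :: complex)"
      proof (rule order_trans[OF norm_triangle_ineq])
        have "norm (2 / of_int c * J l t) \<le> norm (2 / of_int c :: complex) * K1"
          unfolding norm_mult using K1[of t] v by (intro mult_left_mono) auto
        thus "norm (2 / of_int c * J l t) + norm (of_int (x l) :: complex) \<le> norm (2 / of_int c :: complex) * K1 + norm (of_int (x l) :: complex)" by simp
      qed
      hence "norm (h l t) \<le> exp (E * Im t) * (norm (2 / of_int c :: complex) * K1 + norm (of_int (x l) :: complex))"
        unfolding h_def norm_mult[of "q l t"] nq by (intro mult_left_mono) auto
      moreover have "norm (S l t) \<le> exp (E * Im t) * K2"
      proof -
        have "K2 \<ge> 0" using K2[OF v] norm_ge_zero order_trans by blast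
        hence "1 * K2 \<le> exp (E * Im t) * K2" by (intro mult_right_mono e1)
        with K2[OF v] show ?thesis by simp
      qed
      moreover have "norm (f l t) \<le> norm (h l t) + norm (S l t)" unfolding f_def by (rule norm_triangle_ineq)
      ultimately show ?thesis by (simp add: K_def algebra_simps)
    qed
    hence "eventually (\<lambda>t. norm (norm (f l t)) \<le> K * norm (exp (E * Im t))) (filtercomap Im at_top)"
      unfolding eventually_filtercomap_at_top_dense by (intro exI[of _ 1]) auto
    thus ?thesis unfolding linear_exp_growth_def by (intro exI[of _ E] bigoI)
  qed
  have hmf: "harmonic_maass_form N (real k - 1 / 2) (conj_weil_rep N) f"
    unfolding harmonic_maass_form_def
  proof (intro conjI allI impI ballI)
    show "modular N (real k - 1 / 2) (conj_weil_rep N) f" by (rule cvec_modular[OF N k G f])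
  qed (use smooth[OF hh] laplace[OF hh] growth in \<open>simp_all add: f_def\<close>)
  define B where "B = (\<lambda>l j. 2 / of_int c * of_int (A l j) + (if j = 0 then of_int (x l) else 0) :: complex)"
  have hB: "((\<lambda>j. B l j * ee (of_int (int (4 * N * j) - (int l)^2) / of_nat (4 * N) * t)) has_sum h l t) UNIV" if "t \<in> uhp" for l t
  proof -
    have "((\<lambda>j. if j = 0 then of_int (x l) else 0 :: complex) has_sum of_int (x l)) (UNIV :: nat set)"
      by (rule has_sum_finite_neutralI[of "{0}"]) auto
    from has_sum_cmult_right[OF has_sum_add[OF has_sum_cmult_right[OF A[OF that, of l], of "2 / of_int c"] this], of "q l t"]
    have "((\<lambda>j. q l t * (2 / of_int c * (of_int (A l j) * ee (of_nat j * t)) + (if j = 0 then of_int (x l) else 0))) has_sum h l t) UNIV"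
      by (simp add: h_def)
    moreover have "q l t * (2 / of_int c * (of_int (A l j) * ee (of_nat j * t)) + (if j = 0 then of_int (x l) else 0)) =
       B l j * ee (of_int (int (4 * N * j) - (int l)^2) / of_nat (4 * N) * t)" for j
    proof -
      have "of_int (int (4 * N * j) - (int l)^2) / of_nat (4 * N) * t = - (of_int ((int l)^2) / of_nat (4 * N) * t) + of_nat j * t"
        using N by (simp add: field_simps)
      hence "ee (of_int (int (4 * N * j) - (int l)^2) / of_nat (4 * N) * t) = q l t * ee (of_nat j * t)" unfolding q_def by (simp only: ee_add)
      moreover have "B l j * ee (of_nat j * t) = 2 / of_int c * (of_int (A l j) * ee (of_nat j * t)) + (if j = 0 then of_int (x l) else 0)"
        by (simp add: B_def distrib_right mult.assoc)
      ultimately show ?thesis by (metis mult.assoc mult.commute)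
    qed
    ultimately show ?thesis by (simp only:)
  qed
  have "mock_modular_form N (real k - 1 / 2) (conj_weil_rep N) g h"
    unfolding mock_modular_form_def is_holomorphic_part_def
  proof (intro exI[of _ f] conjI hmf allI impI ballI)
    show "\<exists>a. q_expansion N h a" using q_expansionI[OF N hB] by blast
    show "\<exists>b. nonhol_expansion N (real k - 1 / 2) (\<lambda>l t. f l t - h l t) b" using nonhol by (simp add: f_def)
    show "xi (real k - 1 / 2) (f l) t = g l t" if "l < 2 * N" "t \<in> uhp" for l t
      using xi[OF hh that(2,1)] by (simp add: f_def)
  qed
  moreover have "integral_coefficients N (\<lambda>l t. of_nat D * h l t)"
  proof -
    have "((\<lambda>j. of_nat D * B l j * ee (of_int (int (4 * N * j) - (int l)^2) / of_nat (4 * N) * t)) has_sum of_nat D * h l t) UNIV" if "t \<in> uhp" for l t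
      using has_sum_cmult_right[OF hB[OF that, of l], of "of_nat D"] by (simp add: mult.assoc)
    from q_expansionI[OF N this] obtain a where a: "q_expansion N (\<lambda>l t. of_nat D * h l t) a" "\<And>l n. a l n = 0 \<or> (\<exists>j. a l n = of_nat D * B l j)" by blast
    have "of_nat D * B l j \<in> \<int>" for l j
    proof -
      from c(2) obtain d where d: "2 * int D = c * d" by (auto elim: dvdE)
      hence "complex_of_int (2 * int D) = of_int (c * d)" by (rule arg_cong)
      hence e: "of_nat D * (2 / of_int c) = (of_int d :: complex)" using c(1) by (simp add: field_simps)
      have "of_nat D * B l j = of_nat D * (2 / of_int c) * of_int (A l j) + of_nat D * (if j = 0 then of_int (x l) else 0)"
        unfolding B_def distrib_left by (simp only: mult.assoc)
      also have "\<dots> = of_int (d * A l j + (if j = 0 then int D * x l else 0))" unfolding e by simp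
      finally show ?thesis by simp
    qed
    hence "a l n \<in> \<int>" for l n using a(2)[of l n] by auto
    thus ?thesis unfolding integral_coefficients_def using a(1) by blast
  qed
  ultimately show ?thesis by blast
qed

section \<open>The two shadows\<close>

lemma summable_on_int_abs:
  fixes t :: "nat \<Rightarrow> real"
  assumes "summable t" "\<And>n. t n \<ge> 0"
  shows "(\<lambda>n::int. t (nat \<bar>n\<bar>)) summable_on UNIV"
proof -
  have "(\<lambda>n::int. t (nat \<bar>n\<bar>)) summable_on {0..}"
    using summable_on_reindex_bij_betw[OF bij_int_nonneg, of "\<lambda>n. t (nat \<bar>n\<bar>)"] summable_nonneg_imp_summable_on[OF assms] by simp
  moreover have "(\<lambda>n::int. t (nat \<bar>n\<bar>)) summable_on {..<0}"
  proof -
    have "summable (\<lambda>n. t (Suc n))" using assms(1) by (simp add: summable_Suc_iff)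
    hence "(\<lambda>n. t (Suc n)) summable_on UNIV" by (rule summable_nonneg_imp_summable_on) (use assms in auto)
    moreover have "nat \<bar>- int n - 1\<bar> = Suc n" for n by simp
    ultimately show ?thesis using summable_on_reindex_bij_betw[OF bij_int_neg, of "\<lambda>n. t (nat \<bar>n\<bar>)"] by (simp only:)
  qed
  moreover have "{0..} \<union> {..<0} = (UNIV :: int set)" by auto
  ultimately show ?thesis using summable_on_union by metis
qed

text \<open>\<open>unary_theta\<close> is an unconditional sum that would default to 0 without
  summability, so summability is derived first, from the bound for \<open>Tser\<close>.\<close>

lemma unary_theta_has_sum:
  assumes t: "t \<in> uhp" and N: "N > 0"
  shows "((\<lambda>n. of_int n ^ \<nu> * ee (of_int (n^2) / of_nat (4 * N) * t)) has_sum unary_theta N \<nu> l t) {n. [n = int l] (mod int (2 * N))}"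
proof -
  define s where "s = (\<lambda>m::nat. norm (of_real (1 * real m ^ \<nu>) * cnj (ee (of_nat (m^2) / of_nat (4 * N) * t))))"
  have "summable s" unfolding s_def by (rule summable_Tterm[where c="\<lambda>_. 1" and B=1, OF N _ t]) simp
  hence "(\<lambda>n::int. s (nat \<bar>n\<bar>)) summable_on UNIV" by (rule summable_on_int_abs) (simp add: s_def)
  moreover have "s (nat \<bar>n\<bar>) = norm (of_int n ^ \<nu> * ee (of_int (n^2) / of_nat (4 * N) * t))" for n
  proof -
    have "int ((nat \<bar>n\<bar>)^2) = n^2" by simp
    hence "of_int (int ((nat \<bar>n\<bar>)^2)) = (of_int (n^2) :: complex)" by (rule arg_cong)
    hence sq: "of_nat ((nat \<bar>n\<bar>)^2) = (of_int (n^2) :: complex)" by (simp only: of_int_of_nat_eq)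
    show ?thesis unfolding s_def norm_mult complex_mod_cnj sq by (simp add: norm_power power_abs)
  qed
  ultimately have "(\<lambda>n. of_int n ^ \<nu> * ee (of_int (n^2) / of_nat (4 * N) * t)) summable_on UNIV"
    by (simp add: summable_on_iff_abs_summable_on_complex)
  hence "(\<lambda>n. of_int n ^ \<nu> * ee (of_int (n^2) / of_nat (4 * N) * t)) summable_on {n. [n = int l] (mod int (2 * N))}"
    by (rule summable_on_subset) auto
  thus ?thesis unfolding unary_theta_def by (rule has_sum_infsum)
qed

lemma cnj_Tser:
  assumes t: "t \<in> uhp" and N: "N > 0" and cB: "\<And>n. \<bar>c n\<bar> \<le> B"
  shows "(\<lambda>n. of_real (c n * real n ^ p) * ee (of_nat (n^2) / of_nat (4 * N) * t)) sums cnj (Tser N c p t)"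
proof -
  have "(\<lambda>n. of_real (c n * real n ^ p) * cnj (ee (of_nat (n^2) / of_nat (4 * N) * t))) sums Tser N c p t" unfolding Tser_def
    by (rule summable_sums, rule summable_norm_cancel, rule summable_Tterm[OF N cB t])
  hence "(\<lambda>n. cnj (of_real (c n * real n ^ p) * cnj (ee (of_nat (n^2) / of_nat (4 * N) * t)))) sums cnj (Tser N c p t)"
    by (simp only: sums_cnj)
  thus ?thesis by (simp only: complex_cnj_mult complex_cnj_complex_of_real complex_cnj_cnj)
qed

text \<open>The minus sign arises because \<open>theta_coeff\<close> counts n = -m positively; it
  cancels the one in \<open>maass_half\<close>.\<close>

lemma unary_theta_1:
  assumes t: "t \<in> uhp" and N: "N > 0" and l: "l < 2 * N"
  shows "unary_theta N 1 l t = - cnj (Tser N (theta_coeff N 0 (- 1) l) 1 t)"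
proof -
  define u where "u = (\<lambda>m::nat. - (of_nat m * ee (of_nat (m^2) / of_nat (4 * N) * t)))"
  have "((\<lambda>m. of_real (theta_coeff N 0 (- 1) l m) * u m) has_sum unary_theta N 1 l t) UNIV"
    by (rule class_split[OF N l unary_theta_has_sum[OF t N], where ?s0.0=0 and ?s1.0=1 and ?s2.0="- 1"])
       (auto simp: u_def theta_coeff_def)
  hence "(\<lambda>m. of_real (theta_coeff N 0 (- 1) l m) * u m) sums unary_theta N 1 l t" by (rule has_sum_imp_sums)
  moreover have "(\<lambda>m. - (of_real (theta_coeff N 0 (- 1) l m * real m ^ 1) * ee (of_nat (m^2) / of_nat (4 * N) * t))) sums - cnj (Tser N (theta_coeff N 0 (- 1) l) 1 t)"
    by (rule sums_minus[OF cnj_Tser[OF t N theta_coeff_bound]])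
  ultimately show ?thesis by (simp add: u_def sums_unique2 mult.assoc)
qed

lemma unary_theta_0:
  assumes t: "t \<in> uhp" and N: "N > 0" and l: "l < 2 * N"
  shows "unary_theta N 0 l t = cnj (Tser N (theta_coeff N 1 1 l) 0 t)"
proof -
  define u where "u = (\<lambda>m::nat. ee (of_nat (m^2) / of_nat (4 * N) * t))"
  have "((\<lambda>m. of_real (theta_coeff N 1 1 l m) * u m) has_sum unary_theta N 0 l t) UNIV"
    by (rule class_split[OF N l unary_theta_has_sum[OF t N], where ?s0.0=1 and ?s1.0=1 and ?s2.0=1])
       (auto simp: u_def theta_coeff_def)
  hence "(\<lambda>m. of_real (theta_coeff N 1 1 l m) * u m) sums unary_theta N 0 l t" by (rule has_sum_imp_sums)
  moreover have "(\<lambda>m. of_real (theta_coeff N 1 1 l m * real m ^ 0) * ee (of_nat (m^2) / of_nat (4 * N) * t)) sums cnj (Tser N (theta_coeff N 1 1 l) 0 t)"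
    by (rule cnj_Tser[OF t N theta_coeff_bound])
  ultimately show ?thesis by (simp add: u_def sums_unique2)
qed

lemma nonhol_half:
  assumes N: "N > 0"
  shows "\<exists>b. nonhol_expansion N (1/2) (\<lambda>l. Eser N (theta_coeff N 0 (- 1) l) 0) b"
proof (rule nonhol_expansionI)
  fix l t assume t: "t \<in> uhp"
  let ?c = "theta_coeff N 0 (- 1) l"
  let ?e = "\<lambda>m. of_real (?c m * real m ^ 0 * er (real m * sqrt (pi * Im t / real N))) * ee (- (of_nat (m^2) / of_nat (4 * N)) * t)"
  have s: "summable (\<lambda>m. norm (?e m))" by (rule summable_Eterm[OF N theta_coeff_bound t])
  have "(?e has_sum Eser N ?c 0 t) UNIV" unfolding Eser_def
    by (rule norm_summable_imp_has_sum[OF s summable_sums[OF summable_norm_cancel[OF s]]])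
  moreover have "?e m = of_real (?c m / sqrt pi) * nonhol_term N (1/2) (- (int m)\<^sup>2) t" for m
  proof (cases "m = 0")
    case False
    thus ?thesis unfolding nonhol_term_half[OF N _ t, of m] by (subst nonhol_term_half[OF N _ t]) auto
  qed (simp add: theta_coeff_def)
  ultimately show "((\<lambda>m. of_real (?c m / sqrt pi) * nonhol_term N (1/2) (- (int m)\<^sup>2) t) has_sum Eser N ?c 0 t) UNIV" by simp
qed

lemma nonhol_three_half:
  assumes N: "N > 0"
  shows "\<exists>b. nonhol_expansion N (3/2) (\<lambda>l t. Eser N (theta_coeff N 1 1 l) 1 t + of_real (- (real N / pi)) * (of_real (1 / sqrt (real N * Im t)) * Tser N (theta_coeff N 1 1 l) 0 t)) b"
proof (rule nonhol_expansionI)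
  fix l t assume t: "t \<in> uhp"
  have v: "Im t > 0" using t by (simp add: uhp_def)
  let ?c = "theta_coeff N 1 1 l"
  let ?e = "\<lambda>m. of_real (?c m * real m ^ 1 * er (real m * sqrt (pi * Im t / real N))) * ee (- (of_nat (m^2) / of_nat (4 * N)) * t)"
  let ?y = "\<lambda>m. of_real (?c m * real m ^ 0) * cnj (ee (of_nat (m^2) / of_nat (4 * N) * t))"
  let ?K = "\<lambda>y. complex_of_real (- (real N / pi)) * (of_real (1 / sqrt (real N * Im t)) * y)"
  define b where "b = (\<lambda>m::nat. complex_of_real (?c m * (if m = 0 then - (sqrt (real N) / pi) else - (real m / (2 * sqrt pi)))))"
  have s: "summable (\<lambda>m. norm (?e m))" by (rule summable_Eterm[OF N theta_coeff_bound t])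
  have s': "summable (\<lambda>m. norm (?y m))" by (rule summable_Tterm[OF N theta_coeff_bound t])
  have 1: "(?e has_sum Eser N ?c 1 t) UNIV" unfolding Eser_def
    by (rule norm_summable_imp_has_sum[OF s summable_sums[OF summable_norm_cancel[OF s]]])
  have 2: "(?y has_sum Tser N ?c 0 t) UNIV" unfolding Tser_def
    by (rule norm_summable_imp_has_sum[OF s' summable_sums[OF summable_norm_cancel[OF s']]])
  have "((\<lambda>m. ?e m + ?K (?y m)) has_sum Eser N ?c 1 t + ?K (Tser N ?c 0 t)) UNIV"
    by (intro has_sum_add 1 has_sum_cmult_right 2)
  moreover have "?e m + ?K (?y m) = b m * nonhol_term N (3/2) (- (int m)\<^sup>2) t" for m
  proof (cases "m = 0")
    case True
    have p: "Im t powr (1 - 3/2) = 1 / sqrt (Im t)" using v by (simp add: powr_minus powr_half_sqrt[symmetric] field_simps)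
    have r: "real N / pi * (1 / sqrt (real N * Im t)) = sqrt (real N) / pi * (1 / sqrt (Im t))"
    proof -
      have "real N / pi * (1 / sqrt (real N * Im t)) = (sqrt (real N) * sqrt (real N)) / pi * (1 / (sqrt (real N) * sqrt (Im t)))"
        by (simp add: real_sqrt_mult)
      thus ?thesis using N by (simp del: real_sqrt_mult_self)
    qed
    have 1: "?e m + ?K (?y m) = of_real (?c 0) * of_real (- (real N / pi * (1 / sqrt (real N * Im t))))" using True by simp
    have 2: "b m * nonhol_term N (3/2) (- (int m)\<^sup>2) t = of_real (?c 0) * of_real (- (sqrt (real N) / pi * (1 / sqrt (Im t))))"
      using True p by (simp add: b_def nonhol_term_def)
    show ?thesis unfolding 1 2 r ..
  next
    case False
    have "b m * nonhol_term N (3/2) (- (int m)\<^sup>2) t = of_real (?c m) * (of_real (- (real m / (2 * sqrt pi))) * nonhol_term N (3/2) (- (int m)\<^sup>2) t)"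
      using False by (simp add: b_def)
    also have "\<dots> = of_real (?c m) * (of_real (real m * er (real m * sqrt (pi * Im t / real N))) * ee (- (of_nat (m^2) / of_nat (4 * N)) * t)
     + of_real (- (real N / pi)) * (of_real (1 / sqrt (real N * Im t)) * cnj (ee (of_nat (m^2) / of_nat (4 * N) * t))))"
      using nonhol_term_three_half[OF N _ t, of m] False by simp
    also have "\<dots> = ?e m + ?K (?y m)"
    proof -
      have 1: "?e m = of_real (?c m) * (of_real (real m * er (real m * sqrt (pi * Im t / real N))) * ee (- (of_nat (m^2) / of_nat (4 * N)) * t))" by simp
      have 2: "?K (?y m) = of_real (?c m) * ?K (cnj (ee (of_nat (m^2) / of_nat (4 * N) * t)))" by (simp only: power_0 mult_1_right mult.left_commute)
      show ?thesis unfolding 1 2 distrib_left ..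
    qed
    finally show ?thesis ..
  qed
  ultimately show "((\<lambda>m. b m * nonhol_term N (3/2) (- (int m)\<^sup>2) t) has_sum
     (Eser N ?c 1 t + of_real (- (real N / pi)) * (of_real (1 / sqrt (real N * Im t)) * Tser N ?c 0 t))) UNIV" by (simp only:)
qed

theorem theorem1p1:
  fixes N :: nat
  assumes "N > 0"
  shows
    "(\<exists>\<Theta>. mock_modular_form N (1/2) (conj_weil_rep N)
            (\<lambda>h \<tau>. of_real (1 / sqrt (real N)) * unary_theta N 1 h \<tau>) \<Theta> \<and>
          integral_coefficients N (\<lambda>h \<tau>. of_nat (24 * gcd N 4) * \<Theta> h \<tau>)) \<and>
     (\<exists>\<Theta>. mock_modular_form N (3/2) (conj_weil_rep N)
            (\<lambda>h \<tau>. of_real (sqrt (real N) / (2 * pi)) * unary_theta N 0 h \<tau>) \<Theta> \<and>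
          integral_coefficients N (\<lambda>h \<tau>. of_nat (144 * gcd N 4) * \<Theta> h \<tau>))"
proof -
  note N = assms
  \<comment> \<open>The weight 2N + 1 is odd, so one factor wp' of weight 3 with leading coefficient
    -2 is split off, leaving an even weight.\<close>
  have "IE (3 + (2 * N - 2)) (- 2 * 12)"
    by (rule IE_mult) (use EE_DWW IE_12 in \<open>auto simp: IE_def\<close>)
  moreover have "3 + (2 * N - 2) = 2 * N + 1" using N by simp
  ultimately obtain G where G: "EE (2 * N + 1) (- 24) G" by (auto simp: IE_def)
  let ?E = "\<lambda>l. Eser N (theta_coeff N 0 (- 1) l) 0"
  have 1: "\<exists>\<Theta>. mock_modular_form N (real 1 - 1 / 2) (conj_weil_rep N)
            (\<lambda>h \<tau>. of_real (1 / sqrt (real N)) * unary_theta N 1 h \<tau>) \<Theta> \<and>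
          integral_coefficients N (\<lambda>h \<tau>. of_nat (24 * gcd N 4) * \<Theta> h \<tau>)"
  proof (rule mock_form_exists[OF N _ G, where x="\<lambda>l. if l = 0 then 1 else 2" and S="?E"])
    \<comment> \<open>Here 2 / c = -1/12.\<close>
    show "- 24 dvd 2 * int (24 * gcd N 4)" by simp
    fix l \<tau> assume l: "l < 2 * N" and \<tau>: "\<tau> \<in> uhp"
    show "- 2 / (tpi) ^ 1 * (qinv N l \<tau> * mid_coeff (PP N 1 \<tau>) l \<tau>) = of_int (if l = 0 then 1 else 2) * qinv N l \<tau> + ?E l \<tau>"
      unfolding PP_1_coefficient[OF \<tau> N l] by simp
  next
    show "\<exists>b. nonhol_expansion N (real 1 - 1 / 2) ?E b" using nonhol_half[OF N] by simp
    show "\<exists>K. \<forall>\<tau>. Im \<tau> > 1 \<longrightarrow> norm (?E l \<tau>) \<le> K" for l by (rule Eser_bounded[OF N theta_coeff_bound])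
    fix l h assume h: "h holomorphic_on uhp"
    note m = maass_half[OF N theta_coeff_bound h]
    show "smooth_uhp (\<lambda>\<tau>. h \<tau> + ?E l \<tau>)" by (rule m(1))
    fix \<tau> assume \<tau>: "\<tau> \<in> uhp"
    show "laplacian (real 1 - 1 / 2) (\<lambda>\<tau>. h \<tau> + ?E l \<tau>) \<tau> = 0" using m(2)[OF \<tau>] by simp
    assume l: "l < 2 * N"
    show "xi (real 1 - 1 / 2) (\<lambda>\<tau>. h \<tau> + ?E l \<tau>) \<tau> = of_real (1 / sqrt (real N)) * unary_theta N 1 l \<tau>"
      using m(3)[OF \<tau>] unfolding unary_theta_1[OF \<tau> N l] by simp
  qed auto
  \<comment> \<open>The weight is now even, so leading coefficient 12 is attained directly and 2 / c
    = 1/6.\<close>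
  obtain G where G: "EE (2 * N + 2) 12 G" using IE_12[of "2 * N + 2"] by (auto simp: IE_def)
  let ?S = "\<lambda>l \<tau>. Eser N (theta_coeff N 1 1 l) 1 \<tau> + of_real (- (real N / pi)) * (of_real (1 / sqrt (real N * Im \<tau>)) * Tser N (theta_coeff N 1 1 l) 0 \<tau>)"
  have 2: "\<exists>\<Theta>. mock_modular_form N (real 2 - 1 / 2) (conj_weil_rep N)
            (\<lambda>h \<tau>. of_real (sqrt (real N) / (2 * pi)) * unary_theta N 0 h \<tau>) \<Theta> \<and>
          integral_coefficients N (\<lambda>h \<tau>. of_nat (144 * gcd N 4) * \<Theta> h \<tau>)"
  proof (rule mock_form_exists[OF N _ G, where x="\<lambda>l. - 2 * int l" and S="?S"])
    show "12 dvd 2 * int (144 * gcd N 4)" by simp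
    fix l \<tau> assume l: "l < 2 * N" and \<tau>: "\<tau> \<in> uhp"
    have "- 2 / (tpi)^2 * (2 * of_real (pi^2) * X) = X" for X :: complex
      by (simp add: power_mult_distrib)
    thus "- 2 / (tpi) ^ 2 * (qinv N l \<tau> * mid_coeff (PP N 2 \<tau>) l \<tau>) = of_int (- 2 * int l) * qinv N l \<tau> + ?S l \<tau>"
      unfolding PP_2_coefficient[OF \<tau> N l] by simp
  next
    show "\<exists>b. nonhol_expansion N (real 2 - 1 / 2) ?S b" using nonhol_three_half[OF N] by simp
    show "\<exists>K. \<forall>\<tau>. Im \<tau> > 1 \<longrightarrow> norm (?S l \<tau>) \<le> K" for l
    proof -
      let ?c = "theta_coeff N 1 1 l"
      obtain K1 where K1: "\<And>\<tau>. Im \<tau> > 1 \<Longrightarrow> norm (Eser N ?c 1 \<tau>) \<le> K1" using Eser_bounded[OF N, where c="?c", OF theta_coeff_bound] by blast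
      obtain K2 where K2: "\<And>\<tau>. Im \<tau> > 1 \<Longrightarrow> norm (Tser N ?c 0 \<tau>) \<le> K2" using Tser_bounded[OF N, where c="?c", OF theta_coeff_bound] by blast
      have "norm (?S l \<tau>) \<le> K1 + real N / pi * (1 * K2)" if v: "Im \<tau> > 1" for \<tau>
      proof -
        have "1 * 1 \<le> real N * Im \<tau>" using N v by (intro mult_mono) auto
        hence "1 / sqrt (real N * Im \<tau>) \<le> 1" by simp
        hence "norm (of_real (- (real N / pi)) * (of_real (1 / sqrt (real N * Im \<tau>)) * Tser N ?c 0 \<tau>)) \<le> real N / pi * (1 * K2)"
          unfolding norm_mult norm_of_real using K2[OF v] v by (intro mult_mono) auto
        thus ?thesis using K1[OF v] norm_triangle_ineq order_trans add_mono by meson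
      qed
      thus ?thesis by blast
    qed
    fix l h assume h: "h holomorphic_on uhp"
    note m = maass_three_half[OF N theta_coeff_bound h]
    show "smooth_uhp (\<lambda>\<tau>. h \<tau> + ?S l \<tau>)" by (rule m(1))
    fix \<tau> assume \<tau>: "\<tau> \<in> uhp"
    show "laplacian (real 2 - 1 / 2) (\<lambda>\<tau>. h \<tau> + ?S l \<tau>) \<tau> = 0" using m(2)[OF \<tau>] by simp
    assume l: "l < 2 * N"
    show "xi (real 2 - 1 / 2) (\<lambda>\<tau>. h \<tau> + ?S l \<tau>) \<tau> = of_real (sqrt (real N) / (2 * pi)) * unary_theta N 0 l \<tau>"
      using m(3)[OF \<tau>] unfolding unary_theta_0[OF \<tau> N l] by simp
  qed auto
  show ?thesis using 1 2 by simp
qed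

end
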